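(* Let $\Bbbk$ be a field of characteristic $0$, $G$ a finite group, $n\in\mathbb Z_{\ge0}$ and $t\in\Bbbk$. The functor $$\operatorname{Res}_n=(\operatorname{Id}\boxtimes F)\,D\colon\ \mathcal C_t\to\mathcal C_{t-n}\boxtimes\operatorname{Rep}(G\wr S_n)$$ has a simultaneous left and right adjoint functor (i.e. one functor that is both a left adjoint and a right adjoint of $\operatorname{Res}_n$), and this functor sends the tensor unit $\mathbf 1\mapsto X$, where $X=\operatorname{im}(e)\in\mathcal C_t$ is the image of the idempotent $e=e_n\omega_nx_n\in\mathcal C_t([n],[n])$.
   Context: **$G$-partitions.** For $a,b\ge 0$, a $G$-partition (or $G$-diagram) with $a$ upper and $b$ lower points is an equivalence class of pairs consisting of a set partition of $\{1,\dots,a\}\sqcup\{1,\dots,b\}$ (upper and lower points; its blocks are called components) and a labeling of all points by elements of $G$. Two such pairs are equivalent iff the set partitions agree and for each component there is $g\in G$ such that the two labelings of the points of this component differ by left multiplication by $g$. $P_{a,b}$ is the set of these. **Composition.** $f\in P_{a,b}$ and $g\in P_{b,c}$ are compatible if representatives can be chosen such that the labels of the $b$ lower points of $f$ equal those of the $b$ upper points of $g$. Then gluing these representatives along the $b$ middle points gives a labeled diagram; $\mu(f,g)$ is the number of its components containing neither upper points of $f$ nor lower points of $g$, and $f*g\in P_{a,c}$ is obtained by deleting these components and the middle points. For $t\in\Bbbk$ define the bilinear composition $\Bbbk P_{b,c}\otimes\Bbbk P_{a,b}\to\Bbbk P_{a,c}$ by $g\circ f=(|G|\,t)^{\mu(f,g)}\,(f*g)$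 if $f,g$ are compatible and $g\circ f=0$ otherwise. **Categories.** $\mathcal G_t$ is the $\Bbbk$-linear symmetric strict monoidal category with objects $[a]$, $a\in\mathbb Z_{\ge0}$, hom-spaces $\mathcal G_t([a],[b])=\Bbbk P_{a,b}$, composition the bilinear map $\circ$ with $g\circ f=(|G|\,t)^{\mu(f,g)}\,(f*g)$ for compatible $G$-diagrams $f,g$ and $g\circ f=0$ for non-compatible ones, tensor product $[a]\otimes[b]=[a+b]$ given on diagrams by horizontal juxtaposition, unit $[0]$, identities the diagrams with all labels $1$ and components $\{i\text{-th upper},i\text{-th lower}\}$, and symmetry $[a]\otimes[b]\to[b]\otimes[a]$ the diagram with all labels $1$ connecting the $i$-th upper to the $(b+i)$-th lower point ($1\le i\le a$) and the $(a+j)$-th upper to the $j$-th lower point ($1\le j\le b$). $\mathcal C_t:=\operatorname{Ps}(\mathcal G_t)$ is its pseudo-abelian completion (additive and idempotent completion), again symmetric monoidal. For $\Bbbk$-linear symmetric monoidal categories, $\mathcal A\boxtimes\mathcal B$ is the exterior tensor product: the pseudo-abelian completion of the category with objects $A\boxtimes B$ and hom-spaces $\mathcal A(A,A')\otimes_\Bbbk\mathcal B(B,B')$, with componentwise tensor product. **The functor $D$.** For $t=t_1+t_2$, put $V_\Delta:=([1]\boxtimes[0])\oplus([0]\boxtimes[1])\in\mathcal C_{t_1}\boxtimes\mathcal C_{t_2}$. Then $V_\Delta^{\otimes d}=\bigoplus_{I\sqcup J=\{1,\dots,d\}}[\#I]\boxtimes[\#J]$, where the $(I,J)$-summand takes $[1]\boxtimes[0]$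 in the tensor positions in $I$ and $[0]\boxtimes[1]$ in those in $J$ (order preserved); $p_{I,J}$, $q_{I,J}$ are the projection onto and embedding of this summand. For $f\in P_{a,b}$, $\operatorname{Decomp}(f)$ is the set of tuples $(I_1,I_2,J_1,J_2,f_1,f_2)$, abbreviated $f_1\sqcup f_2$, with $I_1\sqcup I_2=\{1,\dots,a\}$, $J_1\sqcup J_2=\{1,\dots,b\}$, such that for $k=1,2$ the upper points in $I_k$ and lower points in $J_k$ form a union of components of $f$, and $f_k$ is the $G$-diagram formed by them. Set $[f_1\boxtimes f_2]:=q_{J_1,J_2}(f_1\boxtimes f_2)p_{I_1,I_2}$. $D\colon\mathcal C_t\to\mathcal C_{t_1}\boxtimes\mathcal C_{t_2}$ is the linear symmetric monoidal functor with $D([1])=V_\Delta$ and $D(f)=\sum_{f_1\sqcup f_2\in\operatorname{Decomp}(f)}[f_1\boxtimes f_2]$ for $G$-diagrams $f$. Here it is used with $t_1=t-n$, $t_2=n$. **The functor $F$.** Put $m=|G|$, fix a bijection $\theta\colon\{1,\dots,m\}\to G$, and let $W$ be the permutation $G\wr S_n$-module of $n\times m$-matrices with basis $E_{ij}$: $S_n$ permutes the rows and the $i$-th copy of $G$ permutes the entries of the $i$-th row by the left regular action of $G$ on $G\simeq\{1,\dots,m\}$ (via $\theta$). $F\colon\mathcal C_n\to\operatorname{Rep}(G\wr S_n)$ (finite-dimensional representations over $\Bbbk$) is the linear symmetric monoidal functor with $F([1])=W$ which sends $f\in P_{a,b}$ to the map $E_{i_1,j_1}\otimes\dots\otimes E_{i_a,j_a}\mapsto\sum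 E_{i'_1,j'_1}\otimes\dots\otimes E_{i'_b,j'_b}$, the sum over all index tuples such that, attaching $(i_r,j_r)$ to the $r$-th upper and $(i'_s,j'_s)$ to the $s$-th lower point, any two points $p,q$ in the same component of $f$, with labels $k_p,k_q$ and attached pairs $(i_p,j_p),(i_q,j_q)$, satisfy $i_p=i_q$ and $\theta(j_p)^{-1}\theta(j_q)=k_p^{-1}k_q$. **The idempotent $e$.** $f'$ is a proper coarsening of a $G$-diagram $f$, written $f'<f$, if the set partition of $f'$ is strictly coarser than that of $f$ and representatives of $f,f'$ can be chosen with the same labels. Recursively $x(f):=f-\sum_{f'<f}x(f')$. Set $x_n:=x(\operatorname{id}_{[n]})$; $e_n:=\frac1{n!}\sum_{\sigma\in S_n}\sigma$, where $\sigma$ is viewed as a permutation diagram with all labels $1$; and $\omega_n:=|G|^{-n}\sum_{k_1,\dots,k_n\in G}\omega(k_1,\dots,k_n)$, where $\omega(k_1,\dots,k_n)\in P_{n,n}$ has components $\{i\text{-th upper},i\text{-th lower}\}$ with upper label $1$ and lower label $k_i$. These are commuting idempotents, so $e$ is an idempotent. *)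

theory Defs
  imports
    "HOL-Algebra.Coset"
    "HOL-Combinatorics.Permutations"
    "HOL-Library.Disjoint_Sets"
    "HOL-Library.FuncSet"
    "HOL-Library.Function_Algebras"
begin

section \<open>Linear categories and functors\<close>

text \<open>
  Every vector space over a field \<open>'k\<close> is isomorphic to a subspace of some \<open>'x \<Rightarrow> 'k\<close>; hom-spaces are
  represented in this way, with the pointwise vector space structure.  Hom-spaces between
  different objects may overlap, so composition carries the three objects as arguments:
  \<open>Comp C A B E g f\<close> is the composite of \<open>f : A \<rightarrow> B\<close> and \<open>g : B \<rightarrow> E\<close>.
  \<open>Unit\<close> is the tensor unit.
\<close>

record ('o, 'x, 'k) lincat =
  Obj :: "'o set"
  Hom :: "'o \<Rightarrow> 'o \<Rightarrow> ('x \<Rightarrow> 'k) set"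
  Idm :: "'o \<Rightarrow> ('x \<Rightarrow> 'k)"
  Comp :: "'o \<Rightarrow> 'o \<Rightarrow> 'o \<Rightarrow> ('x \<Rightarrow> 'k) \<Rightarrow> ('x \<Rightarrow> 'k) \<Rightarrow> ('x \<Rightarrow> 'k)"
  Unit :: "'o"

record ('o, 'x, 'p, 'y, 'k) fnctr =
  fob :: "'o \<Rightarrow> 'p"
  fmor :: "'o \<Rightarrow> 'o \<Rightarrow> ('x \<Rightarrow> 'k) \<Rightarrow> ('y \<Rightarrow> 'k)"

definition smul :: "'k::times \<Rightarrow> ('x \<Rightarrow> 'k) \<Rightarrow> ('x \<Rightarrow> 'k)" where
  "smul c v = (\<lambda>x. c * v x)"

definition is_functor ::
  "('o, 'x, 'k) lincat \<Rightarrow> ('p, 'y, 'k) lincat \<Rightarrow> ('o, 'x, 'p, 'y, 'k) fnctr \<Rightarrow> bool" where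
  "is_functor C D F \<longleftrightarrow>
     (\<forall>A\<in>Obj C. fob F A \<in> Obj D) \<and>
     (\<forall>A\<in>Obj C. \<forall>B\<in>Obj C. \<forall>f\<in>Hom C A B. fmor F A B f \<in> Hom D (fob F A) (fob F B)) \<and>
     (\<forall>A\<in>Obj C. fmor F A A (Idm C A) = Idm D (fob F A)) \<and>
     (\<forall>A\<in>Obj C. \<forall>B\<in>Obj C. \<forall>E\<in>Obj C. \<forall>f\<in>Hom C A B. \<forall>g\<in>Hom C B E.
        fmor F A E (Comp C A B E g f) =
        Comp D (fob F A) (fob F B) (fob F E) (fmor F B E g) (fmor F A B f))"

definition is_linear_functor ::
  "('o, 'x, 'k::field) lincat \<Rightarrow> ('p, 'y, 'k) lincat \<Rightarrow> ('o, 'x, 'p, 'y, 'k) fnctr \<Rightarrow> bool" where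
  "is_linear_functor C D F \<longleftrightarrow> is_functor C D F \<and>
     (\<forall>A\<in>Obj C. \<forall>B\<in>Obj C. \<forall>f\<in>Hom C A B. \<forall>g\<in>Hom C A B.
        fmor F A B (f + g) = fmor F A B f + fmor F A B g) \<and>
     (\<forall>A\<in>Obj C. \<forall>B\<in>Obj C. \<forall>c. \<forall>f\<in>Hom C A B.
        fmor F A B (smul c f) = smul c (fmor F A B f))"

definition id_functor :: "('o, 'x, 'o, 'x, 'k) fnctr" where
  "id_functor = \<lparr>fob = (\<lambda>A. A), fmor = (\<lambda>A B f. f)\<rparr>"

text \<open>\<open>functor_comp K F\<close> is ``\<open>K\<close> after \<open>F\<close>''.\<close>

definition functor_comp ::
  "('p, 'y, 'q, 'z, 'k) fnctr \<Rightarrow> ('o, 'x, 'p, 'y, 'k) fnctr \<Rightarrow> ('o, 'x, 'q, 'z, 'k) fnctr" where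
  "functor_comp K F = \<lparr>fob = (\<lambda>A. fob K (fob F A)),
     fmor = (\<lambda>A B f. fmor K (fob F A) (fob F B) (fmor F A B f))\<rparr>"

text \<open>\<open>adjunction C D L R\<close>: the functor \<open>L : C \<rightarrow> D\<close> is left adjoint to \<open>R : D \<rightarrow> C\<close>.\<close>

definition adjunction ::
  "('o, 'x, 'k) lincat \<Rightarrow> ('p, 'y, 'k) lincat \<Rightarrow>
   ('o, 'x, 'p, 'y, 'k) fnctr \<Rightarrow> ('p, 'y, 'o, 'x, 'k) fnctr \<Rightarrow> bool" where
  "adjunction C D L R \<longleftrightarrow> is_functor C D L \<and> is_functor D C R \<and>
     (\<exists>\<Phi>.
        (\<forall>A\<in>Obj C. \<forall>Y\<in>Obj D.
           bij_betw (\<Phi> A Y) (Hom D (fob L A) Y) (Hom C A (fob R Y))) \<and>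
        (\<forall>A\<in>Obj C. \<forall>A'\<in>Obj C. \<forall>Y\<in>Obj D. \<forall>Y'\<in>Obj D.
           \<forall>f\<in>Hom C A' A. \<forall>g\<in>Hom D Y Y'. \<forall>h\<in>Hom D (fob L A) Y.
             \<Phi> A' Y' (Comp D (fob L A') Y Y' g (Comp D (fob L A') (fob L A) Y h (fmor L A' A f))) =
             Comp C A' (fob R Y) (fob R Y') (fmor R Y Y' g)
               (Comp C A' A (fob R Y) (\<Phi> A Y h) f)))"

definition isomorphic :: "('o, 'x, 'k) lincat \<Rightarrow> 'o \<Rightarrow> 'o \<Rightarrow> bool" where
  "isomorphic C A B \<longleftrightarrow> A \<in> Obj C \<and> B \<in> Obj C \<and>
     (\<exists>f\<in>Hom C A B. \<exists>g\<in>Hom C B A. Comp C A B A g f = Idm C A \<and> Comp C B A B f g = Idm C B)"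


section \<open>Pseudo-abelian completion\<close>

text \<open>
  The additive completion has finite lists of objects as objects and matrices of morphisms as
  morphisms; the entry in row \<open>j\<close> (target) and column \<open>i\<close> (source), both counted from \<open>0\<close>, of
  \<open>M\<close> is \<open>entry M j i\<close>.  An object of the idempotent completion of this is a pair of
  an object and an idempotent on it.
\<close>

definition entry :: "(nat \<times> nat \<times> 'x \<Rightarrow> 'k) \<Rightarrow> nat \<Rightarrow> nat \<Rightarrow> ('x \<Rightarrow> 'k)" where
  "entry M j i = (\<lambda>x. M (j, i, x))"

definition matrix :: "nat \<Rightarrow> nat \<Rightarrow> (nat \<Rightarrow> nat \<Rightarrow> ('x \<Rightarrow> 'k::zero)) \<Rightarrow> (nat \<times> nat \<times> 'x \<Rightarrow> 'k)" where
  "matrix r c \<phi> = (\<lambda>(j, i, x). if j < r \<and> i < c then \<phi> j i x else 0)"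

definition single :: "nat \<Rightarrow> nat \<Rightarrow> ('x \<Rightarrow> 'k::zero) \<Rightarrow> (nat \<times> nat \<times> 'x \<Rightarrow> 'k)" where
  "single j i f = (\<lambda>(j', i', x). if j' = j \<and> i' = i then f x else 0)"

definition mat_hom ::
  "('o, 'x, 'k::zero) lincat \<Rightarrow> 'o list \<Rightarrow> 'o list \<Rightarrow> (nat \<times> nat \<times> 'x \<Rightarrow> 'k) set" where
  "mat_hom C As Bs = {M. \<forall>j i.
     if j < length Bs \<and> i < length As then entry M j i \<in> Hom C (As ! i) (Bs ! j)
     else entry M j i = (\<lambda>x. 0)}"

definition mat_id :: "('o, 'x, 'k::zero) lincat \<Rightarrow> 'o list \<Rightarrow> (nat \<times> nat \<times> 'x \<Rightarrow> 'k)" where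
  "mat_id C As = matrix (length As) (length As)
     (\<lambda>j i. if j = i then Idm C (As ! i) else (\<lambda>x. 0))"

definition mat_comp ::
  "('o, 'x, 'k::field) lincat \<Rightarrow> 'o list \<Rightarrow> 'o list \<Rightarrow> 'o list \<Rightarrow>
   (nat \<times> nat \<times> 'x \<Rightarrow> 'k) \<Rightarrow> (nat \<times> nat \<times> 'x \<Rightarrow> 'k) \<Rightarrow> (nat \<times> nat \<times> 'x \<Rightarrow> 'k)" where
  "mat_comp C As Bs Es N M = matrix (length Es) (length As)
     (\<lambda>l i. \<Sum>j<length Bs. Comp C (As ! i) (Bs ! j) (Es ! l) (entry N l j) (entry M j i))"

type_synonym ('o, 'x, 'k) ps_obj = "'o list \<times> (nat \<times> nat \<times> 'x \<Rightarrow> 'k)"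

definition ps :: "('o, 'x, 'k::field) lincat \<Rightarrow> (('o, 'x, 'k) ps_obj, nat \<times> nat \<times> 'x, 'k) lincat" where
  "ps C = \<lparr>
     Obj = {(As, e). set As \<subseteq> Obj C \<and> e \<in> mat_hom C As As \<and> mat_comp C As As As e e = e},
     Hom = (\<lambda>(As, e) (Bs, e'). {M \<in> mat_hom C As Bs.
              mat_comp C As Bs Bs e' M = M \<and> mat_comp C As As Bs M e = M}),
     Idm = (\<lambda>(As, e). e),
     Comp = (\<lambda>(As, _) (Bs, _) (Es, _). mat_comp C As Bs Es),
     Unit = ([Unit C], mat_id C [Unit C])\<rparr>"

text \<open>The embedding of a category into its pseudo-abelian completion.\<close>

definition emb_ob :: "('o, 'x, 'k::field) lincat \<Rightarrow> 'o \<Rightarrow> ('o, 'x, 'k) ps_obj" where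
  "emb_ob C A = ([A], mat_id C [A])"

definition emb_mor :: "('x \<Rightarrow> 'k::zero) \<Rightarrow> (nat \<times> nat \<times> 'x \<Rightarrow> 'k)" where
  "emb_mor f = single 0 0 f"

definition ps_functor ::
  "('o, 'x, 'p, 'y, 'k::zero) fnctr \<Rightarrow>
   (('o, 'x, 'k) ps_obj, nat \<times> nat \<times> 'x, ('p, 'y, 'k) ps_obj, nat \<times> nat \<times> 'y, 'k) fnctr" where
  "ps_functor F =
     (let mor = (\<lambda>As Bs M. matrix (length Bs) (length As)
                   (\<lambda>j i. fmor F (As ! i) (Bs ! j) (entry M j i)))
      in \<lparr>fob = (\<lambda>(As, e). (map (fob F) As, mor As As e)),
          fmor = (\<lambda>(As, _) (Bs, _) M. mor As Bs M)\<rparr>)"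


section \<open>Exterior tensor product\<close>

text \<open>
  For subspaces \<open>V\<close> of \<open>'x \<Rightarrow> 'k\<close> and \<open>W\<close> of \<open>'y \<Rightarrow> 'k\<close> over a field, the linear map from the
  tensor product of \<open>V\<close> and \<open>W\<close> to \<open>'x \<times> 'y \<Rightarrow> 'k\<close> which sends the pure tensor of \<open>v\<close> and \<open>w\<close>
  to \<open>(x, y) \<mapsto> v x * w y\<close> is injective.  So the tensor product is taken to be its image, the set of
  finite sums of pure tensors (this is closed under scalars, as \<open>V\<close> is).
\<close>

definition tens :: "('x \<Rightarrow> 'k::times) \<Rightarrow> ('y \<Rightarrow> 'k) \<Rightarrow> ('x \<times> 'y \<Rightarrow> 'k)" where
  "tens v w = (\<lambda>(x, y). v x * w y)"

definition tens_sum ::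
  "(('x \<Rightarrow> 'k::field) \<times> ('y \<Rightarrow> 'k)) list \<Rightarrow> ('x \<times> 'y \<Rightarrow> 'k)" where
  "tens_sum xs = (\<Sum>(v, w)\<leftarrow>xs. tens v w)"

text \<open>
  The definite descriptions express the (unique) bilinear, respectively linear, extensions
  from pure tensors.
\<close>

definition tensor_cat ::
  "('o, 'x, 'k::field) lincat \<Rightarrow> ('p, 'y, 'k) lincat \<Rightarrow> ('o \<times> 'p, 'x \<times> 'y, 'k) lincat" where
  "tensor_cat C D = \<lparr>
     Obj = Obj C \<times> Obj D,
     Hom = (\<lambda>(A, A') (B, B'). tens_sum ` lists (Hom C A B \<times> Hom D A' B')),
     Idm = (\<lambda>(A, A'). tens (Idm C A) (Idm D A')),
     Comp = (\<lambda>(A, A') (B, B') (E, E') v u. THE w.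
       \<exists>xs \<in> lists (Hom C A B \<times> Hom D A' B'). \<exists>ys \<in> lists (Hom C B E \<times> Hom D B' E').
         u = tens_sum xs \<and> v = tens_sum ys \<and>
         w = (\<Sum>(g, g')\<leftarrow>ys. \<Sum>(f, f')\<leftarrow>xs. tens (Comp C A B E g f) (Comp D A' B' E' g' f'))),
     Unit = (Unit C, Unit D)\<rparr>"

definition tensor_functor ::
  "('o, 'x, 'k::field) lincat \<Rightarrow> ('p, 'y, 'k) lincat \<Rightarrow>
   ('o, 'x, 'q, 'z, 'k) fnctr \<Rightarrow> ('p, 'y, 'r, 'w, 'k) fnctr \<Rightarrow>
   ('o \<times> 'p, 'x \<times> 'y, 'q \<times> 'r, 'z \<times> 'w, 'k) fnctr" where
  "tensor_functor C D K L = \<lparr>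
     fob = (\<lambda>(A, A'). (fob K A, fob L A')),
     fmor = (\<lambda>(A, A') (B, B') u. THE w.
       \<exists>xs \<in> lists (Hom C A B \<times> Hom D A' B'). u = tens_sum xs \<and>
         w = (\<Sum>(f, f')\<leftarrow>xs. tens (fmor K A B f) (fmor L A' B' f')))\<rparr>"

definition boxtimes (infixr "\<boxtimes>" 70) where
  "C \<boxtimes> D = ps (tensor_cat C D)"

definition boxtimes_functor where
  "boxtimes_functor C D K L = ps_functor (tensor_functor C D K L)"


section \<open>G-partitions\<close>

text \<open>
  \<open>Up i\<close> and \<open>Lo j\<close> are the upper and lower points, numbered from \<open>1\<close>; \<open>Mid j\<close> occurs only when
  two diagrams are glued.
\<close>

datatype point = Up nat | Mid nat | Lo nat

definition points :: "nat \<Rightarrow> nat \<Rightarrow> point set" where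
  "points a b = Up ` {1..a} \<union> Lo ` {1..b}"

type_synonym 'g labeled = "point set set \<times> (point \<Rightarrow> 'g)"
type_synonym 'g gdiag = "'g labeled set"

definition labeled :: "('g, 'z) monoid_scheme \<Rightarrow> nat \<Rightarrow> nat \<Rightarrow> 'g labeled set" where
  "labeled G a b = {(\<pi>, l). partition_on (points a b) \<pi> \<and> l \<in> points a b \<rightarrow>\<^sub>E carrier G}"

definition diag_rel :: "('g, 'z) monoid_scheme \<Rightarrow> nat \<Rightarrow> nat \<Rightarrow> ('g labeled \<times> 'g labeled) set" where
  "diag_rel G a b = {((\<pi>, l), (\<pi>', l')). (\<pi>, l) \<in> labeled G a b \<and> (\<pi>', l') \<in> labeled G a b \<and>
     \<pi>' = \<pi> \<and> (\<forall>c\<in>\<pi>. \<exists>g\<in>carrier G. \<forall>p\<in>c. l' p = g \<otimes>\<^bsub>G\<^esub> l p)}"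

definition P :: "('g, 'z) monoid_scheme \<Rightarrow> nat \<Rightarrow> nat \<Rightarrow> 'g gdiag set" where
  "P G a b = labeled G a b // diag_rel G a b"

definition diag :: "('g, 'z) monoid_scheme \<Rightarrow> nat \<Rightarrow> nat \<Rightarrow> 'g labeled \<Rightarrow> 'g gdiag" where
  "diag G a b d = diag_rel G a b `` {d}"

text \<open>The underlying set partition, which all representatives share.\<close>

definition comps :: "'g gdiag \<Rightarrow> point set set" where
  "comps f = the_elem (fst ` f)"

subsection \<open>Composition of diagrams\<close>

definition matching :: "nat \<Rightarrow> 'g labeled \<Rightarrow> 'g labeled \<Rightarrow> bool" where
  "matching b d d' \<longleftrightarrow> (\<forall>j\<in>{1..b}. snd d (Lo j) = snd d' (Up j))"

definition compatible :: "nat \<Rightarrow> 'g gdiag \<Rightarrow> 'g gdiag \<Rightarrow> bool" where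
  "compatible b f g \<longleftrightarrow> (\<exists>d\<in>f. \<exists>d'\<in>g. matching b d d')"

primrec lower_to_mid :: "point \<Rightarrow> point" where
  "lower_to_mid (Up i) = Up i"
| "lower_to_mid (Mid i) = Mid i"
| "lower_to_mid (Lo i) = Mid i"

primrec upper_to_mid :: "point \<Rightarrow> point" where
  "upper_to_mid (Up i) = Mid i"
| "upper_to_mid (Mid i) = Mid i"
| "upper_to_mid (Lo i) = Lo i"

text \<open>
  The components of the glued diagram: the classes of the equivalence relation on all points of
  the three rows generated by lying in a common component of one of the two diagrams.
\<close>

definition glued :: "point set set \<Rightarrow> point set set \<Rightarrow> point set set" where
  "glued \<pi> \<pi>' =
     (let S = (\<lambda>c. lower_to_mid ` c) ` \<pi> \<union> (\<lambda>c. upper_to_mid ` c) ` \<pi>'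
      in \<Union>S // {(p, q). \<exists>c\<in>S. p \<in> c \<and> q \<in> c}\<^sup>+)"

definition mu :: "'g gdiag \<Rightarrow> 'g gdiag \<Rightarrow> nat" where
  "mu f g = card {c \<in> glued (comps f) (comps g). c \<subseteq> range Mid}"

definition glue_labeled :: "nat \<Rightarrow> nat \<Rightarrow> 'g labeled \<Rightarrow> 'g labeled \<Rightarrow> 'g labeled" where
  "glue_labeled a c d d' =
     ((\<lambda>C. C - range Mid) ` glued (fst d) (fst d') - {{}},
      \<lambda>p\<in>points a c. case p of Up i \<Rightarrow> snd d (Up i) | Lo i \<Rightarrow> snd d' (Lo i) | Mid i \<Rightarrow> undefined)"

definition star ::
  "('g, 'z) monoid_scheme \<Rightarrow> nat \<Rightarrow> nat \<Rightarrow> nat \<Rightarrow> 'g gdiag \<Rightarrow> 'g gdiag \<Rightarrow> 'g gdiag" where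
  "star G a b c f g = (THE h. \<exists>d\<in>f. \<exists>d'\<in>g. matching b d d' \<and> h = diag G a c (glue_labeled a c d d'))"

definition basis :: "'x \<Rightarrow> ('x \<Rightarrow> 'k::zero_neq_one)" where
  "basis f = (\<lambda>h. if h = f then 1 else 0)"

definition diag_comp ::
  "('g, 'z) monoid_scheme \<Rightarrow> 'k::field_char_0 \<Rightarrow> nat \<Rightarrow> nat \<Rightarrow> nat \<Rightarrow>
   'g gdiag \<Rightarrow> 'g gdiag \<Rightarrow> ('g gdiag \<Rightarrow> 'k)" where
  "diag_comp G t a b c g f =
     (if compatible b f g
      then smul ((of_nat (order G) * t) ^ mu f g) (basis (star G a b c f g))
      else 0)"

text \<open>The diagram whose \<open>i\<close>-th upper point has label \<open>1\<close> and is connected to the \<open>\<sigma> i\<close>-th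
  lower point, and whose \<open>j\<close>-th lower point has label \<open>k j\<close>.\<close>

definition strands ::
  "('g, 'z) monoid_scheme \<Rightarrow> nat \<Rightarrow> (nat \<Rightarrow> nat) \<Rightarrow> (nat \<Rightarrow> 'g) \<Rightarrow> 'g gdiag" where
  "strands G n \<sigma> k = diag G n n
     ((\<lambda>i. {Up i, Lo (\<sigma> i)}) ` {1..n},
      \<lambda>p\<in>points n n. case p of Up i \<Rightarrow> \<one>\<^bsub>G\<^esub> | Lo j \<Rightarrow> k j | Mid j \<Rightarrow> undefined)"

definition id_diag :: "('g, 'z) monoid_scheme \<Rightarrow> nat \<Rightarrow> 'g gdiag" where
  "id_diag G n = strands G n id (\<lambda>_. \<one>\<^bsub>G\<^esub>)"

definition Gcat :: "('g, 'z) monoid_scheme \<Rightarrow> 'k::field_char_0 \<Rightarrow> (nat, 'g gdiag, 'k) lincat" where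
  "Gcat G t = \<lparr>
     Obj = UNIV,
     Hom = (\<lambda>a b. {v. \<forall>f. f \<notin> P G a b \<longrightarrow> v f = 0}),
     Idm = (\<lambda>a. basis (id_diag G a)),
     Comp = (\<lambda>a b c v u. \<Sum>f\<in>P G a b. \<Sum>g\<in>P G b c. smul (v g * u f) (diag_comp G t a b c g f)),
     Unit = 0\<rparr>"

definition Ccat ::
  "('g, 'z) monoid_scheme \<Rightarrow> 'k::field_char_0 \<Rightarrow>
   ((nat, 'g gdiag, 'k) ps_obj, nat \<times> nat \<times> 'g gdiag, 'k) lincat" where
  "Ccat G t = ps (Gcat G t)"


section \<open>The functor D\<close>

definition sub_points :: "nat set \<Rightarrow> nat set \<Rightarrow> point set" where
  "sub_points I J = Up ` I \<union> Lo ` J"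

text \<open>Order preserving renumbering of \<open>I\<close> by \<open>{1..card I}\<close> and of \<open>J\<close> by \<open>{1..card J}\<close>.\<close>

definition renumber :: "nat set \<Rightarrow> nat set \<Rightarrow> point \<Rightarrow> point" where
  "renumber I J p = (case p of
       Up i \<Rightarrow> Up (card {x\<in>I. x \<le> i})
     | Lo j \<Rightarrow> Lo (card {x\<in>J. x \<le> j})
     | Mid i \<Rightarrow> Mid i)"

definition sub_labeled :: "nat set \<Rightarrow> nat set \<Rightarrow> 'g labeled \<Rightarrow> 'g labeled" where
  "sub_labeled I J d =
     ((\<lambda>c. renumber I J ` c) ` {c \<in> fst d. c \<subseteq> sub_points I J},
      \<lambda>p\<in>points (card I) (card J). snd d (inv_into (sub_points I J) (renumber I J) p))"

definition Decomp ::
  "('g, 'z) monoid_scheme \<Rightarrow> nat \<Rightarrow> nat \<Rightarrow> 'g gdiag \<Rightarrow>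
   (nat set \<times> nat set \<times> nat set \<times> nat set \<times> 'g gdiag \<times> 'g gdiag) set" where
  "Decomp G a b f = {(I1, I2, J1, J2, f1, f2).
     I1 \<union> I2 = {1..a} \<and> I1 \<inter> I2 = {} \<and> J1 \<union> J2 = {1..b} \<and> J1 \<inter> J2 = {} \<and>
     (\<exists>d\<in>f.
        (\<exists>S\<subseteq>fst d. sub_points I1 J1 = \<Union>S) \<and>
        (\<exists>S\<subseteq>fst d. sub_points I2 J2 = \<Union>S) \<and>
        f1 = diag G (card I1) (card J1) (sub_labeled I1 J1 d) \<and>
        f2 = diag G (card I2) (card J2) (sub_labeled I2 J2 d))}"

text \<open>
  The direct sum decomposition of \<open>V\<^sub>\<Delta>\<^sup>\<otimes>\<^sup>d\<close>, with the summands in lexicographic order, so that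
  \<open>VDelta_pow G t1 t2 1\<close> is \<open>([1] \<boxtimes> [0]) \<oplus> ([0] \<boxtimes> [1])\<close>.  The summand belonging to the decomposition
  of \<open>{1..d}\<close> into \<open>I\<close> and its complement sits at position \<open>pos d I\<close>.
\<close>

definition subset_list :: "nat \<Rightarrow> nat set list" where
  "subset_list d = map set (subseqs [1..<Suc d])"

definition pos :: "nat \<Rightarrow> nat set \<Rightarrow> nat" where
  "pos d I = (THE i. i < length (subset_list d) \<and> subset_list d ! i = I)"

definition VDelta_pow where
  "VDelta_pow G t1 t2 d =
     (let As = map (\<lambda>I. (emb_ob (Gcat G t1) (card I), emb_ob (Gcat G t2) (d - card I))) (subset_list d)
      in (As, mat_id (tensor_cat (Ccat G t1) (Ccat G t2)) As))"

text \<open>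
  \<open>single (pos b J1) (pos a I1)\<close> is the precomposition with the projection \<open>p\<close> onto the summand
  \<open>(I1, I2)\<close> followed by postcomposition with the embedding \<open>q\<close> of the summand \<open>(J1, J2)\<close>.
\<close>

definition D_diag ::
  "('g, 'z) monoid_scheme \<Rightarrow> nat \<Rightarrow> nat \<Rightarrow> 'g gdiag \<Rightarrow>
   (nat \<times> nat \<times> (nat \<times> nat \<times> 'g gdiag) \<times> (nat \<times> nat \<times> 'g gdiag) \<Rightarrow> 'k::field_char_0)" where
  "D_diag G a b f = (\<Sum>(I1, I2, J1, J2, f1, f2)\<in>Decomp G a b f.
     single (pos b J1) (pos a I1) (tens (emb_mor (basis f1)) (emb_mor (basis f2))))"

text \<open>
  A linear functor on \<open>Ccat G t\<close> is determined, up to isomorphism, by its values on the objects \<open>[a]\<close>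
  and on diagrams.
\<close>

definition is_functor_D where
  "is_functor_D G t t1 t2 D \<longleftrightarrow>
     is_linear_functor (Ccat G t) (Ccat G t1 \<boxtimes> Ccat G t2) D \<and>
     (\<forall>a. fob D (emb_ob (Gcat G t) a) = VDelta_pow G t1 t2 a) \<and>
     (\<forall>a b. \<forall>f\<in>P G a b.
        fmor D (emb_ob (Gcat G t) a) (emb_ob (Gcat G t) b) (emb_mor (basis f)) = D_diag G a b f)"


section \<open>Representations and the functor F\<close>

text \<open>
  Finite-dimensional representations in coordinates: a representation is given by a finite set \<open>B\<close>,
  which serves as basis of the underlying space, and matrices \<open>\<rho> h\<close> with rows and columns indexed by
  \<open>B\<close>.  The bases are taken from an infinite type, so every dimension occurs.
\<close>

definition bmat_comp :: "'y set \<Rightarrow> ('y \<times> 'y \<Rightarrow> 'k::field) \<Rightarrow> ('y \<times> 'y \<Rightarrow> 'k) \<Rightarrow> ('y \<times> 'y \<Rightarrow> 'k)" where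
  "bmat_comp B N M = (\<lambda>(z, x). \<Sum>y\<in>B. N (z, y) * M (y, x))"

definition bmats :: "'y set \<Rightarrow> 'y set \<Rightarrow> ('y \<times> 'y \<Rightarrow> 'k::field) set" where
  "bmats B B' = {M. \<forall>y' y. y' \<notin> B' \<or> y \<notin> B \<longrightarrow> M (y', y) = 0}"

definition bmat_id :: "'y set \<Rightarrow> ('y \<times> 'y \<Rightarrow> 'k::field)" where
  "bmat_id B = (\<lambda>(y', y). if y' = y \<and> y \<in> B then 1 else 0)"

type_synonym ('h, 'y, 'k) rep = "'y set \<times> ('h \<Rightarrow> 'y \<times> 'y \<Rightarrow> 'k)"

definition Rep :: "('h, 'z) monoid_scheme \<Rightarrow> (('h, 'i list, 'k::field) rep, 'i list \<times> 'i list, 'k) lincat" where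
  "Rep H = \<lparr>
     Obj = {(B, \<rho>). finite B \<and> (\<forall>h\<in>carrier H. \<rho> h \<in> bmats B B) \<and>
              \<rho> \<one>\<^bsub>H\<^esub> = bmat_id B \<and>
              (\<forall>h\<in>carrier H. \<forall>h'\<in>carrier H. \<rho> (h \<otimes>\<^bsub>H\<^esub> h') = bmat_comp B (\<rho> h) (\<rho> h'))},
     Hom = (\<lambda>(B, \<rho>) (B', \<rho>'). {M \<in> bmats B B'.
              \<forall>h\<in>carrier H. bmat_comp B' (\<rho>' h) M = bmat_comp B M (\<rho> h)}),
     Idm = (\<lambda>(B, \<rho>). bmat_id B),
     Comp = (\<lambda>_ (B, _) _. bmat_comp B),
     Unit = ({[]}, \<lambda>h. bmat_id {[]})\<rparr>"

text \<open>
  The wreath product.  The pair \<open>(k, \<sigma>)\<close> is the product of \<open>k \<in> G\<^sup>n\<close> and \<open>\<sigma> \<in> S\<^sub>n\<close>, in this order.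
\<close>

definition wreath :: "('g, 'z) monoid_scheme \<Rightarrow> nat \<Rightarrow> ((nat \<Rightarrow> 'g) \<times> (nat \<Rightarrow> nat)) monoid" where
  "wreath G n = \<lparr>
     carrier = ({1..n} \<rightarrow>\<^sub>E carrier G) \<times> {\<sigma>. \<sigma> permutes {1..n}},
     monoid.mult = (\<lambda>(k, \<sigma>) (k', \<sigma>'). (\<lambda>i\<in>{1..n}. k i \<otimes>\<^bsub>G\<^esub> k' (inv_into UNIV \<sigma> i), \<sigma> \<circ> \<sigma>')),
     monoid.one = (\<lambda>i\<in>{1..n}. \<one>\<^bsub>G\<^esub>, id)\<rparr>"

text \<open>The action on the index pairs \<open>(i, j)\<close> of the basis \<open>E\<^sub>i\<^sub>j\<close> of \<open>W\<close>.\<close>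

definition wreath_act ::
  "('g, 'z) monoid_scheme \<Rightarrow> (nat \<Rightarrow> 'g) \<Rightarrow> (nat \<Rightarrow> 'g) \<times> (nat \<Rightarrow> nat) \<Rightarrow> nat \<times> nat \<Rightarrow> nat \<times> nat" where
  "wreath_act G \<theta> = (\<lambda>(k, \<sigma>) (i, j).
     (\<sigma> i, inv_into {1..order G} \<theta> (k (\<sigma> i) \<otimes>\<^bsub>G\<^esub> \<theta> j)))"

text \<open>The tensor power \<open>W\<^sup>\<otimes>\<^sup>a\<close>; its basis consists of the tuples of length \<open>a\<close> of index pairs.\<close>

definition W_basis :: "('g, 'z) monoid_scheme \<Rightarrow> nat \<Rightarrow> nat \<Rightarrow> (nat \<times> nat) list set" where
  "W_basis G n a = {xs. length xs = a \<and> set xs \<subseteq> {1..n} \<times> {1..order G}}"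

definition W_pow ::
  "('g, 'z) monoid_scheme \<Rightarrow> nat \<Rightarrow> (nat \<Rightarrow> 'g) \<Rightarrow> nat \<Rightarrow>
   ((nat \<Rightarrow> 'g) \<times> (nat \<Rightarrow> nat), (nat \<times> nat) list, 'k::field) rep" where
  "W_pow G n \<theta> a = (W_basis G n a,
     \<lambda>h (ys, xs). if xs \<in> W_basis G n a \<and> ys = map (wreath_act G \<theta> h) xs then 1 else 0)"

definition attached :: "(nat \<times> nat) list \<Rightarrow> (nat \<times> nat) list \<Rightarrow> point \<Rightarrow> nat \<times> nat" where
  "attached xs ys p = (case p of Up r \<Rightarrow> xs ! (r - 1) | Lo s \<Rightarrow> ys ! (s - 1) | Mid _ \<Rightarrow> undefined)"

definition admissible ::
  "('g, 'z) monoid_scheme \<Rightarrow> (nat \<Rightarrow> 'g) \<Rightarrow> 'g gdiag \<Rightarrow> (nat \<times> nat) list \<Rightarrow> (nat \<times> nat) list \<Rightarrow> bool" where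
  "admissible G \<theta> f xs ys \<longleftrightarrow> (\<exists>(\<pi>, l)\<in>f. \<forall>c\<in>\<pi>. \<forall>p\<in>c. \<forall>q\<in>c.
     fst (attached xs ys p) = fst (attached xs ys q) \<and>
     inv\<^bsub>G\<^esub> (\<theta> (snd (attached xs ys p))) \<otimes>\<^bsub>G\<^esub> \<theta> (snd (attached xs ys q)) =
       inv\<^bsub>G\<^esub> (l p) \<otimes>\<^bsub>G\<^esub> l q)"

definition F_diag ::
  "('g, 'z) monoid_scheme \<Rightarrow> nat \<Rightarrow> (nat \<Rightarrow> 'g) \<Rightarrow> nat \<Rightarrow> nat \<Rightarrow> 'g gdiag \<Rightarrow>
   ((nat \<times> nat) list \<times> (nat \<times> nat) list \<Rightarrow> 'k::field)" where
  "F_diag G n \<theta> a b f = (\<lambda>(ys, xs).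
     if xs \<in> W_basis G n a \<and> ys \<in> W_basis G n b \<and> admissible G \<theta> f xs ys then 1 else 0)"

definition is_functor_F where
  "is_functor_F G n \<theta> F \<longleftrightarrow>
     is_linear_functor (Ccat G (of_nat n)) (Rep (wreath G n)) F \<and>
     (\<forall>a. fob F (emb_ob (Gcat G (of_nat n)) a) = W_pow G n \<theta> a) \<and>
     (\<forall>a b. \<forall>f\<in>P G a b.
        fmor F (emb_ob (Gcat G (of_nat n)) a) (emb_ob (Gcat G (of_nat n)) b) (emb_mor (basis f)) =
        F_diag G n \<theta> a b f)"


section \<open>The functor \<open>Res\<^sub>n\<close>\<close>

definition Res_target where
  "Res_target G n t = Ccat G (t - of_nat n) \<boxtimes> Rep (wreath G n)"

definition Res where
  "Res G n t D F =
     functor_comp (boxtimes_functor (Ccat G (t - of_nat n)) (Ccat G (of_nat n)) id_functor F) D"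


section \<open>The idempotent\<close>

definition proper_coarsening ::
  "('g, 'z) monoid_scheme \<Rightarrow> nat \<Rightarrow> nat \<Rightarrow> 'g gdiag \<Rightarrow> 'g gdiag \<Rightarrow> bool" where
  "proper_coarsening G a b f' f \<longleftrightarrow> f \<in> P G a b \<and> f' \<in> P G a b \<and>
     (\<exists>(\<pi>, l)\<in>f. \<exists>(\<pi>', l')\<in>f'. l' = l \<and> \<pi>' \<noteq> \<pi> \<and> refines (points a b) \<pi> \<pi>')"

lemma comps_eq:
  assumes "f \<in> P G a b" and "d \<in> f"
  shows "comps f = fst d"
proof -
  have "fst ` f = {fst d}"
    using assms by (fastforce simp: P_def diag_rel_def quotient_def)
  then show ?thesis by (simp add: comps_def)
qed

lemma refines_card_less:
  assumes "finite A" and "refines A \<pi> \<pi>'" and "\<pi>' \<noteq> \<pi>"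
  shows "card \<pi>' < card \<pi>"
proof -
  have part: "partition_on A \<pi>" "partition_on A \<pi>'"
    using assms(2) by (auto simp: refines_def)
  have fin: "finite \<pi>"
    using part(1) assms(1) finite_elements by blast
  have disj: "Y = Y'" if "Y \<in> \<pi>'" "Y' \<in> \<pi>'" "p \<in> Y" "p \<in> Y'" for Y Y' p
    using that part(2) by (auto simp: partition_on_def disjoint_def)
  have "\<exists>X\<in>\<pi>. X \<subseteq> Y" if "Y \<in> \<pi>'" for Y
  proof -
    have "Y \<noteq> {}" using \<open>Y \<in> \<pi>'\<close> part(2) by (auto simp: partition_on_def)
    then obtain p where "p \<in> Y" by blast
    moreover have "Y = \<Union>{X \<in> \<pi>. X \<subseteq> Y}"
      using refines_obtains_subset[OF assms(2) \<open>Y \<in> \<pi>'\<close>] by (auto simp: partition_on_def)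
    ultimately show ?thesis by blast
  qed
  then obtain h where h: "\<And>Y. Y \<in> \<pi>' \<Longrightarrow> h Y \<in> \<pi> \<and> h Y \<subseteq> Y"
    by metis
  have ne: "h Y \<noteq> {}" if "Y \<in> \<pi>'" for Y
    using h[OF that] part(1) by (auto simp: partition_on_def)
  have inj: "inj_on h \<pi>'"
    by (rule inj_onI) (metis h ne disj subsetD ex_in_conv)
  have "h ` \<pi>' \<noteq> \<pi>"
  proof
    assume eq: "h ` \<pi>' = \<pi>"
    have "h Y = Y" if "Y \<in> \<pi>'" for Y
    proof
      show "h Y \<subseteq> Y" using h[OF that] by simp
      show "Y \<subseteq> h Y"
      proof
        fix p assume "p \<in> Y"
        then have "p \<in> \<Union>\<pi>" using that part by (auto simp: partition_on_def)
        then obtain Y' where "Y' \<in> \<pi>'" "p \<in> h Y'" using eq by auto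
        then show "p \<in> h Y" using disj[OF that \<open>Y' \<in> \<pi>'\<close> \<open>p \<in> Y\<close>] h by auto
      qed
    qed
    then show False using eq assms(3) by auto
  qed
  then have "h ` \<pi>' \<subset> \<pi>" using h by auto
  then show ?thesis using psubset_card_mono[OF fin] card_image[OF inj] by metis
qed

lemma proper_coarsening_card:
  assumes "proper_coarsening G a b f' f"
  shows "card (comps f') < card (comps f)"
proof -
  have P: "f \<in> P G a b" "f' \<in> P G a b" using assms by (simp_all add: proper_coarsening_def)
  obtain \<pi> l \<pi>' where "(\<pi>, l) \<in> f" "(\<pi>', l) \<in> f'" "\<pi>' \<noteq> \<pi>" "refines (points a b) \<pi> \<pi>'"
    using assms unfolding proper_coarsening_def by blast
  moreover have "finite (points a b)" by (simp add: points_def)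
  ultimately show ?thesis
    using comps_eq[OF P(1)] comps_eq[OF P(2)] refines_card_less by (metis fst_conv)
qed

text \<open>The element \<open>x(f)\<close>; the type argument is the coefficient field.\<close>

function xdiag ::
  "'k itself \<Rightarrow> ('g, 'z) monoid_scheme \<Rightarrow> nat \<Rightarrow> nat \<Rightarrow> 'g gdiag \<Rightarrow> ('g gdiag \<Rightarrow> 'k::field_char_0)" where
  "xdiag K G a b f = basis f - (\<Sum>f'\<in>{f'. proper_coarsening G a b f' f}. xdiag K G a b f')"
  by pat_completeness auto
termination
  by (relation "measure (\<lambda>(K, G, a, b, f). card (comps f))") (auto intro: proper_coarsening_card)

declare xdiag.simps [simp del]

definition x_idem :: "('g, 'z) monoid_scheme \<Rightarrow> nat \<Rightarrow> ('g gdiag \<Rightarrow> 'k::field_char_0)" where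
  "x_idem G n = xdiag TYPE('k) G n n (id_diag G n)"

definition e_sym :: "('g, 'z) monoid_scheme \<Rightarrow> nat \<Rightarrow> ('g gdiag \<Rightarrow> 'k::field_char_0)" where
  "e_sym G n = smul (1 / fact n) (\<Sum>\<sigma>\<in>{\<sigma>. \<sigma> permutes {1..n}}. basis (strands G n \<sigma> (\<lambda>_. \<one>\<^bsub>G\<^esub>)))"

definition omega :: "('g, 'z) monoid_scheme \<Rightarrow> nat \<Rightarrow> ('g gdiag \<Rightarrow> 'k::field_char_0)" where
  "omega G n = smul (1 / of_nat (order G) ^ n)
     (\<Sum>k\<in>{1..n} \<rightarrow>\<^sub>E carrier G. basis (strands G n id k))"

definition e_idem :: "('g, 'z) monoid_scheme \<Rightarrow> 'k::field_char_0 \<Rightarrow> nat \<Rightarrow> ('g gdiag \<Rightarrow> 'k)" where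
  "e_idem G t n = Comp (Gcat G t) n n n (e_sym G n) (Comp (Gcat G t) n n n (omega G n) (x_idem G n))"

definition X_obj ::
  "('g, 'z) monoid_scheme \<Rightarrow> 'k::field_char_0 \<Rightarrow> nat \<Rightarrow> (nat, 'g gdiag, 'k) ps_obj" where
  "X_obj G t n = ([n], emb_mor (e_idem G t n))"

end

theory Submission
  imports Defs "HOL-Computational_Algebra.Polynomial"
begin

text \<open>
  A linear combination of \<open>G\<close>-diagrams is determined by its kernel, its value on all pairs of tuples of
  points (row, group element), where a diagram takes the value \<open>1\<close> on the pairs compatible with
  it and \<open>0\<close> on all others.  For \<open>t = N\<close>, composition is multiplication of the kernels as matrices
  over \<open>N\<close> rows; since it is polynomial in \<open>t\<close>, identities for all large \<open>N\<close> hold for every \<open>t\<close>.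
  On kernels, \<open>Res\<^sub>n\<close> singles out \<open>n\<close> of the rows: those are seen by \<open>F\<close>, the others by
  \<open>\<C>\<^sub>t\<^sub>-\<^sub>n\<close>.

  Call a tuple of \<open>n + a\<close> points good if its first \<open>n\<close> rows are pairwise distinct and distinct from the
  remaining ones.  The restriction to good tuples is an idempotent of \<open>[n + a]\<close>, with image \<open>Z\<^sub>a\<close>
  say.  As \<open>G wr S\<^sub>n\<close> acts simply transitively on the \<open>n\<close>-tuples with rows \<open>1, \<dots>, n\<close> in any order,
  morphisms between \<open>[b]\<close> and \<open>Z\<^sub>a\<close> are, in both directions, morphisms between \<open>Res\<^sub>n [b]\<close> and
  \<open>[a] \<boxtimes> k[G wr S\<^sub>n]\<close>.  So \<open>Z\<^sub>a\<close> is the value of both adjoints on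
  \<open>[a] \<boxtimes> k[G wr S\<^sub>n]\<close>.  The regular representation generates \<open>Rep(G wr S\<^sub>n)\<close> in
  characteristic \<open>0\<close>, hence both adjoints extend to all objects by splitting idempotents, and they
  coincide on morphisms too.  The projection of the regular representation onto the trivial one
  corresponds to the endomorphism \<open>e\<close> of \<open>Z\<^sub>0\<close>.
\<close>

text \<open>Two obstacles shape the proof. \<open>D\<close> and \<open>F\<close> are prescribed only
  on the objects \<open>[a]\<close> and on diagrams, so a universal property can be tested only
  against \<open>[b]\<close>; it reaches all objects because each is a retract of a finite sum of
  these. And one functor has to serve on both sides, also on morphisms. So a representing object
  carries two universal elements, \<epsilon> and \<eta>, and the image of a morphism has to satisfy
  the equations of both; the lift is found from \<epsilon> and then checked against \<eta>.
  Interpolation in \<open>t\<close> is confined to composition. The formula for \<open>Res\<close>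
  on a diagram contains no parameter, so the kernels of \<open>u\<close> and of \<open>Res u\<close>
  can be compared for arbitrary rows. Kernels are faithful by triangularity: the diagrams admitting
  a configuration are those that have its type as a coarsening. The recursion for
  \<open>x(f)\<close> inverts this relation, which is how \<open>x_n\<close> enters
  \<open>e\<close>. The regular representation is taken as the span of the basis tuples of
  \<open>W\<^sup>\<otimes>\<^sup>n\<close> with distinct rows, so a 0/1 matrix cuts it out. The
  constant in \<open>e\<close> is the inverse of the order of the wreath product, from averaging
  over the group.\<close>

hide_const (open) Polynomial.order

section \<open>Linear categories\<close>

lemma sum_fun_apply: "(\<Sum>i\<in>A. f i) x = (\<Sum>i\<in>A. f i x)"
  by (induction A rule: infinite_finite_induct) (auto simp: plus_fun_apply zero_fun_apply)

text \<open>Morphisms are functions but are handled as vectors; pointwise evaluation is requested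
  explicitly through \<open>fun_ev\<close>.\<close>

declare plus_fun_apply [simp del] zero_fun_apply [simp del]

lemma smul_apply: "smul c f x = c * f x"
  by (simp add: smul_def)

lemmas fun_ev = plus_fun_apply zero_fun_apply smul_apply

lemma smul_add: "smul (c::'k::field) (f + g) = smul c f + smul c g"
  by (rule ext) (simp add: fun_ev algebra_simps)

lemma smul_0 [simp]: "smul (c::'k::field) 0 = 0"
  by (rule ext) (simp add: fun_ev)

lemma smul_zero [simp]: "smul (0::'k::field) f = 0"
  by (rule ext) (simp add: fun_ev)

lemma smul_one [simp]: "smul (1::'k::field) f = f"
  by (rule ext) (simp add: fun_ev)

lemma smul_smul [simp]: "smul (c::'k::field) (smul d f) = smul (c * d) f"
  by (rule ext) (simp add: fun_ev)

lemma smul_sum: "smul (c::'k::field) (\<Sum>i\<in>A. f i) = (\<Sum>i\<in>A. smul c (f i))"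
  by (induction A rule: infinite_finite_induct) (auto simp: smul_add)

lemma smul_sum_list: "smul (c::'k::field) (\<Sum>i\<leftarrow>xs. f i) = (\<Sum>i\<leftarrow>xs. smul c (f i))"
  by (induction xs) (auto simp: smul_add)

lemma sum_list_swap: "(\<Sum>x\<leftarrow>xs. \<Sum>y\<leftarrow>ys. f x y) = (\<Sum>y\<leftarrow>ys. \<Sum>x\<leftarrow>xs. (f x y :: 'a::comm_monoid_add))"
  by (induction xs) (auto simp: sum_list_addf)

lemma sum_list_pair_cong:
  "(\<And>x y. (x, y) \<in> set xs \<Longrightarrow> f x y = g x y) \<Longrightarrow> (\<Sum>(x, y)\<leftarrow>xs. f x y) = (\<Sum>(x, y)\<leftarrow>xs. g x y)"
  by (rule arg_cong[where f = sum_list]) auto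

lemma sum_list_pair_smul:
  "(\<Sum>(x, y)\<leftarrow>map (\<lambda>(f, g). (smul c f, g)) xs. h x y) = (\<Sum>(x, y)\<leftarrow>xs. h (smul c x) y)"
  by (induction xs) auto

lemma zero_fun_eq: "(\<lambda>x. 0) = 0"
  by (rule ext) (simp add: fun_ev)

text \<open>\<open>Comp\<close> has no controlled value off the hom-spaces (in
  \<open>tensor_cat\<close> it is a definite description), hence every law is relativised to objects
  and members of hom-spaces.\<close>

locale linear_category =
  fixes C :: "('o, 'x, 'k::field) lincat"
  assumes zero_hom: "\<And>A B. \<lbrakk>A \<in> Obj C; B \<in> Obj C\<rbrakk> \<Longrightarrow> 0 \<in> Hom C A B"
    and add_hom: "\<And>A B f g. \<lbrakk>A \<in> Obj C; B \<in> Obj C; f \<in> Hom C A B; g \<in> Hom C A B\<rbrakk> \<Longrightarrow> f + g \<in> Hom C A B"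
    and smul_hom: "\<And>A B f c. \<lbrakk>A \<in> Obj C; B \<in> Obj C; f \<in> Hom C A B\<rbrakk> \<Longrightarrow> smul c f \<in> Hom C A B"
    and id_hom: "\<And>A. A \<in> Obj C \<Longrightarrow> Idm C A \<in> Hom C A A"
    and comp_hom: "\<And>A B E f g. \<lbrakk>A \<in> Obj C; B \<in> Obj C; E \<in> Obj C; f \<in> Hom C A B; g \<in> Hom C B E\<rbrakk>
      \<Longrightarrow> Comp C A B E g f \<in> Hom C A E"
    and comp_add_left: "\<And>A B E f g g'. \<lbrakk>A \<in> Obj C; B \<in> Obj C; E \<in> Obj C; f \<in> Hom C A B; g \<in> Hom C B E; g' \<in> Hom C B E\<rbrakk>
      \<Longrightarrow> Comp C A B E (g + g') f = Comp C A B E g f + Comp C A B E g' f"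
    and comp_add_right: "\<And>A B E f f' g. \<lbrakk>A \<in> Obj C; B \<in> Obj C; E \<in> Obj C; f \<in> Hom C A B; f' \<in> Hom C A B; g \<in> Hom C B E\<rbrakk>
      \<Longrightarrow> Comp C A B E g (f + f') = Comp C A B E g f + Comp C A B E g f'"
    and comp_smul_left: "\<And>A B E f g c. \<lbrakk>A \<in> Obj C; B \<in> Obj C; E \<in> Obj C; f \<in> Hom C A B; g \<in> Hom C B E\<rbrakk>
      \<Longrightarrow> Comp C A B E (smul c g) f = smul c (Comp C A B E g f)"
    and comp_smul_right: "\<And>A B E f g c. \<lbrakk>A \<in> Obj C; B \<in> Obj C; E \<in> Obj C; f \<in> Hom C A B; g \<in> Hom C B E\<rbrakk>
      \<Longrightarrow> Comp C A B E g (smul c f) = smul c (Comp C A B E g f)"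
    and id_left: "\<And>A B f. \<lbrakk>A \<in> Obj C; B \<in> Obj C; f \<in> Hom C A B\<rbrakk> \<Longrightarrow> Comp C A B B (Idm C B) f = f"
    and id_right: "\<And>A B f. \<lbrakk>A \<in> Obj C; B \<in> Obj C; f \<in> Hom C A B\<rbrakk> \<Longrightarrow> Comp C A A B f (Idm C A) = f"
    and assoc: "\<And>A B E K f g h. \<lbrakk>A \<in> Obj C; B \<in> Obj C; E \<in> Obj C; K \<in> Obj C;
        f \<in> Hom C A B; g \<in> Hom C B E; h \<in> Hom C E K\<rbrakk>
      \<Longrightarrow> Comp C A E K h (Comp C A B E g f) = Comp C A B K (Comp C B E K h g) f"
begin

lemma comp_zero_left: "\<lbrakk>A \<in> Obj C; B \<in> Obj C; E \<in> Obj C; f \<in> Hom C A B\<rbrakk> \<Longrightarrow> Comp C A B E 0 f = 0"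
  using comp_smul_left[of A B E f 0 0] zero_hom by simp

lemma comp_zero_right: "\<lbrakk>A \<in> Obj C; B \<in> Obj C; E \<in> Obj C; g \<in> Hom C B E\<rbrakk> \<Longrightarrow> Comp C A B E g 0 = 0"
  using comp_smul_right[of A B E 0 g 0] zero_hom by simp

lemma sum_hom: "\<lbrakk>A \<in> Obj C; B \<in> Obj C; \<And>i. i \<in> I \<Longrightarrow> f i \<in> Hom C A B\<rbrakk> \<Longrightarrow> (\<Sum>i\<in>I. f i) \<in> Hom C A B"
  by (induction I rule: infinite_finite_induct) (auto intro: zero_hom add_hom)

lemma comp_sum_left: "\<lbrakk>A \<in> Obj C; B \<in> Obj C; E \<in> Obj C; f \<in> Hom C A B; \<And>i. i \<in> I \<Longrightarrow> g i \<in> Hom C B E\<rbrakk>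
   \<Longrightarrow> Comp C A B E (\<Sum>i\<in>I. g i) f = (\<Sum>i\<in>I. Comp C A B E (g i) f)"
  by (induction I rule: infinite_finite_induct) (auto simp: comp_zero_left comp_add_left sum_hom)

lemma comp_sum_right: "\<lbrakk>A \<in> Obj C; B \<in> Obj C; E \<in> Obj C; g \<in> Hom C B E; \<And>i. i \<in> I \<Longrightarrow> f i \<in> Hom C A B\<rbrakk>
   \<Longrightarrow> Comp C A B E g (\<Sum>i\<in>I. f i) = (\<Sum>i\<in>I. Comp C A B E g (f i))"
  by (induction I rule: infinite_finite_induct) (auto simp: comp_zero_right comp_add_right sum_hom)

end

subsection \<open>Linear functors\<close>

locale linear_functor = src: linear_category C + tgt: linear_category D
  for C :: "('o, 'x, 'k::field) lincat" and D :: "('p, 'y, 'k) lincat" +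
  fixes F :: "('o, 'x, 'p, 'y, 'k) fnctr"
  assumes lin: "is_linear_functor C D F"
begin

lemma ob: "A \<in> Obj C \<Longrightarrow> fob F A \<in> Obj D"
  and mor: "\<lbrakk>A \<in> Obj C; B \<in> Obj C; f \<in> Hom C A B\<rbrakk> \<Longrightarrow> fmor F A B f \<in> Hom D (fob F A) (fob F B)"
  and idm: "A \<in> Obj C \<Longrightarrow> fmor F A A (Idm C A) = Idm D (fob F A)"
  and comp: "\<lbrakk>A \<in> Obj C; B \<in> Obj C; E \<in> Obj C; f \<in> Hom C A B; g \<in> Hom C B E\<rbrakk> \<Longrightarrow>
     fmor F A E (Comp C A B E g f) = Comp D (fob F A) (fob F B) (fob F E) (fmor F B E g) (fmor F A B f)"
  and add: "\<lbrakk>A \<in> Obj C; B \<in> Obj C; f \<in> Hom C A B; g \<in> Hom C A B\<rbrakk> \<Longrightarrow>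
     fmor F A B (f + g) = fmor F A B f + fmor F A B g"
  and scal: "\<lbrakk>A \<in> Obj C; B \<in> Obj C; f \<in> Hom C A B\<rbrakk> \<Longrightarrow> fmor F A B (smul c f) = smul c (fmor F A B f)"
  using lin by (auto simp: is_linear_functor_def is_functor_def)

lemma zero: "\<lbrakk>A \<in> Obj C; B \<in> Obj C\<rbrakk> \<Longrightarrow> fmor F A B 0 = 0"
  using scal[of A B 0 0] src.zero_hom by simp

lemma sum: "\<lbrakk>A \<in> Obj C; B \<in> Obj C; \<And>i. i \<in> I \<Longrightarrow> f i \<in> Hom C A B\<rbrakk> \<Longrightarrow>
   fmor F A B (\<Sum>i\<in>I. f i) = (\<Sum>i\<in>I. fmor F A B (f i))"
  by (induction I rule: infinite_finite_induct) (auto simp: zero add src.sum_hom)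

lemma is_fun: "is_functor C D F"
  using lin by (simp add: is_linear_functor_def)

end

lemma linear_functor_id:
  assumes "linear_category C" shows "linear_functor C C id_functor"
proof -
  interpret linear_category C by fact
  show ?thesis by unfold_locales (auto simp: is_linear_functor_def is_functor_def id_functor_def)
qed

lemma linear_functor_comp:
  assumes "linear_functor C D F" "linear_functor D E K"
  shows "linear_functor C E (functor_comp K F)"
proof -
  interpret F: linear_functor C D F by fact
  interpret K: linear_functor D E K by fact
  show ?thesis
    by unfold_locales
      (auto simp: is_linear_functor_def is_functor_def functor_comp_def F.ob F.mor F.idm F.comp F.add F.scal
        K.ob K.mor K.idm K.comp K.add K.scal)
qed

subsection \<open>The pseudo-abelian completion\<close>

lemma entry_matrix: "entry (matrix r c \<phi>) j i = (if j < r \<and> i < c then \<phi> j i else 0)"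
  by (auto simp: entry_def matrix_def fun_eq_iff fun_ev)

lemma entry_single: "entry (single j i f) j' i' = (if j' = j \<and> i' = i then f else 0)"
  by (auto simp: entry_def single_def fun_eq_iff fun_ev)

lemma entry_add: "entry (M + N) j i = entry M j i + entry N j i"
  by (auto simp: entry_def fun_eq_iff fun_ev)

lemma entry_smul: "entry (smul c M) j i = smul c (entry M j i)"
  by (auto simp: entry_def fun_eq_iff fun_ev)

lemma entry_zero: "entry 0 j i = 0"
  by (auto simp: entry_def fun_eq_iff fun_ev)

lemma entry_sum: "entry (\<Sum>k\<in>I. M k) j i = (\<Sum>k\<in>I. entry (M k) j i)"
  by (induction I rule: infinite_finite_induct) (auto simp: entry_zero entry_add)

lemma entry_eqI: "(\<And>j i. entry M j i = entry N j i) \<Longrightarrow> M = N"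
  by (auto simp: entry_def fun_eq_iff fun_ev)

lemma mat_hom_iff:
  "M \<in> mat_hom C As Bs \<longleftrightarrow>
     (\<forall>j<length Bs. \<forall>i<length As. entry M j i \<in> Hom C (As ! i) (Bs ! j)) \<and>
     (\<forall>j i. \<not> (j < length Bs \<and> i < length As) \<longrightarrow> entry M j i = 0)"
  by (auto simp: mat_hom_def zero_fun_eq split: if_splits)

lemma mat_hom_entry: "\<lbrakk>M \<in> mat_hom C As Bs; j < length Bs; i < length As\<rbrakk> \<Longrightarrow> entry M j i \<in> Hom C (As ! i) (Bs ! j)"
  and mat_hom_out: "\<lbrakk>M \<in> mat_hom C As Bs; \<not> (j < length Bs \<and> i < length As)\<rbrakk> \<Longrightarrow> entry M j i = 0"
  by (auto simp: mat_hom_iff)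

lemma mat_hom_eqI:
  assumes "M \<in> mat_hom C As Bs" "N \<in> mat_hom C As Bs"
    and "\<And>j i. j < length Bs \<Longrightarrow> i < length As \<Longrightarrow> entry M j i = entry N j i"
  shows "M = N"
  by (rule entry_eqI) (metis assms mat_hom_out)

lemma matrix_mat_hom:
  assumes "\<And>j i. j < length Bs \<Longrightarrow> i < length As \<Longrightarrow> \<phi> j i \<in> Hom C (As ! i) (Bs ! j)"
    "r = length Bs" "c = length As"
  shows "matrix r c \<phi> \<in> mat_hom C As Bs"
  using assms by (auto simp: mat_hom_iff entry_matrix)

lemma entry_mat_comp:
  "entry (mat_comp C As Bs Es N M) l i = (if l < length Es \<and> i < length As
     then \<Sum>j<length Bs. Comp C (As ! i) (Bs ! j) (Es ! l) (entry N l j) (entry M j i) else 0)"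
  by (simp add: mat_comp_def entry_matrix)

lemma entry_mat_id:
  "entry (mat_id C As) j i = (if j = i \<and> i < length As then Idm C (As ! i) else 0)"
  by (auto simp: mat_id_def entry_matrix zero_fun_eq)

context linear_category
begin

lemma objD [intro]: "set As \<subseteq> Obj C \<Longrightarrow> i < length As \<Longrightarrow> As ! i \<in> Obj C"
  by auto

lemma mat_comp_hom:
  assumes "set As \<subseteq> Obj C" "set Bs \<subseteq> Obj C" "set Es \<subseteq> Obj C"
    and "M \<in> mat_hom C As Bs" "N \<in> mat_hom C Bs Es"
  shows "mat_comp C As Bs Es N M \<in> mat_hom C As Es"
  unfolding mat_comp_def using assms(1-3)[THEN objD]
  by (intro matrix_mat_hom) (auto intro!: sum_hom comp_hom mat_hom_entry[OF assms(4)] mat_hom_entry[OF assms(5)])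

lemma mat_id_hom: "set As \<subseteq> Obj C \<Longrightarrow> mat_id C As \<in> mat_hom C As As"
  unfolding mat_id_def zero_fun_eq by (rule matrix_mat_hom) (auto intro!: id_hom zero_hom objD)

lemma mat_zero_hom: "set As \<subseteq> Obj C \<Longrightarrow> set Bs \<subseteq> Obj C \<Longrightarrow> 0 \<in> mat_hom C As Bs"
  by (auto simp: mat_hom_iff entry_zero intro!: zero_hom objD)

lemma mat_add_hom: "\<lbrakk>set As \<subseteq> Obj C; set Bs \<subseteq> Obj C; M \<in> mat_hom C As Bs; N \<in> mat_hom C As Bs\<rbrakk> \<Longrightarrow> M + N \<in> mat_hom C As Bs"
  by (auto simp: mat_hom_iff entry_add intro!: add_hom objD)

lemma mat_smul_hom: "\<lbrakk>set As \<subseteq> Obj C; set Bs \<subseteq> Obj C; M \<in> mat_hom C As Bs\<rbrakk> \<Longrightarrow> smul c M \<in> mat_hom C As Bs"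
  by (auto simp: mat_hom_iff entry_smul intro!: smul_hom objD)

lemma mat_comp_add_left:
  assumes "set As \<subseteq> Obj C" "set Bs \<subseteq> Obj C" "set Es \<subseteq> Obj C"
    "M \<in> mat_hom C As Bs" "N \<in> mat_hom C Bs Es" "N' \<in> mat_hom C Bs Es"
  shows "mat_comp C As Bs Es (N + N') M = mat_comp C As Bs Es N M + mat_comp C As Bs Es N' M"
  using assms(1-3)[THEN objD] by (intro entry_eqI)
    (auto simp: entry_mat_comp entry_add sum.distrib[symmetric] intro!: sum.cong comp_add_left
      mat_hom_entry[OF assms(4)] mat_hom_entry[OF assms(5)] mat_hom_entry[OF assms(6)])

lemma mat_comp_add_right:
  assumes "set As \<subseteq> Obj C" "set Bs \<subseteq> Obj C" "set Es \<subseteq> Obj C"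
    "M \<in> mat_hom C As Bs" "M' \<in> mat_hom C As Bs" "N \<in> mat_hom C Bs Es"
  shows "mat_comp C As Bs Es N (M + M') = mat_comp C As Bs Es N M + mat_comp C As Bs Es N M'"
  using assms(1-3)[THEN objD] by (intro entry_eqI)
    (auto simp: entry_mat_comp entry_add sum.distrib[symmetric] intro!: sum.cong comp_add_right
      mat_hom_entry[OF assms(4)] mat_hom_entry[OF assms(5)] mat_hom_entry[OF assms(6)])

lemma mat_comp_smul_left:
  assumes "set As \<subseteq> Obj C" "set Bs \<subseteq> Obj C" "set Es \<subseteq> Obj C"
    "M \<in> mat_hom C As Bs" "N \<in> mat_hom C Bs Es"
  shows "mat_comp C As Bs Es (smul c N) M = smul c (mat_comp C As Bs Es N M)"
  using assms(1-3)[THEN objD] by (intro entry_eqI)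
    (auto simp: entry_mat_comp entry_smul smul_sum intro!: sum.cong comp_smul_left
      mat_hom_entry[OF assms(4)] mat_hom_entry[OF assms(5)])

lemma mat_comp_smul_right:
  assumes "set As \<subseteq> Obj C" "set Bs \<subseteq> Obj C" "set Es \<subseteq> Obj C"
    "M \<in> mat_hom C As Bs" "N \<in> mat_hom C Bs Es"
  shows "mat_comp C As Bs Es N (smul c M) = smul c (mat_comp C As Bs Es N M)"
  using assms(1-3)[THEN objD] by (intro entry_eqI)
    (auto simp: entry_mat_comp entry_smul smul_sum intro!: sum.cong comp_smul_right
      mat_hom_entry[OF assms(4)] mat_hom_entry[OF assms(5)])

lemma mat_id_left:
  assumes "set As \<subseteq> Obj C" "set Bs \<subseteq> Obj C" "M \<in> mat_hom C As Bs"
  shows "mat_comp C As Bs Bs (mat_id C Bs) M = M"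
proof (rule mat_hom_eqI)
  fix j i assume l: "j < length Bs" "i < length As"
  have "(\<Sum>k<length Bs. Comp C (As ! i) (Bs ! k) (Bs ! j) (if j = k \<and> k < length Bs then Idm C (Bs ! k) else 0) (entry M k i))
     = (\<Sum>k<length Bs. if k = j then entry M k i else 0)"
    using l assms(1,2) by (intro sum.cong) (auto simp: id_left comp_zero_left mat_hom_entry[OF assms(3)] objD)
  then show "entry (mat_comp C As Bs Bs (mat_id C Bs) M) j i = entry M j i"
    using l by (simp add: entry_mat_comp entry_mat_id)
qed (use assms in \<open>auto intro: mat_comp_hom mat_id_hom\<close>)

lemma mat_id_right:
  assumes "set As \<subseteq> Obj C" "set Bs \<subseteq> Obj C" "M \<in> mat_hom C As Bs"
  shows "mat_comp C As As Bs M (mat_id C As) = M"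
proof (rule mat_hom_eqI)
  fix j i assume l: "j < length Bs" "i < length As"
  have "(\<Sum>k<length As. Comp C (As ! i) (As ! k) (Bs ! j) (entry M j k) (if k = i \<and> i < length As then Idm C (As ! i) else 0))
     = (\<Sum>k<length As. if k = i then entry M j k else 0)"
    using l assms(1,2) by (intro sum.cong) (auto simp: id_right comp_zero_right mat_hom_entry[OF assms(3)] objD)
  then show "entry (mat_comp C As As Bs M (mat_id C As)) j i = entry M j i"
    using l by (simp add: entry_mat_comp entry_mat_id)
qed (use assms in \<open>auto intro: mat_comp_hom mat_id_hom\<close>)

lemma mat_comp_assoc:
  assumes o: "set As \<subseteq> Obj C" "set Bs \<subseteq> Obj C" "set Es \<subseteq> Obj C" "set Ks \<subseteq> Obj C"
    and h: "M \<in> mat_hom C As Bs" "N \<in> mat_hom C Bs Es" "L \<in> mat_hom C Es Ks"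
  shows "mat_comp C As Es Ks L (mat_comp C As Bs Es N M) = mat_comp C As Bs Ks (mat_comp C Bs Es Ks L N) M"
proof (rule mat_hom_eqI)
  fix l i assume li: "l < length Ks" "i < length As"
  note [simp] = o[THEN objD] h[THEN mat_hom_entry] li
  have "entry (mat_comp C As Es Ks L (mat_comp C As Bs Es N M)) l i =
    (\<Sum>k<length Es. \<Sum>j<length Bs. Comp C (As ! i) (Es ! k) (Ks ! l) (entry L l k)
        (Comp C (As ! i) (Bs ! j) (Es ! k) (entry N k j) (entry M j i)))"
    by (auto simp: entry_mat_comp intro!: sum.cong comp_sum_right comp_hom)
  also have "\<dots> = (\<Sum>k<length Es. \<Sum>j<length Bs. Comp C (As ! i) (Bs ! j) (Ks ! l)
        (Comp C (Bs ! j) (Es ! k) (Ks ! l) (entry L l k) (entry N k j)) (entry M j i))"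
    by (intro sum.cong refl assoc) auto
  also have "\<dots> = (\<Sum>j<length Bs. \<Sum>k<length Es. Comp C (As ! i) (Bs ! j) (Ks ! l)
        (Comp C (Bs ! j) (Es ! k) (Ks ! l) (entry L l k) (entry N k j)) (entry M j i))"
    by (rule sum.swap)
  also have "\<dots> = entry (mat_comp C As Bs Ks (mat_comp C Bs Es Ks L N) M) l i"
    by (auto simp: entry_mat_comp intro!: sum.cong comp_sum_left[symmetric] comp_hom)
  finally show "entry (mat_comp C As Es Ks L (mat_comp C As Bs Es N M)) l i =
    entry (mat_comp C As Bs Ks (mat_comp C Bs Es Ks L N) M) l i" .
qed (use assms in \<open>auto intro: mat_comp_hom\<close>)

text \<open>The matrix laws pass to the completion because its hom-spaces consist of the matrices
  absorbing both idempotents, and the idempotent itself acts as the identity.\<close>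

lemma linear_category_ps: "linear_category (ps C)"
proof
  fix A B E K :: "('o, 'x, 'k) ps_obj" and f f' g g' h and c :: 'k
  obtain As a Bs b Es e Ks k where [simp]: "A = (As, a)" "B = (Bs, b)" "E = (Es, e)" "K = (Ks, k)" by fastforce
  assume "A \<in> Obj (ps C)"
  then have A: "set As \<subseteq> Obj C" "a \<in> mat_hom C As As" "mat_comp C As As As a a = a" by (auto simp: ps_def)
  show "Idm (ps C) A \<in> Hom (ps C) A A" using A by (simp add: ps_def)
  assume "B \<in> Obj (ps C)"
  then have B: "set Bs \<subseteq> Obj C" "b \<in> mat_hom C Bs Bs" "mat_comp C Bs Bs Bs b b = b" by (auto simp: ps_def)
  have "mat_comp C As Bs Bs b 0 = 0" "mat_comp C As As Bs 0 a = 0"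
    using mat_comp_smul_right[of As Bs Bs 0 b 0] mat_comp_smul_left[of As As Bs a 0 0] A B mat_zero_hom by simp_all
  then show "0 \<in> Hom (ps C) A B" using A B mat_zero_hom by (simp add: ps_def)
  assume "f \<in> Hom (ps C) A B"
  then have f: "f \<in> mat_hom C As Bs" "mat_comp C As Bs Bs b f = f" "mat_comp C As As Bs f a = f" by (auto simp: ps_def)
  show "smul c f \<in> Hom (ps C) A B" using A B f by (simp add: ps_def mat_smul_hom mat_comp_smul_left mat_comp_smul_right)
  show "Comp (ps C) A B B (Idm (ps C) B) f = f" "Comp (ps C) A A B f (Idm (ps C) A) = f"
    using f by (simp_all add: ps_def)
  { assume "f' \<in> Hom (ps C) A B"
    then have f': "f' \<in> mat_hom C As Bs" "mat_comp C As Bs Bs b f' = f'" "mat_comp C As As Bs f' a = f'" by (auto simp: ps_def)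
    show "f + f' \<in> Hom (ps C) A B" using A B f f' by (simp add: ps_def mat_add_hom mat_comp_add_left mat_comp_add_right) }
  note f' = this
  assume "E \<in> Obj (ps C)"
  then have E: "set Es \<subseteq> Obj C" "e \<in> mat_hom C Es Es" "mat_comp C Es Es Es e e = e" by (auto simp: ps_def)
  { assume "f' \<in> Hom (ps C) A B" "g \<in> Hom (ps C) B E"
    then show "Comp (ps C) A B E g (f + f') = Comp (ps C) A B E g f + Comp (ps C) A B E g f'"
      using A B E f by (simp add: ps_def mat_comp_add_right) }
  assume "g \<in> Hom (ps C) B E"
  then have g: "g \<in> mat_hom C Bs Es" "mat_comp C Bs Es Es e g = g" "mat_comp C Bs Bs Es g b = g" by (auto simp: ps_def)
  have "mat_comp C As Es Es e (mat_comp C As Bs Es g f) = mat_comp C As Bs Es g f"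
    "mat_comp C As As Es (mat_comp C As Bs Es g f) a = mat_comp C As Bs Es g f"
    using mat_comp_assoc[of As Bs Es Es f g e] mat_comp_assoc[of As As Bs Es a f g] A B E f g by simp_all
  then show "Comp (ps C) A B E g f \<in> Hom (ps C) A E" using A B E f g by (simp add: ps_def mat_comp_hom)
  { assume "g' \<in> Hom (ps C) B E"
    then show "Comp (ps C) A B E (g + g') f = Comp (ps C) A B E g f + Comp (ps C) A B E g' f"
      using A B E f g by (simp add: ps_def mat_comp_add_left) }
  show "Comp (ps C) A B E (smul c g) f = smul c (Comp (ps C) A B E g f)"
    "Comp (ps C) A B E g (smul c f) = smul c (Comp (ps C) A B E g f)"
    using A B E f g by (simp_all add: ps_def mat_comp_smul_left mat_comp_smul_right)
  assume "K \<in> Obj (ps C)" "h \<in> Hom (ps C) E K"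
  then show "Comp (ps C) A E K h (Comp (ps C) A B E g f) = Comp (ps C) A B K (Comp (ps C) B E K h g) f"
    using A B E f g by (auto simp: ps_def intro: mat_comp_assoc)
qed

end

section \<open>Extension of linear functors to the pseudo-abelian completion\<close>

lemma (in linear_functor) mat_mor_comp:
  assumes o: "set As \<subseteq> Obj C" "set Bs \<subseteq> Obj C" "set Es \<subseteq> Obj C"
    and h: "M \<in> mat_hom C As Bs" "N \<in> mat_hom C Bs Es"
  shows "matrix (length Es) (length As) (\<lambda>j i. fmor F (As ! i) (Es ! j) (entry (mat_comp C As Bs Es N M) j i)) =
    mat_comp D (map (fob F) As) (map (fob F) Bs) (map (fob F) Es)
      (matrix (length Es) (length Bs) (\<lambda>j i. fmor F (Bs ! i) (Es ! j) (entry N j i)))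
      (matrix (length Bs) (length As) (\<lambda>j i. fmor F (As ! i) (Bs ! j) (entry M j i)))"
proof -
  note [simp] = o[THEN src.objD] h[THEN mat_hom_entry]
  have "fmor F (As ! i) (Es ! j) (\<Sum>k<length Bs. Comp C (As ! i) (Bs ! k) (Es ! j) (entry N j k) (entry M k i)) =
      (\<Sum>k<length Bs. Comp D (fob F (As ! i)) (fob F (Bs ! k)) (fob F (Es ! j)) (fmor F (Bs ! k) (Es ! j) (entry N j k))
         (fmor F (As ! i) (Bs ! k) (entry M k i)))" if "j < length Es" "i < length As" for i j
    using that by (subst sum) (auto intro!: src.comp_hom sum.cong simp: comp)
  then show ?thesis
    by (intro entry_eqI) (simp add: entry_matrix entry_mat_comp)
qed

lemma (in linear_functor) linear_functor_ps: "linear_functor (ps C) (ps D) (ps_functor F)"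
proof -
  let ?m = "\<lambda>As Bs M. matrix (length Bs) (length As) (\<lambda>j i. fmor F (As ! i) (Bs ! j) (entry M j i))"
  have mh: "?m As Bs M \<in> mat_hom D (map (fob F) As) (map (fob F) Bs)"
    if "set As \<subseteq> Obj C" "set Bs \<subseteq> Obj C" "M \<in> mat_hom C As Bs" for As Bs M
    by (rule matrix_mat_hom) (use that in \<open>auto intro!: mor mat_hom_entry\<close>)
  have ob': "fob (ps_functor F) A \<in> Obj (ps D)" if "A \<in> Obj (ps C)" for A
  proof -
    obtain As a where [simp]: "A = (As, a)" by fastforce
    from that have A: "set As \<subseteq> Obj C" "a \<in> mat_hom C As As" "mat_comp C As As As a a = a" by (auto simp: ps_def)
    show ?thesis using mh[OF A(1,1,2)] mat_mor_comp[OF A(1,1,1) A(2,2)] A(3) A(1)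
      by (auto simp: ps_functor_def ps_def ob)
  qed
  have mor': "fmor (ps_functor F) A B f \<in> Hom (ps D) (fob (ps_functor F) A) (fob (ps_functor F) B)"
    if "A \<in> Obj (ps C)" "B \<in> Obj (ps C)" "f \<in> Hom (ps C) A B" for A B f
  proof -
    obtain As a Bs b where [simp]: "A = (As, a)" "B = (Bs, b)" by fastforce
    from that have A: "set As \<subseteq> Obj C" "a \<in> mat_hom C As As" and B: "set Bs \<subseteq> Obj C" "b \<in> mat_hom C Bs Bs"
      and f: "f \<in> mat_hom C As Bs" "mat_comp C As Bs Bs b f = f" "mat_comp C As As Bs f a = f" by (auto simp: ps_def)
    show ?thesis using mh[OF A(1) B(1) f(1)] mat_mor_comp[OF A(1) B(1,1) f(1) B(2)] mat_mor_comp[OF A(1,1) B(1) A(2) f(1)] f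
      by (auto simp: ps_functor_def ps_def)
  qed
  have comp': "fmor (ps_functor F) A E (Comp (ps C) A B E g f) =
      Comp (ps D) (fob (ps_functor F) A) (fob (ps_functor F) B) (fob (ps_functor F) E) (fmor (ps_functor F) B E g) (fmor (ps_functor F) A B f)"
    if "A \<in> Obj (ps C)" "B \<in> Obj (ps C)" "E \<in> Obj (ps C)" "f \<in> Hom (ps C) A B" "g \<in> Hom (ps C) B E" for A B E f g
  proof -
    obtain As a Bs b Es e where [simp]: "A = (As, a)" "B = (Bs, b)" "E = (Es, e)" by fastforce
    show ?thesis using that by (auto simp: ps_functor_def ps_def mat_mor_comp)
  qed
  have id': "fmor (ps_functor F) A A (Idm (ps C) A) = Idm (ps D) (fob (ps_functor F) A)" for A
    by (cases A) (simp add: ps_functor_def ps_def)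
  have add': "fmor (ps_functor F) A B (f + g) = fmor (ps_functor F) A B f + fmor (ps_functor F) A B g"
    if "A \<in> Obj (ps C)" "B \<in> Obj (ps C)" "f \<in> Hom (ps C) A B" "g \<in> Hom (ps C) A B" for A B f g
  proof -
    obtain As a Bs b where [simp]: "A = (As, a)" "B = (Bs, b)" by fastforce
    have o: "set As \<subseteq> Obj C" "set Bs \<subseteq> Obj C" and h: "f \<in> mat_hom C As Bs" "g \<in> mat_hom C As Bs"
      using that by (auto simp: ps_def)
    show ?thesis
      using o[THEN src.objD] h[THEN mat_hom_entry]
      by (intro entry_eqI) (auto simp: ps_functor_def entry_matrix entry_add add)
  qed
  have scal': "fmor (ps_functor F) A B (smul c f) = smul c (fmor (ps_functor F) A B f)"
    if "A \<in> Obj (ps C)" "B \<in> Obj (ps C)" "f \<in> Hom (ps C) A B" for A B f c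
  proof -
    obtain As a Bs b where [simp]: "A = (As, a)" "B = (Bs, b)" by fastforce
    have o: "set As \<subseteq> Obj C" "set Bs \<subseteq> Obj C" and h: "f \<in> mat_hom C As Bs"
      using that by (auto simp: ps_def)
    show ?thesis
      using o[THEN src.objD] h[THEN mat_hom_entry]
      by (intro entry_eqI) (auto simp: ps_functor_def entry_matrix entry_smul scal)
  qed
  interpret s: linear_category "ps C" by (rule src.linear_category_ps)
  interpret t: linear_category "ps D" by (rule tgt.linear_category_ps)
  show ?thesis
    by unfold_locales (use ob' mor' id' comp' add' scal' in \<open>auto simp: is_linear_functor_def is_functor_def\<close>)
qed

subsection \<open>The tensor product of linear categories\<close>

lemma tens_apply: "tens f g (x, y) = f x * g y"
  by (simp add: tens_def)

lemma tens_add_left: "tens (f + f') (g::'y \<Rightarrow> 'k::field) = tens f g + tens f' g"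
  and tens_add_right: "tens f (g + g'::'y \<Rightarrow> 'k::field) = tens f g + tens f g'"
  and tens_smul_left: "tens (smul c f) g = smul c (tens f g)"
  and tens_zero_left: "tens 0 g = 0"
  and tens_zero_right: "tens f 0 = 0"
  by (auto simp: fun_eq_iff algebra_simps fun_ev tens_apply)

lemma tens_sum_append: "tens_sum (xs @ ys) = tens_sum xs + tens_sum ys"
  by (simp add: tens_sum_def)

lemma tens_sum_smul: "tens_sum (map (\<lambda>(f, g). (smul c f, g)) xs) = smul c (tens_sum xs)"
  by (induction xs) (auto simp: tens_sum_def tens_smul_left smul_add)

text \<open>Evaluating a tensor in its second argument gives an identity in the first factor, to which
  \<open>\<phi>\<close> can be applied, and then the roles of the two factors are exchanged.\<close>

lemma tens_sum_ext:
  fixes \<phi> :: "('x \<Rightarrow> 'k::field) \<Rightarrow> 'z \<Rightarrow> 'k" and \<psi> :: "('y \<Rightarrow> 'k) \<Rightarrow> 'w \<Rightarrow> 'k"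
  assumes V: "0 \<in> V" "\<And>f g. f \<in> V \<Longrightarrow> g \<in> V \<Longrightarrow> f + g \<in> V" "\<And>c f. f \<in> V \<Longrightarrow> smul c f \<in> V"
    and W: "0 \<in> W" "\<And>f g. f \<in> W \<Longrightarrow> g \<in> W \<Longrightarrow> f + g \<in> W" "\<And>c f. f \<in> W \<Longrightarrow> smul c f \<in> W"
    and \<phi>: "\<And>f g. f \<in> V \<Longrightarrow> g \<in> V \<Longrightarrow> \<phi> (f + g) = \<phi> f + \<phi> g" "\<And>c f. f \<in> V \<Longrightarrow> \<phi> (smul c f) = smul c (\<phi> f)"
    and \<psi>: "\<And>f g. f \<in> W \<Longrightarrow> g \<in> W \<Longrightarrow> \<psi> (f + g) = \<psi> f + \<psi> g" "\<And>c f. f \<in> W \<Longrightarrow> \<psi> (smul c f) = smul c (\<psi> f)"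
    and xs: "xs \<in> lists (V \<times> W)" "xs' \<in> lists (V \<times> W)" and eq: "tens_sum xs = tens_sum xs'"
  shows "(\<Sum>(f, g)\<leftarrow>xs. tens (\<phi> f) (\<psi> g)) = (\<Sum>(f, g)\<leftarrow>xs'. tens (\<phi> f) (\<psi> g))"
proof -
  have \<phi>0: "\<phi> 0 = 0" using \<phi>(2)[OF V(1), of 0] by simp
  have \<psi>0: "\<psi> 0 = 0" using \<psi>(2)[OF W(1), of 0] by simp
  have 1: "(\<Sum>(f, g)\<leftarrow>ys. smul (g y) f) \<in> V \<and> \<phi> (\<Sum>(f, g)\<leftarrow>ys. smul (g y) f) = (\<Sum>(f, g)\<leftarrow>ys. smul (g y) (\<phi> f))"
    if "ys \<in> lists (V \<times> W)" for ys y
    using that by (induction ys) (auto simp: V \<phi> \<phi>0)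
  have 2: "(\<Sum>(f, g)\<leftarrow>ys. smul (\<phi> f z) g) \<in> W \<and> \<psi> (\<Sum>(f, g)\<leftarrow>ys. smul (\<phi> f z) g) = (\<Sum>(f, g)\<leftarrow>ys. smul (\<phi> f z) (\<psi> g))"
    if "ys \<in> lists (V \<times> W)" for ys z
    using that by (induction ys) (auto simp: W \<psi> \<psi>0)
  have ev: "tens_sum ys (x, y) = (\<Sum>(f, g)\<leftarrow>ys. smul (g y) f) x" for ys :: "(('x \<Rightarrow> 'k) \<times> ('y \<Rightarrow> 'k)) list" and x y
    by (induction ys) (auto simp: tens_sum_def tens_apply fun_ev)
  have ev2: "(\<Sum>(f, g)\<leftarrow>ys. smul (g y) (\<phi> f)) z = (\<Sum>(f, g)\<leftarrow>ys. smul (\<phi> f z) g) y" for ys :: "(('x \<Rightarrow> 'k) \<times> ('y \<Rightarrow> 'k)) list" and z y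
    by (induction ys) (auto simp: tens_apply fun_ev)
  have ev3: "(\<Sum>(f, g)\<leftarrow>ys. tens (\<phi> f) (\<psi> g)) (z, w) = (\<Sum>(f, g)\<leftarrow>ys. smul (\<phi> f z) (\<psi> g)) w" for ys :: "(('x \<Rightarrow> 'k) \<times> ('y \<Rightarrow> 'k)) list" and z w
    by (induction ys) (auto simp: tens_apply fun_ev)
  have "(\<Sum>(f, g)\<leftarrow>xs. smul (g y) f) = (\<Sum>(f, g)\<leftarrow>xs'. smul (g y) f)" for y
    using eq by (intro ext) (simp add: ev[symmetric])
  then have "(\<Sum>(f, g)\<leftarrow>xs. smul (g y) (\<phi> f)) = (\<Sum>(f, g)\<leftarrow>xs'. smul (g y) (\<phi> f))" for y
    using 1 xs by metis
  then have "(\<Sum>(f, g)\<leftarrow>xs. smul (\<phi> f z) g) = (\<Sum>(f, g)\<leftarrow>xs'. smul (\<phi> f z) g)" for z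
    by (intro ext) (simp add: ev2[symmetric])
  then have "(\<Sum>(f, g)\<leftarrow>xs. smul (\<phi> f z) (\<psi> g)) = (\<Sum>(f, g)\<leftarrow>xs'. smul (\<phi> f z) (\<psi> g))" for z
    using 2 xs by metis
  then show ?thesis by (intro ext) (auto simp: ev3)
qed

locale tensor_pair = C: linear_category C + D: linear_category D
  for C :: "('o, 'x, 'k::field) lincat" and D :: "('p, 'y, 'k) lincat"
begin

abbreviation "T \<equiv> tensor_cat C D"

lemma T_sel: "Obj T = Obj C \<times> Obj D" "Hom T (A, A') (B, B') = tens_sum ` lists (Hom C A B \<times> Hom D A' B')"
  "Idm T (A, A') = tens (Idm C A) (Idm D A')"
  by (simp_all add: tensor_cat_def)

lemma T_pure: "f \<in> Hom C A B \<Longrightarrow> g \<in> Hom D A' B' \<Longrightarrow> tens f g \<in> Hom T (A, A') (B, B')"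
  unfolding T_sel by (rule image_eqI[of _ _ "[(f, g)]"]) (auto simp: tens_sum_def)

lemma T_add: "u \<in> Hom T (A, A') (B, B') \<Longrightarrow> v \<in> Hom T (A, A') (B, B') \<Longrightarrow> u + v \<in> Hom T (A, A') (B, B')"
  unfolding T_sel by (force simp: tens_sum_append[symmetric] simp del: in_lists_conv_set intro!: imageI)

lemma T_zero: "0 \<in> Hom T (A, A') (B, B')"
  unfolding T_sel by (rule image_eqI[of _ _ "[]"]) (auto simp: tens_sum_def)

text \<open>Hom-spaces of the tensor product are spans of pure tensors, so bilinear identities need
  to be checked on pure tensors only.\<close>

lemma T_induct [consumes 1, case_names zero pure add]:
  assumes "u \<in> Hom T (A, A') (B, B')" and "Q 0"
    and "\<And>f g. f \<in> Hom C A B \<Longrightarrow> g \<in> Hom D A' B' \<Longrightarrow> Q (tens f g)"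
    and "\<And>u v. u \<in> Hom T (A, A') (B, B') \<Longrightarrow> v \<in> Hom T (A, A') (B, B') \<Longrightarrow> Q u \<Longrightarrow> Q v \<Longrightarrow> Q (u + v)"
  shows "Q u"
proof -
  obtain xs where xs: "xs \<in> lists (Hom C A B \<times> Hom D A' B')" "u = tens_sum xs" using assms(1) by (auto simp: T_sel)
  have "tens_sum xs \<in> Hom T (A, A') (B, B') \<and> Q (tens_sum xs)" using xs(1)
  proof (induction xs)
    case Nil then show ?case using assms(2) T_zero by (simp add: tens_sum_def)
  next
    case (Cons a xs)
    then obtain f g where [simp]: "a = (f, g)" and fg: "f \<in> Hom C A B" "g \<in> Hom D A' B'" by auto
    have "tens_sum (a # xs) = tens f g + tens_sum xs" by (simp add: tens_sum_def)
    then show ?case using Cons assms(3)[OF fg] T_pure[OF fg] assms(4) T_add by simp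
  qed
  then show ?thesis using xs by simp
qed

lemma T_smul: "u \<in> Hom T (A, A') (B, B') \<Longrightarrow> A \<in> Obj C \<Longrightarrow> B \<in> Obj C \<Longrightarrow> smul c u \<in> Hom T (A, A') (B, B')"
  by (induction u rule: T_induct)
    (auto simp: tens_smul_left[symmetric] smul_add T_zero T_add intro!: T_pure C.smul_hom)

text \<open>\<open>tens_sum_ext\<close> is applied in one argument at a time, after exchanging the
  two sums for the second. So the value is the same for all presentations as sums of pure tensors,
  and the definite description in \<open>Comp\<close> has exactly one candidate.\<close>

lemma T_comp_lists:
  assumes o: "A \<in> Obj C" "B \<in> Obj C" "E \<in> Obj C" "A' \<in> Obj D" "B' \<in> Obj D" "E' \<in> Obj D"
    and xs: "xs \<in> lists (Hom C A B \<times> Hom D A' B')" and ys: "ys \<in> lists (Hom C B E \<times> Hom D B' E')"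
  shows "Comp T (A, A') (B, B') (E, E') (tens_sum ys) (tens_sum xs) =
    (\<Sum>(g, g')\<leftarrow>ys. \<Sum>(f, f')\<leftarrow>xs. tens (Comp C A B E g f) (Comp D A' B' E' g' f'))"
proof -
  let ?w = "\<lambda>ys xs. (\<Sum>(g, g')\<leftarrow>ys. \<Sum>(f, f')\<leftarrow>xs. tens (Comp C A B E g f) (Comp D A' B' E' g' f'))"
  have 1: "(\<Sum>(f, f')\<leftarrow>xs. tens (Comp C A B E g f) (Comp D A' B' E' g' f')) = (\<Sum>(f, f')\<leftarrow>xs'. tens (Comp C A B E g f) (Comp D A' B' E' g' f'))"
    if "xs' \<in> lists (Hom C A B \<times> Hom D A' B')" "tens_sum xs = tens_sum xs'" "g \<in> Hom C B E" "g' \<in> Hom D B' E'" for xs' g g'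
    by (rule tens_sum_ext[where V = "Hom C A B" and W = "Hom D A' B'"])
      (use that o xs in \<open>auto simp: C.comp_add_right D.comp_add_right C.comp_smul_right D.comp_smul_right
          intro: C.zero_hom D.zero_hom C.add_hom D.add_hom C.smul_hom D.smul_hom\<close>)
  have 2: "(\<Sum>(g, g')\<leftarrow>ys. tens (Comp C A B E g f) (Comp D A' B' E' g' f')) = (\<Sum>(g, g')\<leftarrow>ys'. tens (Comp C A B E g f) (Comp D A' B' E' g' f'))"
    if "ys' \<in> lists (Hom C B E \<times> Hom D B' E')" "tens_sum ys = tens_sum ys'" "f \<in> Hom C A B" "f' \<in> Hom D A' B'" for ys' f f'
    by (rule tens_sum_ext[where V = "Hom C B E" and W = "Hom D B' E'"])
      (use that o ys in \<open>auto simp: C.comp_add_left D.comp_add_left C.comp_smul_left D.comp_smul_left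
          intro: C.zero_hom D.zero_hom C.add_hom D.add_hom C.smul_hom D.smul_hom\<close>)
  have sw: "?w ys xs = (\<Sum>(f, f')\<leftarrow>xs. \<Sum>(g, g')\<leftarrow>ys. tens (Comp C A B E g f) (Comp D A' B' E' g' f'))" for ys xs
    unfolding case_prod_beta by (rule sum_list_swap)
  have w: "?w ys xs = ?w ys' xs'"
    if xs': "xs' \<in> lists (Hom C A B \<times> Hom D A' B')" "tens_sum xs = tens_sum xs'"
      and ys': "ys' \<in> lists (Hom C B E \<times> Hom D B' E')" "tens_sum ys = tens_sum ys'" for xs' ys'
  proof -
    have "?w ys xs = ?w ys xs'"
      using 1[OF xs'] ys by (intro arg_cong[where f = sum_list] map_cong) auto
    also have "\<dots> = ?w ys' xs'"
      unfolding sw using 2[OF ys'] xs'(1) by (intro arg_cong[where f = sum_list] map_cong) auto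
    finally show ?thesis .
  qed
  show ?thesis
    unfolding tensor_cat_def lincat.simps prod.case
    by (rule the_equality) (use w xs ys in \<open>metis (no_types, lifting)\<close>)+
qed

lemma T_comp_pure:
  assumes "A \<in> Obj C" "B \<in> Obj C" "E \<in> Obj C" "A' \<in> Obj D" "B' \<in> Obj D" "E' \<in> Obj D"
    and "f \<in> Hom C A B" "f' \<in> Hom D A' B'" "g \<in> Hom C B E" "g' \<in> Hom D B' E'"
  shows "Comp T (A, A') (B, B') (E, E') (tens g g') (tens f f') = tens (Comp C A B E g f) (Comp D A' B' E' g' f')"
  using T_comp_lists[of A B E A' B' E' "[(f, f')]" "[(g, g')]"] assms by (simp add: tens_sum_def)

lemma T_comp_add_left:
  assumes "A \<in> Obj C" "B \<in> Obj C" "E \<in> Obj C" "A' \<in> Obj D" "B' \<in> Obj D" "E' \<in> Obj D"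
    and "u \<in> Hom T (A, A') (B, B')" "v \<in> Hom T (B, B') (E, E')" "v' \<in> Hom T (B, B') (E, E')"
  shows "Comp T (A, A') (B, B') (E, E') (v + v') u = Comp T (A, A') (B, B') (E, E') v u + Comp T (A, A') (B, B') (E, E') v' u"
proof -
  obtain xs ys ys' where l: "xs \<in> lists (Hom C A B \<times> Hom D A' B')"
      "ys \<in> lists (Hom C B E \<times> Hom D B' E')" "ys' \<in> lists (Hom C B E \<times> Hom D B' E')"
    and [simp]: "u = tens_sum xs" "v = tens_sum ys" "v' = tens_sum ys'"
    using assms(7-9) unfolding T_sel by (auto simp: image_iff)
  note a = T_comp_lists[OF assms(1-6)]
  show ?thesis
    using l by (simp add: tens_sum_append[symmetric] a append_in_lists_conv)
qed

lemma T_comp_add_right: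
  assumes "A \<in> Obj C" "B \<in> Obj C" "E \<in> Obj C" "A' \<in> Obj D" "B' \<in> Obj D" "E' \<in> Obj D"
    and "u \<in> Hom T (A, A') (B, B')" "u' \<in> Hom T (A, A') (B, B')" "v \<in> Hom T (B, B') (E, E')"
  shows "Comp T (A, A') (B, B') (E, E') v (u + u') = Comp T (A, A') (B, B') (E, E') v u + Comp T (A, A') (B, B') (E, E') v u'"
proof -
  obtain xs xs' ys where l: "xs \<in> lists (Hom C A B \<times> Hom D A' B')" "xs' \<in> lists (Hom C A B \<times> Hom D A' B')"
      "ys \<in> lists (Hom C B E \<times> Hom D B' E')"
    and [simp]: "u = tens_sum xs" "u' = tens_sum xs'" "v = tens_sum ys"
    using assms(7-9) unfolding T_sel by (auto simp: image_iff)
  note a = T_comp_lists[OF assms(1-6)]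
  show ?thesis
    using l unfolding \<open>u = _\<close> \<open>u' = _\<close> \<open>v = _\<close> tens_sum_append[symmetric]
    by (subst (1 2 3) a) (simp_all add: split_def sum_list_addf)
qed

lemmas T_comp_add = T_comp_add_left T_comp_add_right

lemma T_comp_smul:
  assumes o: "A \<in> Obj C" "B \<in> Obj C" "E \<in> Obj C" "A' \<in> Obj D" "B' \<in> Obj D" "E' \<in> Obj D"
    and "u \<in> Hom T (A, A') (B, B')" "v \<in> Hom T (B, B') (E, E')"
  shows "Comp T (A, A') (B, B') (E, E') (smul c v) u = smul c (Comp T (A, A') (B, B') (E, E') v u)"
    and "Comp T (A, A') (B, B') (E, E') v (smul c u) = smul c (Comp T (A, A') (B, B') (E, E') v u)"
proof -
  obtain xs ys where l: "xs \<in> lists (Hom C A B \<times> Hom D A' B')" "ys \<in> lists (Hom C B E \<times> Hom D B' E')"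
    and [simp]: "u = tens_sum xs" "v = tens_sum ys"
    using assms(7-8) unfolding T_sel by (auto simp: image_iff)
  have mem: "\<And>f f'. (f, f') \<in> set xs \<Longrightarrow> f \<in> Hom C A B \<and> f' \<in> Hom D A' B'" "\<And>f f'. (f, f') \<in> set ys \<Longrightarrow> f \<in> Hom C B E \<and> f' \<in> Hom D B' E'"
    using l by auto
  have m: "map (\<lambda>(f, g). (smul c f, g)) ys \<in> lists (Hom C B E \<times> Hom D B' E')" "map (\<lambda>(f, g). (smul c f, g)) xs \<in> lists (Hom C A B \<times> Hom D A' B')"
    using l o by (auto intro!: C.smul_hom)
  note a = T_comp_lists[OF assms(1-6)]
  have "(\<Sum>(g, g')\<leftarrow>map (\<lambda>(f, g). (smul c f, g)) ys. \<Sum>(f, f')\<leftarrow>xs. tens (Comp C A B E g f) (Comp D A' B' E' g' f')) =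
    (\<Sum>(g, g')\<leftarrow>ys. \<Sum>(f, f')\<leftarrow>xs. smul c (tens (Comp C A B E g f) (Comp D A' B' E' g' f')))"
    unfolding sum_list_pair_smul using mem o by (intro sum_list_pair_cong) (auto simp: C.comp_smul_left tens_smul_left)
  then show "Comp T (A, A') (B, B') (E, E') (smul c v) u = smul c (Comp T (A, A') (B, B') (E, E') v u)"
    using l m by (simp add: tens_sum_smul[symmetric] a) (simp add: a smul_sum_list split_def)
  have "(\<Sum>(g, g')\<leftarrow>ys. \<Sum>(f, f')\<leftarrow>map (\<lambda>(f, g). (smul c f, g)) xs. tens (Comp C A B E g f) (Comp D A' B' E' g' f')) =
    (\<Sum>(g, g')\<leftarrow>ys. \<Sum>(f, f')\<leftarrow>xs. smul c (tens (Comp C A B E g f) (Comp D A' B' E' g' f')))"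
    unfolding sum_list_pair_smul using mem o by (intro sum_list_pair_cong) (auto simp: C.comp_smul_right tens_smul_left)
  then show "Comp T (A, A') (B, B') (E, E') v (smul c u) = smul c (Comp T (A, A') (B, B') (E, E') v u)"
    using l m by (simp add: tens_sum_smul[symmetric] a) (simp add: a smul_sum_list split_def)
qed

lemma T_comp_zero_left:
  assumes o: "A \<in> Obj C" "B \<in> Obj C" "E \<in> Obj C" "A' \<in> Obj D" "B' \<in> Obj D" "E' \<in> Obj D"
    and "u \<in> Hom T (A, A') (B, B')"
  shows "Comp T (A, A') (B, B') (E, E') 0 u = 0"
  using T_comp_smul(1)[OF o assms(7) T_zero, of 0] by simp

lemma T_comp_zero_right:
  assumes o: "A \<in> Obj C" "B \<in> Obj C" "E \<in> Obj C" "A' \<in> Obj D" "B' \<in> Obj D" "E' \<in> Obj D"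
    and "v \<in> Hom T (B, B') (E, E')"
  shows "Comp T (A, A') (B, B') (E, E') v 0 = 0"
  using T_comp_smul(2)[OF o T_zero assms(7), of 0] by simp

lemmas T_comp_zero = T_comp_zero_left T_comp_zero_right

lemma T_comp_hom:
  assumes o: "A \<in> Obj C" "B \<in> Obj C" "E \<in> Obj C" "A' \<in> Obj D" "B' \<in> Obj D" "E' \<in> Obj D"
    and u: "u \<in> Hom T (A, A') (B, B')" and v: "v \<in> Hom T (B, B') (E, E')"
  shows "Comp T (A, A') (B, B') (E, E') v u \<in> Hom T (A, A') (E, E')"
  using v u
proof (induction v rule: T_induct)
  case (pure g g')
  show ?case using pure(3) pure(1,2)
    by (induction u rule: T_induct)
      (auto simp: o T_comp_zero T_comp_pure T_comp_add T_pure C.comp_hom D.comp_hom T_zero T_add)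
qed (auto simp: o T_comp_zero T_comp_add T_zero T_add)

lemma T_assoc:
  assumes o: "A \<in> Obj C" "B \<in> Obj C" "E \<in> Obj C" "K \<in> Obj C" "A' \<in> Obj D" "B' \<in> Obj D" "E' \<in> Obj D" "K' \<in> Obj D"
    and u: "u \<in> Hom T (A, A') (B, B')" and v: "v \<in> Hom T (B, B') (E, E')" and w: "w \<in> Hom T (E, E') (K, K')"
  shows "Comp T (A, A') (E, E') (K, K') w (Comp T (A, A') (B, B') (E, E') v u) =
    Comp T (A, A') (B, B') (K, K') (Comp T (B, B') (E, E') (K, K') w v) u"
  using w u v
proof (induction w rule: T_induct)
  case (pure h h')
  note hh = pure(1,2)
  show ?case using pure(4) pure(3)
  proof (induction v rule: T_induct)
    case (pure g g')
    show ?case using pure(3) pure(1,2) hh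
      by (induction u rule: T_induct)
        (auto simp: o T_comp_zero T_comp_pure T_comp_add T_pure C.comp_hom D.comp_hom T_zero T_comp_hom C.assoc D.assoc)
  qed (auto simp: o hh T_comp_zero T_comp_add T_comp_hom T_pure)
qed (auto simp: o T_comp_zero T_comp_add T_comp_hom)

lemma linear_category_T: "linear_category T"
proof
  fix A B E K :: "'o \<times> 'p" and f f' g g' h and c :: 'k
  obtain A1 A2 B1 B2 E1 E2 K1 K2 where [simp]: "A = (A1, A2)" "B = (B1, B2)" "E = (E1, E2)" "K = (K1, K2)" by fastforce
  assume "A \<in> Obj T" then have A: "A1 \<in> Obj C" "A2 \<in> Obj D" by (auto simp: T_sel)
  show "Idm T A \<in> Hom T A A" using A by (simp add: T_sel(3) T_pure C.id_hom D.id_hom)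
  assume "B \<in> Obj T" then have B: "B1 \<in> Obj C" "B2 \<in> Obj D" by (auto simp: T_sel)
  show "0 \<in> Hom T A B" by (simp add: T_zero)
  assume f: "f \<in> Hom T A B"
  show "smul c f \<in> Hom T A B" using f A B T_smul by simp
  have "f \<in> Hom T (A1, A2) (B1, B2)" using f by simp
  then have "Comp T A B B (Idm T B) f = f \<and> Comp T A A B f (Idm T A) = f"
    by (induction f rule: T_induct)
      (use A B in \<open>auto simp: T_sel(3) T_comp_zero T_comp_add T_comp_pure T_pure C.id_hom D.id_hom
        C.id_left D.id_left C.id_right D.id_right\<close>)
  then show "Comp T A B B (Idm T B) f = f" "Comp T A A B f (Idm T A) = f" by auto
  { assume "f' \<in> Hom T A B"
    then show "f + f' \<in> Hom T A B" using f T_add by simp }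
  assume "E \<in> Obj T" then have E: "E1 \<in> Obj C" "E2 \<in> Obj D" by (auto simp: T_sel)
  { assume "f' \<in> Hom T A B" "g \<in> Hom T B E"
    then show "Comp T A B E g (f + f') = Comp T A B E g f + Comp T A B E g f'"
      using A B E f by (simp add: T_comp_add) }
  assume g: "g \<in> Hom T B E"
  show "Comp T A B E g f \<in> Hom T A E" using A B E f g by (simp add: T_comp_hom)
  { assume "g' \<in> Hom T B E"
    then show "Comp T A B E (g + g') f = Comp T A B E g f + Comp T A B E g' f"
      using A B E f g by (simp add: T_comp_add) }
  show "Comp T A B E (smul c g) f = smul c (Comp T A B E g f)" "Comp T A B E g (smul c f) = smul c (Comp T A B E g f)"
    using A B E f g by (simp_all add: T_comp_smul)
  assume "K \<in> Obj T" "h \<in> Hom T E K"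
  then show "Comp T A E K h (Comp T A B E g f) = Comp T A B K (Comp T B E K h g) f"
    using A B E f g by (auto simp: T_sel(1) intro!: T_assoc)
qed

end

section \<open>Tensor products of linear functors\<close>

lemma (in tensor_pair) tensor_functor_lists:
  assumes K: "linear_functor C C' K" and L: "linear_functor D D' L"
    and o: "A \<in> Obj C" "B \<in> Obj C" "A' \<in> Obj D" "B' \<in> Obj D"
    and xs: "xs \<in> lists (Hom C A B \<times> Hom D A' B')"
  shows "fmor (tensor_functor C D K L) (A, A') (B, B') (tens_sum xs) =
    (\<Sum>(f, f')\<leftarrow>xs. tens (fmor K A B f) (fmor L A' B' f'))"
proof -
  interpret K: linear_functor C C' K by fact
  interpret L: linear_functor D D' L by fact
  have 1: "(\<Sum>(f, f')\<leftarrow>xs. tens (fmor K A B f) (fmor L A' B' f')) = (\<Sum>(f, f')\<leftarrow>xs'. tens (fmor K A B f) (fmor L A' B' f'))"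
    if "xs' \<in> lists (Hom C A B \<times> Hom D A' B')" "tens_sum xs = tens_sum xs'" for xs'
    by (rule tens_sum_ext[where V = "Hom C A B" and W = "Hom D A' B'"])
      (use that o xs in \<open>auto simp: K.add L.add K.scal L.scal
          intro: C.zero_hom D.zero_hom C.add_hom D.add_hom C.smul_hom D.smul_hom\<close>)
  show ?thesis
    unfolding tensor_functor_def fnctr.simps prod.case
    by (rule the_equality) (use 1 xs in \<open>metis (no_types, lifting)\<close>)+
qed

lemma (in tensor_pair) tensor_functor_pure:
  assumes K: "linear_functor C C' K" and L: "linear_functor D D' L"
    and o: "A \<in> Obj C" "B \<in> Obj C" "A' \<in> Obj D" "B' \<in> Obj D"
    and "f \<in> Hom C A B" "f' \<in> Hom D A' B'"
  shows "fmor (tensor_functor C D K L) (A, A') (B, B') (tens f f') = tens (fmor K A B f) (fmor L A' B' f')"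
  using tensor_functor_lists[OF K L o, of "[(f, f')]"] assms by (simp add: tens_sum_def)

lemma (in tensor_pair) linear_functor_tensor:
  assumes K: "linear_functor C C' K" and L: "linear_functor D D' L"
  shows "linear_functor T (tensor_cat C' D') (tensor_functor C D K L)"
proof -
  interpret K: linear_functor C C' K by fact
  interpret L: linear_functor D D' L by fact
  interpret T': tensor_pair C' D' by unfold_locales
  interpret t1: linear_category T by (rule linear_category_T)
  interpret t2: linear_category T'.T by (rule T'.linear_category_T)
  let ?F = "tensor_functor C D K L"
  have fob: "fob ?F (A, A') = (fob K A, fob L A')" for A A' by (simp add: tensor_functor_def)
  note tl = tensor_functor_lists[OF K L] and tp = tensor_functor_pure[OF K L]
  have fadd: "fmor ?F (A, A') (B, B') (u + v) = fmor ?F (A, A') (B, B') u + fmor ?F (A, A') (B, B') v"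
    if o: "A \<in> Obj C" "B \<in> Obj C" "A' \<in> Obj D" "B' \<in> Obj D" and uv: "u \<in> Hom T (A, A') (B, B')" "v \<in> Hom T (A, A') (B, B')"
    for A A' B B' u v
  proof -
    obtain xs ys where l: "xs \<in> lists (Hom C A B \<times> Hom D A' B')" "ys \<in> lists (Hom C A B \<times> Hom D A' B')"
      and [simp]: "u = tens_sum xs" "v = tens_sum ys"
      using uv unfolding T_sel by (auto simp: image_iff simp del: in_lists_conv_set)
    show ?thesis using l by (simp add: tens_sum_append[symmetric] tl[OF o] append_in_lists_conv)
  qed
  have scal: "fmor ?F (A, A') (B, B') (smul c u) = smul c (fmor ?F (A, A') (B, B') u)"
    if o: "A \<in> Obj C" "B \<in> Obj C" "A' \<in> Obj D" "B' \<in> Obj D" and uv: "u \<in> Hom T (A, A') (B, B')" for A A' B B' u c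
  proof -
    obtain xs where l: "xs \<in> lists (Hom C A B \<times> Hom D A' B')" and [simp]: "u = tens_sum xs"
      using uv unfolding T_sel by (auto simp: image_iff simp del: in_lists_conv_set)
    have m: "map (\<lambda>(f, g). (smul c f, g)) xs \<in> lists (Hom C A B \<times> Hom D A' B')"
      using l o by (auto intro!: C.smul_hom)
    have "(\<Sum>(f, f')\<leftarrow>map (\<lambda>(f, g). (smul c f, g)) xs. tens (fmor K A B f) (fmor L A' B' f')) =
       (\<Sum>(f, f')\<leftarrow>xs. smul c (tens (fmor K A B f) (fmor L A' B' f')))"
      unfolding sum_list_pair_smul using l o by (intro sum_list_pair_cong) (auto simp: K.scal tens_smul_left)
    then show ?thesis using l m by (simp add: tens_sum_smul[symmetric] tl[OF o]) (simp add: tl[OF o] smul_sum_list split_def)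
  qed
  have fzero: "fmor ?F (A, A') (B, B') 0 = 0" if "A \<in> Obj C" "B \<in> Obj C" "A' \<in> Obj D" "B' \<in> Obj D" for A A' B B'
    using scal[OF that T_zero, of 0] by simp
  have hom: "fmor ?F (A, A') (B, B') u \<in> Hom T'.T (fob ?F (A, A')) (fob ?F (B, B'))"
    if o: "A \<in> Obj C" "B \<in> Obj C" "A' \<in> Obj D" "B' \<in> Obj D" and u: "u \<in> Hom T (A, A') (B, B')" for A A' B B' u
    using u by (induction u rule: T_induct) (auto simp: fzero tp fadd o fob T'.T_zero T'.T_add intro!: T'.T_pure K.mor L.mor)
  have comp: "fmor ?F (A, A') (E, E') (Comp T (A, A') (B, B') (E, E') v u) =
      Comp T'.T (fob ?F (A, A')) (fob ?F (B, B')) (fob ?F (E, E')) (fmor ?F (B, B') (E, E') v) (fmor ?F (A, A') (B, B') u)"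
    if o: "A \<in> Obj C" "B \<in> Obj C" "E \<in> Obj C" "A' \<in> Obj D" "B' \<in> Obj D" "E' \<in> Obj D"
      and u: "u \<in> Hom T (A, A') (B, B')" and v: "v \<in> Hom T (B, B') (E, E')" for A A' B B' E E' u v
    using v u
  proof (induction v rule: T_induct)
    case zero
    then show ?case
      using o hom[OF o(1,2,4,5) zero] by (simp add: T_comp_zero fzero fob K.ob L.ob T'.T_comp_zero)
  next
    case (pure g g')
    show ?case using pure(3) pure(1,2)
    proof (induction u rule: T_induct)
      case zero
      then show ?case using o hom[OF o(2,3,5,6) T_pure[OF zero]]
        by (simp add: T_comp_zero T_pure fzero fob K.ob L.ob T'.T_comp_zero)
    next
      case (pure f f')
      then show ?case using o by (simp add: T_comp_pure tp C.comp_hom D.comp_hom fob T'.T_comp_pure K.ob L.ob K.mor L.mor K.comp L.comp)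
    next
      case (add u v)
      have h: "fmor ?F (A, A') (B, B') u \<in> Hom T'.T (fob ?F (A, A')) (fob ?F (B, B'))"
        "fmor ?F (A, A') (B, B') v \<in> Hom T'.T (fob ?F (A, A')) (fob ?F (B, B'))"
        "fmor ?F (B, B') (E, E') (tens g g') \<in> Hom T'.T (fob ?F (B, B')) (fob ?F (E, E'))"
        using o add T_pure hom by auto
      show ?case using o add h by (simp add: T_comp_add T_pure T_comp_hom fadd fob K.ob L.ob T'.T_comp_add)
    qed
  next
    case (add v w)
    have h: "fmor ?F (A, A') (B, B') u \<in> Hom T'.T (fob ?F (A, A')) (fob ?F (B, B'))"
      "fmor ?F (B, B') (E, E') v \<in> Hom T'.T (fob ?F (B, B')) (fob ?F (E, E'))"
      "fmor ?F (B, B') (E, E') w \<in> Hom T'.T (fob ?F (B, B')) (fob ?F (E, E'))"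
      using o add u hom by auto
    show ?case using o add h u by (simp add: T_comp_add T_comp_hom fadd fob K.ob L.ob T'.T_comp_add)
  qed
  have idm: "fmor ?F (A, A') (A, A') (Idm T (A, A')) = Idm T'.T (fob ?F (A, A'))" if "A \<in> Obj C" "A' \<in> Obj D" for A A'
    using that by (simp add: T_sel T'.T_sel fob tp C.id_hom D.id_hom K.idm L.idm)
  show ?thesis
    by unfold_locales
      (auto simp: is_linear_functor_def is_functor_def T_sel(1) T'.T_sel(1) fadd scal comp idm fob K.ob L.ob
        intro!: hom[unfolded fob])
qed

section \<open>Two-sided adjoints from generators\<close>

lemma sum_cong_lt: "K = L \<Longrightarrow> (\<And>k. k < L \<Longrightarrow> f k = g k) \<Longrightarrow> sum f {..<K} = sum g {..<(L::nat)}"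
  by (rule sum.cong) auto

text \<open>A retract of a bijection is a bijection, here with the family of the \<psi>'s in the
  middle: equal images under \<phi> have equal components \<open>a k\<close>, and a preimage of
  \<open>y\<close> is assembled by \<open>b\<close> from preimages of the components
  \<open>a' k y\<close>.\<close>

lemma bij_betw_retract_sum:
  assumes bij: "\<And>k. k < K \<Longrightarrow> bij_betw (\<psi> k) (V k) (W k)" and \<phi>: "\<And>x. x \<in> X \<Longrightarrow> \<phi> x \<in> Y"
    and a: "\<And>k x. k < K \<Longrightarrow> x \<in> X \<Longrightarrow> a k x \<in> V k" "\<And>k x. k < K \<Longrightarrow> x \<in> X \<Longrightarrow> \<psi> k (a k x) = a' k (\<phi> x)"
    and a': "\<And>k y. k < K \<Longrightarrow> y \<in> Y \<Longrightarrow> a' k y \<in> W k"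
    and b: "\<And>x. (\<And>k. k < K \<Longrightarrow> x k \<in> V k) \<Longrightarrow> (\<Sum>k<K. b k (x k)) \<in> X"
      "\<And>x. (\<And>k. k < K \<Longrightarrow> x k \<in> V k) \<Longrightarrow> \<phi> (\<Sum>k<K. b k (x k)) = (\<Sum>k<(K::nat). b' k (\<psi> k (x k)))"
    and ab: "\<And>x. x \<in> X \<Longrightarrow> (\<Sum>k<K. b k (a k x)) = x" and ab': "\<And>y. y \<in> Y \<Longrightarrow> (\<Sum>k<K. b' k (a' k y)) = y"
  shows "bij_betw \<phi> X Y"
  unfolding bij_betw_def
proof
  show "inj_on \<phi> X"
  proof (rule inj_onI)
    fix x y assume xy: "x \<in> X" "y \<in> X" "\<phi> x = \<phi> y"
    have "a k x = a k y" if "k < K" for k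
      by (rule inj_onD[OF bij_betw_imp_inj_on[OF bij[OF that]]]) (simp_all add: a that xy)
    then have "(\<Sum>k<K. b k (a k x)) = (\<Sum>k<K. b k (a k y))" by simp
    then show "x = y" by (simp add: ab xy)
  qed
  show "\<phi> ` X = Y"
  proof (intro equalityI subsetI)
    fix y assume y: "y \<in> Y"
    have "\<exists>x. x \<in> V k \<and> \<psi> k x = a' k y" if "k < K" for k
      using bij_betw_imp_surj_on[OF bij[OF that]] a'[OF that y] by (metis imageE)
    then obtain x where x: "\<And>k. k < K \<Longrightarrow> x k \<in> V k" "\<And>k. k < K \<Longrightarrow> \<psi> k (x k) = a' k y" by metis
    have "\<phi> (\<Sum>k<K. b k (x k)) = (\<Sum>k<K. b' k (\<psi> k (x k)))" by (rule b(2)) (rule x(1))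
    also have "\<dots> = (\<Sum>k<K. b' k (a' k y))" by (rule sum_cong_lt) (simp_all add: x(2))
    finally have "\<phi> (\<Sum>k<K. b k (x k)) = y" unfolding ab'[OF y] .
    moreover have "(\<Sum>k<K. b k (x k)) \<in> X" by (rule b(1)) (rule x(1))
    ultimately show "y \<in> \<phi> ` X" by blast
  qed (use \<phi> in auto)
qed

locale two_sided = linear_functor A B F
  for A :: "('o, 'x, 'k::field) lincat" and B :: "('p, 'y, 'k) lincat" and F :: "('o, 'x, 'p, 'y, 'k) fnctr"
begin

abbreviation "cA \<equiv> Comp A"
abbreviation "cB \<equiv> Comp B"
abbreviation "oF \<equiv> fob F"
abbreviation "mF \<equiv> fmor F"

text \<open>The same \<open>Z\<close> represents \<open>Hom (F -) Y\<close> through \<epsilon> and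
  \<open>Hom Y (F -)\<close> through \<eta>. Recording universal elements makes naturality in
  \<open>X\<close> automatic.\<close>

definition represents :: "'p \<Rightarrow> 'o \<Rightarrow> ('y \<Rightarrow> 'k) \<Rightarrow> ('y \<Rightarrow> 'k) \<Rightarrow> bool" where
  "represents Y Z \<epsilon> \<eta> \<longleftrightarrow> Z \<in> Obj A \<and> \<epsilon> \<in> Hom B (oF Z) Y \<and> \<eta> \<in> Hom B Y (oF Z) \<and>
     (\<forall>X\<in>Obj A. bij_betw (\<lambda>f. cB (oF X) (oF Z) Y \<epsilon> (mF X Z f)) (Hom A X Z) (Hom B (oF X) Y)) \<and>
     (\<forall>X\<in>Obj A. bij_betw (\<lambda>f. cB Y (oF Z) (oF X) (mF Z X f) \<eta>) (Hom A Z X) (Hom B Y (oF X)))"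

text \<open>Under the universal properties, each of the two equations has a unique solution
  \<open>h\<close>. Asking one \<open>h\<close> to solve both is what makes the left and the right
  adjoint agree on morphisms.\<close>

definition lifts :: "'p \<Rightarrow> 'o \<Rightarrow> ('y \<Rightarrow> 'k) \<Rightarrow> ('y \<Rightarrow> 'k) \<Rightarrow> 'p \<Rightarrow> 'o \<Rightarrow> ('y \<Rightarrow> 'k) \<Rightarrow> ('y \<Rightarrow> 'k) \<Rightarrow> ('y \<Rightarrow> 'k) \<Rightarrow> ('x \<Rightarrow> 'k) \<Rightarrow> bool" where
  "lifts Y Z \<epsilon> \<eta> Y' Z' \<epsilon>' \<eta>' g h \<longleftrightarrow> h \<in> Hom A Z Z' \<and>
     cB (oF Z) (oF Z') Y' \<epsilon>' (mF Z Z' h) = cB (oF Z) Y Y' g \<epsilon> \<and>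
     cB Y (oF Z) (oF Z') (mF Z Z' h) \<eta> = cB Y Y' (oF Z') \<eta>' g"

lemma representsD:
  assumes "represents Y Z \<epsilon> \<eta>"
  shows "Z \<in> Obj A" "\<epsilon> \<in> Hom B (oF Z) Y" "\<eta> \<in> Hom B Y (oF Z)"
    and "X \<in> Obj A \<Longrightarrow> bij_betw (\<lambda>f. cB (oF X) (oF Z) Y \<epsilon> (mF X Z f)) (Hom A X Z) (Hom B (oF X) Y)"
    and "X \<in> Obj A \<Longrightarrow> bij_betw (\<lambda>f. cB Y (oF Z) (oF X) (mF Z X f) \<eta>) (Hom A Z X) (Hom B Y (oF X))"
  using assms by (auto simp: represents_def)

lemma represents_inj:
  assumes "represents Y Z \<epsilon> \<eta>" "X \<in> Obj A" "f \<in> Hom A X Z" "f' \<in> Hom A X Z"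
    "cB (oF X) (oF Z) Y \<epsilon> (mF X Z f) = cB (oF X) (oF Z) Y \<epsilon> (mF X Z f')"
  shows "f = f'"
  using inj_onD[OF bij_betw_imp_inj_on[OF representsD(4)[OF assms(1,2)]]] assms(3-5) by blast

lemma represents_surj:
  assumes "represents Y Z \<epsilon> \<eta>" "X \<in> Obj A" "g \<in> Hom B (oF X) Y"
  obtains f where "f \<in> Hom A X Z" "cB (oF X) (oF Z) Y \<epsilon> (mF X Z f) = g"
proof -
  have "g \<in> (\<lambda>f. cB (oF X) (oF Z) Y \<epsilon> (mF X Z f)) ` Hom A X Z"
    using bij_betw_imp_surj_on[OF representsD(4)[OF assms(1,2)]] assms(3) by simp
  then show thesis using that by auto
qed

lemma lift_comp:
  assumes r: "represents Y Z \<epsilon> \<eta>" "represents Y' Z' \<epsilon>' \<eta>'" "represents Y'' Z'' \<epsilon>'' \<eta>''"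
    and o: "Y \<in> Obj B" "Y' \<in> Obj B" "Y'' \<in> Obj B" and g: "g \<in> Hom B Y Y'" "g' \<in> Hom B Y' Y''"
    and l: "lifts Y Z \<epsilon> \<eta> Y' Z' \<epsilon>' \<eta>' g h" "lifts Y' Z' \<epsilon>' \<eta>' Y'' Z'' \<epsilon>'' \<eta>'' g' h'"
  shows "lifts Y Z \<epsilon> \<eta> Y'' Z'' \<epsilon>'' \<eta>'' (cB Y Y' Y'' g' g) (cA Z Z' Z'' h' h)"
proof -
  note Z = r(1)[THEN representsD(1)] r(2)[THEN representsD(1)] r(3)[THEN representsD(1)]
  note e = r(1)[THEN representsD(2)] r(2)[THEN representsD(2)] r(3)[THEN representsD(2)]
    r(1)[THEN representsD(3)] r(2)[THEN representsD(3)] r(3)[THEN representsD(3)]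
  have h: "h \<in> Hom A Z Z'" "h' \<in> Hom A Z' Z''"
    and h1: "cB (oF Z) (oF Z') Y' \<epsilon>' (mF Z Z' h) = cB (oF Z) Y Y' g \<epsilon>" "cB Y (oF Z) (oF Z') (mF Z Z' h) \<eta> = cB Y Y' (oF Z') \<eta>' g"
    and h2: "cB (oF Z') (oF Z'') Y'' \<epsilon>'' (mF Z' Z'' h') = cB (oF Z') Y' Y'' g' \<epsilon>'" "cB Y' (oF Z') (oF Z'') (mF Z' Z'' h') \<eta>' = cB Y' Y'' (oF Z'') \<eta>'' g'"
    using l by (auto simp: lifts_def)
  have "cB (oF Z) (oF Z'') Y'' \<epsilon>'' (mF Z Z'' (cA Z Z' Z'' h' h)) = cB (oF Z) (oF Z') Y'' (cB (oF Z') (oF Z'') Y'' \<epsilon>'' (mF Z' Z'' h')) (mF Z Z' h)"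
    using Z e h o by (simp add: comp ob mor tgt.assoc)
  also have "\<dots> = cB (oF Z) Y' Y'' g' (cB (oF Z) (oF Z') Y' \<epsilon>' (mF Z Z' h))"
    unfolding h2 using Z e h o g by (simp add: ob mor tgt.assoc)
  also have "\<dots> = cB (oF Z) Y Y'' (cB Y Y' Y'' g' g) \<epsilon>"
    unfolding h1 using Z e h o g by (simp add: ob tgt.assoc)
  finally have 1: "cB (oF Z) (oF Z'') Y'' \<epsilon>'' (mF Z Z'' (cA Z Z' Z'' h' h)) = cB (oF Z) Y Y'' (cB Y Y' Y'' g' g) \<epsilon>" .
  have "cB Y (oF Z) (oF Z'') (mF Z Z'' (cA Z Z' Z'' h' h)) \<eta> = cB Y (oF Z') (oF Z'') (mF Z' Z'' h') (cB Y (oF Z) (oF Z') (mF Z Z' h) \<eta>)"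
    using Z e h o by (simp add: comp ob mor tgt.assoc)
  also have "\<dots> = cB Y Y' (oF Z'') (cB Y' (oF Z') (oF Z'') (mF Z' Z'' h') \<eta>') g"
    unfolding h1 using Z e h o g by (simp add: ob mor tgt.assoc)
  also have "\<dots> = cB Y Y'' (oF Z'') \<eta>'' (cB Y Y' Y'' g' g)"
    unfolding h2 using Z e h o g by (simp add: ob tgt.assoc)
  finally show ?thesis using 1 Z h by (simp add: lifts_def src.comp_hom)
qed

lemma lift_id:
  assumes r: "represents Y Z \<epsilon> \<eta>" and o: "Y \<in> Obj B"
  shows "lifts Y Z \<epsilon> \<eta> Y Z \<epsilon> \<eta> (Idm B Y) (Idm A Z)"
  using representsD(1-3)[OF r] o by (simp add: lifts_def idm src.id_hom tgt.id_left tgt.id_right ob)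

lemma lift_unique:
  assumes r: "represents Y Z \<epsilon> \<eta>" "represents Y' Z' \<epsilon>' \<eta>'"
    and l: "lifts Y Z \<epsilon> \<eta> Y' Z' \<epsilon>' \<eta>' g h" "lifts Y Z \<epsilon> \<eta> Y' Z' \<epsilon>' \<eta>' g h'"
  shows "h = h'"
  using l by (intro represents_inj[OF r(2) representsD(1)[OF r(1)]]) (auto simp: lifts_def)

text \<open>The Yoneda argument: each universal element factors through the other, and both
  composites have the same image as the identity under an injective map.\<close>

lemma represents_unique:
  assumes r: "represents Y Z \<epsilon> \<eta>" "represents Y Z' \<epsilon>' \<eta>'" and o: "Y \<in> Obj B"
  shows "isomorphic A Z Z'"
proof -
  note Z = r(1)[THEN representsD(1)] r(2)[THEN representsD(1)]
  note e = r(1)[THEN representsD(2)] r(2)[THEN representsD(2)]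
  obtain f where f: "f \<in> Hom A Z Z'" "cB (oF Z) (oF Z') Y \<epsilon>' (mF Z Z' f) = \<epsilon>"
    by (rule represents_surj[OF r(2) Z(1) e(1)])
  obtain g where g: "g \<in> Hom A Z' Z" "cB (oF Z') (oF Z) Y \<epsilon> (mF Z' Z g) = \<epsilon>'"
    by (rule represents_surj[OF r(1) Z(2) e(2)])
  have 1: "cB (oF Z) (oF Z) Y \<epsilon> (mF Z Z (cA Z Z' Z g f)) = cB (oF Z) (oF Z) Y \<epsilon> (mF Z Z (Idm A Z))"
    using Z e f g o by (simp add: comp idm ob mor tgt.id_right tgt.assoc)
  have 2: "cB (oF Z') (oF Z') Y \<epsilon>' (mF Z' Z' (cA Z' Z Z' f g)) = cB (oF Z') (oF Z') Y \<epsilon>' (mF Z' Z' (Idm A Z'))"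
    using Z e f g o by (simp add: comp idm ob mor tgt.id_right tgt.assoc)
  have "cA Z Z' Z g f = Idm A Z" "cA Z' Z Z' f g = Idm A Z'"
    using represents_inj[OF r(1) Z(1) _ _ 1] represents_inj[OF r(2) Z(2) _ _ 2] Z f g
    by (auto simp: src.comp_hom src.id_hom)
  then show ?thesis using Z f g by (auto simp: isomorphic_def)
qed

text \<open>An arbitrary choice of simultaneous lifts is functorial, because lifts are unique. The
  bijections given by \<epsilon> and by \<eta> then yield the two adjunctions for one and the same
  functor.\<close>

theorem adjoint_from_representations:
  assumes rep: "\<And>Y. Y \<in> Obj B \<Longrightarrow> represents Y (Z Y) (\<epsilon> Y) (\<eta> Y)"
    and lift: "\<And>Y Y' g. \<lbrakk>Y \<in> Obj B; Y' \<in> Obj B; g \<in> Hom B Y Y'\<rbrakk>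
        \<Longrightarrow> \<exists>h. lifts Y (Z Y) (\<epsilon> Y) (\<eta> Y) Y' (Z Y') (\<epsilon> Y') (\<eta> Y') g h"
  shows "\<exists>R. adjunction A B F R \<and> adjunction B A R F \<and> fob R = Z"
proof -
  define m where "m = (\<lambda>Y Y' g. SOME h. lifts Y (Z Y) (\<epsilon> Y) (\<eta> Y) Y' (Z Y') (\<epsilon> Y') (\<eta> Y') g h)"
  define R where "R = \<lparr>fob = Z, fmor = m\<rparr>"
  have fR [simp]: "fob R = Z" "fmor R = m" by (simp_all add: R_def)
  have m: "lifts Y (Z Y) (\<epsilon> Y) (\<eta> Y) Y' (Z Y') (\<epsilon> Y') (\<eta> Y') g (m Y Y' g)"
    if "Y \<in> Obj B" "Y' \<in> Obj B" "g \<in> Hom B Y Y'" for Y Y' g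
    unfolding m_def using lift[OF that] by (rule someI_ex)
  have mI: "m Y Y' g = h" if "Y \<in> Obj B" "Y' \<in> Obj B" "g \<in> Hom B Y Y'"
    "lifts Y (Z Y) (\<epsilon> Y) (\<eta> Y) Y' (Z Y') (\<epsilon> Y') (\<eta> Y') g h" for Y Y' g h
    using lift_unique[OF rep rep m] that by blast
  have R: "is_functor B A R"
    unfolding is_functor_def fR
    using rep[THEN representsD(1)] m[unfolded lifts_def]
    by (auto simp: tgt.id_hom tgt.comp_hom lift_id[OF rep] intro!: mI lift_comp[OF rep rep rep] m)
  \<comment> \<open>\<open>adjunction\<close> wants the direction from \<open>Hom B (F X) Y\<close>
    to \<open>Hom A X (Z Y)\<close>, that is, the inverse of composing with
    \<open>\<epsilon> Y\<close>. Naturality is therefore checked after composing with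
    \<open>\<epsilon> Y'\<close>, which is injective.\<close>
  define \<Phi> where "\<Phi> = (\<lambda>X Y. inv_into (Hom A X (Z Y)) (\<lambda>f. cB (oF X) (oF (Z Y)) Y (\<epsilon> Y) (mF X (Z Y) f)))"
  have \<Phi>: "bij_betw (\<Phi> X Y) (Hom B (oF X) Y) (Hom A X (Z Y))" if "X \<in> Obj A" "Y \<in> Obj B" for X Y
    unfolding \<Phi>_def by (rule bij_betw_inv_into) (rule representsD(4)[OF rep[OF that(2)] that(1)])
  have \<Phi>h: "\<Phi> X Y h \<in> Hom A X (Z Y)" "cB (oF X) (oF (Z Y)) Y (\<epsilon> Y) (mF X (Z Y) (\<Phi> X Y h)) = h"
    if "X \<in> Obj A" "Y \<in> Obj B" "h \<in> Hom B (oF X) Y" for X Y h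
    using bij_betwE[OF \<Phi>[OF that(1,2)]] that bij_betw_inv_into_right[OF representsD(4)[OF rep[OF that(2)] that(1)] that(3)]
    by (auto simp: \<Phi>_def)
  have 1: "adjunction A B F R"
    unfolding adjunction_def fR
  proof (intro conjI is_fun R exI[of _ \<Phi>] ballI \<Phi>, assumption, assumption)
    fix X X' Y Y' f g h
    assume o: "X \<in> Obj A" "X' \<in> Obj A" "Y \<in> Obj B" "Y' \<in> Obj B"
      and h: "f \<in> Hom A X' X" "g \<in> Hom B Y Y'" "h \<in> Hom B (oF X) Y"
    note Z = rep[OF o(3), THEN representsD(1)] rep[OF o(4), THEN representsD(1)]
    note e = rep[OF o(3), THEN representsD(2)] rep[OF o(4), THEN representsD(2)]
    have mm: "m Y Y' g \<in> Hom A (Z Y) (Z Y')"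
      "cB (oF (Z Y)) (oF (Z Y')) Y' (\<epsilon> Y') (mF (Z Y) (Z Y') (m Y Y' g)) = cB (oF (Z Y)) Y Y' g (\<epsilon> Y)"
      using m[OF o(3,4) h(2)] by (auto simp: lifts_def)
    have gh: "cB (oF X') Y Y' g (cB (oF X') (oF X) Y h (mF X' X f)) \<in> Hom B (oF X') Y'"
      using o h by (simp add: tgt.comp_hom ob mor)
    show "\<Phi> X' Y' (cB (oF X') Y Y' g (cB (oF X') (oF X) Y h (mF X' X f))) =
       cA X' (Z Y) (Z Y') (m Y Y' g) (cA X' X (Z Y) (\<Phi> X Y h) f)" (is "_ = ?r")
    proof (rule represents_inj[OF rep[OF o(4)] o(2)])
      have "cB (oF X') (oF (Z Y')) Y' (\<epsilon> Y') (mF X' (Z Y') ?r) =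
         cB (oF X') (oF (Z Y)) Y' (cB (oF (Z Y)) (oF (Z Y')) Y' (\<epsilon> Y') (mF (Z Y) (Z Y') (m Y Y' g)))
           (cB (oF X') (oF X) (oF (Z Y)) (mF X (Z Y) (\<Phi> X Y h)) (mF X' X f))"
        using o h Z e mm(1) \<Phi>h(1)[OF o(1,3) h(3)] by (simp add: comp src.comp_hom tgt.comp_hom mor ob tgt.assoc)
      also have "\<dots> = cB (oF X') Y Y' g (cB (oF X') (oF X) Y (cB (oF X) (oF (Z Y)) Y (\<epsilon> Y) (mF X (Z Y) (\<Phi> X Y h))) (mF X' X f))"
        unfolding mm(2)
        using o h Z e mm(1) \<Phi>h(1)[OF o(1,3) h(3)] by (simp add: tgt.comp_hom mor ob tgt.assoc)
      also have "\<dots> = cB (oF X') (oF (Z Y')) Y' (\<epsilon> Y') (mF X' (Z Y') (\<Phi> X' Y' (cB (oF X') Y Y' g (cB (oF X') (oF X) Y h (mF X' X f)))))"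
        unfolding \<Phi>h(2)[OF o(1,3) h(3)] \<Phi>h(2)[OF o(2,4) gh] ..
      finally show "cB (oF X') (oF (Z Y')) Y' (\<epsilon> Y') (mF X' (Z Y') (\<Phi> X' Y' (cB (oF X') Y Y' g (cB (oF X') (oF X) Y h (mF X' X f))))) =
        cB (oF X') (oF (Z Y')) Y' (\<epsilon> Y') (mF X' (Z Y') ?r)" ..
    qed (use o h Z mm(1) \<Phi>h(1)[OF o(1,3) h(3)] \<Phi>h(1)[OF o(2,4) gh] in \<open>auto simp: src.comp_hom\<close>)
  qed
  have 2: "adjunction B A R F"
    unfolding adjunction_def fR
  \<comment> \<open>For the other adjunction, composing with \<open>\<eta> Y\<close> already has the
    required direction.\<close>
  proof (intro conjI is_fun R exI[of _ "\<lambda>Y X f. cB Y (oF (Z Y)) (oF X) (mF (Z Y) X f) (\<eta> Y)"] ballI)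
    fix X Y assume "X \<in> Obj A" "Y \<in> Obj B"
    then show "bij_betw (\<lambda>f. cB Y (oF (Z Y)) (oF X) (mF (Z Y) X f) (\<eta> Y)) (Hom A (Z Y) X) (Hom B Y (oF X))"
      using rep[THEN representsD(5)] by blast
  next
    fix X X' Y Y' f g h
    assume o: "Y \<in> Obj B" "Y' \<in> Obj B" "X \<in> Obj A" "X' \<in> Obj A"
      and h: "f \<in> Hom B Y' Y" "g \<in> Hom A X X'" "h \<in> Hom A (Z Y) X"
    note Z = rep[OF o(1), THEN representsD(1)] rep[OF o(2), THEN representsD(1)]
    note e = rep[OF o(1), THEN representsD(3)] rep[OF o(2), THEN representsD(3)]
    have mm: "m Y' Y f \<in> Hom A (Z Y') (Z Y)"
      "cB Y' (oF (Z Y')) (oF (Z Y)) (mF (Z Y') (Z Y) (m Y' Y f)) (\<eta> Y') = cB Y' Y (oF (Z Y)) (\<eta> Y) f"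
      using m[OF o(2,1) h(1)] by (auto simp: lifts_def)
    have "cB Y' (oF (Z Y')) (oF X') (mF (Z Y') X' (cA (Z Y') X X' g (cA (Z Y') (Z Y) X h (m Y' Y f)))) (\<eta> Y') =
       cB Y' (oF X) (oF X') (mF X X' g) (cB Y' (oF (Z Y)) (oF X) (mF (Z Y) X h)
         (cB Y' (oF (Z Y')) (oF (Z Y)) (mF (Z Y') (Z Y) (m Y' Y f)) (\<eta> Y')))"
      using o h Z e mm(1) by (simp add: comp src.comp_hom tgt.comp_hom mor ob tgt.assoc)
    also have "\<dots> = cB Y' (oF X) (oF X') (mF X X' g) (cB Y' Y (oF X) (cB Y (oF (Z Y)) (oF X) (mF (Z Y) X h) (\<eta> Y)) f)"
      unfolding mm(2) using o h Z e by (simp add: mor ob tgt.assoc)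
    finally show "cB Y' (oF (Z Y')) (oF X') (mF (Z Y') X' (cA (Z Y') X X' g (cA (Z Y') (Z Y) X h (m Y' Y f)))) (\<eta> Y') =
       cB Y' (oF X) (oF X') (mF X X' g) (cB Y' Y (oF X) (cB Y (oF (Z Y)) (oF X) (mF (Z Y) X h) (\<eta> Y)) f)" .
  qed
  show ?thesis using 1 2 fR(1) by blast
qed

section \<open>Objects assembled from representable pieces\<close>

lemmas Fsum = sum[where I = "{..<K}" for K :: nat, unfolded lessThan_iff]
lemmas suml = src.comp_sum_left[where I = "{..<K}" for K :: nat, unfolded lessThan_iff]
  tgt.comp_sum_left[where I = "{..<K}" for K :: nat, unfolded lessThan_iff]
lemmas sumr = src.comp_sum_right[where I = "{..<K}" for K :: nat, unfolded lessThan_iff]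
  tgt.comp_sum_right[where I = "{..<K}" for K :: nat, unfolded lessThan_iff]
lemmas sum_homs = src.sum_hom[where I = "{..<K}" for K :: nat, unfolded lessThan_iff]
  tgt.sum_hom[where I = "{..<K}" for K :: nat, unfolded lessThan_iff]

lemma lift_sum:
  assumes r: "represents Y Z \<epsilon> \<eta>" "represents Y' Z' \<epsilon>' \<eta>'" and o: "Y \<in> Obj B" "Y' \<in> Obj B"
    and g: "\<And>k. k < K \<Longrightarrow> g k \<in> Hom B Y Y'" and l: "\<And>k. k < (K::nat) \<Longrightarrow> lifts Y Z \<epsilon> \<eta> Y' Z' \<epsilon>' \<eta>' (g k) (h k)"
  shows "lifts Y Z \<epsilon> \<eta> Y' Z' \<epsilon>' \<eta>' (\<Sum>k<K. g k) (\<Sum>k<K. h k)"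
  using r[THEN representsD(1)] r[THEN representsD(2)] r[THEN representsD(3)] o g l
  by (simp add: lifts_def Fsum sum_homs suml sumr ob mor cong: sum_cong_lt)

text \<open>The maps \<open>i k\<close>, \<open>p k\<close> exhibit \<open>Y\<close> as a retract of
  the direct sum of the \<open>Yg k\<close> without forming that sum, and their lifts
  \<open>u k\<close>, \<open>d k\<close> exhibit \<open>Z\<close> in the same way in terms of the
  \<open>Zg k\<close>.\<close>

definition decomposed where
  "decomposed Y Z \<epsilon> \<eta> (K::nat) Yg Zg \<epsilon>g \<eta>g i p u d \<longleftrightarrow>
     Y \<in> Obj B \<and> Z \<in> Obj A \<and> \<epsilon> \<in> Hom B (oF Z) Y \<and> \<eta> \<in> Hom B Y (oF Z) \<and>
     (\<forall>k<K. Yg k \<in> Obj B \<and> represents (Yg k) (Zg k) (\<epsilon>g k) (\<eta>g k) \<and>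
       i k \<in> Hom B Y (Yg k) \<and> p k \<in> Hom B (Yg k) Y \<and> lifts Y Z \<epsilon> \<eta> (Yg k) (Zg k) (\<epsilon>g k) (\<eta>g k) (i k) (u k) \<and>
       lifts (Yg k) (Zg k) (\<epsilon>g k) (\<eta>g k) Y Z \<epsilon> \<eta> (p k) (d k)) \<and>
     (\<Sum>k<K. cB Y (Yg k) Y (p k) (i k)) = Idm B Y \<and> (\<Sum>k<K. cA Z (Zg k) Z (d k) (u k)) = Idm A Z"

text \<open>Composition with \<open>u\<close>, \<open>d\<close> on one side and with
  \<open>i\<close>, \<open>p\<close> on the other makes the map in question a retract of the
  corresponding bijections for the pieces; the four lifting squares are the commutations required.
  For \<eta> the arrows are reversed.\<close>

lemma decomposed_represents:
  assumes "decomposed Y Z \<epsilon> \<eta> K Yg Zg \<epsilon>g \<eta>g i p u d"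
  shows "represents Y Z \<epsilon> \<eta>"
proof -
  note dd = assms[unfolded decomposed_def]
  have o [simp]: "Y \<in> Obj B" "Z \<in> Obj A" "\<epsilon> \<in> Hom B (oF Z) Y" "\<eta> \<in> Hom B Y (oF Z)" using dd by auto
  have r: "k < K \<Longrightarrow> represents (Yg k) (Zg k) (\<epsilon>g k) (\<eta>g k)" for k using dd by auto
  have g [simp]: "k < K \<Longrightarrow> Yg k \<in> Obj B" "k < K \<Longrightarrow> i k \<in> Hom B Y (Yg k)" "k < K \<Longrightarrow> p k \<in> Hom B (Yg k) Y"
    "k < K \<Longrightarrow> u k \<in> Hom A Z (Zg k)" "k < K \<Longrightarrow> d k \<in> Hom A (Zg k) Z" for k using dd by (auto simp: lifts_def)
  note rr [simp] = r[THEN representsD(1)] r[THEN representsD(2)] r[THEN representsD(3)]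
  note [simp] = ob mor src.comp_hom tgt.comp_hom
  have E: "cB (oF Z) Y (Yg k) (i k) \<epsilon> = cB (oF Z) (oF (Zg k)) (Yg k) (\<epsilon>g k) (mF Z (Zg k) (u k))"
    and E': "cB (oF (Zg k)) (oF Z) Y \<epsilon> (mF (Zg k) Z (d k)) = cB (oF (Zg k)) (Yg k) Y (p k) (\<epsilon>g k)"
    and H: "cB (Yg k) Y (oF Z) \<eta> (p k) = cB (Yg k) (oF (Zg k)) (oF Z) (mF (Zg k) Z (d k)) (\<eta>g k)"
    and H': "cB Y (oF Z) (oF (Zg k)) (mF Z (Zg k) (u k)) \<eta> = cB Y (Yg k) (oF (Zg k)) (\<eta>g k) (i k)" if "k < K" for k
    using dd that by (auto simp: lifts_def)
  have pi: "(\<Sum>k<K. cB Y (Yg k) Y (p k) (i k)) = Idm B Y" and du: "(\<Sum>k<K. cA Z (Zg k) Z (d k) (u k)) = Idm A Z"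
    using dd by auto
  have "bij_betw (\<lambda>f. cB (oF X) (oF Z) Y \<epsilon> (mF X Z f)) (Hom A X Z) (Hom B (oF X) Y)" if X [simp]: "X \<in> Obj A" for X
  proof (rule bij_betw_retract_sum[where a = "\<lambda>k. cA X Z (Zg k) (u k)" and a' = "\<lambda>k. cB (oF X) Y (Yg k) (i k)"
        and b = "\<lambda>k. cA X (Zg k) Z (d k)" and b' = "\<lambda>k. cB (oF X) (Yg k) Y (p k)"])
    show "k < K \<Longrightarrow> bij_betw (\<lambda>f. cB (oF X) (oF (Zg k)) (Yg k) (\<epsilon>g k) (mF X (Zg k) f)) (Hom A X (Zg k)) (Hom B (oF X) (Yg k))" for k
      by (rule representsD(4)[OF r X])
    fix x assume x: "\<And>k. k < K \<Longrightarrow> x k \<in> Hom A X (Zg k)"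
    then show "(\<Sum>k<K. cA X (Zg k) Z (d k) (x k)) \<in> Hom A X Z" by (intro sum_homs) simp_all
    have "cB (oF X) (oF Z) Y \<epsilon> (mF X Z (\<Sum>k<K. cA X (Zg k) Z (d k) (x k))) =
        (\<Sum>k<K. cB (oF X) (oF (Zg k)) Y (cB (oF (Zg k)) (oF Z) Y \<epsilon> (mF (Zg k) Z (d k))) (mF X (Zg k) (x k)))"
      by (simp add: Fsum x comp sumr tgt.assoc)
    also have "\<dots> = (\<Sum>k<K. cB (oF X) (Yg k) Y (p k) (cB (oF X) (oF (Zg k)) (Yg k) (\<epsilon>g k) (mF X (Zg k) (x k))))"
      by (intro sum_cong_lt refl) (simp add: E' tgt.assoc x)
    finally show "cB (oF X) (oF Z) Y \<epsilon> (mF X Z (\<Sum>k<K. cA X (Zg k) Z (d k) (x k))) =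
        (\<Sum>k<K. cB (oF X) (Yg k) Y (p k) (cB (oF X) (oF (Zg k)) (Yg k) (\<epsilon>g k) (mF X (Zg k) (x k))))" .
  qed (simp_all add: comp tgt.assoc E src.assoc suml[symmetric] pi du src.id_left tgt.id_left)
  moreover have "bij_betw (\<lambda>f. cB Y (oF Z) (oF X) (mF Z X f) \<eta>) (Hom A Z X) (Hom B Y (oF X))" if X [simp]: "X \<in> Obj A" for X
  proof (rule bij_betw_retract_sum[where a = "\<lambda>k f. cA (Zg k) Z X f (d k)" and a' = "\<lambda>k f. cB (Yg k) Y (oF X) f (p k)"
        and b = "\<lambda>k f. cA Z (Zg k) X f (u k)" and b' = "\<lambda>k f. cB Y (Yg k) (oF X) f (i k)"])
    show "k < K \<Longrightarrow> bij_betw (\<lambda>f. cB (Yg k) (oF (Zg k)) (oF X) (mF (Zg k) X f) (\<eta>g k)) (Hom A (Zg k) X) (Hom B (Yg k) (oF X))" for k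
      by (rule representsD(5)[OF r X])
    fix x assume x: "\<And>k. k < K \<Longrightarrow> x k \<in> Hom A (Zg k) X"
    then show "(\<Sum>k<K. cA Z (Zg k) X (x k) (u k)) \<in> Hom A Z X" by (intro sum_homs) simp_all
    have "cB Y (oF Z) (oF X) (mF Z X (\<Sum>k<K. cA Z (Zg k) X (x k) (u k))) \<eta> =
        (\<Sum>k<K. cB Y (oF (Zg k)) (oF X) (mF (Zg k) X (x k)) (cB Y (oF Z) (oF (Zg k)) (mF Z (Zg k) (u k)) \<eta>))"
      by (simp add: Fsum x comp suml tgt.assoc)
    also have "\<dots> = (\<Sum>k<K. cB Y (Yg k) (oF X) (cB (Yg k) (oF (Zg k)) (oF X) (mF (Zg k) X (x k)) (\<eta>g k)) (i k))"
      by (intro sum_cong_lt refl) (simp add: H' tgt.assoc x)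
    finally show "cB Y (oF Z) (oF X) (mF Z X (\<Sum>k<K. cA Z (Zg k) X (x k) (u k))) \<eta> =
        (\<Sum>k<K. cB Y (Yg k) (oF X) (cB (Yg k) (oF (Zg k)) (oF X) (mF (Zg k) X (x k)) (\<eta>g k)) (i k))" .
  qed (simp_all add: comp tgt.assoc[symmetric] H[symmetric] src.assoc[symmetric] sumr[symmetric] pi du src.id_right tgt.id_right)
  ultimately show ?thesis by (simp add: represents_def)
qed

text \<open>Insert both resolutions of the identity: \<open>g\<close> is the sum of all
  \<open>p' k (i' k g p l) i l\<close>. The middle factors lift by assumption, the outer ones by the
  decompositions.\<close>

lemma decomposed_lift:
  assumes dec: "decomposed Y Z \<epsilon> \<eta> K Yg Zg \<epsilon>g \<eta>g i p u d" "decomposed Y' Z' \<epsilon>' \<eta>' K' Yg' Zg' \<epsilon>g' \<eta>g' i' p' u' d'"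
    and g: "g \<in> Hom B Y Y'"
    and l: "\<And>k l. k < K' \<Longrightarrow> l < K \<Longrightarrow> \<exists>h. lifts (Yg l) (Zg l) (\<epsilon>g l) (\<eta>g l) (Yg' k) (Zg' k) (\<epsilon>g' k) (\<eta>g' k)
        (cB (Yg l) Y' (Yg' k) (i' k) (cB (Yg l) Y Y' g (p l))) h"
  shows "\<exists>h. lifts Y Z \<epsilon> \<eta> Y' Z' \<epsilon>' \<eta>' g h"
proof -
  note d1 = dec(1)[unfolded decomposed_def] and d2 = dec(2)[unfolded decomposed_def]
  note R = decomposed_represents[OF dec(1)] decomposed_represents[OF dec(2)]
  have o [simp]: "Y \<in> Obj B" "Y' \<in> Obj B" using d1 d2 by auto
  have r: "k < K \<Longrightarrow> represents (Yg k) (Zg k) (\<epsilon>g k) (\<eta>g k)" and r': "k < K' \<Longrightarrow> represents (Yg' k) (Zg' k) (\<epsilon>g' k) (\<eta>g' k)" for k using d1 d2 by auto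
  note [simp] = g tgt.comp_hom
  have h [simp]: "k < K \<Longrightarrow> Yg k \<in> Obj B" "k < K \<Longrightarrow> i k \<in> Hom B Y (Yg k)" "k < K \<Longrightarrow> p k \<in> Hom B (Yg k) Y"
    "k < K' \<Longrightarrow> Yg' k \<in> Obj B" "k < K' \<Longrightarrow> i' k \<in> Hom B Y' (Yg' k)" "k < K' \<Longrightarrow> p' k \<in> Hom B (Yg' k) Y'" for k using d1 d2 by auto
  have li: "k < K \<Longrightarrow> lifts Y Z \<epsilon> \<eta> (Yg k) (Zg k) (\<epsilon>g k) (\<eta>g k) (i k) (u k)"
    and lp: "k < K' \<Longrightarrow> lifts (Yg' k) (Zg' k) (\<epsilon>g' k) (\<eta>g' k) Y' Z' \<epsilon>' \<eta>' (p' k) (d' k)" for k using d1 d2 by auto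
  have pi: "(\<Sum>k<K. cB Y (Yg k) Y (p k) (i k)) = Idm B Y" "(\<Sum>k<K'. cB Y' (Yg' k) Y' (p' k) (i' k)) = Idm B Y'" using d1 d2 by auto
  obtain q where q: "\<And>k l. k < K' \<Longrightarrow> l < K \<Longrightarrow> lifts (Yg l) (Zg l) (\<epsilon>g l) (\<eta>g l) (Yg' k) (Zg' k) (\<epsilon>g' k) (\<eta>g' k)
        (cB (Yg l) Y' (Yg' k) (i' k) (cB (Yg l) Y Y' g (p l))) (q k l)"
    using l by metis
  let ?g = "\<lambda>k l. cB Y (Yg' k) Y' (p' k) (cB Y (Yg l) (Yg' k) (cB (Yg l) Y' (Yg' k) (i' k) (cB (Yg l) Y Y' g (p l))) (i l))"
  have "lifts Y Z \<epsilon> \<eta> Y' Z' \<epsilon>' \<eta>' (?g k l) (cA Z (Zg' k) Z' (d' k) (cA Z (Zg l) (Zg' k) (q k l) (u l)))" if "k < K'" "l < K" for k l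
    by (rule lift_comp[OF R(1) r'[OF that(1)] R(2) _ _ _ _ _ lift_comp[OF R(1) r[OF that(2)] r'[OF that(1)] _ _ _ _ _ li[OF that(2)] q[OF that]] lp[OF that(1)]])
      (use that in simp_all)
  then have "lifts Y Z \<epsilon> \<eta> Y' Z' \<epsilon>' \<eta>' (\<Sum>k<K'. \<Sum>l<K. ?g k l) (\<Sum>k<K'. \<Sum>l<K. cA Z (Zg' k) Z' (d' k) (cA Z (Zg l) (Zg' k) (q k l) (u l)))"
    by (intro lift_sum[OF R] sum_homs) simp_all
  moreover have "(\<Sum>k<K'. \<Sum>l<K. ?g k l) = (\<Sum>k<K'. \<Sum>l<K. cB Y Y' Y' (cB Y' (Yg' k) Y' (p' k) (i' k)) (cB Y Y Y' g (cB Y (Yg l) Y (p l) (i l))))"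
    by (intro sum_cong_lt refl) (simp add: tgt.assoc)
  then have "(\<Sum>k<K'. \<Sum>l<K. ?g k l) = g"
    by (simp add: sumr[symmetric] suml[symmetric] sum_homs pi tgt.id_left tgt.id_right)
  ultimately show ?thesis by auto
qed

text \<open>The maps \<open>i k p l\<close> form an idempotent matrix with image \<open>Y\<close>;
  an object \<open>Z\<close> splitting the lifted matrix \<open>h\<close> takes its place. The
  universal elements are forced by the squares for \<open>u\<close> and \<open>d\<close>: \<epsilon>
  is the sum of the \<open>p k \<epsilon>g k F(u k)\<close> and \<eta> that of the
  \<open>F(d k) \<eta>g k i k\<close>.\<close>

lemma decomposed_from_splitting:
  assumes o: "Y \<in> Obj B" "Z \<in> Obj A"
    and Yg: "\<And>k. k < K \<Longrightarrow> Yg k \<in> Obj B"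
    and r: "\<And>k. k < K \<Longrightarrow> represents (Yg k) (Zg k) (\<epsilon>g k) (\<eta>g k)"
    and ip: "\<And>k. k < K \<Longrightarrow> i k \<in> Hom B Y (Yg k)" "\<And>k. k < K \<Longrightarrow> p k \<in> Hom B (Yg k) Y"
    and pi: "(\<Sum>k<K. cB Y (Yg k) Y (p k) (i k)) = Idm B Y"
    and h: "\<And>k l. k < K \<Longrightarrow> l < K \<Longrightarrow> lifts (Yg l) (Zg l) (\<epsilon>g l) (\<eta>g l) (Yg k) (Zg k) (\<epsilon>g k) (\<eta>g k) (cB (Yg l) Y (Yg k) (i k) (p l)) (h k l)"
    and ud: "\<And>k. k < K \<Longrightarrow> u k \<in> Hom A Z (Zg k)" "\<And>k. k < K \<Longrightarrow> d k \<in> Hom A (Zg k) Z"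
    and du: "(\<Sum>k<K. cA Z (Zg k) Z (d k) (u k)) = Idm A Z"
    and hud: "\<And>k l. k < K \<Longrightarrow> l < K \<Longrightarrow> cA (Zg l) Z (Zg k) (u k) (d l) = h k l"
  shows "decomposed Y Z (\<Sum>k<K. cB (oF Z) (Yg k) Y (p k) (cB (oF Z) (oF (Zg k)) (Yg k) (\<epsilon>g k) (mF Z (Zg k) (u k))))
    (\<Sum>k<K. cB Y (Yg k) (oF Z) (cB (Yg k) (oF (Zg k)) (oF Z) (mF (Zg k) Z (d k)) (\<eta>g k)) (i k)) K Yg Zg \<epsilon>g \<eta>g i p u d"
    (is "decomposed Y Z ?e ?t K Yg Zg \<epsilon>g \<eta>g i p u d")
proof -
  note [simp] = o Yg ip ud r[THEN representsD(1)] r[THEN representsD(2)] r[THEN representsD(3)] ob mor src.comp_hom tgt.comp_hom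
  have hh [simp]: "h k l \<in> Hom A (Zg l) (Zg k)"
    and h1: "cB (oF (Zg l)) (oF (Zg k)) (Yg k) (\<epsilon>g k) (mF (Zg l) (Zg k) (h k l)) =
       cB (oF (Zg l)) (Yg l) (Yg k) (cB (Yg l) Y (Yg k) (i k) (p l)) (\<epsilon>g l)"
    and h2: "cB (Yg l) (oF (Zg l)) (oF (Zg k)) (mF (Zg l) (Zg k) (h k l)) (\<eta>g l) =
       cB (Yg l) (Yg k) (oF (Zg k)) (\<eta>g k) (cB (Yg l) Y (Yg k) (i k) (p l))" if "k < K" "l < K" for k l
    using h[OF that] by (auto simp: lifts_def)
  have e: "?e \<in> Hom B (oF Z) Y" "?t \<in> Hom B Y (oF Z)" by (auto intro!: sum_homs)
  \<comment> \<open>The matrix \<open>h\<close> acts as the identity on its image: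
    \<open>h u = u\<close>, and below \<open>d h = d\<close>.\<close>
  have uk: "(\<Sum>l<K. cA Z (Zg l) (Zg k) (h k l) (u l)) = u k" if [simp]: "k < K" for k
  proof -
    have "(\<Sum>l<K. cA Z (Zg l) (Zg k) (h k l) (u l)) = (\<Sum>l<K. cA Z Z (Zg k) (u k) (cA Z (Zg l) Z (d l) (u l)))"
      by (rule sum.cong) (simp_all add: hud[symmetric] src.assoc)
    also have "\<dots> = u k" by (subst sumr[symmetric]) (simp_all add: du src.id_right)
    finally show ?thesis .
  qed
  have dk: "(\<Sum>k<K. cA (Zg l) (Zg k) Z (d k) (h k l)) = d l" if [simp]: "l < K" for l
  proof -
    have "(\<Sum>k<K. cA (Zg l) (Zg k) Z (d k) (h k l)) = (\<Sum>k<K. cA (Zg l) Z Z (cA Z (Zg k) Z (d k) (u k)) (d l))"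
      by (rule sum.cong) (simp_all add: hud[symmetric] src.assoc)
    also have "\<dots> = d l" by (subst suml[symmetric]) (simp_all add: du src.id_left)
    finally show ?thesis .
  qed
  have E: "cB (oF Z) Y (Yg k) (i k) ?e = cB (oF Z) (oF (Zg k)) (Yg k) (\<epsilon>g k) (mF Z (Zg k) (u k))" if [simp]: "k < K" for k
  proof -
    have "cB (oF Z) Y (Yg k) (i k) ?e = (\<Sum>l<K. cB (oF Z) (oF (Zg l)) (Yg k) (cB (oF (Zg l)) (Yg l) (Yg k) (cB (Yg l) Y (Yg k) (i k) (p l)) (\<epsilon>g l)) (mF Z (Zg l) (u l)))"
      by (simp add: sumr tgt.assoc)
    also have "\<dots> = cB (oF Z) (oF (Zg k)) (Yg k) (\<epsilon>g k) (mF Z (Zg k) (\<Sum>l<K. cA Z (Zg l) (Zg k) (h k l) (u l)))"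
      by (simp add: h1[symmetric] Fsum comp sumr tgt.assoc)
    finally show ?thesis by (simp add: uk)
  qed
  have E': "cB (oF (Zg l)) (oF Z) Y ?e (mF (Zg l) Z (d l)) = cB (oF (Zg l)) (Yg l) Y (p l) (\<epsilon>g l)" if [simp]: "l < K" for l
  proof -
    have "cB (oF (Zg l)) (oF Z) Y ?e (mF (Zg l) Z (d l)) = (\<Sum>k<K. cB (oF (Zg l)) (Yg k) Y (p k) (cB (oF (Zg l)) (oF (Zg k)) (Yg k) (\<epsilon>g k) (mF (Zg l) (Zg k) (h k l))))"
      by (simp add: suml tgt.assoc[symmetric] comp[symmetric] hud)
    also have "\<dots> = cB (oF (Zg l)) (Yg l) Y (cB (Yg l) Y Y (\<Sum>k<K. cB Y (Yg k) Y (p k) (i k)) (p l)) (\<epsilon>g l)"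
      by (simp add: h1 suml tgt.assoc)
    finally show ?thesis by (simp add: pi tgt.id_left)
  qed
  have H: "cB (Yg l) Y (oF Z) ?t (p l) = cB (Yg l) (oF (Zg l)) (oF Z) (mF (Zg l) Z (d l)) (\<eta>g l)" if [simp]: "l < K" for l
  proof -
    have "cB (Yg l) Y (oF Z) ?t (p l) = (\<Sum>k<K. cB (Yg l) (oF (Zg k)) (oF Z) (mF (Zg k) Z (d k)) (cB (Yg l) (Yg k) (oF (Zg k)) (\<eta>g k) (cB (Yg l) Y (Yg k) (i k) (p l))))"
      by (simp add: suml tgt.assoc)
    also have "\<dots> = (\<Sum>k<K. cB (Yg l) (oF (Zg k)) (oF Z) (mF (Zg k) Z (d k)) (cB (Yg l) (oF (Zg l)) (oF (Zg k)) (mF (Zg l) (Zg k) (h k l)) (\<eta>g l)))"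
      by (rule sum.cong) (simp_all add: h2)
    also have "\<dots> = cB (Yg l) (oF (Zg l)) (oF Z) (mF (Zg l) Z (\<Sum>k<K. cA (Zg l) (Zg k) Z (d k) (h k l))) (\<eta>g l)"
      by (simp add: Fsum comp suml tgt.assoc)
    finally show ?thesis by (simp add: dk)
  qed
  have H': "cB Y (oF Z) (oF (Zg k)) (mF Z (Zg k) (u k)) ?t = cB Y (Yg k) (oF (Zg k)) (\<eta>g k) (i k)" if [simp]: "k < K" for k
  proof -
    have "cB Y (oF Z) (oF (Zg k)) (mF Z (Zg k) (u k)) ?t = (\<Sum>l<K. cB Y (Yg l) (oF (Zg k)) (cB (Yg l) (oF (Zg l)) (oF (Zg k)) (mF (Zg l) (Zg k) (h k l)) (\<eta>g l)) (i l))"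
      by (simp add: sumr tgt.assoc comp[symmetric] hud)
    also have "\<dots> = cB Y (Yg k) (oF (Zg k)) (\<eta>g k) (cB Y Y (Yg k) (i k) (\<Sum>l<K. cB Y (Yg l) Y (p l) (i l)))"
      by (simp add: h2 sumr tgt.assoc)
    finally show ?thesis by (simp add: pi tgt.id_right)
  qed
  show ?thesis
    unfolding decomposed_def lifts_def using e E E' H H' pi du r by simp
qed

end

subsection \<open>Morphisms factoring through sums of generators\<close>

text \<open>\<open>Idm C Y \<in> thru C S Y Y\<close> expresses that \<open>Y\<close> is a retract
  of a finite direct sum of objects of \<open>S\<close>, again without forming the sum.\<close>

inductive_set thru :: "('o, 'x, 'k::field) lincat \<Rightarrow> 'o set \<Rightarrow> 'o \<Rightarrow> 'o \<Rightarrow> ('x \<Rightarrow> 'k) set"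
  for C S Y Y' where
  zero: "0 \<in> thru C S Y Y'"
| step: "\<lbrakk>f \<in> thru C S Y Y'; s \<in> S; i \<in> Hom C Y s; p \<in> Hom C s Y'\<rbrakk> \<Longrightarrow> f + Comp C Y s Y' p i \<in> thru C S Y Y'"

lemma thru_one: "\<lbrakk>s \<in> S; i \<in> Hom C Y s; p \<in> Hom C s Y'\<rbrakk> \<Longrightarrow> Comp C Y s Y' p i \<in> thru C S Y Y'"
  using thru.step[OF thru.zero] by fastforce

lemma thru_add: "g \<in> thru C S Y Y' \<Longrightarrow> f \<in> thru C S Y Y' \<Longrightarrow> f + g \<in> thru C S Y Y'"
proof (induction rule: thru.induct)
  case (step g s i p)
  then have "(f + g) + Comp C Y s Y' p i \<in> thru C S Y Y'" by (intro thru.step) auto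
  then show ?case by (simp add: add.assoc)
qed simp

lemma thru_sum: "(\<And>i. i \<in> I \<Longrightarrow> f i \<in> thru C S Y Y') \<Longrightarrow> (\<Sum>i\<in>I. f i) \<in> thru C S Y Y'"
  by (induction I rule: infinite_finite_induct) (auto intro: thru.zero thru_add)

lemma thru_decompose:
  assumes "f \<in> thru C S Y Y'"
  obtains K :: nat and s i p where "\<And>k. k < K \<Longrightarrow> s k \<in> S" "\<And>k. k < K \<Longrightarrow> i k \<in> Hom C Y (s k)"
    "\<And>k. k < K \<Longrightarrow> p k \<in> Hom C (s k) Y'" "(\<Sum>k<K. Comp C Y (s k) Y' (p k) (i k)) = f"
proof -
  have "\<exists>K s i p. (\<forall>k<K. s k \<in> S \<and> i k \<in> Hom C Y (s k) \<and> p k \<in> Hom C (s k) Y') \<and>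
     (\<Sum>k<(K::nat). Comp C Y (s k) Y' (p k) (i k)) = f"
    using assms
  proof (induction rule: thru.induct)
    case zero
    show ?case by (rule exI[of _ 0]) simp
  next
    case (step f s0 i0 p0)
    then obtain K s i p where IH: "\<forall>k<K. s k \<in> S \<and> i k \<in> Hom C Y (s k) \<and> p k \<in> Hom C (s k) Y'"
      "(\<Sum>k<(K::nat). Comp C Y (s k) Y' (p k) (i k)) = f" by blast
    show ?case
      by (rule exI[of _ "Suc K"], rule exI[of _ "s(K := s0)"], rule exI[of _ "i(K := i0)"], rule exI[of _ "p(K := p0)"])
        (use IH step in \<open>auto simp: less_Suc_eq\<close>)
  qed
  then show thesis using that by blast
qed

lemma sum_lt_zero: "sum f {..<0::nat} = 0"
  by simp

context linear_category
begin

lemma thru_hom: "f \<in> thru C S Y Y' \<Longrightarrow> S \<subseteq> Obj C \<Longrightarrow> Y \<in> Obj C \<Longrightarrow> Y' \<in> Obj C \<Longrightarrow> f \<in> Hom C Y Y'"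
  by (induction rule: thru.induct) (auto intro!: zero_hom add_hom comp_hom)

lemma thru_comp_left:
  assumes "f \<in> thru C S Y Y'" "S \<subseteq> Obj C" "Y \<in> Obj C" "Y' \<in> Obj C" "Y'' \<in> Obj C" "g \<in> Hom C Y' Y''"
  shows "Comp C Y Y' Y'' g f \<in> thru C S Y Y''"
  using assms(1)
proof (induction rule: thru.induct)
  case zero
  then show ?case using assms by (simp add: comp_zero_right thru.zero)
next
  case (step f s i p)
  have [simp]: "s \<in> Obj C" using step assms by auto
  have "Comp C Y Y' Y'' g (f + Comp C Y s Y' p i) = Comp C Y Y' Y'' g f + Comp C Y s Y'' (Comp C s Y' Y'' g p) i"
    using step assms thru_hom[OF step(1)] by (simp add: comp_add_right comp_hom assoc)
  then show ?case using step assms by (auto intro!: thru.step comp_hom)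
qed

lemma thru_comp_right:
  assumes "f \<in> thru C S Y' Y''" "S \<subseteq> Obj C" "Y \<in> Obj C" "Y' \<in> Obj C" "Y'' \<in> Obj C" "g \<in> Hom C Y Y'"
  shows "Comp C Y Y' Y'' f g \<in> thru C S Y Y''"
  using assms(1)
proof (induction rule: thru.induct)
  case zero
  then show ?case using assms by (simp add: comp_zero_left thru.zero)
next
  case (step f s i p)
  have [simp]: "s \<in> Obj C" using step assms by auto
  have "Comp C Y Y' Y'' (f + Comp C Y' s Y'' p i) g = Comp C Y Y' Y'' f g + Comp C Y s Y'' p (Comp C Y Y' s i g)"
    using step assms thru_hom[OF step(1)] by (simp add: comp_add_left comp_hom assoc)
  then show ?case using step assms by (auto intro!: thru.step comp_hom)
qed

text \<open>Each summand \<open>p i\<close> equals \<open>p 1 i\<close> with the identity of an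
  object of \<open>S\<close> in the middle, and that identity is resolved through
  \<open>S'\<close>.\<close>

lemma thru_trans:
  assumes "f \<in> thru C S Y Y'" "S \<subseteq> Obj C" "S' \<subseteq> Obj C" "Y \<in> Obj C" "Y' \<in> Obj C"
    and S: "\<And>s. s \<in> S \<Longrightarrow> Idm C s \<in> thru C S' s s"
  shows "f \<in> thru C S' Y Y'"
  using assms(1)
proof (induction rule: thru.induct)
  case (step f s i p)
  have [simp]: "s \<in> Obj C" using step assms by auto
  have "Comp C Y s Y' p (Comp C Y s s (Idm C s) i) \<in> thru C S' Y Y'"
    using step assms by (intro thru_comp_left thru_comp_right S) auto
  then have "Comp C Y s Y' p i \<in> thru C S' Y Y'" using step assms by (simp add: id_left)
  then show ?case using step(5) by (rule thru_add)
qed (rule thru.zero)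

lemma obj_ps: "(As, e) \<in> Obj (ps C) \<longleftrightarrow> set As \<subseteq> Obj C \<and> e \<in> mat_hom C As As \<and> mat_comp C As As As e e = e"
  by (simp add: ps_def)

lemma emb_mor_hom: "f \<in> Hom C A B \<Longrightarrow> emb_mor f \<in> mat_hom C [A] [B]"
  by (auto simp: mat_hom_iff emb_mor_def entry_single)

lemma mat_hom_single: "M \<in> mat_hom C [A] [B] \<longleftrightarrow> (\<exists>f\<in>Hom C A B. M = emb_mor f)"
proof
  assume M: "M \<in> mat_hom C [A] [B]"
  then have "entry M 0 0 \<in> Hom C A B" "M = emb_mor (entry M 0 0)"
    by (auto simp: mat_hom_iff emb_mor_def entry_single intro!: entry_eqI)
  then show "\<exists>f\<in>Hom C A B. M = emb_mor f" by blast
qed (auto intro: emb_mor_hom)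

lemma mat_id_single: "mat_id C [A] = emb_mor (Idm C A)"
  by (rule entry_eqI) (auto simp: entry_mat_id emb_mor_def entry_single)

lemma mat_comp_single: "mat_comp C [A] [B] [E] (emb_mor g) (emb_mor f) = emb_mor (Comp C A B E g f)"
  by (rule entry_eqI) (auto simp: entry_mat_comp emb_mor_def entry_single)

lemma obj_emb: "A \<in> Obj C \<Longrightarrow> emb_ob C A \<in> Obj (ps C)"
  by (simp add: emb_ob_def obj_ps mat_id_hom mat_id_left)

lemma hom_full:
  assumes "set As \<subseteq> Obj C" "set Bs \<subseteq> Obj C"
  shows "Hom (ps C) (As, mat_id C As) (Bs, mat_id C Bs) = mat_hom C As Bs"
  using assms by (auto simp: ps_def mat_id_left mat_id_right)

lemma comp_ps [simp]: "Comp (ps C) (As, e) (Bs, e') (Es, e'') = mat_comp C As Bs Es"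
  by (simp add: ps_def)

lemma hom_emb: "A \<in> Obj C \<Longrightarrow> B \<in> Obj C \<Longrightarrow> Hom (ps C) (emb_ob C A) (emb_ob C B) = emb_mor ` Hom C A B"
  unfolding emb_ob_def by (subst hom_full) (auto simp: mat_hom_single)

lemma comp_emb: "Comp (ps C) (emb_ob C A) (emb_ob C B) (emb_ob C E) (emb_mor g) (emb_mor f) = emb_mor (Comp C A B E g f)"
  by (simp add: emb_ob_def mat_comp_single)

lemma idm_emb: "Idm (ps C) (emb_ob C A) = emb_mor (Idm C A)"
  by (simp add: emb_ob_def ps_def mat_id_single)

lemma emb_mor_inj: "emb_mor f = emb_mor g \<Longrightarrow> f = g"
  by (metis emb_mor_def entry_single)

lemma emb_mor_add: "emb_mor (f + g) = emb_mor f + (emb_mor g :: nat \<times> nat \<times> 'x \<Rightarrow> 'k)"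
  by (rule entry_eqI) (auto simp: emb_mor_def entry_single entry_add)

lemma emb_mor_zero: "emb_mor 0 = (0 :: nat \<times> nat \<times> 'x \<Rightarrow> 'k)"
  by (rule entry_eqI) (auto simp: emb_mor_def entry_single entry_zero)

lemma emb_mor_smul: "emb_mor (smul c f) = smul c (emb_mor f :: nat \<times> nat \<times> 'x \<Rightarrow> 'k)"
  by (rule entry_eqI) (auto simp: emb_mor_def entry_single entry_smul)

lemma emb_mor_sum: "emb_mor (\<Sum>i\<in>I. f i) = (\<Sum>i\<in>I. emb_mor (f i) :: nat \<times> nat \<times> 'x \<Rightarrow> 'k)"
  by (induction I rule: infinite_finite_induct) (auto simp: emb_mor_add emb_mor_zero)

lemma thru_emb: "f \<in> thru C S A B \<Longrightarrow> emb_mor f \<in> thru (ps C) (emb_ob C ` S) (emb_ob C A) (emb_ob C B)"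
  if "S \<subseteq> Obj C" "A \<in> Obj C" "B \<in> Obj C" for A B f
proof (induction rule: thru.induct)
  case (step f s i p)
  have "s \<in> Obj C" using step that by auto
  then have "emb_mor f + Comp (ps C) (emb_ob C A) (emb_ob C s) (emb_ob C B) (emb_mor p) (emb_mor i) \<in> thru (ps C) (emb_ob C ` S) (emb_ob C A) (emb_ob C B)"
    using step that by (intro thru.step) (auto simp: hom_emb)
  then show ?case by (simp add: emb_mor_add comp_emb)
qed (simp add: emb_mor_zero thru.zero)

text \<open>For \<open>Y = (As, e)\<close>, the \<open>k\<close>-th row of \<open>e\<close> maps
  \<open>Y\<close> to its \<open>k\<close>-th entry and the \<open>k\<close>-th column maps back.
  The composites add up to \<open>e e = e\<close>, which is the identity of
  \<open>Y\<close>.\<close>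

lemma thru_ps:
  assumes Y: "Y \<in> Obj (ps C)"
  shows "Idm (ps C) Y \<in> thru (ps C) (emb_ob C ` Obj C) Y Y"
proof -
  obtain As e where [simp]: "Y = (As, e)" by fastforce
  have A: "set As \<subseteq> Obj C" and e: "e \<in> mat_hom C As As" and ee: "mat_comp C As As As e e = e" using Y by (auto simp: obj_ps)
  note [simp] = objD[OF A] mat_hom_entry[OF e]
  define i where "i k = matrix 1 (length As) (\<lambda>_ l. entry e k l)" for k
  define p where "p k = matrix (length As) 1 (\<lambda>l _. entry e l k)" for k
  have ih: "i k \<in> mat_hom C As [As ! k]" and ph: "p k \<in> mat_hom C [As ! k] As" if "k < length As" for k
    using that by (auto simp: i_def p_def intro!: matrix_mat_hom)
  have ee': "(\<Sum>j<length As. Comp C (As ! m) (As ! j) (As ! l) (entry e l j) (entry e j m)) = entry e l m" if "l < length As" "m < length As" for l m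
    using arg_cong[OF ee, of "\<lambda>M. entry M l m"] that by (simp add: entry_mat_comp)
  have 1: "mat_comp C As As [As ! k] (i k) e = i k" "mat_comp C [As ! k] As As e (p k) = p k" if "k < length As" for k
    using that by (auto intro!: entry_eqI simp: entry_mat_comp i_def p_def entry_matrix ee')
  have hi: "i k \<in> Hom (ps C) Y (emb_ob C (As ! k))" "p k \<in> Hom (ps C) (emb_ob C (As ! k)) Y" if "k < length As" for k
    using that A ih[OF that] ph[OF that] 1[OF that] by (auto simp: ps_def emb_ob_def mat_id_left mat_id_right)
  have "(\<Sum>k<length As. Comp (ps C) Y (emb_ob C (As ! k)) Y (p k) (i k)) = e"
  proof (rule entry_eqI)
    fix j l show "entry (\<Sum>k<length As. Comp (ps C) Y (emb_ob C (As ! k)) Y (p k) (i k)) j l = entry e j l"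
      using mat_hom_out[OF e, of j l]
      by (cases "j < length As \<and> l < length As") (auto simp: entry_sum emb_ob_def entry_mat_comp i_def p_def entry_matrix ee')
  qed
  moreover have "(\<Sum>k<length As. Comp (ps C) Y (emb_ob C (As ! k)) Y (p k) (i k)) \<in> thru (ps C) (emb_ob C ` Obj C) Y Y"
    by (intro thru_sum thru_one hi) auto
  ultimately show ?thesis by (simp add: ps_def)
qed

text \<open>The entries of the \<open>h k l\<close> form one idempotent matrix on the list of the
  \<open>a k\<close>, and this pair is the splitting; its rows are \<open>u\<close> and its columns
  \<open>d\<close>. The \<open>e k\<close> are absorbed because the \<open>h k l\<close> are
  morphisms between the images. One-entry lists are the shape of the objects \<open>Z a\<close>
  below.\<close>

lemma ps_splitting:
  fixes K :: nat
  assumes Z: "\<And>k. k < K \<Longrightarrow> ([a k], e k) \<in> Obj (ps C)"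
    and h: "\<And>k l. k < K \<Longrightarrow> l < K \<Longrightarrow> h k l \<in> Hom (ps C) ([a l], e l) ([a k], e k)"
    and hh: "\<And>k m. k < K \<Longrightarrow> m < K \<Longrightarrow> (\<Sum>l<K. Comp (ps C) ([a m], e m) ([a l], e l) ([a k], e k) (h k l) (h l m)) = h k m"
  shows "\<exists>Z u d. Z \<in> Obj (ps C) \<and> (\<forall>k<K. u k \<in> Hom (ps C) Z ([a k], e k) \<and> d k \<in> Hom (ps C) ([a k], e k) Z) \<and>
    (\<Sum>k<K. Comp (ps C) Z ([a k], e k) Z (d k) (u k)) = Idm (ps C) Z \<and>
    (\<forall>k<K. \<forall>l<K. Comp (ps C) ([a l], e l) Z ([a k], e k) (u k) (d l) = h k l)"
proof -
  have a [simp]: "k < K \<Longrightarrow> a k \<in> Obj C" and e: "k < K \<Longrightarrow> e k \<in> mat_hom C [a k] [a k]" for k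
    using Z[of k] by (auto simp: obj_ps)
  define q where "q k l = entry (h k l) 0 0" for k l
  have hm: "h k l \<in> mat_hom C [a l] [a k]" and he: "mat_comp C [a l] [a l] [a k] (h k l) (e l) = h k l"
    "mat_comp C [a l] [a k] [a k] (e k) (h k l) = h k l" if "k < K" "l < K" for k l
    using h[OF that] by (auto simp: ps_def)
  have hq: "h k l = emb_mor (q k l)" and q [simp]: "q k l \<in> Hom C (a l) (a k)" if "k < K" "l < K" for k l
    using hm[OF that] by (auto simp: mat_hom_iff emb_mor_def entry_single q_def intro!: entry_eqI)
  have qq: "(\<Sum>l<K. Comp C (a m) (a l) (a k) (q k l) (q l m)) = q k m" if "k < K" "m < K" for k m
  proof -
    have "emb_mor (\<Sum>l<K. Comp C (a m) (a l) (a k) (q k l) (q l m)) = (\<Sum>l<K. mat_comp C [a m] [a l] [a k] (h k l) (h l m))"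
      unfolding emb_mor_sum by (rule sum.cong) (use that in \<open>auto simp: hq mat_comp_single\<close>)
    also have "\<dots> = emb_mor (q k m)" using hh[OF that] that by (simp add: hq)
    finally show ?thesis by (rule emb_mor_inj)
  qed
  define As where "As = map a [0..<K]"
  have As: "length As = K" "\<And>k. k < K \<Longrightarrow> As ! k = a k" "set As \<subseteq> Obj C" by (auto simp: As_def)
  define Z where "Z = (As, matrix K K q)"
  define u where "u k = matrix 1 K (\<lambda>_ l. q k l)" for k
  define d where "d k = matrix K 1 (\<lambda>l _. q l k)" for k
  have qe: "Comp C (a l) (a l) (a k) (q k l) (entry (e l) 0 0) = q k l" "Comp C (a l) (a k) (a k) (entry (e k) 0 0) (q k l) = q k l" if "k < K" "l < K" for k l
    using arg_cong[OF he(1)[OF that], of "\<lambda>M. entry M 0 0"] arg_cong[OF he(2)[OF that], of "\<lambda>M. entry M 0 0"]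
    by (simp_all add: entry_mat_comp q_def)
  have mh: "matrix K K q \<in> mat_hom C As As" "k < K \<Longrightarrow> u k \<in> mat_hom C As [a k]" "k < K \<Longrightarrow> d k \<in> mat_hom C [a k] As" for k
    by (auto simp: u_def d_def As intro!: matrix_mat_hom)
  have c: "mat_comp C As As As (matrix K K q) (matrix K K q) = matrix K K q"
    by (rule entry_eqI) (auto simp: entry_mat_comp entry_matrix As qq cong: sum_cong_lt)
  have cu: "mat_comp C As As [a k] (u k) (matrix K K q) = u k" "mat_comp C As [a k] [a k] (e k) (u k) = u k"
    and cd: "mat_comp C [a k] As As (matrix K K q) (d k) = d k" "mat_comp C [a k] [a k] As (d k) (e k) = d k" if "k < K" for k
    using that by (auto intro!: entry_eqI simp: entry_mat_comp entry_matrix As qq u_def d_def qe sum_lt_zero cong: sum_cong_lt)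
  have "(\<Sum>k<K. Comp (ps C) Z ([a k], e k) Z (d k) (u k)) = Idm (ps C) Z"
    unfolding Z_def
  proof (rule entry_eqI)
    fix j l show "entry (\<Sum>k<K. Comp (ps C) (As, matrix K K q) ([a k], e k) (As, matrix K K q) (d k) (u k)) j l = entry (Idm (ps C) (As, matrix K K q)) j l"
      by (cases "j < K \<and> l < K") (auto simp: ps_def entry_sum entry_mat_comp u_def d_def entry_matrix As qq cong: sum_cong_lt)
  qed
  moreover have "Comp (ps C) ([a l], e l) Z ([a k], e k) (u k) (d l) = h k l" if "k < K" "l < K" for k l
    unfolding Z_def using that
    by (intro entry_eqI) (auto simp: entry_mat_comp u_def d_def entry_matrix As qq hq emb_mor_def entry_single cong: sum_cong_lt)
  moreover have "Z \<in> Obj (ps C)" using mh c As by (simp add: Z_def obj_ps)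
  moreover have "u k \<in> Hom (ps C) Z ([a k], e k)" "d k \<in> Hom (ps C) ([a k], e k) Z" if "k < K" for k
    using mh cu[OF that] cd[OF that] that by (simp_all add: ps_def Z_def)
  ultimately show ?thesis by blast
qed

end

lemma (in tensor_pair) thru_tensor:
  assumes f: "f \<in> thru C S A B" and g: "g \<in> thru D S' A' B'"
    and o: "S \<subseteq> Obj C" "S' \<subseteq> Obj D" "A \<in> Obj C" "B \<in> Obj C" "A' \<in> Obj D" "B' \<in> Obj D"
  shows "tens f g \<in> thru T (S \<times> S') (A, A') (B, B')"
  using f
proof (induction rule: thru.induct)
  case zero
  then show ?case by (simp add: tens_zero_left thru.zero)
next
  case (step f s i p)
  note st = step
  have "tens (Comp C A s B p i) g \<in> thru T (S \<times> S') (A, A') (B, B')"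
    using g
  proof (induction rule: thru.induct)
    case zero
    then show ?case by (simp add: tens_zero_right thru.zero)
  next
    case (step g s' i' p')
    have "tens (Comp C A s B p i) (Comp D A' s' B' p' i') = Comp T (A, A') (s, s') (B, B') (tens p p') (tens i i')"
      using st step o by (subst T_comp_pure) auto
    then show ?case using st step by (auto simp: tens_add_right intro!: thru.step T_pure)
  qed
  then show ?case using step by (simp add: tens_add_left thru_add)
qed

section \<open>Reduction to test objects and to generators\<close>

context two_sided
begin

text \<open>An object \<open>X\<close> is a retract of a sum of objects of \<open>T\<close>, so the
  map at \<open>X\<close> is a retract of the maps at these. It will be used with the objects
  \<open>[b]\<close> as \<open>T\<close>, where \<open>Res\<close> is known explicitly.\<close>

lemma represents_from_dense:
  assumes T: "T \<subseteq> Obj A" "\<And>X. X \<in> Obj A \<Longrightarrow> Idm A X \<in> thru A T X X"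
    and o: "Y \<in> Obj B" "Z \<in> Obj A" "\<epsilon> \<in> Hom B (oF Z) Y" "\<eta> \<in> Hom B Y (oF Z)"
    and 1: "\<And>X. X \<in> T \<Longrightarrow> bij_betw (\<lambda>f. cB (oF X) (oF Z) Y \<epsilon> (mF X Z f)) (Hom A X Z) (Hom B (oF X) Y)"
    and 2: "\<And>X. X \<in> T \<Longrightarrow> bij_betw (\<lambda>f. cB Y (oF Z) (oF X) (mF Z X f) \<eta>) (Hom A Z X) (Hom B Y (oF X))"
  shows "represents Y Z \<epsilon> \<eta>"
proof -
  note [simp] = o ob mor src.comp_hom tgt.comp_hom
  have "bij_betw (\<lambda>f. cB (oF X) (oF Z) Y \<epsilon> (mF X Z f)) (Hom A X Z) (Hom B (oF X) Y) \<and>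
     bij_betw (\<lambda>f. cB Y (oF Z) (oF X) (mF Z X f) \<eta>) (Hom A Z X) (Hom B Y (oF X))" if X [simp]: "X \<in> Obj A" for X
  proof
    obtain K :: nat and s i p where s: "\<And>k. k < K \<Longrightarrow> s k \<in> T" and ip [simp]: "\<And>k. k < K \<Longrightarrow> i k \<in> Hom A X (s k)"
      "\<And>k. k < K \<Longrightarrow> p k \<in> Hom A (s k) X" and pi: "(\<Sum>k<K. cA X (s k) X (p k) (i k)) = Idm A X"
      by (rule thru_decompose[OF T(2)[OF X]], rule that)
    have [simp]: "k < K \<Longrightarrow> s k \<in> Obj A" for k using s T(1) by auto
    have pi': "(\<Sum>k<K. cB (oF X) (oF (s k)) (oF X) (mF (s k) X (p k)) (mF X (s k) (i k))) = Idm B (oF X)"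
      using arg_cong[OF pi, of "mF X X"] by (simp add: Fsum comp idm)
    show "bij_betw (\<lambda>f. cB (oF X) (oF Z) Y \<epsilon> (mF X Z f)) (Hom A X Z) (Hom B (oF X) Y)"
    proof (rule bij_betw_retract_sum[where a = "\<lambda>k f. cA (s k) X Z f (p k)" and a' = "\<lambda>k g. cB (oF (s k)) (oF X) Y g (mF (s k) X (p k))"
          and b = "\<lambda>k f. cA X (s k) Z f (i k)" and b' = "\<lambda>k g. cB (oF X) (oF (s k)) Y g (mF X (s k) (i k))"])
      show "k < K \<Longrightarrow> bij_betw (\<lambda>f. cB (oF (s k)) (oF Z) Y \<epsilon> (mF (s k) Z f)) (Hom A (s k) Z) (Hom B (oF (s k)) Y)" for k
        by (rule 1[OF s])
      fix x assume x: "\<And>k. k < K \<Longrightarrow> x k \<in> Hom A (s k) Z"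
      then show "(\<Sum>k<K. cA X (s k) Z (x k) (i k)) \<in> Hom A X Z" by (intro sum_homs) simp_all
      show "cB (oF X) (oF Z) Y \<epsilon> (mF X Z (\<Sum>k<K. cA X (s k) Z (x k) (i k))) =
          (\<Sum>k<K. cB (oF X) (oF (s k)) Y (cB (oF (s k)) (oF Z) Y \<epsilon> (mF (s k) Z (x k))) (mF X (s k) (i k)))"
        by (simp add: Fsum x comp sumr tgt.assoc)
    qed (simp_all add: comp src.assoc[symmetric] tgt.assoc[symmetric] sumr[symmetric] pi pi' src.id_right tgt.id_right)
    show "bij_betw (\<lambda>f. cB Y (oF Z) (oF X) (mF Z X f) \<eta>) (Hom A Z X) (Hom B Y (oF X))"
    proof (rule bij_betw_retract_sum[where a = "\<lambda>k. cA Z X (s k) (i k)" and a' = "\<lambda>k. cB Y (oF X) (oF (s k)) (mF X (s k) (i k))"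
          and b = "\<lambda>k. cA Z (s k) X (p k)" and b' = "\<lambda>k. cB Y (oF (s k)) (oF X) (mF (s k) X (p k))"])
      show "k < K \<Longrightarrow> bij_betw (\<lambda>f. cB Y (oF Z) (oF (s k)) (mF Z (s k) f) \<eta>) (Hom A Z (s k)) (Hom B Y (oF (s k)))" for k
        by (rule 2[OF s])
      fix x assume x: "\<And>k. k < K \<Longrightarrow> x k \<in> Hom A Z (s k)"
      then show "(\<Sum>k<K. cA Z (s k) X (p k) (x k)) \<in> Hom A Z X" by (intro sum_homs) simp_all
      show "cB Y (oF Z) (oF X) (mF Z X (\<Sum>k<K. cA Z (s k) X (p k) (x k))) \<eta> =
          (\<Sum>k<K. cB Y (oF (s k)) (oF X) (mF (s k) X (p k)) (cB Y (oF Z) (oF (s k)) (mF Z (s k) (x k)) \<eta>))"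
        by (simp add: Fsum x comp suml tgt.assoc)
    qed (simp_all add: comp src.assoc tgt.assoc suml[symmetric] pi pi' src.id_left tgt.id_left)
  qed
  then show ?thesis using o by (simp add: represents_def)
qed

text \<open>Every \<open>Y\<close> is a retract of a sum of generators. The corresponding idempotent
  matrix lifts, its lift is idempotent by uniqueness of lifts, and \<open>split\<close> provides its
  image. For \<open>Y1\<close>, a retract of one generator, the splitting \<open>X\<close> is given
  in advance; uniqueness of representing objects identifies it with the value of the
  adjoint.\<close>

theorem adjoint_from_generators:
  assumes Yg: "\<And>s. Yg s \<in> Obj B" and r: "\<And>s. represents (Yg s) (Zg s) (\<epsilon>g s) (\<eta>g s)"
    and l: "\<And>s s' g. g \<in> Hom B (Yg s) (Yg s') \<Longrightarrow> \<exists>h. lifts (Yg s) (Zg s) (\<epsilon>g s) (\<eta>g s) (Yg s') (Zg s') (\<epsilon>g s') (\<eta>g s') g h"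
    and gen: "\<And>Y. Y \<in> Obj B \<Longrightarrow> Idm B Y \<in> thru B (range Yg) Y Y"
    and split: "\<And>K s h. \<lbrakk>\<And>k l. k < K \<Longrightarrow> l < K \<Longrightarrow> h k l \<in> Hom A (Zg (s l)) (Zg (s k));
        \<And>k m. k < K \<Longrightarrow> m < K \<Longrightarrow> (\<Sum>l<K. cA (Zg (s m)) (Zg (s l)) (Zg (s k)) (h k l) (h l m)) = h k m\<rbrakk>
      \<Longrightarrow> \<exists>Z u d. Z \<in> Obj A \<and> (\<forall>k<K. u k \<in> Hom A Z (Zg (s k)) \<and> d k \<in> Hom A (Zg (s k)) Z) \<and>
        (\<Sum>k<(K::nat). cA Z (Zg (s k)) Z (d k) (u k)) = Idm A Z \<and> (\<forall>k<K. \<forall>l<K. cA (Zg (s l)) Z (Zg (s k)) (u k) (d l) = h k l)"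
    and Y1: "Y1 \<in> Obj B" "i1 \<in> Hom B Y1 (Yg s1)" "p1 \<in> Hom B (Yg s1) Y1" "cB Y1 (Yg s1) Y1 p1 i1 = Idm B Y1"
    and X: "X \<in> Obj A" "u1 \<in> Hom A X (Zg s1)" "d1 \<in> Hom A (Zg s1) X" "cA X (Zg s1) X d1 u1 = Idm A X"
    and l1: "lifts (Yg s1) (Zg s1) (\<epsilon>g s1) (\<eta>g s1) (Yg s1) (Zg s1) (\<epsilon>g s1) (\<eta>g s1) (cB (Yg s1) Y1 (Yg s1) i1 p1) (cA (Zg s1) X (Zg s1) u1 d1)"
  shows "\<exists>R. adjunction A B F R \<and> adjunction B A R F \<and> isomorphic A (fob R Y1) X"
proof -
  have "\<exists>Z \<epsilon> \<eta> K s i p u d. decomposed Y Z \<epsilon> \<eta> K (\<lambda>k. Yg (s k)) (\<lambda>k. Zg (s k)) (\<lambda>k. \<epsilon>g (s k)) (\<lambda>k. \<eta>g (s k)) i p u d"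
    if Y [simp]: "Y \<in> Obj B" for Y
  proof -
    obtain K :: nat and y i p where y: "\<And>k. k < K \<Longrightarrow> y k \<in> range Yg" and ip0: "\<And>k. k < K \<Longrightarrow> i k \<in> Hom B Y (y k)"
      "\<And>k. k < K \<Longrightarrow> p k \<in> Hom B (y k) Y" and pi0: "(\<Sum>k<K. cB Y (y k) Y (p k) (i k)) = Idm B Y"
      by (rule thru_decompose[OF gen[OF Y]], rule that)
    define s where "s k = inv_into UNIV Yg (y k)" for k
    have s: "y k = Yg (s k)" if "k < K" for k unfolding s_def using f_inv_into_f[OF y[OF that]] by simp
    have ip [simp]: "\<And>k. k < K \<Longrightarrow> i k \<in> Hom B Y (Yg (s k))" "\<And>k. k < K \<Longrightarrow> p k \<in> Hom B (Yg (s k)) Y"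
      and pi: "(\<Sum>k<K. cB Y (Yg (s k)) Y (p k) (i k)) = Idm B Y" using ip0 pi0 s by (auto cong: sum_cong_lt)
    note [simp] = Yg tgt.comp_hom src.comp_hom r[THEN representsD(1)]
    have "\<exists>h. lifts (Yg (s l)) (Zg (s l)) (\<epsilon>g (s l)) (\<eta>g (s l)) (Yg (s k)) (Zg (s k)) (\<epsilon>g (s k)) (\<eta>g (s k)) (cB (Yg (s l)) Y (Yg (s k)) (i k) (p l)) h"
      if "k < K" "m < K" "l < K" for k l m using that by (intro l) simp
    then obtain h where h: "\<And>k l. k < K \<Longrightarrow> l < K \<Longrightarrow> lifts (Yg (s l)) (Zg (s l)) (\<epsilon>g (s l)) (\<eta>g (s l)) (Yg (s k)) (Zg (s k)) (\<epsilon>g (s k)) (\<eta>g (s k)) (cB (Yg (s l)) Y (Yg (s k)) (i k) (p l)) (h k l)"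
      by metis
    have hh [simp]: "h k l \<in> Hom A (Zg (s l)) (Zg (s k))" if "k < K" "l < K" for k l using h[OF that] by (simp add: lifts_def)
    have "(\<Sum>l<K. cA (Zg (s m)) (Zg (s l)) (Zg (s k)) (h k l) (h l m)) = h k m" if km [simp]: "k < K" "m < K" for k m
    proof (rule lift_unique[OF r r])
      have 1: "lifts (Yg (s m)) (Zg (s m)) (\<epsilon>g (s m)) (\<eta>g (s m)) (Yg (s k)) (Zg (s k)) (\<epsilon>g (s k)) (\<eta>g (s k))
         (cB (Yg (s m)) (Yg (s l)) (Yg (s k)) (cB (Yg (s l)) Y (Yg (s k)) (i k) (p l)) (cB (Yg (s m)) Y (Yg (s l)) (i l) (p m)))
         (cA (Zg (s m)) (Zg (s l)) (Zg (s k)) (h k l) (h l m))" if [simp]: "l < K" for l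
        by (rule lift_comp[OF r r r _ _ _ _ _ h h]) auto
      \<comment> \<open>The middle factors \<open>p l i l\<close> add up to the identity of
        \<open>Y\<close>, so the matrix with entries \<open>i k p m\<close> is idempotent.\<close>
      have 2: "(\<Sum>l<K. cB (Yg (s m)) (Yg (s l)) (Yg (s k)) (cB (Yg (s l)) Y (Yg (s k)) (i k) (p l)) (cB (Yg (s m)) Y (Yg (s l)) (i l) (p m))) = cB (Yg (s m)) Y (Yg (s k)) (i k) (p m)" (is "sum ?c _ = _")
      proof -
        have "sum ?c {..<K} = (\<Sum>l<K. cB (Yg (s m)) Y (Yg (s k)) (i k) (cB (Yg (s m)) Y Y (cB Y (Yg (s l)) Y (p l) (i l)) (p m)))"
          by (rule sum_cong_lt) (simp_all add: tgt.assoc)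
        also have "\<dots> = cB (Yg (s m)) Y (Yg (s k)) (i k) (cB (Yg (s m)) Y Y (\<Sum>l<K. cB Y (Yg (s l)) Y (p l) (i l)) (p m))"
          by (simp add: suml sumr)
        finally show ?thesis by (simp add: pi tgt.id_left)
      qed
      show "lifts (Yg (s m)) (Zg (s m)) (\<epsilon>g (s m)) (\<eta>g (s m)) (Yg (s k)) (Zg (s k)) (\<epsilon>g (s k)) (\<eta>g (s k)) (cB (Yg (s m)) Y (Yg (s k)) (i k) (p m))
         (\<Sum>l<K. cA (Zg (s m)) (Zg (s l)) (Zg (s k)) (h k l) (h l m))"
        unfolding 2[symmetric] using 1 by (intro lift_sum[OF r r]) simp_all
      show "lifts (Yg (s m)) (Zg (s m)) (\<epsilon>g (s m)) (\<eta>g (s m)) (Yg (s k)) (Zg (s k)) (\<epsilon>g (s k)) (\<eta>g (s k)) (cB (Yg (s m)) Y (Yg (s k)) (i k) (p m)) (h k m)"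
        by (rule h) simp_all
    qed
    then have "\<exists>Z u d. Z \<in> Obj A \<and> (\<forall>k<K. u k \<in> Hom A Z (Zg (s k)) \<and> d k \<in> Hom A (Zg (s k)) Z) \<and>
        (\<Sum>k<K. cA Z (Zg (s k)) Z (d k) (u k)) = Idm A Z \<and> (\<forall>k<K. \<forall>l<K. cA (Zg (s l)) Z (Zg (s k)) (u k) (d l) = h k l)"
      by (intro split hh)
    then obtain Z u d where Z: "Z \<in> Obj A" "\<And>k. k < K \<Longrightarrow> u k \<in> Hom A Z (Zg (s k))" "\<And>k. k < K \<Longrightarrow> d k \<in> Hom A (Zg (s k)) Z"
      "(\<Sum>k<K. cA Z (Zg (s k)) Z (d k) (u k)) = Idm A Z" "\<And>k l. k < K \<Longrightarrow> l < K \<Longrightarrow> cA (Zg (s l)) Z (Zg (s k)) (u k) (d l) = h k l"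
      by blast
    show ?thesis
      using decomposed_from_splitting[where Yg = "\<lambda>k. Yg (s k)" and Zg = "\<lambda>k. Zg (s k)" and \<epsilon>g = "\<lambda>k. \<epsilon>g (s k)" and \<eta>g = "\<lambda>k. \<eta>g (s k)", OF Y Z(1) Yg r ip pi h Z(2-5)]
      by blast
  qed
  then obtain Z \<epsilon> \<eta> K s i p u d where dec: "\<And>Y. Y \<in> Obj B \<Longrightarrow> decomposed Y (Z Y) (\<epsilon> Y) (\<eta> Y) (K Y) (\<lambda>k. Yg (s Y k)) (\<lambda>k. Zg (s Y k)) (\<lambda>k. \<epsilon>g (s Y k)) (\<lambda>k. \<eta>g (s Y k)) (i Y) (p Y) (u Y) (d Y)"
    by metis
  have rep: "Y \<in> Obj B \<Longrightarrow> represents Y (Z Y) (\<epsilon> Y) (\<eta> Y)" for Y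
    by (rule decomposed_represents[OF dec])
  have "\<exists>h. lifts Y (Z Y) (\<epsilon> Y) (\<eta> Y) Y' (Z Y') (\<epsilon> Y') (\<eta> Y') g h" if o: "Y \<in> Obj B" "Y' \<in> Obj B" "g \<in> Hom B Y Y'" for Y Y' g
  proof (rule decomposed_lift[OF dec dec])
    fix k m assume "k < K Y'" "m < K Y"
    then show "\<exists>h. lifts (Yg (s Y m)) (Zg (s Y m)) (\<epsilon>g (s Y m)) (\<eta>g (s Y m)) (Yg (s Y' k)) (Zg (s Y' k)) (\<epsilon>g (s Y' k)) (\<eta>g (s Y' k))
        (cB (Yg (s Y m)) Y' (Yg (s Y' k)) (i Y' k) (cB (Yg (s Y m)) Y Y' g (p Y m))) h"
      using dec[OF o(1)] dec[OF o(2)] o Yg by (intro l tgt.comp_hom) (auto simp: decomposed_def)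
  qed (use o in auto)
  then obtain R where R: "adjunction A B F R" "adjunction B A R F" "fob R = Z"
    using adjoint_from_representations[of Z \<epsilon> \<eta>] rep by blast
  have "represents Y1 X (\<Sum>k<1::nat. cB (oF X) (Yg s1) Y1 p1 (cB (oF X) (oF (Zg s1)) (Yg s1) (\<epsilon>g s1) (mF X (Zg s1) u1)))
      (\<Sum>k<1::nat. cB Y1 (Yg s1) (oF X) (cB (Yg s1) (oF (Zg s1)) (oF X) (mF (Zg s1) X d1) (\<eta>g s1)) i1)"
    by (rule decomposed_represents, rule decomposed_from_splitting[where K = 1 and Yg = "\<lambda>_. Yg s1" and Zg = "\<lambda>_. Zg s1"
          and \<epsilon>g = "\<lambda>_. \<epsilon>g s1" and \<eta>g = "\<lambda>_. \<eta>g s1" and i = "\<lambda>_. i1" and p = "\<lambda>_. p1" and u = "\<lambda>_. u1" and d = "\<lambda>_. d1"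
          and h = "\<lambda>_ _. cA (Zg s1) X (Zg s1) u1 d1"]) (use Y1 X l1 Yg r in auto)
  then have "isomorphic A (fob R Y1) X" unfolding R(3) by (rule represents_unique[OF rep[OF Y1(1)] _ Y1(1)])
  then show ?thesis using R by blast
qed

end

section \<open>Kernels of G-diagrams\<close>

locale fin_group = group +
  assumes fin: "finite (carrier G)"
begin

text \<open>A configuration attaches a row and an element of \<open>G\<close> to every point; \<open>adm f z\<close> is the
  condition under which the matrix of \<open>F(f)\<close> has the entry \<open>1\<close> at \<open>z\<close>, but with arbitrary rows.\<close>

definition fits :: "'a labeled \<Rightarrow> (point \<Rightarrow> nat \<times> 'a) \<Rightarrow> bool" where
  "fits d z \<longleftrightarrow> (\<forall>c\<in>fst d. \<forall>p\<in>c. \<forall>q\<in>c. fst (z p) = fst (z q) \<and> inv (snd (z p)) \<otimes> snd (z q) = inv (snd d p) \<otimes> snd d q)"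

definition adm :: "'a gdiag \<Rightarrow> (point \<Rightarrow> nat \<times> 'a) \<Rightarrow> bool" where
  "adm f z \<longleftrightarrow> (\<exists>d\<in>f. fits d z)"

definition valid :: "nat \<Rightarrow> nat \<Rightarrow> (point \<Rightarrow> nat \<times> 'a) \<Rightarrow> bool" where
  "valid a b z \<longleftrightarrow> (\<forall>p\<in>points a b. snd (z p) \<in> carrier G)"

lemma validD: "valid a b z \<Longrightarrow> p \<in> points a b \<Longrightarrow> snd (z p) \<in> carrier G"
  by (simp add: valid_def)

lemma finite_points [simp]: "finite (points a b)"
  by (simp add: points_def)

lemma labeledD:
  assumes "(\<pi>, l) \<in> labeled G a b"
  shows "partition_on (points a b) \<pi>" "l \<in> points a b \<rightarrow>\<^sub>E carrier G"
  using assms by (auto simp: labeled_def)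

lemma labeled_block:
  assumes "d \<in> labeled G a b" "c \<in> fst d" "p \<in> c"
  shows "p \<in> points a b" "snd d p \<in> carrier G"
proof -
  show "p \<in> points a b" using assms by (auto simp: labeled_def partition_on_def)
  then show "snd d p \<in> carrier G" using assms by (auto simp: labeled_def)
qed

lemma equiv_diag_rel: "equiv (labeled G a b) (diag_rel G a b)"
proof (rule equivI)
  have lab: "l p \<in> carrier G" if "(\<pi>, l) \<in> labeled G a b" "c \<in> \<pi>" "p \<in> c" for \<pi> l c p
    using labeled_block[OF that(1), of c p] that by simp
  show "refl_on (labeled G a b) (diag_rel G a b)"
    using lab by (auto simp: refl_on_def diag_rel_def intro!: bexI[of _ \<one>])
  show "diag_rel G a b \<subseteq> labeled G a b \<times> labeled G a b" by (auto simp: diag_rel_def)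
  show "sym (diag_rel G a b)"
  proof (rule symI)
    fix d d' assume "(d, d') \<in> diag_rel G a b"
    then obtain \<pi> l l' where [simp]: "d = (\<pi>, l)" "d' = (\<pi>, l')" and L: "(\<pi>, l) \<in> labeled G a b" "(\<pi>, l') \<in> labeled G a b"
      and g: "\<And>c. c \<in> \<pi> \<Longrightarrow> \<exists>g\<in>carrier G. \<forall>p\<in>c. l' p = g \<otimes> l p" by (auto simp: diag_rel_def)
    have "\<exists>g\<in>carrier G. \<forall>p\<in>c. l p = g \<otimes> l' p" if c: "c \<in> \<pi>" for c
    proof -
      obtain g where "g \<in> carrier G" "\<forall>p\<in>c. l' p = g \<otimes> l p" using g[OF c] by blast
      then show ?thesis using lab[OF L(1) c] by (intro bexI[of _ "inv g"]) (auto simp: m_assoc[symmetric])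
    qed
    then show "(d', d) \<in> diag_rel G a b" using L by (simp add: diag_rel_def)
  qed
  show "trans (diag_rel G a b)"
  proof (rule transI)
    fix d d' d'' assume "(d, d') \<in> diag_rel G a b" "(d', d'') \<in> diag_rel G a b"
    then obtain \<pi> l l' l'' where [simp]: "d = (\<pi>, l)" "d' = (\<pi>, l')" "d'' = (\<pi>, l'')" and L: "(\<pi>, l) \<in> labeled G a b" "(\<pi>, l'') \<in> labeled G a b"
      and g: "\<And>c. c \<in> \<pi> \<Longrightarrow> \<exists>g\<in>carrier G. \<forall>p\<in>c. l' p = g \<otimes> l p" "\<And>c. c \<in> \<pi> \<Longrightarrow> \<exists>g\<in>carrier G. \<forall>p\<in>c. l'' p = g \<otimes> l' p"
      by (auto simp: diag_rel_def)
    have "\<exists>g\<in>carrier G. \<forall>p\<in>c. l'' p = g \<otimes> l p" if c: "c \<in> \<pi>" for c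
    proof -
      obtain g h where "g \<in> carrier G" "\<forall>p\<in>c. l' p = g \<otimes> l p" "h \<in> carrier G" "\<forall>p\<in>c. l'' p = h \<otimes> l' p" using g[OF c] by blast
      then show ?thesis using lab[OF L(1) c] by (intro bexI[of _ "h \<otimes> g"]) (auto simp: m_assoc)
    qed
    then show "(d, d'') \<in> diag_rel G a b" using L by (simp add: diag_rel_def)
  qed
qed

lemma finite_labeled: "finite (labeled G a b)"
proof (rule finite_subset)
  show "labeled G a b \<subseteq> Pow (Pow (points a b)) \<times> (points a b \<rightarrow>\<^sub>E carrier G)"
    by (auto simp: labeled_def partition_on_def)
  show "finite (Pow (Pow (points a b)) \<times> (points a b \<rightarrow>\<^sub>E carrier G))"
    by (simp add: finite_PiE fin)
qed

lemma finite_P [simp]: "finite (P G a b)"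
proof (rule finite_subset)
  show "P G a b \<subseteq> Pow (labeled G a b)"
    unfolding P_def quotient_def diag_rel_def by auto
qed (simp add: finite_labeled)

lemma diag_in_P: "d \<in> labeled G a b \<Longrightarrow> diag G a b d \<in> P G a b"
  by (auto simp: P_def diag_def intro: quotientI)

lemma diag_self: "d \<in> labeled G a b \<Longrightarrow> d \<in> diag G a b d"
  using equiv_class_self[OF equiv_diag_rel] by (simp add: diag_def)

lemma P_diag: "f \<in> P G a b \<Longrightarrow> d \<in> f \<Longrightarrow> f = diag G a b d"
proof -
  assume "f \<in> P G a b" and d: "d \<in> f"
  then obtain d0 where f: "f = diag_rel G a b `` {d0}" unfolding P_def by (auto elim: quotientE)
  then have "(d0, d) \<in> diag_rel G a b" using d by simp
  then show ?thesis unfolding f diag_def by (rule equiv_class_eq[OF equiv_diag_rel])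
qed

lemma P_labeled: "f \<in> P G a b \<Longrightarrow> d \<in> f \<Longrightarrow> d \<in> labeled G a b"
  using equiv_diag_rel by (auto simp: P_def quotient_def diag_rel_def)

lemma P_nonempty: "f \<in> P G a b \<Longrightarrow> \<exists>d. d \<in> f"
  unfolding P_def quotient_def using equiv_class_self[OF equiv_diag_rel] by blast

lemma diag_mem: "d' \<in> diag G a b d \<longleftrightarrow> (d, d') \<in> diag_rel G a b"
  by (simp add: diag_def)

lemma inv_mult_cancel: "g \<in> carrier G \<Longrightarrow> x \<in> carrier G \<Longrightarrow> y \<in> carrier G \<Longrightarrow> inv (g \<otimes> x) \<otimes> (g \<otimes> y) = inv x \<otimes> y"
proof -
  assume [simp]: "g \<in> carrier G" "x \<in> carrier G" "y \<in> carrier G"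
  have "inv g \<otimes> (g \<otimes> y) = y" by (simp add: m_assoc[symmetric])
  then show ?thesis by (simp add: inv_mult_group m_assoc)
qed

text \<open>A common left factor cancels in \<open>inv (l p) \<otimes> l q\<close>.\<close>

lemma fits_rel:
  assumes "(d, d') \<in> diag_rel G a b"
  shows "fits d z \<longleftrightarrow> fits d' z"
proof -
  obtain \<pi> l l' where [simp]: "d = (\<pi>, l)" "d' = (\<pi>, l')" and L: "(\<pi>, l) \<in> labeled G a b" "(\<pi>, l') \<in> labeled G a b"
    and g: "\<And>c. c \<in> \<pi> \<Longrightarrow> \<exists>g\<in>carrier G. \<forall>p\<in>c. l' p = g \<otimes> l p" using assms by (auto simp: diag_rel_def)
  have "inv (l' p) \<otimes> l' q = inv (l p) \<otimes> l q" if c: "c \<in> \<pi>" "p \<in> c" "q \<in> c" for c p q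
    using g[OF c(1)] c labeled_block(2)[OF L(1), of c] by (auto simp: inv_mult_cancel)
  then show ?thesis by (simp add: fits_def)
qed

lemma adm_fits: "f \<in> P G a b \<Longrightarrow> d \<in> f \<Longrightarrow> adm f z \<longleftrightarrow> fits d z"
  using fits_rel P_diag diag_mem by (metis adm_def)

lemma adm_diag: "d \<in> labeled G a b \<Longrightarrow> adm (diag G a b d) z \<longleftrightarrow> fits d z"
  using adm_fits[OF diag_in_P diag_self] by blast

lemma adm_cong:
  assumes f: "f \<in> P G a b" and z: "\<And>p. p \<in> points a b \<Longrightarrow> z p = z' p"
  shows "adm f z \<longleftrightarrow> adm f z'"
proof -
  obtain d where d: "d \<in> f" using P_nonempty[OF f] by blast
  have "fits d z \<longleftrightarrow> fits d z'"
    unfolding fits_def using labeled_block(1)[OF P_labeled[OF f d]] z by (intro ball_cong refl) auto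
  then show ?thesis using adm_fits[OF f d] by simp
qed

definition relab :: "nat \<Rightarrow> nat \<Rightarrow> (point \<Rightarrow> nat \<times> 'a) \<Rightarrow> point \<Rightarrow> 'a" where
  "relab a b z = (\<lambda>p\<in>points a b. snd (z p))"

text \<open>On a component, the quotients of labels determine the labelling up to a left factor. So
  the group elements of a fitting configuration are themselves a labelling of the diagram; the
  factor is read off at any point \<open>p0\<close> of the component.\<close>

lemma fits_relab:
  assumes d: "(\<pi>, l) \<in> labeled G a b" and f: "fits (\<pi>, l) z" and v: "valid a b z"
  shows "((\<pi>, l), (\<pi>, relab a b z)) \<in> diag_rel G a b"
proof -
  have part: "partition_on (points a b) \<pi>" using labeledD[OF d] by blast
  have "\<exists>g\<in>carrier G. \<forall>p\<in>c. relab a b z p = g \<otimes> l p" if c: "c \<in> \<pi>" for c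
  proof -
    obtain p0 where p0: "p0 \<in> c" using c part unfolding partition_on_def by (metis ex_in_conv)
    have lp: "p \<in> points a b \<and> l p \<in> carrier G \<and> snd (z p) \<in> carrier G" if "p \<in> c" for p
      using labeled_block[OF d, of c p] c that v by (auto simp: valid_def)
    have e: "snd (z p) = (snd (z p0) \<otimes> inv (l p0)) \<otimes> l p" if p: "p \<in> c" for p
    proof -
      have "inv (snd (z p0)) \<otimes> snd (z p) = inv (l p0) \<otimes> l p" using f c p0 p by (auto simp: fits_def)
      then have "snd (z p) = snd (z p0) \<otimes> (inv (l p0) \<otimes> l p)" using lp[OF p0] lp[OF p] by (metis inv_closed inv_solve_left m_closed)
      then show ?thesis using lp[OF p0] lp[OF p] by (simp add: m_assoc)
    qed
    show ?thesis
    proof (intro bexI[of _ "snd (z p0) \<otimes> inv (l p0)"] ballI)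
      fix p assume p: "p \<in> c"
      show "relab a b z p = snd (z p0) \<otimes> inv (l p0) \<otimes> l p" using lp[OF p] by (simp only: relab_def e[OF p, symmetric]) simp
    qed (use lp[OF p0] in simp)
  qed
  moreover have "(\<pi>, relab a b z) \<in> labeled G a b" using part v by (auto simp: labeled_def relab_def valid_def)
  ultimately show ?thesis using d by (auto simp: diag_rel_def)
qed

section \<open>The type of a configuration\<close>

definition rowpart :: "nat \<Rightarrow> nat \<Rightarrow> (point \<Rightarrow> nat \<times> 'a) \<Rightarrow> point set set" where
  "rowpart a b z = (\<lambda>p. {q\<in>points a b. fst (z q) = fst (z p)}) ` points a b"

text \<open>The coarsest diagram that admits \<open>z\<close> (see \<open>adm_ty\<close>): all
  points in the same row are joined, and the labels are the group elements of
  \<open>z\<close>.\<close>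

definition ty :: "nat \<Rightarrow> nat \<Rightarrow> (point \<Rightarrow> nat \<times> 'a) \<Rightarrow> 'a gdiag" where
  "ty a b z = diag G a b (rowpart a b z, relab a b z)"

lemma rowpart_partition: "partition_on (points a b) (rowpart a b z)"
  by (rule partition_onI) (auto simp: rowpart_def disjnt_def)

lemma ty_labeled: "valid a b z \<Longrightarrow> (rowpart a b z, relab a b z) \<in> labeled G a b"
  using rowpart_partition by (auto simp: labeled_def relab_def valid_def)

lemma ty_in_P: "valid a b z \<Longrightarrow> ty a b z \<in> P G a b"
  by (simp add: ty_def diag_in_P ty_labeled)

lemma ty_mem: "valid a b z \<Longrightarrow> (rowpart a b z, relab a b z) \<in> ty a b z"
  by (simp add: ty_def diag_self ty_labeled)

lemma fits_ty: "fits (rowpart a b z, relab a b z) z' \<longleftrightarrow>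
    (\<forall>p\<in>points a b. \<forall>q\<in>points a b. fst (z p) = fst (z q) \<longrightarrow>
      fst (z' p) = fst (z' q) \<and> inv (snd (z' p)) \<otimes> snd (z' q) = inv (snd (z p)) \<otimes> snd (z q))"
    (is "?l \<longleftrightarrow> ?r")
proof
  assume l: ?l
  show ?r
  proof (intro ballI impI)
    fix p q assume p: "p \<in> points a b" "q \<in> points a b" "fst (z p) = fst (z q)"
    let ?c = "{x\<in>points a b. fst (z x) = fst (z p)}"
    have "?c \<in> rowpart a b z" "p \<in> ?c" "q \<in> ?c" using p by (auto simp: rowpart_def)
    then have "fst (z' p) = fst (z' q) \<and> inv (snd (z' p)) \<otimes> snd (z' q) = inv (relab a b z p) \<otimes> relab a b z q"
      using l[unfolded fits_def fst_conv snd_conv, rule_format, of ?c p q] by blast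
    then show "fst (z' p) = fst (z' q) \<and> inv (snd (z' p)) \<otimes> snd (z' q) = inv (snd (z p)) \<otimes> snd (z q)"
      using p by (simp add: relab_def)
  qed
next
  assume r: ?r
  show ?l
    unfolding fits_def
  proof (intro ballI)
    fix c p q assume "c \<in> fst (rowpart a b z, relab a b z)" "p \<in> c" "q \<in> c"
    then have p: "p \<in> points a b" "q \<in> points a b" "fst (z p) = fst (z q)" by (auto simp: rowpart_def)
    show "fst (z' p) = fst (z' q) \<and> inv (snd (z' p)) \<otimes> snd (z' q) = inv (snd (rowpart a b z, relab a b z) p) \<otimes> snd (rowpart a b z, relab a b z) q"
      using r[rule_format, OF p] p by (simp add: relab_def)
  qed
qed

lemma refines_rowpart:
  assumes d: "(\<pi>, l) \<in> labeled G a b" and f: "fits (\<pi>, l) z"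
  shows "refines (points a b) \<pi> (rowpart a b z)"
  unfolding refines_def
proof (intro conjI rowpart_partition ballI)
  show part: "partition_on (points a b) \<pi>" using labeledD[OF d] by blast
  fix c assume c: "c \<in> \<pi>"
  then obtain p where p: "p \<in> c" using part unfolding partition_on_def by (metis ex_in_conv)
  have "c \<subseteq> {q\<in>points a b. fst (z q) = fst (z p)}"
  proof
    fix q assume q: "q \<in> c"
    then have "fst (z q) = fst (z p)" using f c p unfolding fits_def fst_conv by blast
    then show "q \<in> {q\<in>points a b. fst (z q) = fst (z p)}" using labeled_block(1)[OF d, of c q] c q by simp
  qed
  then show "\<exists>Y\<in>rowpart a b z. c \<subseteq> Y"
    using labeled_block(1)[OF d, of c p] c p by (auto simp: rowpart_def)
qed

text \<open>If \<open>f\<close> admits \<open>z\<close>, its components lie in single rows and may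
  be labelled by \<open>z\<close> itself, so \<open>ty a b z\<close> coarsens \<open>f\<close>. The
  matrix of admissibility of diagrams against types is thus unitriangular for coarsening.\<close>

lemma adm_ty:
  assumes f: "f \<in> P G a b" and v: "valid a b z"
  shows "adm f z \<longleftrightarrow> ty a b z = f \<or> proper_coarsening G a b (ty a b z) f"
proof
  assume "adm f z"
  then obtain \<pi> l where d: "(\<pi>, l) \<in> f" and fi: "fits (\<pi>, l) z" by (auto simp: adm_def)
  note L = P_labeled[OF f d]
  have m: "(\<pi>, relab a b z) \<in> f" using fits_relab[OF L fi v] P_diag[OF f d] by (simp add: diag_mem)
  show "ty a b z = f \<or> proper_coarsening G a b (ty a b z) f"
  proof (cases "\<pi> = rowpart a b z")
    case True
    then have "f = ty a b z" using P_diag[OF f m] by (simp add: ty_def)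
    then show ?thesis by simp
  next
    case False
    have "proper_coarsening G a b (ty a b z) f"
      unfolding proper_coarsening_def
      by (intro conjI f ty_in_P[OF v] bexI[OF _ m]) (use ty_mem[OF v] False refines_rowpart[OF L fi] in auto)
    then show ?thesis ..
  qed
next
  assume "ty a b z = f \<or> proper_coarsening G a b (ty a b z) f"
  then show "adm f z"
  proof
    assume "ty a b z = f"
    then show ?thesis using ty_mem[OF v] fits_ty[of a b z z] by (auto simp: adm_def)
  next
    assume "proper_coarsening G a b (ty a b z) f"
    then obtain \<pi> l \<pi>' where m: "(\<pi>, l) \<in> f" "(\<pi>', l) \<in> ty a b z" and r: "refines (points a b) \<pi> \<pi>'"
      by (auto simp: proper_coarsening_def)
    have "adm (ty a b z) z" using ty_mem[OF v] fits_ty[of a b z z] by (auto simp: adm_def)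
    then have "fits (\<pi>', l) z" using adm_fits[OF ty_in_P[OF v] m(2)] by simp
    have "\<exists>c'\<in>\<pi>'. c \<subseteq> c'" if "c \<in> \<pi>" for c using r that by (auto simp: refines_def)
    then have "fits (\<pi>, l) z" using \<open>fits (\<pi>', l) z\<close> unfolding fits_def fst_conv snd_conv by (meson subsetD)
    then show ?thesis using m by (auto simp: adm_def)
  qed
qed

text \<open>If the types agree, each is admissible for both configurations, which compares rows in
  both directions. Below, types are always compared in this form: the pattern of equal rows and the
  quotients of group elements within rows.\<close>

lemma ty_eq_iff:
  assumes v: "valid a b z" "valid a b z'"
  shows "ty a b z = ty a b z' \<longleftrightarrow> (\<forall>p\<in>points a b. \<forall>q\<in>points a b. (fst (z p) = fst (z q) \<longleftrightarrow> fst (z' p) = fst (z' q)) \<and>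
     (fst (z p) = fst (z q) \<longrightarrow> inv (snd (z p)) \<otimes> snd (z q) = inv (snd (z' p)) \<otimes> snd (z' q)))"
proof
  assume e: "ty a b z = ty a b z'"
  have "adm (ty a b z) z" "adm (ty a b z') z'" using v by (simp_all add: adm_ty[OF ty_in_P])
  then have "fits (rowpart a b z', relab a b z') z" "fits (rowpart a b z, relab a b z) z'"
    using e adm_fits[OF ty_in_P[OF v(1)] ty_mem[OF v(1)]] adm_fits[OF ty_in_P[OF v(2)] ty_mem[OF v(2)]] by auto
  then show "\<forall>p\<in>points a b. \<forall>q\<in>points a b. (fst (z p) = fst (z q) \<longleftrightarrow> fst (z' p) = fst (z' q)) \<and>
     (fst (z p) = fst (z q) \<longrightarrow> inv (snd (z p)) \<otimes> snd (z q) = inv (snd (z' p)) \<otimes> snd (z' q))"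
    unfolding fits_ty by metis
next
  assume h: "\<forall>p\<in>points a b. \<forall>q\<in>points a b. (fst (z p) = fst (z q) \<longleftrightarrow> fst (z' p) = fst (z' q)) \<and>
     (fst (z p) = fst (z q) \<longrightarrow> inv (snd (z p)) \<otimes> snd (z q) = inv (snd (z' p)) \<otimes> snd (z' q))"
  then have "fits (rowpart a b z, relab a b z) z'" unfolding fits_ty by metis
  from fits_relab[OF ty_labeled[OF v(1)] this v(2)]
  have 1: "((rowpart a b z, relab a b z), (rowpart a b z, relab a b z')) \<in> diag_rel G a b" .
  have "rowpart a b z = rowpart a b z'" unfolding rowpart_def using h by (intro image_cong refl) auto
  then show "ty a b z = ty a b z'" using equiv_class_eq[OF equiv_diag_rel 1] by (simp add: ty_def diag_def)
qed

text \<open>An injective numbering of \<open>points a b\<close> by the numbers up to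
  \<open>a + b\<close>, from which rows are taken.\<close>

primrec code :: "nat \<Rightarrow> point \<Rightarrow> nat" where
  "code a (Up i) = i" | "code a (Lo j) = a + j" | "code a (Mid j) = 0"

text \<open>Every component gets a row of its own, \<open>r\<close> plus the number of one of its
  points, and the labels serve as group elements. The offset \<open>r\<close> keeps the first rows
  free; it will be \<open>n\<close> where these are reserved for the representations.\<close>

lemma ty_surj:
  assumes f: "f \<in> P G a b"
  shows "\<exists>z. valid a b z \<and> (\<forall>p\<in>points a b. fst (z p) \<in> {r<..r + a + b}) \<and> ty a b z = f"
proof -
  obtain \<pi> l where d: "(\<pi>, l) \<in> f" using P_nonempty[OF f] by auto
  note L = P_labeled[OF f d]
  have part: "partition_on (points a b) \<pi>" and lp: "l \<in> points a b \<rightarrow>\<^sub>E carrier G" using labeledD[OF L] by auto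
  define blk where "blk p = (THE c. c \<in> \<pi> \<and> p \<in> c)" for p
  have blk: "blk p = c" if "c \<in> \<pi>" "p \<in> c" for c p
    unfolding blk_def by (rule the_equality) (use that part in \<open>auto simp: partition_on_def disjoint_def\<close>)
  have blk': "blk p \<in> \<pi> \<and> p \<in> blk p" if "p \<in> points a b" for p
  proof -
    have "p \<in> \<Union>\<pi>" using that part by (auto simp: partition_on_def)
    then obtain c where "c \<in> \<pi>" "p \<in> c" by blast
    then show ?thesis using blk by simp
  qed
  define h where "h c = (SOME p. p \<in> c)" for c :: "point set"
  have h: "h c \<in> c" if "c \<in> \<pi>" for c
    unfolding h_def using that part by (auto simp: partition_on_def some_in_eq)
  have hp: "h c \<in> points a b" if "c \<in> \<pi>" for c using h[OF that] that part by (auto simp: partition_on_def)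
  have cinj: "p = q" if "code a p = code a q" "p \<in> points a b" "q \<in> points a b" for p q
    using that by (auto simp: points_def)
  define z where "z p = (r + code a (h (blk p)), l p)" for p
  have row: "fst (z p) = fst (z q) \<longleftrightarrow> blk p = blk q" if "p \<in> points a b" "q \<in> points a b" for p q
  proof
    note b = blk'[OF that(1), THEN conjunct1] blk'[OF that(2), THEN conjunct1]
    assume "fst (z p) = fst (z q)"
    then have "code a (h (blk p)) = code a (h (blk q))" by (simp add: z_def)
    then have "h (blk p) = h (blk q)" by (rule cinj[OF _ hp[OF b(1)] hp[OF b(2)]])
    then show "blk p = blk q" by (metis blk[OF b(1) h[OF b(1)]] blk[OF b(2) h[OF b(2)]])
  qed (simp add: z_def)
  have v: "valid a b z" using lp by (auto simp: valid_def z_def)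
  have rr: "fst (z p) \<in> {r<..r + a + b}" if "p \<in> points a b" for p
  proof -
    have "0 < code a q \<and> code a q \<le> a + b" if "q \<in> points a b" for q using that by (auto simp: points_def)
    from this[OF hp[OF blk'[OF that, THEN conjunct1]]] show ?thesis by (simp add: z_def)
  qed
  have "rowpart a b z = \<pi>"
  proof
    have e: "{q\<in>points a b. fst (z q) = fst (z p)} = blk p" if p: "p \<in> points a b" for p
    proof -
      have "{q\<in>points a b. fst (z q) = fst (z p)} = {q\<in>points a b. blk q = blk p}" using row p by blast
      also have "\<dots> = blk p"
      proof
        show "{q\<in>points a b. blk q = blk p} \<subseteq> blk p" using blk' by blast
        show "blk p \<subseteq> {q\<in>points a b. blk q = blk p}"
        proof
          fix q assume q: "q \<in> blk p"
          have "q \<in> \<Union>\<pi>" using q blk'[OF p] by blast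
          then have "q \<in> points a b" using part unfolding partition_on_def by blast
          then show "q \<in> {q\<in>points a b. blk q = blk p}" using blk[OF _ q] blk'[OF p] by simp
        qed
      qed
      finally show ?thesis .
    qed
    then show "rowpart a b z \<subseteq> \<pi>" using blk' by (auto simp: rowpart_def)
    show "\<pi> \<subseteq> rowpart a b z"
    proof
      fix c assume c: "c \<in> \<pi>"
      have "c = {q\<in>points a b. fst (z q) = fst (z (h c))}" using e[OF hp[OF c]] blk[OF c h[OF c]] by simp
      then show "c \<in> rowpart a b z" unfolding rowpart_def using hp[OF c] by (rule image_eqI)
    qed
  qed
  moreover have "relab a b z = l" using lp by (auto simp: relab_def z_def fun_eq_iff PiE_def extensional_def)
  ultimately have "ty a b z = f" using P_diag[OF f d] by (simp add: ty_def)
  then show ?thesis using v rr by blast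
qed

section \<open>Kernels and Moebius inversion\<close>

definition ker :: "nat \<Rightarrow> nat \<Rightarrow> ('a gdiag \<Rightarrow> 'k::field_char_0) \<Rightarrow> (point \<Rightarrow> nat \<times> 'a) \<Rightarrow> 'k" where
  "ker a b u z = (\<Sum>f\<in>P G a b. u f * of_bool (adm f z))"

lemma ker_add: "ker a b (u + v) z = ker a b u z + ker a b v z"
  by (simp add: ker_def plus_fun_apply algebra_simps sum.distrib)

lemma ker_diff: "ker a b (u - v) z = ker a b u z - ker a b v z"
  by (simp add: ker_def algebra_simps sum_subtractf)

lemma ker_zero: "ker a b 0 z = 0"
  by (simp add: ker_def zero_fun_apply)

lemma ker_smul: "ker a b (smul c u) z = c * ker a b u z"
  unfolding ker_def sum_distrib_left by (rule sum.cong) (simp_all add: smul_apply)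

lemma ker_sum: "ker a b (\<Sum>i\<in>I. u i) z = (\<Sum>i\<in>I. ker a b (u i) z)"
  by (induction I rule: infinite_finite_induct) (auto simp: ker_zero ker_add)

lemma ker_basis: "f \<in> P G a b \<Longrightarrow> ker a b (basis f) z = of_bool (adm f z)"
  by (simp add: ker_def basis_def sum.delta if_distrib[of "\<lambda>x. x * _"] cong: if_cong)

lemma ker_cong: "(\<And>p. p \<in> points a b \<Longrightarrow> z p = z' p) \<Longrightarrow> ker a b u z = ker a b u z'"
  unfolding ker_def by (intro sum.cong refl arg_cong2[where f = "(*)"] arg_cong[where f = of_bool] adm_cong) auto

lemma finite_coarsenings: "finite {f'. proper_coarsening G a b f' f}"
  by (rule finite_subset[of _ "P G a b"]) (auto simp: proper_coarsening_def)

text \<open>Moebius inversion: by \<open>adm_ty\<close> the kernel of \<open>f\<close> is the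
  indicator of the configurations whose type is \<open>f\<close> or a proper coarsening of
  \<open>f\<close>, and the recursion subtracts the coarsenings. So the \<open>x(f)\<close> are dual
  to the types.\<close>

lemma xdiag_props:
  assumes "f \<in> P G a b"
  shows "(\<forall>z. valid a b z \<longrightarrow> ker a b (xdiag TYPE('k::field_char_0) G a b f) z = of_bool (ty a b z = f)) \<and>
    (\<forall>h. h \<notin> P G a b \<longrightarrow> xdiag TYPE('k) G a b f h = 0)"
  using assms
proof (induction "card (comps f)" arbitrary: f rule: less_induct)
  case less
  let ?S = "{f'. proper_coarsening G a b f' f}"
  have IH: "f' \<in> ?S \<Longrightarrow> (\<forall>z. valid a b z \<longrightarrow> ker a b (xdiag TYPE('k) G a b f') z = of_bool (ty a b z = f')) \<and>
    (\<forall>h. h \<notin> P G a b \<longrightarrow> xdiag TYPE('k) G a b f' h = 0)" for f'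
    by (rule less.hyps) (simp_all add: proper_coarsening_card, simp add: proper_coarsening_def)
  show ?case
  proof (intro conjI allI impI)
    fix z assume v: "valid a b z"
    have "ker a b (xdiag TYPE('k) G a b f) z = of_bool (adm f z) - (\<Sum>f'\<in>?S. of_bool (ty a b z = f'))"
      using IH v less.prems by (subst xdiag.simps) (simp add: ker_diff ker_basis ker_sum)
    also have "(\<Sum>f'\<in>?S. of_bool (ty a b z = f') :: 'k) = of_bool (proper_coarsening G a b (ty a b z) f)"
      using finite_coarsenings by (simp add: of_bool_def sum.delta)
    also have "of_bool (adm f z) - of_bool (proper_coarsening G a b (ty a b z) f) = (of_bool (ty a b z = f) :: 'k)"
      using proper_coarsening_card[of G a b f f] by (auto simp: adm_ty[OF less.prems v])
    finally show "ker a b (xdiag TYPE('k) G a b f) z = of_bool (ty a b z = f)" .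
  next
    fix h assume "h \<notin> P G a b"
    then show "xdiag TYPE('k) G a b f h = 0"
      using IH less.prems by (subst xdiag.simps) (auto simp: basis_def sum_fun_apply)
  qed
qed

lemmas ker_xdiag = xdiag_props[THEN conjunct1, rule_format]
lemmas xdiag_support = xdiag_props[THEN conjunct2, rule_format]

lemma Gcat_sel [simp]: "Obj (Gcat G t) = UNIV" "Idm (Gcat G t) a = basis (id_diag G a)" "Unit (Gcat G t) = 0"
  by (simp_all add: Gcat_def)

lemma Gcat_hom: "u \<in> Hom (Gcat G t) a b \<longleftrightarrow> (\<forall>f. f \<notin> P G a b \<longrightarrow> u f = 0)"
  by (simp add: Gcat_def)

text \<open>The elements \<open>x(f)\<close> have the indicators of the types as kernels, so any
  function of the type is the kernel of a combination of them. Morphisms will be constructed by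
  writing down such functions.\<close>

lemma ker_exists:
  fixes T :: "(point \<Rightarrow> nat \<times> 'a) \<Rightarrow> 'k::field_char_0" and t :: 'k
  assumes inv: "\<And>z z'. valid a b z \<Longrightarrow> valid a b z' \<Longrightarrow> ty a b z = ty a b z' \<Longrightarrow> T z = T z'"
  shows "\<exists>u. u \<in> Hom (Gcat G t) a b \<and> (\<forall>z. valid a b z \<longrightarrow> ker a b u z = T z)"
proof -
  have "\<exists>zf. \<forall>f\<in>P G a b. valid a b (zf f) \<and> ty a b (zf f) = f" by (rule bchoice) (use ty_surj in blast)
  then obtain zf where zf: "\<And>f. f \<in> P G a b \<Longrightarrow> valid a b (zf f) \<and> ty a b (zf f) = f" by blast
  define u where "u = (\<Sum>f\<in>P G a b. smul (T (zf f)) (xdiag TYPE('k) G a b f))"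
  have "ker a b u z = T z" if v: "valid a b z" for z
  proof -
    have "ker a b u z = (\<Sum>f\<in>P G a b. if ty a b z = f then T (zf f) else 0)"
      unfolding u_def ker_sum by (rule sum.cong) (auto simp: ker_smul ker_xdiag v)
    also have "\<dots> = T (zf (ty a b z))" using ty_in_P[OF v] by (simp add: sum.delta)
    also have "\<dots> = T z" using zf[OF ty_in_P[OF v]] v by (intro inv) auto
    finally show ?thesis .
  qed
  moreover have "u \<in> Hom (Gcat G t) a b"
    unfolding Gcat_hom u_def by (auto simp: sum_fun_apply smul_apply xdiag_support)
  ultimately show ?thesis by blast
qed

text \<open>Triangularity: take \<open>f\<close> in the support with the most components and a
  configuration of type \<open>f\<close>. Any other diagram admitting it has \<open>f\<close> as a
  proper coarsening, hence more components, and coefficient \<open>0\<close>. A window of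
  \<open>a + b\<close> rows above \<open>r\<close> contains such a configuration.\<close>

lemma ker_inj0:
  fixes u :: "'a gdiag \<Rightarrow> 'k::field_char_0"
  assumes u: "u \<in> Hom (Gcat G t) a b"
    and z: "\<And>z. valid a b z \<Longrightarrow> (\<And>p. p \<in> points a b \<Longrightarrow> fst (z p) \<in> {r<..r + a + b}) \<Longrightarrow> ker a b u z = 0"
  shows "u = 0"
proof (rule ccontr)
  assume "u \<noteq> 0"
  then obtain f0 where "u f0 \<noteq> 0" by (auto simp: fun_eq_iff zero_fun_apply)
  then have ne: "{f. u f \<noteq> 0} \<noteq> {}" by blast
  have sub: "{f. u f \<noteq> 0} \<subseteq> P G a b" using u by (auto simp: Gcat_hom)
  have fin: "finite {f. u f \<noteq> 0}" by (rule finite_subset[OF sub]) simp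
  obtain f where f: "u f \<noteq> 0" and mx: "\<And>f'. u f' \<noteq> 0 \<Longrightarrow> card (comps f') \<le> card (comps f)"
    using obtains_MAX[OF fin ne, of "\<lambda>f. card (comps f)"] Max_ge[of "(\<lambda>f. card (comps f)) ` {f. u f \<noteq> 0}"] fin
    by (metis (mono_tags, lifting) finite_imageI imageI mem_Collect_eq)
  have fP: "f \<in> P G a b" using f sub by auto
  obtain z0 where z0: "valid a b z0" "\<forall>p\<in>points a b. fst (z0 p) \<in> {r<..r + a + b}" "ty a b z0 = f" using ty_surj[OF fP] by blast
  have "ker a b u z0 = (\<Sum>f'\<in>P G a b. if f' = f then u f else 0)"
    unfolding ker_def
  proof (rule sum.cong[OF refl])
    fix f' assume f': "f' \<in> P G a b"
    have "u f' = 0" if "proper_coarsening G a b f f'" using proper_coarsening_card[OF that] mx[of f'] by (meson not_le)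
    then show "u f' * of_bool (adm f' z0) = (if f' = f then u f else 0)"
      using adm_ty[OF f' z0(1)] z0(3) by auto
  qed
  also have "\<dots> = u f" using fP by (simp add: sum.delta)
  finally show False using z[OF z0(1)] z0(2) f by simp
qed

lemma ker_inj:
  fixes u :: "'a gdiag \<Rightarrow> 'k::field_char_0"
  assumes u: "u \<in> Hom (Gcat G t) a b" "v \<in> Hom (Gcat G t) a b"
    and z: "\<And>z. valid a b z \<Longrightarrow> (\<And>p. p \<in> points a b \<Longrightarrow> fst (z p) \<in> {r<..r + a + b}) \<Longrightarrow> ker a b u z = ker a b v z"
  shows "u = v"
proof -
  have "u - v = 0"
    by (rule ker_inj0[where r = r and t = t and a = a and b = b]) (use u z in \<open>auto simp: Gcat_hom ker_diff\<close>)
  then show ?thesis by simp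
qed

end

subsection \<open>Composition of diagrams as matrix multiplication\<close>

context fin_group
begin

definition jn :: "(nat \<Rightarrow> nat \<times> 'a) \<Rightarrow> (nat \<Rightarrow> nat \<times> 'a) \<Rightarrow> point \<Rightarrow> nat \<times> 'a" where
  "jn x y p = (case p of Up i \<Rightarrow> x i | Lo j \<Rightarrow> y j | Mid _ \<Rightarrow> undefined)"

lemma jn_simps [simp]: "jn x y (Up i) = x i" "jn x y (Lo j) = y j"
  by (simp_all add: jn_def)

lemma ker_jn: "ker a b u z = ker a b u (jn (\<lambda>i. z (Up i)) (\<lambda>j. z (Lo j)))"
  by (rule ker_cong) (auto simp: points_def)

definition val1 :: "nat \<Rightarrow> (nat \<Rightarrow> nat \<times> 'a) \<Rightarrow> bool" where
  "val1 a x \<longleftrightarrow> (\<forall>i\<in>{1..a}. snd (x i) \<in> carrier G)"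

lemma points_ball: "(\<forall>p\<in>points a b. Q p) \<longleftrightarrow> (\<forall>i\<in>{1..a}. Q (Up i)) \<and> (\<forall>j\<in>{1..b}. Q (Lo j))"
  by (auto simp: points_def)

lemma valid_jn: "valid a b (jn x y) \<longleftrightarrow> val1 a x \<and> val1 b y"
  by (simp add: valid_def val1_def points_ball)

text \<open>Extensional functions, so that sums over \<open>conf\<close> count each tuple
  once.\<close>

definition conf :: "nat set \<Rightarrow> nat \<Rightarrow> (nat \<Rightarrow> nat \<times> 'a) set" where
  "conf R a = {1..a} \<rightarrow>\<^sub>E (R \<times> carrier G)"

lemma conf_mem: "x \<in> conf R a \<Longrightarrow> i \<in> {1..a} \<Longrightarrow> fst (x i) \<in> R \<and> snd (x i) \<in> carrier G"
  unfolding conf_def by (drule PiE_mem) (auto simp: mem_Times_iff)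

lemma conf_val1: "x \<in> conf R a \<Longrightarrow> val1 a x"
  using conf_mem by (auto simp: val1_def)

lemma finite_conf: "finite R \<Longrightarrow> finite (conf R a)"
  by (auto simp: conf_def intro!: finite_PiE fin)

definition points3 :: "nat \<Rightarrow> nat \<Rightarrow> nat \<Rightarrow> point set" where
  "points3 a b c = Up ` {1..a} \<union> Mid ` {1..b} \<union> Lo ` {1..c}"

definition tri :: "(nat \<Rightarrow> 'c) \<Rightarrow> (nat \<Rightarrow> 'c) \<Rightarrow> (nat \<Rightarrow> 'c) \<Rightarrow> point \<Rightarrow> 'c" where
  "tri x y w p = (case p of Up i \<Rightarrow> x i | Mid j \<Rightarrow> y j | Lo k \<Rightarrow> w k)"

lemma tri_simps [simp]: "tri x y w (Up i) = x i" "tri x y w (Mid j) = y j" "tri x y w (Lo k) = w k"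
  by (simp_all add: tri_def)

lemma finer_class:
  assumes S: "\<Union>S = A" "{} \<notin> S"
  defines "r \<equiv> {(p, q). \<exists>c\<in>S. p \<in> c \<and> q \<in> c}\<^sup>+"
  shows "equiv A r" "c \<in> S \<Longrightarrow> p \<in> c \<Longrightarrow> q \<in> c \<Longrightarrow> (p, q) \<in> r"
proof -
  have sub: "{(p, q). \<exists>c\<in>S. p \<in> c \<and> q \<in> c} \<subseteq> A \<times> A" using S by auto
  have rA: "r \<subseteq> A \<times> A" unfolding r_def by (rule trancl_subset_Sigma[OF sub])
  show 1: "(p, q) \<in> r" if "c \<in> S" "p \<in> c" "q \<in> c" for c p q
    unfolding r_def using that by (intro r_into_trancl) auto
  have "refl_on A r" unfolding refl_on_def using 1 S by blast
  moreover have "sym r" unfolding r_def by (intro sym_trancl symI) auto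
  moreover have "trans r" unfolding r_def by (rule trans_trancl)
  ultimately show "equiv A r" using rA by (auto intro: equivI)
qed

end

section \<open>Counting the configurations of the middle row\<close>

locale gluing = fin_group +
  fixes a b c :: nat and d d'
  assumes d: "d \<in> labeled G a b" and d': "d' \<in> labeled G b c" and match: "matching b d d'"
begin

definition S3 :: "point set set" where
  "S3 = (\<lambda>c. lower_to_mid ` c) ` fst d \<union> (\<lambda>c. upper_to_mid ` c) ` fst d'"

definition rr where "rr = {(p, q). \<exists>c\<in>S3. p \<in> c \<and> q \<in> c}\<^sup>+"

definition \<Gamma> :: "point set set" where "\<Gamma> = glued (fst d) (fst d')"

text \<open>On the middle row the labels of \<open>d\<close> and \<open>d'\<close> agree by
  \<open>match\<close>; those of \<open>d\<close> are written.\<close>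

definition L :: "point \<Rightarrow> 'a" where
  "L = tri (\<lambda>i. snd d (Up i)) (\<lambda>j. snd d (Lo j)) (\<lambda>k. snd d' (Lo k))"

lemma parts: "partition_on (points a b) (fst d)" "partition_on (points b c) (fst d')"
  using d d' by (auto simp: labeled_def)

lemma S3_Union: "\<Union>S3 = points3 a b c"
proof -
  have "\<Union>S3 = lower_to_mid ` (\<Union>(fst d)) \<union> upper_to_mid ` (\<Union>(fst d'))" by (auto simp: S3_def)
  also have "\<dots> = lower_to_mid ` points a b \<union> upper_to_mid ` points b c" using parts by (simp add: partition_on_def)
  also have "\<dots> = points3 a b c" by (auto simp: points_def points3_def image_Un image_image)
  finally show ?thesis .
qed

lemma S3_empty: "{} \<notin> S3"
  using parts by (auto simp: S3_def partition_on_def)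

lemma rr_equiv: "equiv (points3 a b c) rr"
  unfolding rr_def by (rule finer_class(1)[OF S3_Union S3_empty])

lemma rrI: "C \<in> S3 \<Longrightarrow> p \<in> C \<Longrightarrow> q \<in> C \<Longrightarrow> (p, q) \<in> rr"
  unfolding rr_def by (rule finer_class(2)[OF S3_Union S3_empty])

lemma \<Gamma>_eq: "\<Gamma> = points3 a b c // rr"
  unfolding \<Gamma>_def glued_def rr_def Let_def S3_Union[symmetric] S3_def ..

lemma \<Gamma>_class: "C \<in> \<Gamma> \<Longrightarrow> p \<in> C \<Longrightarrow> C = rr `` {p}" "p \<in> points3 a b c \<Longrightarrow> rr `` {p} \<in> \<Gamma>" "p \<in> points3 a b c \<Longrightarrow> p \<in> rr `` {p}"
proof -
  show "C = rr `` {p}" if C: "C \<in> \<Gamma>" "p \<in> C"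
  proof -
    obtain q where q: "C = rr `` {q}" using C(1) unfolding \<Gamma>_eq by (auto elim: quotientE)
    then have "(q, p) \<in> rr" using C(2) by simp
    then show ?thesis unfolding q by (rule equiv_class_eq[OF rr_equiv])
  qed
  show "p \<in> points3 a b c \<Longrightarrow> rr `` {p} \<in> \<Gamma>" unfolding \<Gamma>_eq by (rule quotientI)
  show "p \<in> points3 a b c \<Longrightarrow> p \<in> rr `` {p}" by (rule equiv_class_self[OF rr_equiv])
qed

lemma \<Gamma>_sub: "C \<in> \<Gamma> \<Longrightarrow> C \<subseteq> points3 a b c"
  unfolding \<Gamma>_eq using rr_equiv by (auto simp: quotient_def equiv_def)

lemma \<Gamma>_ne: "C \<in> \<Gamma> \<Longrightarrow> C \<noteq> {}"
  unfolding \<Gamma>_eq using in_quotient_imp_non_empty[OF rr_equiv] .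

lemma \<Gamma>_partition: "partition_on (points3 a b c) \<Gamma>"
  unfolding \<Gamma>_eq by (rule partition_on_quotient[OF rr_equiv])

lemma \<Gamma>_S3: "C \<in> S3 \<Longrightarrow> \<exists>E\<in>\<Gamma>. C \<subseteq> E"
proof -
  assume C: "C \<in> S3"
  then obtain p where p: "p \<in> C" using S3_empty by (metis ex_in_conv)
  then have "p \<in> points3 a b c" using C S3_Union by auto
  then show ?thesis using rrI[OF C p] \<Gamma>_class(2) by (intro bexI[of _ "rr `` {p}"]) auto
qed

lemma L_lower: "p \<in> points a b \<Longrightarrow> L (lower_to_mid p) = snd d p"
  by (auto simp: points_def L_def)

lemma L_upper: "p \<in> points b c \<Longrightarrow> L (upper_to_mid p) = snd d' p"
  using match by (auto simp: points_def L_def matching_def)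

lemma L_carrier: "p \<in> points3 a b c \<Longrightarrow> L p \<in> carrier G"
proof -
  assume "p \<in> points3 a b c"
  then obtain C where "C \<in> S3" "p \<in> C" using S3_Union by auto
  then show ?thesis using labeled_block[OF d] labeled_block[OF d'] by (fastforce simp: S3_def L_lower L_upper)
qed

definition fits3 :: "(point \<Rightarrow> nat \<times> 'a) \<Rightarrow> point set set \<Rightarrow> bool" where
  "fits3 z S \<longleftrightarrow> (\<forall>C\<in>S. \<forall>p\<in>C. \<forall>q\<in>C. fst (z p) = fst (z q) \<and> inv (snd (z p)) \<otimes> snd (z q) = inv (L p) \<otimes> L q)"

lemma fits3D: "fits3 z S \<Longrightarrow> C \<in> S \<Longrightarrow> p \<in> C \<Longrightarrow> q \<in> C \<Longrightarrow> fst (z p) = fst (z q) \<and> inv (snd (z p)) \<otimes> snd (z q) = inv (L p) \<otimes> L q"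
  unfolding fits3_def by blast

lemma ball_image_nonempty: "(\<forall>c\<in>h ` A - {{}}. \<forall>p\<in>c. \<forall>q\<in>c. Q p q) \<longleftrightarrow> (\<forall>C\<in>A. \<forall>p\<in>h C. \<forall>q\<in>h C. Q p q)"
  by blast

lemma fits3_Un: "fits3 z (S \<union> S') \<longleftrightarrow> fits3 z S \<and> fits3 z S'"
  unfolding fits3_def by blast

lemma fits_S3: "fits d (jn x y) \<and> fits d' (jn y w) \<longleftrightarrow> fits3 (tri x y w) S3"
proof -
  have 1: "tri x y w (lower_to_mid p) = jn x y p" if "p \<in> points a b" for p using that by (auto simp: points_def)
  have 2: "tri x y w (upper_to_mid p) = jn y w p" if "p \<in> points b c" for p using that by (auto simp: points_def)
  have "fits d (jn x y) \<longleftrightarrow> fits3 (tri x y w) ((\<lambda>c. lower_to_mid ` c) ` fst d)"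
    unfolding fits_def fits3_def by (simp add: 1 L_lower labeled_block(1)[OF d] cong: ball_cong)
  moreover have "fits d' (jn y w) \<longleftrightarrow> fits3 (tri x y w) ((\<lambda>c. upper_to_mid ` c) ` fst d')"
    unfolding fits_def fits3_def by (simp add: 2 L_upper labeled_block(1)[OF d'] cong: ball_cong)
  ultimately show ?thesis unfolding S3_def fits3_Un by simp
qed

lemma step_iff:
  assumes "x \<in> carrier G" "y \<in> carrier G" "l \<in> carrier G" "k \<in> carrier G"
  shows "inv x \<otimes> y = inv l \<otimes> k \<longleftrightarrow> y = (x \<otimes> inv l) \<otimes> k"
  using assms by (metis inv_closed inv_solve_left m_assoc m_closed)

text \<open>Quotients of labels multiply along a chain of overlapping blocks, so the condition on
  the blocks of the two diagrams propagates to the components which they generate.\<close>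

lemma fits3_\<Gamma>:
  assumes v: "\<And>p. p \<in> points3 a b c \<Longrightarrow> snd (z p) \<in> carrier G"
  shows "fits3 z S3 \<longleftrightarrow> fits3 z \<Gamma>"
proof
  assume s: "fits3 z S3"
  have st: "fst (z p) = fst (z q) \<and> inv (snd (z p)) \<otimes> snd (z q) = inv (L p) \<otimes> L q" if "(p, q) \<in> rr" for p q
    using that unfolding rr_def
  proof (induction rule: trancl_induct)
    case (base q)
    then obtain C where "C \<in> S3" "p \<in> C" "q \<in> C" by auto
    then show ?case by (rule fits3D[OF s])
  next
    case (step q r)
    then obtain C where C: "C \<in> S3" "q \<in> C" "r \<in> C" by auto
    have qr: "fst (z q) = fst (z r)" "inv (snd (z q)) \<otimes> snd (z r) = inv (L q) \<otimes> L r" using fits3D[OF s C] by auto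
    have "(p, q) \<in> rr" using step(1) by (simp add: rr_def)
    then have pt: "p \<in> points3 a b c" "q \<in> points3 a b c" "r \<in> points3 a b c"
      using rr_equiv C S3_Union by (auto simp: equiv_def)
    note [simp] = v[OF pt(1)] v[OF pt(2)] v[OF pt(3)] L_carrier[OF pt(1)] L_carrier[OF pt(2)] L_carrier[OF pt(3)]
    have "inv (snd (z p)) \<otimes> snd (z r) = (inv (snd (z p)) \<otimes> snd (z q)) \<otimes> (inv (snd (z q)) \<otimes> snd (z r))"
      by (simp add: m_assoc[symmetric]) (simp add: m_assoc)
    also have "\<dots> = (inv (L p) \<otimes> L q) \<otimes> (inv (L q) \<otimes> L r)" using step.IH qr by simp
    also have "\<dots> = inv (L p) \<otimes> L r" by (simp add: m_assoc[symmetric]) (simp add: m_assoc)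
    finally show ?case using step.IH qr by simp
  qed
  show "fits3 z \<Gamma>"
    unfolding fits3_def
  proof (intro ballI)
    fix C p q assume C: "C \<in> \<Gamma>" "p \<in> C" "q \<in> C"
    then have "(p, q) \<in> rr" using \<Gamma>_class(1)[OF C(1,2)] by auto
    then show "fst (z p) = fst (z q) \<and> inv (snd (z p)) \<otimes> snd (z q) = inv (L p) \<otimes> L q" by (rule st)
  qed
next
  assume g: "fits3 z \<Gamma>"
  show "fits3 z S3"
    unfolding fits3_def
  proof (intro ballI)
    fix C p q assume C: "C \<in> S3" "p \<in> C" "q \<in> C"
    obtain E where "E \<in> \<Gamma>" "C \<subseteq> E" using \<Gamma>_S3[OF C(1)] by blast
    then show "fst (z p) = fst (z q) \<and> inv (snd (z p)) \<otimes> snd (z q) = inv (L p) \<otimes> L q" using fits3D[OF g, of E p q] C by blast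
  qed
qed

abbreviation "glue \<equiv> glue_labeled a c d d'"

lemma glue_blocks: "fst glue = (\<lambda>C. C - range Mid) ` \<Gamma> - {{}}"
  by (simp add: glue_labeled_def \<Gamma>_def)

lemma glue_label: "p \<in> points a c \<Longrightarrow> snd glue p = L p"
  by (auto simp: glue_labeled_def points_def L_def)

lemma glue_in: "glue \<in> labeled G a c"
proof -
  have "partition_on (points a c) (fst glue)"
    unfolding partition_on_def
  proof (intro conjI)
    have "\<Union>(fst glue) = \<Union>\<Gamma> - range Mid" by (auto simp: glue_blocks)
    also have "\<dots> = points a c" using \<Gamma>_partition by (auto simp: partition_on_def points3_def points_def)
    finally show "\<Union>(fst glue) = points a c" .
    show "disjoint (fst glue)" using \<Gamma>_partition unfolding partition_on_def glue_blocks disjoint_def by blast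
  qed (auto simp: glue_blocks)
  moreover have "snd glue \<in> points a c \<rightarrow>\<^sub>E carrier G"
  proof (rule PiE_I)
    fix p assume p: "p \<in> points a c"
    then have "p \<in> points3 a b c" by (auto simp: points_def points3_def)
    then show "snd glue p \<in> carrier G" using L_carrier glue_label[OF p] by simp
  qed (simp add: glue_labeled_def)
  ultimately show ?thesis by (cases glue) (auto simp: labeled_def)
qed

text \<open>The tuple \<open>y\<close> is arbitrary, as only outer points are compared; this form
  can be set beside \<open>fits3\<close> for the whole glued diagram.\<close>

lemma fits_glue: "fits glue (jn x w) \<longleftrightarrow>
  (\<forall>C\<in>\<Gamma>. \<forall>p\<in>C - range Mid. \<forall>q\<in>C - range Mid.
     fst (tri x y w p) = fst (tri x y w q) \<and> inv (snd (tri x y w p)) \<otimes> snd (tri x y w q) = inv (L p) \<otimes> L q)"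
proof -
  have 1: "tri x y w p = jn x w p" "p \<in> points a c" if "C \<in> \<Gamma>" "p \<in> C" "p \<notin> range Mid" for p C
    using \<Gamma>_sub[OF that(1)] that(2,3) by (auto simp: points3_def points_def)
  show ?thesis
  proof -
    have "fits glue (jn x w) \<longleftrightarrow> (\<forall>C\<in>\<Gamma>. \<forall>p\<in>C - range Mid. \<forall>q\<in>C - range Mid.
        fst (jn x w p) = fst (jn x w q) \<and> inv (snd (jn x w p)) \<otimes> snd (jn x w q) = inv (snd glue p) \<otimes> snd glue q)"
      unfolding fits_def glue_blocks by (rule ball_image_nonempty)
    also have "\<dots> \<longleftrightarrow> (\<forall>C\<in>\<Gamma>. \<forall>p\<in>C - range Mid. \<forall>q\<in>C - range Mid.
        fst (tri x y w p) = fst (tri x y w q) \<and> inv (snd (tri x y w p)) \<otimes> snd (tri x y w q) = inv (L p) \<otimes> L q)"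
      using 1 by (intro ball_cong refl) (simp add: glue_label)
    finally show ?thesis .
  qed
qed

definition \<Gamma>0 where "\<Gamma>0 = {C \<in> \<Gamma>. C \<subseteq> range Mid}"

text \<open>A component reaching an outer row prescribes the row and the group element of each of
  its middle points. A component inside the middle row leaves free one row in \<open>R\<close> and
  one left factor in the group. This is where the factor \<open>|G| t\<close> of the composition
  comes from, with \<open>t = card R\<close>.\<close>

lemma count_middle:
  assumes R: "finite R" and x: "x \<in> conf R a" and w: "w \<in> conf R c"
  shows "card {y \<in> conf R b. fits d (jn x y) \<and> fits d' (jn y w)} =
    (if fits glue (jn x w) then (card R * card (carrier G)) ^ card \<Gamma>0 else 0)"
proof -
  have tv: "snd (tri x y w p) \<in> carrier G \<and> fst (tri x y w p) \<in> R" if "p \<in> points3 a b c" "y \<in> conf R b" for y p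
    using that(1) conf_mem[OF x] conf_mem[OF w] conf_mem[OF that(2)] by (auto simp: points3_def)
  define N where "N = {y \<in> conf R b. fits d (jn x y) \<and> fits d' (jn y w)}"
  have N: "y \<in> N \<longleftrightarrow> y \<in> conf R b \<and> fits3 (tri x y w) \<Gamma>" for y
    unfolding N_def mem_Collect_eq fits_S3 using fits3_\<Gamma>[of "tri x y w"] tv by blast
  show ?thesis
  proof (cases "fits glue (jn x w)")
    case False
    have "N = {}"
    proof (rule ccontr)
      assume "N \<noteq> {}"
      then obtain y where "fits3 (tri x y w) \<Gamma>" using N by auto
      then have "fits glue (jn x w)" unfolding fits_glue[of x w y] fits3_def by auto
      then show False using False by simp
    qed
    then show ?thesis using False by (simp add: N_def[symmetric])
  next
    case True
    define z0 where "z0 = tri x undefined w"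
    define p1 where "p1 C = (SOME p. p \<in> C \<and> p \<notin> range Mid)" for C :: "point set"
    \<comment> \<open>A row together with a left factor by which the configuration differs from the
      labelling \<open>L\<close> on the component. It is forced at components with an outer point,
      where it is read off; \<open>vl\<close> combines it with a free choice \<phi> on the remaining
      components.\<close>
    define anc where "anc C = (fst (z0 (p1 C)), snd (z0 (p1 C)) \<otimes> inv (L (p1 C)))" for C
    define cls where "cls p = rr `` {p}" for p
    define vl where "vl \<phi> C = (if C \<in> \<Gamma>0 then \<phi> C else anc C)" for \<phi> :: "point set \<Rightarrow> nat \<times> 'a" and C
    define Y where "Y \<phi> = (\<lambda>j\<in>{1..b}. (fst (vl \<phi> (cls (Mid j))), snd (vl \<phi> (cls (Mid j))) \<otimes> L (Mid j)))" for \<phi>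
    let ?D = "\<Gamma>0 \<rightarrow>\<^sub>E (R \<times> carrier G)"
    have p1: "p1 C \<in> C \<and> p1 C \<notin> range Mid" if "C \<in> \<Gamma>" "C \<notin> \<Gamma>0" for C
      unfolding p1_def by (rule someI_ex) (use that in \<open>auto simp: \<Gamma>0_def\<close>)
    have z0: "tri x y w p = z0 p" if "p \<notin> range Mid" for p y using that by (cases p) (auto simp: z0_def)
    have Rc: "fst (z0 p) \<in> R \<and> snd (z0 p) \<in> carrier G" if "p \<in> points3 a b c" "p \<notin> range Mid" for p
      using that conf_mem[OF x] conf_mem[OF w] by (auto simp: points3_def z0_def)
    have ancR: "anc C \<in> R \<times> carrier G" if "C \<in> \<Gamma>" "C \<notin> \<Gamma>0" for C
      using p1[OF that] Rc[of "p1 C"] \<Gamma>_sub[OF that(1)] L_carrier[of "p1 C"] by (auto simp: anc_def)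
    have vlR: "vl \<phi> C \<in> R \<times> carrier G" if "\<phi> \<in> ?D" "C \<in> \<Gamma>" for \<phi> C
      using that ancR by (auto simp: vl_def PiE_def Pi_def)
    have mid: "Mid j \<in> points3 a b c \<longleftrightarrow> j \<in> {1..b}" for j by (auto simp: points3_def)
    have Yc: "Y \<phi> \<in> conf R b" if "\<phi> \<in> ?D" for \<phi>
      using vlR[OF that \<Gamma>_class(2)] L_carrier mid by (fastforce simp: Y_def conf_def cls_def)
    have zY: "tri x (Y \<phi>) w p = (fst (vl \<phi> C), snd (vl \<phi> C) \<otimes> L p)" if \<phi>: "\<phi> \<in> ?D" and C: "C \<in> \<Gamma>" "p \<in> C" for \<phi> C p
    proof (cases "p \<in> range Mid")
      case True
      then obtain j where [simp]: "p = Mid j" by auto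
      have "j \<in> {1..b}" using C \<Gamma>_sub[OF C(1)] mid by auto
      moreover have "cls (Mid j) = C" using \<Gamma>_class(1)[OF C] by (simp add: cls_def)
      ultimately show ?thesis by (simp add: Y_def)
    next
      case False
      then have C0: "C \<notin> \<Gamma>0" using C by (auto simp: \<Gamma>0_def)
      have pp: "p \<in> points3 a b c" "p1 C \<in> points3 a b c" using p1[OF C(1) C0] \<Gamma>_sub[OF C(1)] C by auto
      have "fst (z0 (p1 C)) = fst (z0 p) \<and> inv (snd (z0 (p1 C))) \<otimes> snd (z0 p) = inv (L (p1 C)) \<otimes> L p"
        using True[unfolded fits_glue[of x w undefined], rule_format, OF C(1), of "p1 C" p] p1[OF C(1) C0] C False by (simp add: z0_def)
      then have "z0 p = (fst (anc C), snd (anc C) \<otimes> L p)"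
        using step_iff[of "snd (z0 (p1 C))" "snd (z0 p)" "L (p1 C)" "L p"] Rc[OF pp(1) False] Rc[OF pp(2)] p1[OF C(1) C0] L_carrier[OF pp(1)] L_carrier[OF pp(2)]
        by (auto simp: anc_def prod_eq_iff)
      then show ?thesis using z0[OF False] C0 by (simp add: vl_def)
    qed
    have YN: "Y \<phi> \<in> N" if \<phi>: "\<phi> \<in> ?D" for \<phi>
      unfolding N fits3_def
    proof (intro conjI Yc[OF \<phi>] ballI)
      fix C p q assume C: "C \<in> \<Gamma>" "p \<in> C" "q \<in> C"
      have "L p \<in> carrier G" "L q \<in> carrier G" "snd (vl \<phi> C) \<in> carrier G" using C \<Gamma>_sub L_carrier vlR[OF \<phi> C(1)] by auto
      then show "fst (tri x (Y \<phi>) w p) = fst (tri x (Y \<phi>) w q)"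
        "inv (snd (tri x (Y \<phi>) w p)) \<otimes> snd (tri x (Y \<phi>) w q) = inv (L p) \<otimes> L q"
        unfolding zY[OF \<phi> C(1,2)] zY[OF \<phi> C(1,3)] by (simp_all add: inv_mult_cancel)
    qed
    have inj: "inj_on Y ?D"
    proof (rule inj_onI)
      fix \<phi> \<phi>' assume ph: "\<phi> \<in> ?D" "\<phi>' \<in> ?D" and eq: "Y \<phi> = Y \<phi>'"
      show "\<phi> = \<phi>'"
      proof (rule PiE_ext[OF ph])
        fix C assume C: "C \<in> \<Gamma>0"
        then have CG: "C \<in> \<Gamma>" by (simp add: \<Gamma>0_def)
        obtain p where p: "p \<in> C" using \<Gamma>_ne[OF CG] by blast
        have "(fst (\<phi> C), snd (\<phi> C) \<otimes> L p) = (fst (\<phi>' C), snd (\<phi>' C) \<otimes> L p)"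
          using zY[OF ph(1) CG p] zY[OF ph(2) CG p] eq C by (simp add: vl_def)
        moreover have "\<phi> C \<in> R \<times> carrier G" "\<phi>' C \<in> R \<times> carrier G" using ph C by auto
        ultimately show "\<phi> C = \<phi>' C" using L_carrier[of p] \<Gamma>_sub[OF CG] p by (auto simp: prod_eq_iff)
      qed
    qed
    have surj: "N \<subseteq> Y ` ?D"
    proof
      fix y assume y: "y \<in> N"
      then have yc: "y \<in> conf R b" and f3: "fits3 (tri x y w) \<Gamma>" using N by auto
      let ?z = "tri x y w"
      define q where "q C = (SOME p. p \<in> C)" for C :: "point set"
      have q: "q C \<in> C" if "C \<in> \<Gamma>" for C unfolding q_def using \<Gamma>_ne[OF that] by (simp add: some_in_eq)
      \<comment> \<open>The inverse of \<open>Y\<close>: the row and the left factor are read off at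
        any point of the component.\<close>
      define \<phi> where "\<phi> = (\<lambda>C\<in>\<Gamma>0. (fst (?z (q C)), snd (?z (q C)) \<otimes> inv (L (q C))))"
      have \<phi>: "\<phi> \<in> ?D"
      proof (rule PiE_I)
        fix C assume C: "C \<in> \<Gamma>0"
        then have "C \<in> \<Gamma>" by (simp add: \<Gamma>0_def)
        then have "q C \<in> points3 a b c" using q \<Gamma>_sub by blast
        then show "\<phi> C \<in> R \<times> carrier G" using tv[OF _ yc, of "q C"] L_carrier[of "q C"] C by (simp add: \<phi>_def)
      qed (simp add: \<phi>_def)
      have key: "?z p = (fst (?z r), (snd (?z r) \<otimes> inv (L r)) \<otimes> L p)" if "C \<in> \<Gamma>" "r \<in> C" "p \<in> C" for C r p
      proof -
        have pp: "p \<in> points3 a b c" "r \<in> points3 a b c" using that \<Gamma>_sub by auto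
        have "fst (?z r) = fst (?z p) \<and> inv (snd (?z r)) \<otimes> snd (?z p) = inv (L r) \<otimes> L p" using fits3D[OF f3 that] by simp
        then show ?thesis using step_iff[of "snd (?z r)" "snd (?z p)" "L r" "L p"] tv[OF pp(1) yc] tv[OF pp(2) yc] L_carrier[OF pp(1)] L_carrier[OF pp(2)]
          by (auto simp: prod_eq_iff)
      qed
      have "Y \<phi> = y"
      proof (rule PiE_ext[OF Yc[OF \<phi>, unfolded conf_def] yc[unfolded conf_def]])
        fix j assume j: "j \<in> {1..b}"
        let ?C = "cls (Mid j)"
        have C: "?C \<in> \<Gamma>" "Mid j \<in> ?C" using j mid \<Gamma>_class by (auto simp: cls_def)
        show "Y \<phi> j = y j"
        proof (cases "?C \<in> \<Gamma>0")
          case True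
          then show ?thesis using key[OF C(1) q[OF C(1)] C(2)] j by (simp add: Y_def vl_def \<phi>_def)
        next
          case False
          have "p1 ?C \<in> ?C" "p1 ?C \<notin> range Mid" using p1[OF C(1) False] by auto
          then show ?thesis using key[OF C(1) _ C(2), of "p1 ?C"] z0[of "p1 ?C" y] j False by (simp add: Y_def vl_def anc_def)
        qed
      qed
      then show "y \<in> Y ` ?D" using \<phi> by blast
    qed
    have "N = Y ` ?D" using surj YN by auto
    then have "card N = card ?D" using card_image[OF inj] by simp
    also have "\<dots> = (card R * card (carrier G)) ^ card \<Gamma>0"
    proof -
      have "finite \<Gamma>" using finite_elements[OF _ \<Gamma>_partition] by (simp add: points3_def)
      then have "finite \<Gamma>0" by (simp add: \<Gamma>0_def)
      then show ?thesis by (simp add: card_PiE card_cartesian_product)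
    qed
    finally show ?thesis using True by (simp add: N_def[symmetric])
  qed
qed

end

context fin_group
begin

lemma glue_sum:
  assumes f: "f \<in> P G a b" "d \<in> f" and g: "g \<in> P G b c" "d' \<in> g" and m: "matching b d d'"
    and R: "finite R" "x \<in> conf R a" "w \<in> conf R c"
  shows "(\<Sum>y\<in>conf R b. of_bool (adm f (jn x y)) * of_bool (adm g (jn y w))) =
    (of_nat (card R) * of_nat (card (carrier G))) ^ mu f g * (of_bool (adm (diag G a c (glue_labeled a c d d')) (jn x w)) :: 'k::field_char_0)"
proof -
  interpret gluing G a b c d d' by unfold_locales (use f g m P_labeled in auto)
  have "(\<Sum>y\<in>conf R b. of_bool (adm f (jn x y)) * of_bool (adm g (jn y w))) = (of_nat (card {y \<in> conf R b. fits d (jn x y) \<and> fits d' (jn y w)}) :: 'k)"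
    using adm_fits[OF f] adm_fits[OF g] finite_conf[OF R(1)] by (simp add: of_bool_conj[symmetric] Int_def)
  moreover have "mu f g = card \<Gamma>0"
    using comps_eq[OF f] comps_eq[OF g] by (simp add: mu_def \<Gamma>0_def \<Gamma>_def)
  ultimately show ?thesis using count_middle[OF R] adm_diag[OF glue_in] by (simp add: of_nat_power)
qed

text \<open>The group elements of \<open>x\<close>, \<open>y\<close> and \<open>w\<close> label both
  diagrams at once, and these labellings agree on the shared row \<open>y\<close>.\<close>

lemma not_compatible:
  assumes f: "f \<in> P G a b" and g: "g \<in> P G b c" and v: "val1 a x" "val1 b y" "val1 c w"
    and ad: "adm f (jn x y)" "adm g (jn y w)"
  shows "compatible b f g"
proof -
  obtain \<pi> l \<pi>' l' where d: "(\<pi>, l) \<in> f" "fits (\<pi>, l) (jn x y)" "(\<pi>', l') \<in> g" "fits (\<pi>', l') (jn y w)"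
    using ad by (auto simp: adm_def)
  have 1: "(\<pi>, relab a b (jn x y)) \<in> f"
    using fits_relab[OF P_labeled[OF f d(1)] d(2)] v P_diag[OF f d(1)] by (simp add: valid_jn diag_mem)
  have 2: "(\<pi>', relab b c (jn y w)) \<in> g"
    using fits_relab[OF P_labeled[OF g d(3)] d(4)] v P_diag[OF g d(3)] by (simp add: valid_jn diag_mem)
  have "matching b (\<pi>, relab a b (jn x y)) (\<pi>', relab b c (jn y w))"
    by (auto simp: matching_def relab_def points_def)
  then show ?thesis using 1 2 by (auto simp: compatible_def)
qed

text \<open>Well-definedness of gluing by counting: the number of middle tuples does not involve the
  chosen representatives, and it is a nonzero multiple of the admissibility of the glued diagram. So
  two results admit the same configurations, and kernels separate diagrams.\<close>

lemma star_eq: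
  assumes f: "f \<in> P G a b" "d \<in> f" and g: "g \<in> P G b c" "d' \<in> g" and m: "matching b d d'"
  shows "star G a b c f g = diag G a c (glue_labeled a c d d')"
  unfolding star_def
proof (rule the_equality)
  show "\<exists>e\<in>f. \<exists>e'\<in>g. matching b e e' \<and> diag G a c (glue_labeled a c d d') = diag G a c (glue_labeled a c e e')"
    using f g m by blast
  fix h assume "\<exists>e\<in>f. \<exists>e'\<in>g. matching b e e' \<and> h = diag G a c (glue_labeled a c e e')"
  then obtain e e' where e: "e \<in> f" "e' \<in> g" "matching b e e'" and h: "h = diag G a c (glue_labeled a c e e')" by blast
  interpret A: gluing G a b c d d' by unfold_locales (use f g m P_labeled in auto)
  interpret B: gluing G a b c e e' by unfold_locales (use f g e P_labeled in auto)
  let ?h' = "diag G a c (glue_labeled a c d d')"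
  have hP: "h \<in> P G a c" "?h' \<in> P G a c" using A.glue_in B.glue_in diag_in_P h by auto
  \<comment> \<open>The row \<open>1\<close> is added to keep \<open>R\<close> nonempty if
    \<open>a + c = 0\<close>; the common factor to be cancelled is then nonzero.\<close>
  define R where "R = {0<..0 + a + c} \<union> {1}"
  have eq: "adm h z \<longleftrightarrow> adm ?h' z" if v: "valid a c z" and r: "\<And>p. p \<in> points a c \<Longrightarrow> fst (z p) \<in> {0<..0 + a + c}" for z
  proof -
    define x w where "x = (\<lambda>i\<in>{1..a}. z (Up i))" and "w = (\<lambda>k\<in>{1..c}. z (Lo k))"
    have xw: "x \<in> conf R a" "w \<in> conf R c"
      using v r by (auto simp: x_def w_def conf_def R_def valid_def points_def mem_Times_iff)
    have R: "finite R" "R \<noteq> {}" by (auto simp: R_def)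
    have "(of_nat (card R) * of_nat (card (carrier G))) ^ mu f g * of_bool (adm ?h' (jn x w)) =
        (of_nat (card R) * of_nat (card (carrier G))) ^ mu f g * (of_bool (adm h (jn x w)) :: rat)"
      unfolding h by (rule trans[OF glue_sum[OF f(1) f(2) g(1) g(2) m R(1) xw, symmetric] glue_sum[OF f(1) e(1) g(1) e(2,3) R(1) xw]])
    moreover have "card R \<noteq> 0" "card (carrier G) \<noteq> 0" using R fin by auto
    then have "(of_nat (card R) * of_nat (card (carrier G))) ^ mu f g \<noteq> (0 :: rat)" by simp
    ultimately have "of_bool (adm ?h' (jn x w)) = (of_bool (adm h (jn x w)) :: rat)" by (metis mult_left_cancel)
    then have "adm ?h' (jn x w) \<longleftrightarrow> adm h (jn x w)" by (simp add: of_bool_def split: if_splits)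
    moreover have "jn x w p = z p" if "p \<in> points a c" for p using that by (auto simp: points_def x_def w_def)
    ultimately show ?thesis using adm_cong[OF hP(1), of z "jn x w"] adm_cong[OF hP(2), of z "jn x w"] by simp
  qed
  have "basis h = (basis ?h' :: 'a gdiag \<Rightarrow> rat)"
    by (rule ker_inj[where r = 0 and a = a and b = c and t = 0]) (use hP eq in \<open>auto simp: Gcat_hom basis_def[abs_def] ker_basis[unfolded basis_def]\<close>)
  then show "h = ?h'" by (metis basis_def zero_neq_one)
qed

lemma star_in_P: "f \<in> P G a b \<Longrightarrow> g \<in> P G b c \<Longrightarrow> compatible b f g \<Longrightarrow> star G a b c f g \<in> P G a c"
proof -
  assume f: "f \<in> P G a b" and g: "g \<in> P G b c" and "compatible b f g"
  then obtain d d' where e: "d \<in> f" "d' \<in> g" "matching b d d'" by (auto simp: compatible_def)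
  interpret A: gluing G a b c d d' by unfold_locales (use f g e P_labeled in auto)
  show ?thesis using star_eq[OF f e(1) g e(2,3)] diag_in_P[OF A.glue_in] by simp
qed

lemma diag_comp_sum:
  assumes f: "f \<in> P G a b" and g: "g \<in> P G b c" and R: "finite R" "x \<in> conf R a" "w \<in> conf R c"
  shows "(\<Sum>y\<in>conf R b. of_bool (adm f (jn x y)) * of_bool (adm g (jn y w))) =
    ker a c (diag_comp G (of_nat (card R) :: 'k::field_char_0) a b c g f) (jn x w)"
proof (cases "compatible b f g")
  case True
  then obtain d d' where e: "d \<in> f" "d' \<in> g" "matching b d d'" by (auto simp: compatible_def)
  show ?thesis
    unfolding glue_sum[OF f e(1) g e(2,3) R]
    using True star_eq[OF f e(1) g e(2,3)] star_in_P[OF f g True]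
    by (simp add: diag_comp_def ker_smul ker_basis Coset.order_def mult.commute)
next
  case False
  have "\<not> (adm f (jn x y) \<and> adm g (jn y w))" if "y \<in> conf R b" for y
    using not_compatible[OF f g] False conf_val1 that R by blast
  then have "(\<Sum>y\<in>conf R b. of_bool (adm f (jn x y)) * of_bool (adm g (jn y w))) = (0::'k)"
    by (intro sum.neutral) auto
  then show ?thesis using False by (simp add: diag_comp_def ker_zero)
qed

lemma diag_comp_hom: "f \<in> P G a b \<Longrightarrow> g \<in> P G b c \<Longrightarrow> h \<notin> P G a c \<Longrightarrow> diag_comp G t a b c g f h = 0"
  using star_in_P by (auto simp: diag_comp_def smul_apply basis_def zero_fun_apply)

section \<open>Composition in \<open>Gcat\<close> and interpolation in the parameter\<close>

abbreviation "gc t a b c \<equiv> Comp (Gcat G t) a b c"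

lemma gcomp: "gc t a b c v u = (\<Sum>f\<in>P G a b. \<Sum>g\<in>P G b c. smul (v g * u f) (diag_comp G t a b c g f))"
  by (simp add: Gcat_def)

text \<open>The parameter \<open>t'\<close> is independent of \<open>t\<close>: hom-spaces are the
  same for all parameters, so composites formed at different parameters can be compared in one
  space.\<close>

lemma gcomp_hom: "gc t a b c v u \<in> Hom (Gcat G t') a c"
  by (auto simp: Gcat_hom gcomp sum_fun_apply smul_apply diag_comp_hom intro!: sum.neutral)

text \<open>The bridge from diagrams to matrices. It is available only at natural numbers as
  parameters, which is why polynomiality is studied next.\<close>

lemma ker_gcomp:
  assumes R: "finite R" "x \<in> conf R a" "w \<in> conf R c"
  shows "ker a c (gc (of_nat (card R)) a b c v u) (jn x w) = (\<Sum>y\<in>conf R b. ker a b u (jn x y) * ker b c v (jn y w))"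
proof -
  have "ker a c (gc (of_nat (card R)) a b c v u) (jn x w) =
    (\<Sum>f\<in>P G a b. \<Sum>g\<in>P G b c. \<Sum>y\<in>conf R b. (u f * of_bool (adm f (jn x y))) * (v g * of_bool (adm g (jn y w))))"
    unfolding gcomp ker_sum ker_smul
    by (intro sum.cong refl) (simp add: diag_comp_sum[OF _ _ R, symmetric] sum_distrib_left algebra_simps)
  also have "\<dots> = (\<Sum>f\<in>P G a b. \<Sum>y\<in>conf R b. \<Sum>g\<in>P G b c. (u f * of_bool (adm f (jn x y))) * (v g * of_bool (adm g (jn y w))))"
    by (intro sum.cong refl sum.swap)
  also have "\<dots> = (\<Sum>y\<in>conf R b. \<Sum>f\<in>P G a b. \<Sum>g\<in>P G b c. (u f * of_bool (adm f (jn x y))) * (v g * of_bool (adm g (jn y w))))"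
    by (rule sum.swap)
  also have "\<dots> = (\<Sum>y\<in>conf R b. ker a b u (jn x y) * ker b c v (jn y w))"
    unfolding ker_def sum_product ..
  finally show ?thesis .
qed

definition polyfun :: "('k::field_char_0 \<Rightarrow> 'k) \<Rightarrow> bool" where
  "polyfun p \<longleftrightarrow> (\<exists>q. \<forall>t. p t = poly q t)"

lemma polyfun_const: "polyfun (\<lambda>_. c)" and polyfun_id: "polyfun (\<lambda>t. t)"
  by (auto simp: polyfun_def intro: exI[of _ "[:c:]"] exI[of _ "[:0, 1:]"])

lemma polyfun_add: "polyfun p \<Longrightarrow> polyfun q \<Longrightarrow> polyfun (\<lambda>t. p t + q t)"
  unfolding polyfun_def by (metis poly_add)

lemma polyfun_mult: "polyfun p \<Longrightarrow> polyfun q \<Longrightarrow> polyfun (\<lambda>t. p t * q t)"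
  unfolding polyfun_def by (metis poly_mult)

lemma polyfun_power: "polyfun p \<Longrightarrow> polyfun (\<lambda>t. p t ^ n)"
  unfolding polyfun_def by (metis poly_power)

lemma polyfun_sum: "(\<And>i. i \<in> I \<Longrightarrow> polyfun (p i)) \<Longrightarrow> polyfun (\<lambda>t. \<Sum>i\<in>I. p i t)"
  by (induction I rule: infinite_finite_induct) (auto intro: polyfun_const polyfun_add)

text \<open>In characteristic \<open>0\<close> the large natural numbers are infinitely many roots
  of the difference polynomial.\<close>

lemma polyfun_eq:
  fixes p q :: "'k::field_char_0 \<Rightarrow> 'k"
  assumes "polyfun p" "polyfun q" and eq: "\<And>N. N \<ge> N0 \<Longrightarrow> p (of_nat N) = q (of_nat N)"
  shows "p t = q t"
proof -
  obtain p' q' where pq: "\<And>t. p t = poly p' t" "\<And>t. q t = poly q' t" using assms by (auto simp: polyfun_def)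
  have "of_nat ` {N0..} \<subseteq> {x. poly (p' - q') x = 0}" using eq pq by auto
  moreover have "infinite (of_nat ` {N0..} :: 'k set)"
    using finite_imageD[of "of_nat :: nat \<Rightarrow> 'k" "{N0..}"] infinite_Ici by (auto simp: inj_on_def)
  ultimately have "infinite {x. poly (p' - q') x = 0}" using finite_subset by blast
  then have "p' - q' = 0" using poly_roots_finite by blast
  then show ?thesis using pq by simp
qed

lemma polyfun_diag_comp: "polyfun (\<lambda>t. diag_comp G t a b c g f h)"
proof (cases "compatible b f g")
  case True
  then show ?thesis by (simp add: diag_comp_def smul_apply) (intro polyfun_mult polyfun_power polyfun_const polyfun_id)
next
  case False
  then show ?thesis by (simp add: diag_comp_def zero_fun_apply polyfun_const)
qed

lemma polyfun_gcomp:
  assumes "\<And>g. polyfun (\<lambda>t. v t g)" "\<And>f. polyfun (\<lambda>t. u t f)"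
  shows "polyfun (\<lambda>t. gc t a b c (v t) (u t) h)"
  unfolding gcomp sum_fun_apply smul_apply
  by (intro polyfun_sum polyfun_mult polyfun_diag_comp assms)

lemma polyfun_gcomp_const: "polyfun (\<lambda>t. gc t a b c v u h)"
  by (rule polyfun_gcomp[where v = "\<lambda>_. v" and u = "\<lambda>_. u"]) (rule polyfun_const)+

text \<open>An identity which holds for matrices indexed by configurations in sufficiently many rows
  holds for all parameters, as both sides are polynomial in the parameter.\<close>

lemma gcomp_eqI:
  fixes u :: "'a gdiag \<Rightarrow> 'k::field_char_0"
  assumes w: "w \<in> Hom (Gcat G t) a c"
    and eq: "\<And>N x z. N \<ge> a + c \<Longrightarrow> x \<in> conf {1..N} a \<Longrightarrow> z \<in> conf {1..N} c \<Longrightarrow>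
      (\<Sum>y\<in>conf {1..N} b. ker a b u (jn x y) * ker b c v (jn y z)) = ker a c w (jn x z)"
  shows "gc t a b c v u = w"
proof
  fix h
  have "gc (of_nat N) a b c v u = w" if N: "N \<ge> a + c" for N
  proof (rule ker_inj[where r = 0 and a = a and b = c and t = t])
    fix z assume v: "valid a c z" and r: "\<And>p. p \<in> points a c \<Longrightarrow> fst (z p) \<in> {0<..0 + a + c}"
    define x y where "x = (\<lambda>i\<in>{1..a}. z (Up i))" and "y = (\<lambda>k\<in>{1..c}. z (Lo k))"
    have "fst (z p) \<in> {1..N}" if "p \<in> points a c" for p using r[OF that] N by auto
    then have xy: "x \<in> conf {1..N} a" "y \<in> conf {1..N} c"
      using v by (auto simp: x_def y_def conf_def valid_def points_def mem_Times_iff)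
    have zz: "ker a c s z = ker a c s (jn x y)" for s :: "'a gdiag \<Rightarrow> 'k"
      by (rule ker_cong) (auto simp: points_def x_def y_def)
    show "ker a c (gc (of_nat N) a b c v u) z = ker a c w z"
      unfolding zz using ker_gcomp[of "{1..N}" x a y c b v u, OF _ xy] eq[OF N xy] by simp
  qed (rule gcomp_hom w)+
  then show "gc t a b c v u h = w h"
    by (intro polyfun_eq[where p = "\<lambda>t. gc t a b c v u h" and q = "\<lambda>_. w h" and ?N0.0 = "a + c" and t = t, OF polyfun_gcomp_const polyfun_const]) simp
qed

text \<open>Here both sides vary with the parameter, so instead of \<open>gcomp_eqI\<close> its
  interpolation argument is repeated with two polynomials. At natural numbers the claim is
  associativity of matrix multiplication.\<close>

lemma gcomp_assoc:
  fixes u v w :: "'a gdiag \<Rightarrow> 'k::field_char_0"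
  shows "gc t a c e w (gc t a b c v u) = gc t a b e (gc t b c e w v) u"
proof
  fix h
  have "gc (of_nat N) a c e w (gc (of_nat N) a b c v u) = gc (of_nat N) a b e (gc (of_nat N) b c e w v) u" if N: "N \<ge> a + e" for N
  proof (rule ker_inj[where r = 0 and a = a and b = e and t = t])
    fix z assume v: "valid a e z" and r: "\<And>p. p \<in> points a e \<Longrightarrow> fst (z p) \<in> {0<..0 + a + e}"
    define x y where "x = (\<lambda>i\<in>{1..a}. z (Up i))" and "y = (\<lambda>k\<in>{1..e}. z (Lo k))"
    have "fst (z p) \<in> {1..N}" if "p \<in> points a e" for p using r[OF that] N by auto
    then have xy: "x \<in> conf {1..N} a" "y \<in> conf {1..N} e"
      using v by (auto simp: x_def y_def conf_def valid_def points_def mem_Times_iff)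
    have zz: "ker a e s z = ker a e s (jn x y)" for s :: "'a gdiag \<Rightarrow> 'k"
      by (rule ker_cong) (auto simp: points_def x_def y_def)
    note k = ker_gcomp[of "{1..N}", simplified]
    have "ker a e (gc (of_nat N) a c e w (gc (of_nat N) a b c v u)) (jn x y) =
      (\<Sum>q\<in>conf {1..N} c. \<Sum>p\<in>conf {1..N} b. ker a b u (jn x p) * ker b c v (jn p q) * ker c e w (jn q y))"
      using xy by (simp add: k sum_distrib_right)
    also have "\<dots> = (\<Sum>p\<in>conf {1..N} b. \<Sum>q\<in>conf {1..N} c. ker a b u (jn x p) * ker b c v (jn p q) * ker c e w (jn q y))"
      by (rule sum.swap)
    also have "\<dots> = ker a e (gc (of_nat N) a b e (gc (of_nat N) b c e w v) u) (jn x y)"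
      using xy by (simp add: k sum_distrib_left mult.assoc)
    finally show "ker a e (gc (of_nat N) a c e w (gc (of_nat N) a b c v u)) z = ker a e (gc (of_nat N) a b e (gc (of_nat N) b c e w v) u) z"
      unfolding zz .
  qed (rule gcomp_hom)+
  then show "gc t a c e w (gc t a b c v u) h = gc t a b e (gc t b c e w v) u h"
    by (intro polyfun_eq[where p = "\<lambda>t. gc t a c e w (gc t a b c v u) h" and q = "\<lambda>t. gc t a b e (gc t b c e w v) u h" and ?N0.0 = "a + e" and t = t,
        OF polyfun_gcomp[where v = "\<lambda>_. w", OF polyfun_const polyfun_gcomp_const] polyfun_gcomp[where u = "\<lambda>_. u", OF polyfun_gcomp_const polyfun_const]]) simp
qed

section \<open>Permutation diagrams and identities\<close>

lemma strands_labeled: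
  assumes s: "\<sigma> permutes {1..n}" and k: "\<And>i. i \<in> {1..n} \<Longrightarrow> k i \<in> carrier G"
  shows "((\<lambda>i. {Up i, Lo (\<sigma> i)}) ` {1..n}, \<lambda>p\<in>points n n. case p of Up i \<Rightarrow> \<one> | Lo j \<Rightarrow> k j | Mid j \<Rightarrow> undefined) \<in> labeled G n n"
proof -
  have "partition_on (points n n) ((\<lambda>i. {Up i, Lo (\<sigma> i)}) ` {1..n})"
    unfolding partition_on_def
  proof (intro conjI)
    have "\<Union>((\<lambda>i. {Up i, Lo (\<sigma> i)}) ` {1..n}) = Up ` {1..n} \<union> Lo ` (\<sigma> ` {1..n})" by auto
    then show "\<Union>((\<lambda>i. {Up i, Lo (\<sigma> i)}) ` {1..n}) = points n n" using permutes_image[OF s] by (simp add: points_def)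
    show "disjoint ((\<lambda>i. {Up i, Lo (\<sigma> i)}) ` {1..n})"
      using permutes_inj[OF s] by (auto simp: disjoint_def inj_def)
  qed auto
  then show ?thesis using k by (auto simp: labeled_def points_def)
qed

text \<open>With upper label \<open>1\<close> and lower label \<open>k j\<close>, the quotient of
  the group elements along a strand has to be \<open>k j\<close>. So labels multiply from the right,
  and thereby commute with the left action of the wreath product.\<close>

lemma adm_strands:
  assumes s: "\<sigma> permutes {1..n}" and k: "\<And>i. i \<in> {1..n} \<Longrightarrow> k i \<in> carrier G" and v: "val1 n x" "val1 n y"
  shows "adm (strands G n \<sigma> k) (jn x y) \<longleftrightarrow> (\<forall>i\<in>{1..n}. y (\<sigma> i) = (fst (x i), snd (x i) \<otimes> k (\<sigma> i)))"
proof -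
  have "fits ((\<lambda>i. {Up i, Lo (\<sigma> i)}) ` {1..n}, \<lambda>p\<in>points n n. case p of Up i \<Rightarrow> \<one> | Lo j \<Rightarrow> k j | Mid j \<Rightarrow> undefined) (jn x y) \<longleftrightarrow>
     (\<forall>i\<in>{1..n}. y (\<sigma> i) = (fst (x i), snd (x i) \<otimes> k (\<sigma> i)))"
    unfolding fits_def fst_conv snd_conv ball_simps(9)
  proof (intro ball_cong refl)
    fix i assume i: "i \<in> {1..n}"
    then have si: "\<sigma> i \<in> {1..n}" using permutes_in_image[OF s] by blast
    have c: "snd (x i) \<in> carrier G" "snd (y (\<sigma> i)) \<in> carrier G" "k (\<sigma> i) \<in> carrier G" using v k i si by (auto simp: val1_def)
    have e: "inv (snd (x i)) \<otimes> snd (y (\<sigma> i)) = k (\<sigma> i) \<longleftrightarrow> snd (y (\<sigma> i)) = snd (x i) \<otimes> k (\<sigma> i)"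
      using c by (metis inv_solve_left)
    have e2: "inv (snd (y (\<sigma> i))) \<otimes> snd (x i) = inv (k (\<sigma> i))" if "snd (y (\<sigma> i)) = snd (x i) \<otimes> k (\<sigma> i)"
      using c by (simp add: that inv_mult_group m_assoc)
    show "(\<forall>p\<in>{Up i, Lo (\<sigma> i)}. \<forall>q\<in>{Up i, Lo (\<sigma> i)}. fst (jn x y p) = fst (jn x y q) \<and>
        inv (snd (jn x y p)) \<otimes> snd (jn x y q) = inv ((\<lambda>p\<in>points n n. case p of Up i \<Rightarrow> \<one> | Lo j \<Rightarrow> k j | Mid j \<Rightarrow> undefined) p) \<otimes>
          (\<lambda>p\<in>points n n. case p of Up i \<Rightarrow> \<one> | Lo j \<Rightarrow> k j | Mid j \<Rightarrow> undefined) q) \<longleftrightarrow>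
      y (\<sigma> i) = (fst (x i), snd (x i) \<otimes> k (\<sigma> i))"
      using i si c e e2 by (auto simp: points_def prod_eq_iff)
  qed
  then show ?thesis unfolding strands_def by (subst adm_diag[OF strands_labeled[OF s k]]) auto
qed

lemma strands_in_P: "\<sigma> permutes {1..n} \<Longrightarrow> (\<And>i. i \<in> {1..n} \<Longrightarrow> k i \<in> carrier G) \<Longrightarrow> strands G n \<sigma> k \<in> P G n n"
  unfolding strands_def by (intro diag_in_P strands_labeled)

lemma id_in_P: "id_diag G n \<in> P G n n"
  unfolding id_diag_def by (rule strands_in_P) (auto simp: permutes_id)

lemma basis_hom: "f \<in> P G a b \<Longrightarrow> basis f \<in> Hom (Gcat G t) a b"
  by (auto simp: Gcat_hom basis_def)

lemma ker_id:
  assumes "val1 n x" "val1 n y"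
  shows "ker n n (basis (id_diag G n)) (jn x y) = of_bool (\<forall>i\<in>{1..n}. x i = y i)"
proof -
  have "adm (id_diag G n) (jn x y) \<longleftrightarrow> (\<forall>i\<in>{1..n}. x i = y i)"
    unfolding id_diag_def using assms
    by (subst adm_strands) (auto simp: permutes_id prod_eq_iff val1_def)
  then show ?thesis by (simp add: ker_basis id_in_P)
qed

lemma conf_eq: "x \<in> conf R n \<Longrightarrow> y \<in> conf R n \<Longrightarrow> (\<forall>i\<in>{1..n}. x i = y i) \<longleftrightarrow> x = y"
  unfolding conf_def by (metis PiE_ext)

text \<open>Bilinearity is visible pointwise. The identity laws are identities of kernels, where the
  identity diagram gives the identity matrix.\<close>

lemma Gcat_linear: "linear_category (Gcat G (t :: 'k::field_char_0))"
proof
  fix A B E K :: nat and f f' g g' h :: "'a gdiag \<Rightarrow> 'k" and c :: 'k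
  show "Comp (Gcat G t) A B E (g + g') f = Comp (Gcat G t) A B E g f + Comp (Gcat G t) A B E g' f"
    by (rule ext) (simp add: gcomp plus_fun_apply sum_fun_apply smul_apply algebra_simps sum.distrib)
  show "Comp (Gcat G t) A B E g (f + f') = Comp (Gcat G t) A B E g f + Comp (Gcat G t) A B E g f'"
    by (rule ext) (simp add: gcomp plus_fun_apply sum_fun_apply smul_apply algebra_simps sum.distrib)
  show "Comp (Gcat G t) A B E (smul c g) f = smul c (Comp (Gcat G t) A B E g f)"
    by (rule ext) (simp add: gcomp sum_fun_apply smul_apply sum_distrib_left mult.assoc)
  show "Comp (Gcat G t) A B E g (smul c f) = smul c (Comp (Gcat G t) A B E g f)"
    by (rule ext) (simp add: gcomp sum_fun_apply smul_apply sum_distrib_left mult.assoc mult.left_commute)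
  show "Comp (Gcat G t) A E K h (Comp (Gcat G t) A B E g f) = Comp (Gcat G t) A B K (Comp (Gcat G t) B E K h g) f"
    by (rule gcomp_assoc)
  assume f: "f \<in> Hom (Gcat G t) A B"
  show "Comp (Gcat G t) A B B (Idm (Gcat G t) B) f = f"
    unfolding Gcat_sel
  proof (rule gcomp_eqI[OF f])
    fix N x z assume c: "x \<in> conf {1..N} A" "z \<in> conf {1..N} B"
    have "(\<Sum>y\<in>conf {1..N} B. ker A B f (jn x y) * ker B B (basis (id_diag G B)) (jn y z)) = (\<Sum>y\<in>conf {1..N} B. if y = z then ker A B f (jn x z) else 0)"
      by (rule sum.cong) (use c conf_eq in \<open>auto simp: ker_id conf_val1\<close>)
    then show "(\<Sum>y\<in>conf {1..N} B. ker A B f (jn x y) * ker B B (basis (id_diag G B)) (jn y z)) = ker A B f (jn x z)"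
      using c finite_conf[of "{1..N}" B] by (simp add: sum.delta)
  qed
  show "Comp (Gcat G t) A A B f (Idm (Gcat G t) A) = f"
    unfolding Gcat_sel
  proof (rule gcomp_eqI[OF f])
    fix N x z assume c: "x \<in> conf {1..N} A" "z \<in> conf {1..N} B"
    have "(\<Sum>y\<in>conf {1..N} A. ker A A (basis (id_diag G A)) (jn x y) * ker A B f (jn y z)) = (\<Sum>y\<in>conf {1..N} A. if y = x then ker A B f (jn x z) else 0)"
      by (rule sum.cong) (use c conf_eq in \<open>auto simp: ker_id conf_val1\<close>)
    then show "(\<Sum>y\<in>conf {1..N} A. ker A A (basis (id_diag G A)) (jn x y) * ker A B f (jn y z)) = ker A B f (jn x z)"
      using c finite_conf[of "{1..N}" A] by (simp add: sum.delta)
  qed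
qed (auto simp: Gcat_hom gcomp_hom[unfolded Gcat_hom] basis_hom[OF id_in_P, unfolded Gcat_hom] plus_fun_apply smul_apply zero_fun_apply)

end

section \<open>Representations of the wreath product\<close>

lemma bmat_comp_apply: "bmat_comp B N M (z, x) = (\<Sum>y\<in>B. N (z, y) * M (y, x))"
  by (simp add: bmat_comp_def)

lemma bmat_eqI: "(\<And>z x. M (z, x) = N (z, x)) \<Longrightarrow> M = N"
  by auto

lemma bmat_assoc: "bmat_comp B2 L (bmat_comp B1 N M) = bmat_comp B1 (bmat_comp B2 L N) M"
proof (rule bmat_eqI)
  fix z x
  have "bmat_comp B2 L (bmat_comp B1 N M) (z, x) = (\<Sum>y\<in>B2. \<Sum>w\<in>B1. L (z, y) * N (y, w) * M (w, x))"
    by (simp add: bmat_comp_apply sum_distrib_left mult.assoc)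
  also have "\<dots> = (\<Sum>w\<in>B1. \<Sum>y\<in>B2. L (z, y) * N (y, w) * M (w, x))" by (rule sum.swap)
  finally show "bmat_comp B2 L (bmat_comp B1 N M) (z, x) = bmat_comp B1 (bmat_comp B2 L N) M (z, x)"
    by (simp add: bmat_comp_apply sum_distrib_right)
qed

lemma bmat_id_left: "finite B' \<Longrightarrow> M \<in> bmats B B' \<Longrightarrow> bmat_comp B' (bmat_id B') M = M"
proof (rule bmat_eqI)
  fix z x assume "finite B'" "M \<in> bmats B B'"
  then show "bmat_comp B' (bmat_id B') M (z, x) = M (z, x)"
    by (auto simp: bmat_comp_apply bmat_id_def bmats_def if_distrib[of "\<lambda>c. c * _"] sum.delta cong: if_cong conj_cong)
qed

lemma bmat_id_right: "finite B \<Longrightarrow> M \<in> bmats B B' \<Longrightarrow> bmat_comp B M (bmat_id B) = M"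
proof (rule bmat_eqI)
  fix z x assume "finite B" "M \<in> bmats B B'"
  then show "bmat_comp B M (bmat_id B) (z, x) = M (z, x)"
    by (cases "x \<in> B") (auto simp: bmat_comp_apply bmat_id_def bmats_def if_distrib[of "\<lambda>c. _ * c"] sum.delta cong: if_cong conj_cong)
qed

lemma Rep_obj: "(B, \<rho>) \<in> Obj (Rep H) \<longleftrightarrow> finite B \<and> (\<forall>h\<in>carrier H. \<rho> h \<in> bmats B B) \<and> \<rho> \<one>\<^bsub>H\<^esub> = bmat_id B \<and>
    (\<forall>h\<in>carrier H. \<forall>h'\<in>carrier H. \<rho> (h \<otimes>\<^bsub>H\<^esub> h') = bmat_comp B (\<rho> h) (\<rho> h'))"
  by (simp add: Rep_def)

lemma Rep_hom: "M \<in> Hom (Rep H) (B, \<rho>) (B', \<rho>') \<longleftrightarrow> M \<in> bmats B B' \<and> (\<forall>h\<in>carrier H. bmat_comp B' (\<rho>' h) M = bmat_comp B M (\<rho> h))"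
  by (simp add: Rep_def)

lemma Rep_sel: "Idm (Rep H) (B, \<rho>) = bmat_id B" "Comp (Rep H) A (B, \<rho>) E = bmat_comp B" "Unit (Rep H) = ({[]}, \<lambda>h. bmat_id {[]})"
  by (simp_all add: Rep_def)

lemma bmat_add_left: "bmat_comp B (N + N') M = bmat_comp B N M + bmat_comp B N' M"
  and bmat_add_right: "bmat_comp B N (M + M') = bmat_comp B N M + bmat_comp B N M'"
  and bmat_smul_left: "bmat_comp B (smul c N) M = smul c (bmat_comp B N M)"
  and bmat_smul_right: "bmat_comp B N (smul c M) = smul c (bmat_comp B N M)"
  by (rule bmat_eqI, simp add: bmat_comp_apply fun_ev algebra_simps sum.distrib sum_distrib_left)+

lemma bmat_zero: "bmat_comp B 0 M = 0" "bmat_comp B N 0 = 0"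
  by (rule bmat_eqI, simp add: bmat_comp_apply fun_ev)+

lemma bmats_closed: "0 \<in> bmats B B'" "M \<in> bmats B B' \<Longrightarrow> N \<in> bmats B B' \<Longrightarrow> M + N \<in> bmats B B'" "M \<in> bmats B B' \<Longrightarrow> smul c M \<in> bmats B B'"
  "M \<in> bmats B B' \<Longrightarrow> N \<in> bmats B' B'' \<Longrightarrow> bmat_comp B' N M \<in> bmats B B''"
  by (auto simp: bmats_def fun_ev bmat_comp_apply)

lemma Rep_linear:
  fixes H :: "('h, 'z) monoid_scheme"
  shows "linear_category (Rep H :: (('h, 'i list, 'k::field) rep, 'i list \<times> 'i list, 'k) lincat)"
proof
  fix A B E K :: "('h, 'i list, 'k) rep" and f f' g g' h :: "'i list \<times> 'i list \<Rightarrow> 'k" and c :: 'k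
  obtain A' \<alpha> B' \<beta> E' \<epsilon> K' \<kappa> where [simp]: "A = (A', \<alpha>)" "B = (B', \<beta>)" "E = (E', \<epsilon>)" "K = (K', \<kappa>)" by fastforce
  show "Comp (Rep H) A B E (g + g') f = Comp (Rep H) A B E g f + Comp (Rep H) A B E g' f"
    "Comp (Rep H) A B E g (f + f') = Comp (Rep H) A B E g f + Comp (Rep H) A B E g f'"
    "Comp (Rep H) A B E (smul c g) f = smul c (Comp (Rep H) A B E g f)"
    "Comp (Rep H) A B E g (smul c f) = smul c (Comp (Rep H) A B E g f)"
    by (simp_all add: Rep_sel bmat_add_left bmat_add_right bmat_smul_left bmat_smul_right)
  show "Comp (Rep H) A E K h (Comp (Rep H) A B E g f) = Comp (Rep H) A B K (Comp (Rep H) B E K h g) f"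
    by (simp add: Rep_sel bmat_assoc)
  assume A: "A \<in> Obj (Rep H)"
  show "Idm (Rep H) A \<in> Hom (Rep H) A A"
    using A by (auto simp: Rep_sel Rep_hom Rep_obj bmat_id_left[of _ _ A'] bmat_id_right[of _ _ A']) (auto simp: bmats_def bmat_id_def)
  assume B: "B \<in> Obj (Rep H)"
  show "0 \<in> Hom (Rep H) A B" by (simp add: Rep_hom bmats_closed bmat_zero)
  assume f: "f \<in> Hom (Rep H) A B"
  show "smul c f \<in> Hom (Rep H) A B" using f by (simp add: Rep_hom bmats_closed bmat_smul_left bmat_smul_right)
  show "f' \<in> Hom (Rep H) A B \<Longrightarrow> f + f' \<in> Hom (Rep H) A B"
    using f by (simp add: Rep_hom bmats_closed bmat_add_left bmat_add_right)
  show "Comp (Rep H) A B B (Idm (Rep H) B) f = f" "Comp (Rep H) A A B f (Idm (Rep H) A) = f"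
    using A B f by (auto simp: Rep_sel Rep_hom Rep_obj bmat_id_left[of _ _ A'] bmat_id_right[of _ _ B'])
  assume E: "E \<in> Obj (Rep H)" and g: "g \<in> Hom (Rep H) B E"
  show "Comp (Rep H) A B E g f \<in> Hom (Rep H) A E"
    using f g by (auto simp: Rep_sel Rep_hom bmats_closed bmat_assoc) (simp add: bmat_assoc[symmetric])
qed

section \<open>The wreath product and its action\<close>

locale wreath_rep = fin_group G for G :: "('a, 'b) monoid_scheme" (structure) +
  fixes n :: nat and \<theta> :: "nat \<Rightarrow> 'a"
  assumes \<theta>: "bij_betw \<theta> {1..order G} (carrier G)"
begin

abbreviation "H \<equiv> wreath G n"
abbreviation "act h \<equiv> map (wreath_act G \<theta> h)"

definition pairs :: "(nat \<times> nat) set" where "pairs = {1..n} \<times> {1..order G}"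

text \<open>\<open>dec\<close> and \<open>cod\<close> translate, by means of \<theta>, between the
  index pairs of the basis of \<open>W\<close> and the pairs of a row and a group element on which
  kernels are evaluated.\<close>

definition dec :: "nat \<times> nat \<Rightarrow> nat \<times> 'a" where "dec p = (fst p, \<theta> (snd p))"
definition cod :: "nat \<times> 'a \<Rightarrow> nat \<times> nat" where "cod q = (fst q, inv_into {1..order G} \<theta> (snd q))"
definition hact :: "(nat \<Rightarrow> 'a) \<times> (nat \<Rightarrow> nat) \<Rightarrow> nat \<times> 'a \<Rightarrow> nat \<times> 'a" where
  "hact h q = (snd h (fst q), fst h (snd h (fst q)) \<otimes> snd q)"

lemma dec_cod [simp]: "snd q \<in> carrier G \<Longrightarrow> dec (cod q) = q"
  using bij_betw_inv_into_right[OF \<theta>] by (simp add: dec_def cod_def)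

lemma cod_dec [simp]: "p \<in> pairs \<Longrightarrow> cod (dec p) = p"
  using bij_betw_inv_into_left[OF \<theta>] by (auto simp: dec_def cod_def pairs_def)

lemma dec_mem: "p \<in> pairs \<Longrightarrow> fst (dec p) \<in> {1..n} \<and> snd (dec p) \<in> carrier G"
  using bij_betwE[OF \<theta>] by (auto simp: dec_def pairs_def)

lemma cod_mem: "fst q \<in> {1..n} \<Longrightarrow> snd q \<in> carrier G \<Longrightarrow> cod q \<in> pairs"
  using bij_betwE[OF bij_betw_inv_into[OF \<theta>]] by (auto simp: cod_def pairs_def)

lemma cod_fst [simp]: "fst (cod q) = fst q" and dec_fst [simp]: "fst (dec p) = fst p"
  by (simp_all add: cod_def dec_def)

lemma wreath_act_cod: "wreath_act G \<theta> h p = cod (hact h (dec p))"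
  by (cases h; cases p) (simp add: wreath_act_def cod_def hact_def dec_def)

lemma H_carrier: "h \<in> carrier H \<longleftrightarrow> fst h \<in> {1..n} \<rightarrow>\<^sub>E carrier G \<and> snd h permutes {1..n}"
  by (cases h) (auto simp: wreath_def)

lemma H_sel: "\<one>\<^bsub>H\<^esub> = (\<lambda>i\<in>{1..n}. \<one>, id)"
  "(k, \<sigma>) \<otimes>\<^bsub>H\<^esub> (k', \<sigma>') = (\<lambda>i\<in>{1..n}. k i \<otimes> k' (inv_into UNIV \<sigma> i), \<sigma> \<circ> \<sigma>')"
  by (simp_all add: wreath_def)

lemma hact_mem:
  assumes "h \<in> carrier H" "fst q \<in> {1..n}" "snd q \<in> carrier G"
  shows "fst (hact h q) \<in> {1..n}" "snd (hact h q) \<in> carrier G"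
proof -
  show 1: "fst (hact h q) \<in> {1..n}" using assms permutes_in_image[of "snd h" "{1..n}"] by (simp add: hact_def H_carrier)
  then show "snd (hact h q) \<in> carrier G" using assms by (auto simp: hact_def H_carrier)
qed

lemma hact_mult:
  assumes "h \<in> carrier H" "h' \<in> carrier H" "fst q \<in> {1..n}" "snd q \<in> carrier G"
  shows "hact (h \<otimes>\<^bsub>H\<^esub> h') q = hact h (hact h' q)"
proof -
  obtain k \<sigma> k' \<sigma>' where [simp]: "h = (k, \<sigma>)" "h' = (k', \<sigma>')" by fastforce
  have s: "\<sigma> permutes {1..n}" "\<sigma>' permutes {1..n}" and k: "k \<in> {1..n} \<rightarrow>\<^sub>E carrier G" "k' \<in> {1..n} \<rightarrow>\<^sub>E carrier G"
    using assms by (auto simp: H_carrier)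
  have m: "\<sigma>' (fst q) \<in> {1..n}" "\<sigma> (\<sigma>' (fst q)) \<in> {1..n}" using s assms(3) by (simp_all only: permutes_in_image)
  have "inv_into UNIV \<sigma> (\<sigma> (\<sigma>' (fst q))) = \<sigma>' (fst q)" using permutes_inverses(2)[OF s(1)] .
  then show ?thesis using m PiE_mem[OF k(1) m(2)] PiE_mem[OF k(2) m(1)] assms(4)
    by (simp add: H_sel hact_def m_assoc del: atLeastAtMost_iff)
qed

lemma hact_one: "fst q \<in> {1..n} \<Longrightarrow> snd q \<in> carrier G \<Longrightarrow> hact \<one>\<^bsub>H\<^esub> q = q"
  by (simp add: H_sel hact_def)

text \<open>One test point per row determines the permutation, and cancellation then gives the
  component of \<open>G\<close> at each image row.\<close>

lemma hact_inj: "h \<in> carrier H \<Longrightarrow> h' \<in> carrier H \<Longrightarrow> (\<And>i. i \<in> {1..n} \<Longrightarrow> \<exists>g\<in>carrier G. hact h (i, g) = hact h' (i, g)) \<Longrightarrow> h = h'"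
proof -
  assume h: "h \<in> carrier H" "h' \<in> carrier H" and e: "\<And>i. i \<in> {1..n} \<Longrightarrow> \<exists>g\<in>carrier G. hact h (i, g) = hact h' (i, g)"
  have s: "snd h i = snd h' i" for i
  proof (cases "i \<in> {1..n}")
    case True
    then show ?thesis using e[OF True] by (auto simp: hact_def)
  next
    case False
    then show ?thesis using h by (metis H_carrier permutes_not_in)
  qed
  have "fst h j = fst h' j" if j: "j \<in> {1..n}" for j
  proof -
    obtain i where i: "i \<in> {1..n}" "snd h i = j" using h(1) j permutes_image by (metis H_carrier imageE)
    obtain g where g: "g \<in> carrier G" "hact h (i, g) = hact h' (i, g)" using e[OF i(1)] by blast
    then have "fst h j \<otimes> g = fst h' j \<otimes> g" using i s by (simp add: hact_def)
    moreover have "fst h j \<in> carrier G" "fst h' j \<in> carrier G"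
      using h[unfolded H_carrier] PiE_mem[of "fst h" "{1..n}" "\<lambda>_. carrier G" j] PiE_mem[of "fst h'" "{1..n}" "\<lambda>_. carrier G" j] j by blast+
    ultimately show ?thesis using g(1) by simp
  qed
  then have "fst h = fst h'" using PiE_ext[of "fst h" "{1..n}" "\<lambda>_. carrier G" "fst h'"] h[unfolded H_carrier] by blast
  moreover have "snd h = snd h'" using s by auto
  ultimately show "h = h'" by (simp add: prod_eq_iff)
qed

lemma H_mult_closed: "h \<in> carrier H \<Longrightarrow> h' \<in> carrier H \<Longrightarrow> h \<otimes>\<^bsub>H\<^esub> h' \<in> carrier H"
proof -
  assume h: "h \<in> carrier H" "h' \<in> carrier H"
  obtain k \<sigma> k' \<sigma>' where [simp]: "h = (k, \<sigma>)" "h' = (k', \<sigma>')" by fastforce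
  have s: "\<sigma> permutes {1..n}" "\<sigma>' permutes {1..n}" and k: "k \<in> {1..n} \<rightarrow>\<^sub>E carrier G" "k' \<in> {1..n} \<rightarrow>\<^sub>E carrier G"
    using h by (auto simp: H_carrier)
  have "k i \<otimes> k' (inv_into UNIV \<sigma> i) \<in> carrier G" if "i \<in> {1..n}" for i
  proof -
    have "inv_into UNIV \<sigma> i \<in> {1..n}" using permutes_in_image[OF permutes_inv[OF s(1)]] that by simp
    then show ?thesis using PiE_mem[OF k(1) that] PiE_mem[OF k(2)] by simp
  qed
  then show ?thesis using permutes_compose[OF s(2,1)] by (simp add: H_carrier H_sel del: atLeastAtMost_iff)
qed

text \<open>The laws are inherited from the composition of maps: \<open>hact\<close> is
  multiplicative and faithful, so no computation with the twisted multiplication is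
  required.\<close>

lemma group_H: "group H"
proof (rule groupI)
  show one: "\<one>\<^bsub>H\<^esub> \<in> carrier H" by (simp add: H_carrier H_sel permutes_id)
  show cl: "x \<otimes>\<^bsub>H\<^esub> y \<in> carrier H" if "x \<in> carrier H" "y \<in> carrier H" for x y by (rule H_mult_closed[OF that])
  note fm = hact_mem[simplified]
  fix x assume x: "x \<in> carrier H"
  show "\<one>\<^bsub>H\<^esub> \<otimes>\<^bsub>H\<^esub> x = x"
    by (rule hact_inj[OF cl[OF one x] x]) (auto simp: hact_mult x one hact_one fm intro!: bexI[of _ \<one>])
  show "(x \<otimes>\<^bsub>H\<^esub> y) \<otimes>\<^bsub>H\<^esub> z = x \<otimes>\<^bsub>H\<^esub> (y \<otimes>\<^bsub>H\<^esub> z)" if y: "y \<in> carrier H" and z: "z \<in> carrier H" for y z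
    by (rule hact_inj[OF cl[OF cl[OF x y] z] cl[OF x cl[OF y z]]]) (auto simp: hact_mult x y z cl fm intro!: bexI[of _ \<one>])
  obtain k \<sigma> where [simp]: "x = (k, \<sigma>)" by fastforce
  have s: "\<sigma> permutes {1..n}" and k: "k \<in> {1..n} \<rightarrow>\<^sub>E carrier G" using x by (auto simp: H_carrier)
  define y where "y = (\<lambda>i\<in>{1..n}. inv (k (\<sigma> i)), inv_into UNIV \<sigma>)"
  have ks: "k (\<sigma> i) \<in> carrier G" if "i \<in> {1..n}" for i using PiE_mem[OF k] permutes_in_image[OF s] that by simp
  have y: "y \<in> carrier H" using ks permutes_inv[OF s] by (simp add: y_def H_carrier)
  have "y \<otimes>\<^bsub>H\<^esub> x = \<one>\<^bsub>H\<^esub>"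
  proof (rule hact_inj[OF cl[OF y x] one])
    fix i assume i: "i \<in> {1..n}"
    have "hact (y \<otimes>\<^bsub>H\<^esub> x) (i, \<one>) = hact y (hact x (i, \<one>))" using hact_mult[OF y x, of "(i, \<one>)"] i by simp
    also have "\<dots> = (i, \<one>)"
      using i ks[OF i] permutes_inverses(2)[OF s] by (simp add: hact_def y_def del: atLeastAtMost_iff)
    also have "\<dots> = hact \<one>\<^bsub>H\<^esub> (i, \<one>)" using i by (simp add: hact_one)
    finally show "\<exists>g\<in>carrier G. hact (y \<otimes>\<^bsub>H\<^esub> x) (i, g) = hact \<one>\<^bsub>H\<^esub> (i, g)" by blast
  qed
  then show "\<exists>y\<in>carrier H. y \<otimes>\<^bsub>H\<^esub> x = \<one>\<^bsub>H\<^esub>" using y by blast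
qed

sublocale H: group H by (rule group_H)

lemma wact_mem: "h \<in> carrier H \<Longrightarrow> p \<in> pairs \<Longrightarrow> wreath_act G \<theta> h p \<in> pairs"
  unfolding wreath_act_cod using dec_mem[of p] hact_mem[of h "dec p"] by (intro cod_mem) auto

lemma dec_wact: "h \<in> carrier H \<Longrightarrow> p \<in> pairs \<Longrightarrow> dec (wreath_act G \<theta> h p) = hact h (dec p)"
  unfolding wreath_act_cod using dec_mem[of p] hact_mem[of h "dec p"] by (intro dec_cod) auto

lemma wact_mult: "h \<in> carrier H \<Longrightarrow> h' \<in> carrier H \<Longrightarrow> p \<in> pairs \<Longrightarrow>
   wreath_act G \<theta> (h \<otimes>\<^bsub>H\<^esub> h') p = wreath_act G \<theta> h (wreath_act G \<theta> h' p)"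
  using hact_mult[of h h' "dec p"] dec_mem[of p] dec_wact[of h' p] by (simp add: wreath_act_cod[of h] wreath_act_cod[of "h \<otimes>\<^bsub>H\<^esub> h'"])

lemma wact_one: "p \<in> pairs \<Longrightarrow> wreath_act G \<theta> \<one>\<^bsub>H\<^esub> p = p"
  using hact_one[of "dec p"] dec_mem[of p] by (simp add: wreath_act_cod)

lemma act_mult: "h \<in> carrier H \<Longrightarrow> h' \<in> carrier H \<Longrightarrow> set xs \<subseteq> pairs \<Longrightarrow> act (h \<otimes>\<^bsub>H\<^esub> h') xs = act h (act h' xs)"
  by (auto simp: wact_mult subset_iff)

lemma act_one: "set xs \<subseteq> pairs \<Longrightarrow> act \<one>\<^bsub>H\<^esub> xs = xs"
  by (rule map_idI) (metis subsetD wact_one)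

section \<open>Permutation representations\<close>

definition stable :: "(nat \<times> nat) list set \<Rightarrow> bool" where
  "stable B \<longleftrightarrow> finite B \<and> (\<forall>xs\<in>B. set xs \<subseteq> pairs) \<and> (\<forall>h\<in>carrier H. \<forall>xs\<in>B. act h xs \<in> B)"

definition perm_rep :: "(nat \<times> nat) list set \<Rightarrow> ((nat \<Rightarrow> 'a) \<times> (nat \<Rightarrow> nat), (nat \<times> nat) list, 'k::field_char_0) rep" where
  "perm_rep B = (B, \<lambda>h (ys, xs). if xs \<in> B \<and> ys = act h xs then 1 else 0)"

lemma act_inv: "h \<in> carrier H \<Longrightarrow> set xs \<subseteq> pairs \<Longrightarrow> act (inv\<^bsub>H\<^esub> h) (act h xs) = xs" "h \<in> carrier H \<Longrightarrow> set xs \<subseteq> pairs \<Longrightarrow> act h (act (inv\<^bsub>H\<^esub> h) xs) = xs"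
  using act_mult[of "inv\<^bsub>H\<^esub> h" h xs] act_mult[of h "inv\<^bsub>H\<^esub> h" xs] act_one[of xs] by simp_all

lemma stableD: "stable B \<Longrightarrow> finite B" "stable B \<Longrightarrow> xs \<in> B \<Longrightarrow> set xs \<subseteq> pairs" "stable B \<Longrightarrow> h \<in> carrier H \<Longrightarrow> xs \<in> B \<Longrightarrow> act h xs \<in> B"
  by (auto simp: stable_def)

lemma perm_rep_obj: "stable B \<Longrightarrow> (perm_rep B :: (_, _, 'k::field_char_0) rep) \<in> Obj (Rep H)"
  unfolding perm_rep_def Rep_obj
proof (intro conjI ballI)
  assume s: "stable B"
  note sd = stableD[OF s]
  let ?\<rho> = "\<lambda>h (ys, xs). if xs \<in> B \<and> ys = act h xs then 1 else (0::'k)"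
  show "finite B" by (rule sd)
  show "?\<rho> h \<in> bmats B B" if "h \<in> carrier H" for h using sd(3)[OF that] by (auto simp: bmats_def)
  show "?\<rho> \<one>\<^bsub>H\<^esub> = bmat_id B" using act_one[OF sd(2)] by (auto simp: bmat_id_def fun_eq_iff)
  fix h h' assume h: "h \<in> carrier H" "h' \<in> carrier H"
  show "?\<rho> (h \<otimes>\<^bsub>H\<^esub> h') = bmat_comp B (?\<rho> h) (?\<rho> h')"
  proof (rule bmat_eqI)
    fix z x
    have "bmat_comp B (?\<rho> h) (?\<rho> h') (z, x) = (\<Sum>y\<in>B. if y = act h' x then if x \<in> B \<and> z = act h (act h' x) then 1 else 0 else 0)"
      unfolding bmat_comp_apply by (rule sum.cong) auto
    then show "?\<rho> (h \<otimes>\<^bsub>H\<^esub> h') (z, x) = bmat_comp B (?\<rho> h) (?\<rho> h') (z, x)"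
      using sd(1) sd(3)[OF h(2), of x] act_mult[OF h sd(2), of x] by (auto simp: sum.delta)
  qed
qed

text \<open>Composing with the permutation matrix of \<open>h\<close> only moves an argument, by
  \<open>inv h\<close> on the left and by \<open>h\<close> on the right. So intertwiners are the
  matrices constant on orbits of pairs of basis elements.\<close>

lemma perm_rep_hom:
  assumes B: "stable B" and B': "stable B'"
  shows "M \<in> Hom (Rep H) (perm_rep B) (perm_rep B') \<longleftrightarrow>
    M \<in> bmats B B' \<and> (\<forall>h\<in>carrier H. \<forall>xs\<in>B. \<forall>ys\<in>B'. M (act h ys, act h xs) = (M (ys, xs) :: 'k::field_char_0))"
proof -
  let ?\<rho> = "\<lambda>B h (ys, xs). if xs \<in> B \<and> ys = act h xs then 1 else (0::'k)"
  have "(bmat_comp B' (?\<rho> B' h) M = bmat_comp B M (?\<rho> B h)) \<longleftrightarrow> (\<forall>xs\<in>B. \<forall>ys\<in>B'. M (act h ys, act h xs) = M (ys, xs))"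
    if M: "M \<in> bmats B B'" and h: "h \<in> carrier H" for h
  proof -
    note hi = H.inv_closed[OF h]
    have l: "bmat_comp B' (?\<rho> B' h) M (z, x) = (if z \<in> B' then M (act (inv\<^bsub>H\<^esub> h) z, x) else 0)" for z x
    proof -
      have "bmat_comp B' (?\<rho> B' h) M (z, x) = (\<Sum>y\<in>B'. if y = act (inv\<^bsub>H\<^esub> h) z then if z \<in> B' then M (y, x) else 0 else 0)"
        unfolding bmat_comp_apply
      proof (rule sum.cong[OF refl])
        fix y assume y: "y \<in> B'"
        have "z = act h y \<longleftrightarrow> y = act (inv\<^bsub>H\<^esub> h) z \<and> z \<in> B'"
          using act_inv[OF h stableD(2)[OF B' y]] act_inv(2)[OF h stableD(2)[OF B'], of z] stableD(3)[OF B' h y] by auto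
        then show "?\<rho> B' h (z, y) * M (y, x) = (if y = act (inv\<^bsub>H\<^esub> h) z then if z \<in> B' then M (y, x) else 0 else 0)" using y by auto
      qed
      then show ?thesis using stableD(1)[OF B'] stableD(3)[OF B' hi, of z] by (simp add: sum.delta)
    qed
    have r: "bmat_comp B M (?\<rho> B h) (z, x) = (if x \<in> B then M (z, act h x) else 0)" for z x
    proof -
      have "bmat_comp B M (?\<rho> B h) (z, x) = (\<Sum>y\<in>B. if y = act h x then if x \<in> B then M (z, y) else 0 else 0)"
        unfolding bmat_comp_apply by (rule sum.cong) auto
      then show ?thesis using stableD(1)[OF B] stableD(3)[OF B h, of x] by (simp add: sum.delta)
    qed
    show ?thesis
    proof
      assume e: "bmat_comp B' (?\<rho> B' h) M = bmat_comp B M (?\<rho> B h)"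
      show "\<forall>xs\<in>B. \<forall>ys\<in>B'. M (act h ys, act h xs) = M (ys, xs)"
      proof (intro ballI)
        fix xs ys assume "xs \<in> B" "ys \<in> B'"
        then show "M (act h ys, act h xs) = M (ys, xs)"
          using fun_cong[OF e, of "(act h ys, xs)"] act_inv(1)[OF h stableD(2)[OF B']] stableD(3)[OF B' h] unfolding l r by simp
      qed
    next
      assume a: "\<forall>xs\<in>B. \<forall>ys\<in>B'. M (act h ys, act h xs) = M (ys, xs)"
      show "bmat_comp B' (?\<rho> B' h) M = bmat_comp B M (?\<rho> B h)"
      proof (rule bmat_eqI)
        fix z x
        show "bmat_comp B' (?\<rho> B' h) M (z, x) = bmat_comp B M (?\<rho> B h) (z, x)"
        proof (cases "z \<in> B' \<and> x \<in> B")
          case True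
          then have "act (inv\<^bsub>H\<^esub> h) z \<in> B'" using stableD(3)[OF B' hi] by simp
          then have "M (act h (act (inv\<^bsub>H\<^esub> h) z), act h x) = M (act (inv\<^bsub>H\<^esub> h) z, x)" using a True by blast
          then show ?thesis unfolding l r using True act_inv(2)[OF h stableD(2)[OF B'], of z] by simp
        next
          case False
          then show ?thesis unfolding l r using M by (auto simp: bmats_def)
        qed
      qed
    qed
  qed
  then show ?thesis unfolding perm_rep_def Rep_hom by blast
qed

lemma W_mem: "xs \<in> W_basis G n a \<longleftrightarrow> length xs = a \<and> set xs \<subseteq> pairs"
  by (simp add: W_basis_def pairs_def)

lemma W_stable: "stable (W_basis G n a)"
  unfolding stable_def
proof (intro conjI ballI)
  have "W_basis G n a \<subseteq> {xs. set xs \<subseteq> pairs \<and> length xs = a}" by (auto simp: W_basis_def pairs_def)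
  moreover have "finite {xs. set xs \<subseteq> pairs \<and> length xs = a}" by (rule finite_lists_length_eq) (simp add: pairs_def)
  ultimately show "finite (W_basis G n a)" by (rule finite_subset)
  show "set xs \<subseteq> pairs" if "xs \<in> W_basis G n a" for xs using that by (simp add: W_basis_def pairs_def)
  show "act h xs \<in> W_basis G n a" if "h \<in> carrier H" "xs \<in> W_basis G n a" for h xs
  proof -
    have "wreath_act G \<theta> h ` set xs \<subseteq> pairs" using that(2) wact_mem[OF that(1)] unfolding W_mem by blast
    then show ?thesis using that(2) by (simp add: W_mem)
  qed
qed

lemma W_pow_perm: "W_pow G n \<theta> a = perm_rep (W_basis G n a)"
  by (simp add: W_pow_def perm_rep_def)

text \<open>The basis of a copy of the regular representation inside
  \<open>W\<^sup>\<otimes>\<^sup>n\<close>: by \<open>B0_transitive\<close> the wreath product acts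
  on it simply transitively.\<close>

definition B0 :: "(nat \<times> nat) list set" where
  "B0 = {xs \<in> W_basis G n n. distinct (map fst xs)}"

lemma B0_W: "B0 \<subseteq> W_basis G n n"
  by (auto simp: B0_def)

lemma B0_pairs: "xs \<in> B0 \<Longrightarrow> set xs \<subseteq> pairs" and B0_length: "xs \<in> B0 \<Longrightarrow> length xs = n"
  by (auto simp: B0_def W_basis_def pairs_def)

lemma fst_act: "map fst (act h xs) = map (snd h) (map fst xs)"
  by (cases h) (auto simp: wreath_act_def)

lemma B0_stable: "stable B0"
  unfolding stable_def
proof (intro conjI ballI)
  show "finite B0" using stableD(1)[OF W_stable] B0_W by (rule finite_subset[rotated])
  show "set xs \<subseteq> pairs" if "xs \<in> B0" for xs using that by (rule B0_pairs)
  show "act h xs \<in> B0" if h: "h \<in> carrier H" and xs: "xs \<in> B0" for h xs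
  proof -
    have "inj (snd h)" using h permutes_inj by (auto simp: H_carrier)
    then have "distinct (map fst (act h xs))" unfolding fst_act using xs by (simp add: B0_def distinct_map inj_on_def inj_def)
    then show ?thesis using stableD(3)[OF W_stable h] xs by (simp add: B0_def)
  qed
qed

lemma B0_rows: "xs \<in> B0 \<Longrightarrow> bij_betw (\<lambda>i. fst (xs ! i)) {..<n} {1..n}"
proof -
  assume xs: "xs \<in> B0"
  then have d: "distinct (map fst xs)" "length xs = n" "set (map fst xs) \<subseteq> {1..n}" by (auto simp: B0_def W_basis_def)
  have inj: "inj_on (\<lambda>i. fst (xs ! i)) {..<n}"
    using d by (auto simp: distinct_conv_nth inj_on_def)
  moreover have "(\<lambda>i. fst (xs ! i)) ` {..<n} = {1..n}"
  proof (rule card_subset_eq)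
    show "(\<lambda>i. fst (xs ! i)) ` {..<n} \<subseteq> {1..n}" using d by (force simp: set_conv_nth)
    show "card ((\<lambda>i. fst (xs ! i)) ` {..<n}) = card {1..n}" using card_image[OF inj] by simp
  qed simp
  ultimately show ?thesis by (simp add: bij_betw_def)
qed

text \<open>By \<open>B0_rows\<close> every row occurs exactly once in each of the two tuples, so
  comparing the tuples position by position prescribes where each row goes and by which group
  element it is multiplied, and nothing else is left to choose.\<close>

lemma B0_transitive:
  assumes xs: "xs \<in> B0" and ys: "ys \<in> B0"
  shows "\<exists>!h. h \<in> carrier H \<and> act h xs = ys"
proof -
  define r where "r = (\<lambda>i. fst (xs ! i))"
  define s where "s = (\<lambda>i. fst (ys ! i))"
  have r: "bij_betw r {..<n} {1..n}" and s: "bij_betw s {..<n} {1..n}" unfolding r_def s_def using B0_rows xs ys by auto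
  define ri where "ri = inv_into {..<n} r"
  define si where "si = inv_into {..<n} s"
  \<comment> \<open>The row \<open>r i\<close> of \<open>xs\<close> has to move to the row
    \<open>s i\<close> of \<open>ys\<close>.\<close>
  define \<sigma> where "\<sigma> j = (if j \<in> {1..n} then s (ri j) else j)" for j
  have ri: "bij_betw ri {1..n} {..<n}" and rir: "\<And>i. i < n \<Longrightarrow> ri (r i) = i"
    unfolding ri_def using bij_betw_inv_into[OF r] bij_betw_inv_into_left[OF r] by auto
  have si: "bij_betw si {1..n} {..<n}" and sis: "\<And>i. i < n \<Longrightarrow> si (s i) = i"
    unfolding si_def using bij_betw_inv_into[OF s] bij_betw_inv_into_left[OF s] by auto
  have "bij_betw \<sigma> {1..n} {1..n}"
    using bij_betw_trans[OF ri s] by (rule bij_betw_cong[THEN iffD1, rotated]) (simp add: \<sigma>_def)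
  then have sp: "\<sigma> permutes {1..n}" by (rule bij_imp_permutes) (auto simp: \<sigma>_def)
  define gx where "gx i = snd (dec (xs ! i))" for i
  define gy where "gy i = snd (dec (ys ! i))" for i
  have xp: "xs ! i \<in> pairs" "ys ! i \<in> pairs" if "i < n" for i using B0_pairs B0_length xs ys that by (metis nth_mem subsetD)+
  have gc: "gx i \<in> carrier G" "gy i \<in> carrier G" if "i < n" for i using dec_mem xp[OF that] by (auto simp: gx_def gy_def)
  \<comment> \<open>Indexed by the target row, as in \<open>hact\<close>: at the row
    \<open>s i\<close> it is the quotient taking the group element \<open>gx i\<close> to
    \<open>gy i\<close>.\<close>
  define k where "k = (\<lambda>j\<in>{1..n}. gy (si j) \<otimes> inv (gx (si j)))"
  have h: "(k, \<sigma>) \<in> carrier H"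
    using sp gc bij_betwE[OF si] by (auto simp: H_carrier k_def)
  have rs: "r i \<in> {1..n}" "s i \<in> {1..n}" if "i < n" for i using bij_betwE[OF r] bij_betwE[OF s] that by auto
  have e: "act (k, \<sigma>) xs = ys"
  proof (rule nth_equalityI)
    fix i assume "i < length (act (k, \<sigma>) xs)"
    then have i: "i < n" using B0_length[OF xs] by simp
    have "hact (k, \<sigma>) (dec (xs ! i)) = dec (ys ! i)"
    proof -
      have dx: "dec (xs ! i) = (r i, gx i)" "dec (ys ! i) = (s i, gy i)" by (simp_all add: prod_eq_iff r_def s_def gx_def gy_def)
      have "\<sigma> (r i) = s i" using rs[OF i] rir[OF i] by (simp add: \<sigma>_def)
      moreover have "k (s i) = gy i \<otimes> inv (gx i)" using rs[OF i] sis[OF i] by (simp add: k_def)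
      ultimately show ?thesis unfolding dx using gc[OF i] by (simp add: hact_def m_assoc)
    qed
    then show "act (k, \<sigma>) xs ! i = ys ! i" using i xp[OF i] B0_length[OF xs] by (simp add: wreath_act_cod)
  qed (simp add: B0_length xs ys)
  have "h' = (k, \<sigma>)" if h': "h' \<in> carrier H" "act h' xs = ys" for h'
  proof (rule hact_inj[OF h'(1) h])
    fix j assume j: "j \<in> {1..n}"
    then have "j \<in> r ` {..<n}" using bij_betw_imp_surj_on[OF r] by simp
    then obtain i where i: "i < n" "r i = j" by auto
    have "wreath_act G \<theta> h' (xs ! i) = wreath_act G \<theta> (k, \<sigma>) (xs ! i)"
      using h'(2) e i B0_length[OF xs] by (metis nth_map)
    then have "hact h' (dec (xs ! i)) = hact (k, \<sigma>) (dec (xs ! i))" using dec_wact[OF h'(1) xp(1)[OF i(1)]] dec_wact[OF h xp(1)[OF i(1)]] by simp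
    moreover have "dec (xs ! i) = (j, gx i)" using i by (simp add: prod_eq_iff r_def gx_def)
    ultimately show "\<exists>g\<in>carrier G. hact h' (j, g) = hact (k, \<sigma>) (j, g)" using gc(1)[OF i(1)] by (intro bexI[of _ "gx i"]) simp_all
  qed
  then show ?thesis using h e by blast
qed

lemma B0_free: "h \<in> carrier H \<Longrightarrow> h' \<in> carrier H \<Longrightarrow> xs \<in> B0 \<Longrightarrow> act h xs = act h' xs \<Longrightarrow> h = h'"
proof -
  assume a: "h \<in> carrier H" "h' \<in> carrier H" "xs \<in> B0" "act h xs = act h' xs"
  obtain k where "\<And>g. g \<in> carrier H \<and> act g xs = act h' xs \<Longrightarrow> g = k"
    using B0_transitive[OF a(3) stableD(3)[OF B0_stable a(2,3)]] by (rule ex1E) blast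
  then show "h = h'" using a by metis
qed

text \<open>The base point: \<open>h \<mapsto> act h y0\<close> identifies the wreath product with
  \<open>B0\<close>.\<close>

definition y0 :: "(nat \<times> nat) list" where "y0 = map (\<lambda>i. cod (i, \<one>)) [1..<Suc n]"

lemma y0_B0: "y0 \<in> B0"
  using cod_mem by (auto simp: B0_def W_mem y0_def o_def simp del: upt_Suc)

lemma card_B0: "card B0 = order G ^ n * fact n"
proof -
  have "bij_betw (\<lambda>h. act h y0) (carrier H) B0"
  proof (rule bij_betwI')
    show "act x y0 = act y y0 \<longleftrightarrow> x = y" if "x \<in> carrier H" "y \<in> carrier H" for x y
      using B0_free[OF that y0_B0] by auto
    show "act x y0 \<in> B0" if "x \<in> carrier H" for x using stableD(3)[OF B0_stable that y0_B0] .
    show "\<exists>x\<in>carrier H. y = act x y0" if "y \<in> B0" for y using B0_transitive[OF y0_B0 that] by auto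
  qed
  then have "card B0 = card (carrier H)" by (rule bij_betw_same_card[symmetric])
  also have "\<dots> = card ({1..n} \<rightarrow>\<^sub>E carrier G) * card {\<sigma>. \<sigma> permutes {1..n}}" by (simp add: wreath_def card_cartesian_product)
  also have "\<dots> = order G ^ n * fact n" by (simp add: card_PiE card_permutations[OF refl] Coset.order_def)
  finally show ?thesis .
qed

abbreviation kH :: "((nat \<Rightarrow> 'a) \<times> (nat \<Rightarrow> nat), (nat \<times> nat) list, 'k::field_char_0) rep" where "kH \<equiv> perm_rep B0"

text \<open>The regular representation generates: average the maps \<open>h y\<^sub>0 \<mapsto> h b\<close> over the basis
  elements \<open>b\<close> of a representation.\<close>

lemma Rep_generated:
  assumes V: "(V :: (_, _, 'k::field_char_0) rep) \<in> Obj (Rep H)"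
  shows "Idm (Rep H) V \<in> thru (Rep H) {kH} V V"
proof -
  obtain B \<rho> where [simp]: "V = (B, \<rho>)" by fastforce
  have B: "finite B" and \<rho>b: "\<And>h. h \<in> carrier H \<Longrightarrow> \<rho> h \<in> bmats B B" and \<rho>1: "\<rho> \<one>\<^bsub>H\<^esub> = bmat_id B"
    and \<rho>m: "\<And>h h'. h \<in> carrier H \<Longrightarrow> h' \<in> carrier H \<Longrightarrow> \<rho> (h \<otimes>\<^bsub>H\<^esub> h') = bmat_comp B (\<rho> h) (\<rho> h')"
    using V by (auto simp: Rep_obj)
  \<comment> \<open>The group element corresponding to \<open>y\<close> under the identification by
    the base point.\<close>
  define hy where "hy y = (THE h. h \<in> carrier H \<and> act h y0 = y)" for y
  have hy: "hy y \<in> carrier H" "act (hy y) y0 = y" if "y \<in> B0" for y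
    unfolding hy_def using theI'[OF B0_transitive[OF y0_B0 that]] by auto
  have hyU: "hy y = h" if "y \<in> B0" "h \<in> carrier H" "act h y0 = y" for y h
    using B0_transitive[OF y0_B0 that(1)] hy[OF that(1)] that by blast
  have hya: "hy (act h y) = h \<otimes>\<^bsub>H\<^esub> hy y" if "h \<in> carrier H" "y \<in> B0" for h y
    by (rule hyU) (use that hy[OF that(2)] stableD(3)[OF B0_stable] act_mult[OF that(1) hy(1)[OF that(2)] B0_pairs[OF y0_B0]] in auto)
  let ?c = "1 / of_nat (card B0) :: 'k"
  \<comment> \<open>\<open>p b\<close> sends the basis element \<open>y\<close> to
    \<open>hy y\<close> applied to \<open>b\<close>; \<open>i b\<close> has at \<open>y\<close> the
    \<open>b\<close>-coordinate of the inverse of \<open>hy y\<close> applied to \<open>v\<close>,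
    divided by the order of the group. Summing over \<open>b\<close> gives matrix products of a
    group element and its inverse, so the total is the identity.\<close>
  define p where "p b = (\<lambda>(v, y). if y \<in> B0 then \<rho> (hy y) (v, b) else 0)" for b
  define i where "i b = (\<lambda>(y, v). if y \<in> B0 then ?c * \<rho> (inv\<^bsub>H\<^esub> (hy y)) (b, v) else 0)" for b
  have kHd: "kH = (B0, \<lambda>h (ys, xs). if xs \<in> B0 \<and> ys = act h xs then 1 else 0)" by (simp add: perm_rep_def)
  have rout: "\<rho> h (v, w) = 0" if "h \<in> carrier H" "v \<notin> B \<or> w \<notin> B" for h v w using \<rho>b[OF that(1)] that(2) by (auto simp: bmats_def)
  have p: "p b \<in> Hom (Rep H) kH V" for b
    unfolding \<open>V = _\<close> kHd Rep_hom
  proof (intro conjI ballI)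
    show "p b \<in> bmats B0 B" using hy rout by (auto simp: bmats_def p_def)
    fix h assume h: "h \<in> carrier H"
    show "bmat_comp B (\<rho> h) (p b) = bmat_comp B0 (p b) (\<lambda>(ys, xs). if xs \<in> B0 \<and> ys = act h xs then 1 else 0)"
    proof (rule bmat_eqI)
      fix v y
      show "bmat_comp B (\<rho> h) (p b) (v, y) = bmat_comp B0 (p b) (\<lambda>(ys, xs). if xs \<in> B0 \<and> ys = act h xs then 1 else 0) (v, y)"
      proof (cases "y \<in> B0")
        case True
        have "bmat_comp B (\<rho> h) (p b) (v, y) = bmat_comp B (\<rho> h) (\<rho> (hy y)) (v, b)" using True by (simp add: bmat_comp_apply p_def)
        also have "\<dots> = p b (v, act h y)" using \<rho>m[OF h hy(1)[OF True]] hya[OF h True] stableD(3)[OF B0_stable h True] by (simp add: p_def)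
        also have "\<dots> = (\<Sum>y'\<in>B0. if y' = act h y then p b (v, y') else 0)"
          using stableD(1)[OF B0_stable] stableD(3)[OF B0_stable h True] by (simp add: sum.delta)
        also have "\<dots> = bmat_comp B0 (p b) (\<lambda>(ys, xs). if xs \<in> B0 \<and> ys = act h xs then 1 else 0) (v, y)"
          unfolding bmat_comp_apply using True by (intro sum.cong) auto
        finally show ?thesis .
      qed (simp add: bmat_comp_apply p_def)
    qed
  qed
  have i: "i b \<in> Hom (Rep H) V kH" for b
    unfolding \<open>V = _\<close> kHd Rep_hom
  proof (intro conjI ballI)
    show "i b \<in> bmats B B0" using hy rout by (auto simp: bmats_def i_def)
    fix h assume h: "h \<in> carrier H"
    show "bmat_comp B0 (\<lambda>(ys, xs). if xs \<in> B0 \<and> ys = act h xs then 1 else 0) (i b) = bmat_comp B (i b) (\<rho> h)"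
    proof (rule bmat_eqI)
      fix y v
      show "bmat_comp B0 (\<lambda>(ys, xs). if xs \<in> B0 \<and> ys = act h xs then 1 else 0) (i b) (y, v) = bmat_comp B (i b) (\<rho> h) (y, v)"
      proof (cases "y \<in> B0")
        case True
        let ?y = "act (inv\<^bsub>H\<^esub> h) y"
        have hi: "inv\<^bsub>H\<^esub> h \<in> carrier H" using h by simp
        have yB: "?y \<in> B0" using stableD(3)[OF B0_stable hi True] .
        have "bmat_comp B0 (\<lambda>(ys, xs). if xs \<in> B0 \<and> ys = act h xs then 1 else 0) (i b) (y, v) = (\<Sum>y'\<in>B0. if y' = ?y then i b (y', v) else 0)"
          unfolding bmat_comp_apply
        proof (rule sum.cong[OF refl])
          fix y' assume y': "y' \<in> B0"
          have "y = act h y' \<longleftrightarrow> y' = ?y" using act_inv[OF h B0_pairs[OF y']] act_inv(2)[OF h B0_pairs[OF True]] by auto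
          then show "(\<lambda>(ys, xs). if xs \<in> B0 \<and> ys = act h xs then 1 else 0) (y, y') * i b (y', v) = (if y' = ?y then i b (y', v) else 0)" using y' by auto
        qed
        also have "\<dots> = i b (?y, v)" using stableD(1)[OF B0_stable] yB by (simp add: sum.delta)
        also have "\<dots> = ?c * bmat_comp B (\<rho> (inv\<^bsub>H\<^esub> (hy y))) (\<rho> h) (b, v)"
          using \<rho>m[of "inv\<^bsub>H\<^esub> (hy y)" h] hya[OF hi True] hy(1)[OF True] h yB by (simp add: i_def H.inv_mult_group)
        also have "\<dots> = bmat_comp B (i b) (\<rho> h) (y, v)" using True by (simp add: bmat_comp_apply i_def sum_distrib_left mult.assoc)
        finally show ?thesis .
      next
        case False
        then have "y \<noteq> act h x" if "x \<in> B0" for x using stableD(3)[OF B0_stable h that] by auto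
        then show ?thesis using False by (auto simp: bmat_comp_apply i_def intro!: sum.neutral)
      qed
    qed
  qed
  have ne: "of_nat (card B0) \<noteq> (0 :: 'k)" using stableD(1)[OF B0_stable] y0_B0 by auto
  have "(\<Sum>b\<in>B. Comp (Rep H) V kH V (p b) (i b)) = Idm (Rep H) V"
  proof (rule bmat_eqI)
    fix w v
    have "(\<Sum>b\<in>B. Comp (Rep H) V kH V (p b) (i b)) (w, v) = (\<Sum>b\<in>B. \<Sum>y\<in>B0. p b (w, y) * i b (y, v))"
      by (simp add: sum_fun_apply kHd Rep_sel bmat_comp_apply)
    also have "\<dots> = (\<Sum>y\<in>B0. \<Sum>b\<in>B. p b (w, y) * i b (y, v))" by (rule sum.swap)
    also have "\<dots> = (\<Sum>y\<in>B0. ?c * bmat_id B (w, v))"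
    proof (rule sum.cong[OF refl])
      fix y assume y: "y \<in> B0"
      have "(\<Sum>b\<in>B. p b (w, y) * i b (y, v)) = ?c * bmat_comp B (\<rho> (hy y)) (\<rho> (inv\<^bsub>H\<^esub> (hy y))) (w, v)"
        using y by (simp add: p_def i_def bmat_comp_apply sum_distrib_left mult_ac)
      then show "(\<Sum>b\<in>B. p b (w, y) * i b (y, v)) = ?c * bmat_id B (w, v)"
        using \<rho>m[of "hy y" "inv\<^bsub>H\<^esub> (hy y)"] hy(1)[OF y] \<rho>1 by simp
    qed
    also have "\<dots> = bmat_id B (w, v)" using ne by simp
    finally show "(\<Sum>b\<in>B. Comp (Rep H) V kH V (p b) (i b)) (w, v) = Idm (Rep H) V (w, v)" by (simp add: Rep_sel)
  qed
  moreover have "(\<Sum>b\<in>B. Comp (Rep H) V kH V (p b) (i b)) \<in> thru (Rep H) {kH} V V"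
    by (intro thru_sum thru_one p i) simp
  ultimately show ?thesis by simp
qed

end

section \<open>Decompositions of diagrams\<close>

text \<open>The \<open>r\<close>-th smallest element of \<open>K\<close>, inverse to the rank
  function that \<open>renumber\<close> uses.\<close>

definition en :: "nat set \<Rightarrow> nat \<Rightarrow> nat" where
  "en K r = inv_into K (\<lambda>i. card {x\<in>K. x \<le> i}) r"

lemma rank_bij:
  fixes K :: "nat set"
  assumes K: "finite K"
  shows "bij_betw (\<lambda>i. card {x\<in>K. x \<le> i}) K {1..card K}"
proof -
  have mono: "card {x\<in>K. x \<le> i} < card {x\<in>K. x \<le> j}" if "i < j" "j \<in> K" for i j
  proof (rule psubset_card_mono)
    have "j \<in> {x\<in>K. x \<le> j}" "j \<notin> {x\<in>K. x \<le> i}" using that by auto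
    moreover have "{x\<in>K. x \<le> i} \<subseteq> {x\<in>K. x \<le> j}" using that by auto
    ultimately show "{x\<in>K. x \<le> i} \<subset> {x\<in>K. x \<le> j}" by blast
  qed (use K in simp)
  have inj: "inj_on (\<lambda>i. card {x\<in>K. x \<le> i}) K"
  proof (rule inj_onI)
    fix i j assume "i \<in> K" "j \<in> K" "card {x\<in>K. x \<le> i} = card {x\<in>K. x \<le> j}"
    then show "i = j" using mono[of i j] mono[of j i] by (cases i j rule: linorder_cases) auto
  qed
  moreover have "(\<lambda>i. card {x\<in>K. x \<le> i}) ` K = {1..card K}"
  proof (rule card_subset_eq)
    show "(\<lambda>i. card {x\<in>K. x \<le> i}) ` K \<subseteq> {1..card K}"
    proof clarify
      fix i assume i: "i \<in> K"
      have "{x\<in>K. x \<le> i} \<noteq> {}" using i by auto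
      then have "0 < card {x\<in>K. x \<le> i}" using K by (simp add: card_gt_0_iff)
      moreover have "card {x\<in>K. x \<le> i} \<le> card K" using K by (intro card_mono) auto
      ultimately show "card {x\<in>K. x \<le> i} \<in> {1..card K}" by simp
    qed
    show "card ((\<lambda>i. card {x\<in>K. x \<le> i}) ` K) = card {1..card K}" using card_image[OF inj] by simp
  qed simp
  ultimately show ?thesis by (simp add: bij_betw_def)
qed

lemma en_bij: "finite K \<Longrightarrow> bij_betw (en K) {1..card K} K"
  using bij_betw_inv_into[OF rank_bij] by (simp add: en_def[abs_def])

lemma en_mem: "finite K \<Longrightarrow> r \<in> {1..card K} \<Longrightarrow> en K r \<in> K"
  using en_bij bij_betwE by blast

lemma en_rank: "finite K \<Longrightarrow> i \<in> K \<Longrightarrow> en K (card {x\<in>K. x \<le> i}) = i"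
  unfolding en_def using bij_betw_inv_into_left[OF rank_bij] by blast

lemma rank_mem: "finite (K :: nat set) \<Longrightarrow> i \<in> K \<Longrightarrow> card {x\<in>K. x \<le> i} \<in> {1..card K}"
  using bspec[OF bij_betwE[OF rank_bij[of K]], of i] by simp

lemma rank_en: "finite K \<Longrightarrow> r \<in> {1..card K} \<Longrightarrow> card {x\<in>K. x \<le> en K r} = r"
  unfolding en_def using bij_betw_inv_into_right[OF rank_bij] by blast

lemma en_interval: "r \<in> {1..a} \<Longrightarrow> en {n<..n + a} r = n + r"
proof -
  assume r: "r \<in> {1..a}"
  have "{x\<in>{n<..n + a}. x \<le> n + r} = {n<..n + r}" using r by auto
  then have "card {x\<in>{n<..n + a}. x \<le> n + r} = r" by simp
  then show ?thesis using en_rank[of "{n<..n + a}" "n + r"] r by simp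
qed

lemma en_initial: "r \<in> {1..a} \<Longrightarrow> en {1..a} r = r"
proof -
  have "{0<..0 + a} = {1..a}" by auto
  then show "r \<in> {1..a} \<Longrightarrow> en {1..a} r = r" using en_interval[of r a 0] by simp
qed

section \<open>Restricting diagrams to sets of points\<close>

context
  fixes I J :: "nat set" assumes fI: "finite I" and fJ: "finite J"
begin

lemma renumber_bij: "bij_betw (renumber I J) (sub_points I J) (points (card I) (card J))"
proof -
  have inj: "i = j" if "card {x\<in>K. x \<le> i} = card {x\<in>K. x \<le> j}" "i \<in> K" "j \<in> K" "finite K" for i j :: nat and K
    using inj_onD[OF bij_betw_imp_inj_on[OF rank_bij[OF that(4)]] that(1-3)] .
  have im: "renumber I J ` Up ` I = Up ` (\<lambda>i. card {x\<in>I. x \<le> i}) ` I" "renumber I J ` Lo ` J = Lo ` (\<lambda>i. card {x\<in>J. x \<le> i}) ` J"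
    by (simp_all add: image_image renumber_def)
  have "bij_betw (renumber I J) (Up ` I) (Up ` {1..card I})"
    unfolding bij_betw_def im bij_betw_imp_surj_on[OF rank_bij[OF fI]]
  proof (intro conjI inj_onI refl)
    fix p q assume a: "p \<in> Up ` I" "q \<in> Up ` I" "renumber I J p = renumber I J q"
    then obtain i j where [simp]: "p = Up i" "q = Up j" and ij: "i \<in> I" "j \<in> I" by blast
    have "card {x\<in>I. x \<le> i} = card {x\<in>I. x \<le> j}" using a(3) by (simp add: renumber_def)
    then show "p = q" using inj[OF _ ij fI] by simp
  qed
  moreover have "bij_betw (renumber I J) (Lo ` J) (Lo ` {1..card J})"
    unfolding bij_betw_def im bij_betw_imp_surj_on[OF rank_bij[OF fJ]]
  proof (intro conjI inj_onI refl)
    fix p q assume a: "p \<in> Lo ` J" "q \<in> Lo ` J" "renumber I J p = renumber I J q"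
    then obtain i j where [simp]: "p = Lo i" "q = Lo j" and ij: "i \<in> J" "j \<in> J" by blast
    have "card {x\<in>J. x \<le> i} = card {x\<in>J. x \<le> j}" using a(3) by (simp add: renumber_def)
    then show "p = q" using inj[OF _ ij fJ] by simp
  qed
  ultimately show ?thesis unfolding sub_points_def points_def by (rule bij_betw_combine) auto
qed

lemma renumber_mem: "p \<in> sub_points I J \<Longrightarrow> renumber I J p \<in> points (card I) (card J)"
  using renumber_bij bij_betwE by blast

lemma renumber_inv: "p \<in> sub_points I J \<Longrightarrow> inv_into (sub_points I J) (renumber I J) (renumber I J p) = p"
  using bij_betw_inv_into_left[OF renumber_bij] .

end

context fin_group
begin

lemma jn_renumber:
  assumes "finite I" "finite J" "p \<in> sub_points I J"
  shows "jn (x \<circ> en I) (y \<circ> en J) (renumber I J p) = jn x y p"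
  using assms by (auto simp: sub_points_def renumber_def en_rank)

definition pairok :: "'a labeled \<Rightarrow> (point \<Rightarrow> nat \<times> 'a) \<Rightarrow> point set \<Rightarrow> bool" where
  "pairok d z c \<longleftrightarrow> (\<forall>p\<in>c. \<forall>q\<in>c. fst (z p) = fst (z q) \<and> inv (snd (z p)) \<otimes> snd (z q) = inv (snd d p) \<otimes> snd d q)"

lemma fits_pairok: "fits d z \<longleftrightarrow> (\<forall>c\<in>fst d. pairok d z c)"
  by (simp add: fits_def pairok_def)

lemma sub_label:
  assumes "finite I" "finite J" "p \<in> sub_points I J"
  shows "snd (sub_labeled I J d) (renumber I J p) = snd d p"
  using assms by (simp add: sub_labeled_def renumber_mem renumber_inv)

lemma sub_fits:
  assumes "finite I" "finite J"
  shows "fits (sub_labeled I J d) (jn (x \<circ> en I) (y \<circ> en J)) \<longleftrightarrow> (\<forall>c\<in>fst d. c \<subseteq> sub_points I J \<longrightarrow> pairok d (jn x y) c)"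
proof -
  have "pairok (sub_labeled I J d) (jn (x \<circ> en I) (y \<circ> en J)) (renumber I J ` c) \<longleftrightarrow> pairok d (jn x y) c" if "c \<subseteq> sub_points I J" for c
    unfolding pairok_def using that
    by (auto simp: jn_renumber[OF assms] sub_label[OF assms] subset_iff)
  then show ?thesis unfolding fits_pairok by (auto simp: sub_labeled_def)
qed

lemma union_blocks: "partition_on A \<pi> \<Longrightarrow> (\<exists>S\<subseteq>\<pi>. X = \<Union>S) \<Longrightarrow> \<Union>{c\<in>\<pi>. c \<subseteq> X} = X"
  by auto

lemma split_union: "(\<And>c. c \<in> \<pi> \<Longrightarrow> c \<subseteq> X \<or> c \<subseteq> X') \<Longrightarrow> X \<inter> X' = {} \<Longrightarrow> \<Union>\<pi> = X \<union> X' \<Longrightarrow> X = \<Union>{c\<in>\<pi>. c \<subseteq> X}"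
  by blast

lemma sub_points_sub: "I \<subseteq> {1..a} \<Longrightarrow> J \<subseteq> {1..b} \<Longrightarrow> sub_points I J \<subseteq> points a b"
  by (auto simp: sub_points_def points_def)

lemma sub_labeled_in:
  assumes d: "d \<in> labeled G a b" and S: "\<exists>S\<subseteq>fst d. sub_points I J = \<Union>S" and IJ: "I \<subseteq> {1..a}" "J \<subseteq> {1..b}"
  shows "sub_labeled I J d \<in> labeled G (card I) (card J)"
proof -
  have fin: "finite I" "finite J" using IJ finite_subset by auto
  let ?X = "sub_points I J" let ?r = "renumber I J"
  have part: "partition_on (points a b) (fst d)" using d by (auto simp: labeled_def)
  have "partition_on ?X {c\<in>fst d. c \<subseteq> ?X}"
    using union_blocks[OF part S] part unfolding partition_on_def by (auto simp: disjoint_def)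
  from partition_on_inj_image[OF this, of ?r] renumber_bij[OF fin]
  have "partition_on (points (card I) (card J)) ((`) ?r ` {c\<in>fst d. c \<subseteq> ?X} - {{}})" by (simp add: bij_betw_def)
  moreover have "{} \<notin> (`) ?r ` {c\<in>fst d. c \<subseteq> ?X}" using part by (auto simp: partition_on_def)
  ultimately have 1: "partition_on (points (card I) (card J)) (fst (sub_labeled I J d))" by (simp add: sub_labeled_def)
  have "snd (sub_labeled I J d) \<in> points (card I) (card J) \<rightarrow>\<^sub>E carrier G"
  proof (rule PiE_I)
    fix p assume "p \<in> points (card I) (card J)"
    then obtain q where q: "q \<in> ?X" "p = ?r q" using renumber_bij[OF fin] by (auto simp: bij_betw_def)
    have "q \<in> points a b" using q(1) sub_points_sub[OF IJ] by blast
    then have "snd d q \<in> carrier G" using d by (auto simp: labeled_def)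
    then show "snd (sub_labeled I J d) p \<in> carrier G" unfolding q(2) sub_label[OF fin q(1)] .
  qed (simp add: sub_labeled_def)
  then show ?thesis using 1 by (cases "sub_labeled I J d") (simp add: labeled_def)
qed

lemma sub_rel:
  assumes r: "(d, d') \<in> diag_rel G a b" and S: "\<exists>S\<subseteq>fst d. sub_points I J = \<Union>S" and IJ: "I \<subseteq> {1..a}" "J \<subseteq> {1..b}"
  shows "(sub_labeled I J d, sub_labeled I J d') \<in> diag_rel G (card I) (card J)"
proof -
  have fin: "finite I" "finite J" using IJ finite_subset by auto
  have e: "fst d' = fst d" and L: "d \<in> labeled G a b" "d' \<in> labeled G a b"
    and g: "\<And>c. c \<in> fst d \<Longrightarrow> \<exists>g\<in>carrier G. \<forall>p\<in>c. snd d' p = g \<otimes> snd d p"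
    using r by (auto simp: diag_rel_def)
  have i: "sub_labeled I J d \<in> labeled G (card I) (card J)" "sub_labeled I J d' \<in> labeled G (card I) (card J)"
    using sub_labeled_in[OF L(1) S IJ] sub_labeled_in[OF L(2) _ IJ] S e by auto
  have f: "fst (sub_labeled I J d') = fst (sub_labeled I J d)" by (simp add: sub_labeled_def e)
  have "\<exists>g\<in>carrier G. \<forall>p\<in>c. snd (sub_labeled I J d') p = g \<otimes> snd (sub_labeled I J d) p" if "c \<in> fst (sub_labeled I J d)" for c
  proof -
    obtain c0 where c0: "c0 \<in> fst d" "c0 \<subseteq> sub_points I J" "c = renumber I J ` c0" using \<open>c \<in> _\<close> by (auto simp: sub_labeled_def)
    obtain h where "h \<in> carrier G" "\<forall>p\<in>c0. snd d' p = h \<otimes> snd d p" using g[OF c0(1)] by blast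
    moreover have "snd (sub_labeled I J e) (renumber I J p) = snd e p" if "p \<in> c0" for e :: "'a labeled" and p
      using sub_label[OF fin, of p e] c0(2) that by blast
    ultimately show ?thesis unfolding c0(3) by (intro bexI[of _ h]) auto
  qed
  then show ?thesis using i f by (auto simp: diag_rel_def prod_eq_iff split_beta)
qed

text \<open>\<open>Decomp\<close> sorted by summands: the sets \<open>I1\<close> and
  \<open>J1\<close> determine their complements, so two index sets name a matrix entry of
  \<open>D\<close>.\<close>

definition DD :: "nat \<Rightarrow> nat \<Rightarrow> 'a gdiag \<Rightarrow> nat set \<Rightarrow> nat set \<Rightarrow> ('a gdiag \<times> 'a gdiag) set" where
  "DD a b f I J = {(f1, f2). (I, {1..a} - I, J, {1..b} - J, f1, f2) \<in> Decomp G a b f}"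

definition splits_at :: "nat \<Rightarrow> nat \<Rightarrow> 'a labeled \<Rightarrow> nat set \<Rightarrow> nat set \<Rightarrow> bool" where
  "splits_at a b d I J \<longleftrightarrow> (\<exists>S\<subseteq>fst d. sub_points I J = \<Union>S) \<and> (\<exists>S\<subseteq>fst d. sub_points ({1..a} - I) ({1..b} - J) = \<Union>S)"

text \<open>For given index sets the two parts are determined, and by \<open>sub_rel\<close> they do
  not depend on the representative. So there is at most one decomposition.\<close>

lemma DD_alt:
  assumes f: "f \<in> P G a b" "d \<in> f" and IJ: "I \<subseteq> {1..a}" "J \<subseteq> {1..b}"
  shows "DD a b f I J = (if splits_at a b d I J then {(diag G (card I) (card J) (sub_labeled I J d),
      diag G (a - card I) (b - card J) (sub_labeled ({1..a} - I) ({1..b} - J) d))} else {})"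
proof -
  have c: "card ({1..a} - I) = a - card I" "card ({1..b} - J) = b - card J"
    using IJ finite_subset[OF IJ(1)] finite_subset[OF IJ(2)] by (simp_all add: card_Diff_subset)
  have IJ': "{1..a} - I \<subseteq> {1..a}" "{1..b} - J \<subseteq> {1..b}" by auto
  have s1: "splits_at a b e I J \<longleftrightarrow> splits_at a b d I J" if "e \<in> f" for e
    using comps_eq[OF f] comps_eq[OF f(1) that] by (simp add: splits_at_def)
  have s2: "diag G (card I) (card J) (sub_labeled I J e) = diag G (card I) (card J) (sub_labeled I J d)"
      "diag G (a - card I) (b - card J) (sub_labeled ({1..a} - I) ({1..b} - J) e) = diag G (a - card I) (b - card J) (sub_labeled ({1..a} - I) ({1..b} - J) d)"
    if e: "e \<in> f" and sp: "splits_at a b d I J" for e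
  proof -
    have r: "(d, e) \<in> diag_rel G a b" using P_diag[OF f] e diag_mem by blast
    show "diag G (card I) (card J) (sub_labeled I J e) = diag G (card I) (card J) (sub_labeled I J d)"
      unfolding diag_def using sp by (intro equiv_class_eq[OF equiv_diag_rel, symmetric] sub_rel[OF r _ IJ]) (simp add: splits_at_def)
    show "diag G (a - card I) (b - card J) (sub_labeled ({1..a} - I) ({1..b} - J) e) = diag G (a - card I) (b - card J) (sub_labeled ({1..a} - I) ({1..b} - J) d)"
      unfolding diag_def c[symmetric] using sp by (intro equiv_class_eq[OF equiv_diag_rel, symmetric] sub_rel[OF r _ IJ']) (simp add: splits_at_def)
  qed
  have s3: "DD a b f I J = {(f1, f2). \<exists>e\<in>f. splits_at a b e I J \<and> f1 = diag G (card I) (card J) (sub_labeled I J e) \<and>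
      f2 = diag G (a - card I) (b - card J) (sub_labeled ({1..a} - I) ({1..b} - J) e)}"
    using IJ by (auto simp: DD_def Decomp_def splits_at_def c simp del: One_nat_def)
  show ?thesis
  proof (cases "splits_at a b d I J")
    case True
    have "DD a b f I J = {(f1, f2). \<exists>e\<in>f. f1 = diag G (card I) (card J) (sub_labeled I J d) \<and>
      f2 = diag G (a - card I) (b - card J) (sub_labeled ({1..a} - I) ({1..b} - J) d)}"
      unfolding s3 by (intro Collect_cong prod.case_cong refl bex_cong) (use s1 s2 True in simp)
    then show ?thesis using True f(2) by (cases d) auto
  next
    case False
    then show ?thesis unfolding s3 using s1 by auto
  qed
qed

lemma finite_DD: "f \<in> P G a b \<Longrightarrow> I \<subseteq> {1..a} \<Longrightarrow> J \<subseteq> {1..b} \<Longrightarrow> finite (DD a b f I J)"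
  using P_nonempty[of f a b] DD_alt by auto

lemma DD_in_P:
  assumes f: "f \<in> P G a b" and IJ: "I \<subseteq> {1..a}" "J \<subseteq> {1..b}" and m: "(f1, f2) \<in> DD a b f I J"
  shows "f1 \<in> P G (card I) (card J)" "f2 \<in> P G (a - card I) (b - card J)"
proof -
  obtain d where d: "d \<in> f" using P_nonempty[OF f] by blast
  have c: "card ({1..a} - I) = a - card I" "card ({1..b} - J) = b - card J"
    using IJ finite_subset[OF IJ(1)] finite_subset[OF IJ(2)] by (simp_all add: card_Diff_subset)
  have sp: "splits_at a b d I J" and e: "f1 = diag G (card I) (card J) (sub_labeled I J d)"
    "f2 = diag G (a - card I) (b - card J) (sub_labeled ({1..a} - I) ({1..b} - J) d)"
    using m DD_alt[OF f d IJ] by (auto split: if_splits)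
  show "f1 \<in> P G (card I) (card J)"
    unfolding e using sp by (intro diag_in_P sub_labeled_in[OF P_labeled[OF f d] _ IJ]) (simp add: splits_at_def)
  show "f2 \<in> P G (a - card I) (b - card J)"
    unfolding e c[symmetric] using sp by (intro diag_in_P sub_labeled_in[OF P_labeled[OF f d]]) (auto simp: splits_at_def)
qed

text \<open>If the rows of a configuration are distributed over two disjoint sets, a diagram is admissible
  iff it decomposes accordingly into two admissible diagrams, as components lie in single rows.\<close>

lemma DD_kernel:
  assumes f: "f \<in> P G a b" and I: "I = {i\<in>{1..a}. n < fst (x i)}" and J: "J = {j\<in>{1..b}. n < fst (y j)}"
  shows "(\<Sum>(f1, f2)\<in>DD a b f I J. of_bool (adm f1 (jn (x \<circ> en I) (y \<circ> en J))) *
      of_bool (adm f2 (jn (x \<circ> en ({1..a} - I)) (y \<circ> en ({1..b} - J))))) = (of_bool (adm f (jn x y)) :: 'k::field_char_0)"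
proof -
  obtain d where d: "d \<in> f" using P_nonempty[OF f] by blast
  note L = P_labeled[OF f d]
  let ?X = "sub_points I J" and ?X' = "sub_points ({1..a} - I) ({1..b} - J)"
  have IJ: "I \<subseteq> {1..a}" "J \<subseteq> {1..b}" using I J by auto
  have IJ': "{1..a} - I \<subseteq> {1..a}" "{1..b} - J \<subseteq> {1..b}" by auto
  have fin: "finite I" "finite J" using IJ finite_subset by auto
  have c: "card ({1..a} - I) = a - card I" "card ({1..b} - J) = b - card J"
    using IJ fin by (auto simp: card_Diff_subset)
  have part: "partition_on (points a b) (fst d)" using L by (auto simp: labeled_def)
  have Un: "points a b = ?X \<union> ?X'" using IJ by (auto simp: points_def sub_points_def)
  show ?thesis
  proof (cases "splits_at a b d I J")
    case True
    have s: "\<exists>S\<subseteq>fst d. ?X = \<Union>S" "\<exists>S\<subseteq>fst d. ?X' = \<Union>S" using True by (auto simp: splits_at_def)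
    have "c \<subseteq> ?X \<or> c \<subseteq> ?X'" if cd: "c \<in> fst d" for c
    proof -
      obtain p where p: "p \<in> c" using cd part unfolding partition_on_def by (metis ex_in_conv)
      then have "p \<in> ?X \<or> p \<in> ?X'" using labeled_block(1)[OF L cd] Un by blast
      then obtain X where X: "p \<in> X" "X = ?X \<or> X = ?X'" "\<exists>S\<subseteq>fst d. X = \<Union>S" using s by blast
      then obtain c' where c': "c' \<in> fst d" "p \<in> c'" "c' \<subseteq> X" by blast
      then have "c' = c" using part cd p unfolding partition_on_def disjoint_def by blast
      then show ?thesis using c' X by blast
    qed
    then have "fits d (jn x y) \<longleftrightarrow> fits (sub_labeled I J d) (jn (x \<circ> en I) (y \<circ> en J)) \<and>
        fits (sub_labeled ({1..a} - I) ({1..b} - J) d) (jn (x \<circ> en ({1..a} - I)) (y \<circ> en ({1..b} - J)))"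
      unfolding sub_fits[OF fin] sub_fits[OF finite_Diff[OF finite_atLeastAtMost] finite_Diff[OF finite_atLeastAtMost]] fits_pairok[of d] by blast
    moreover note adm_diag[OF sub_labeled_in[OF L s(1) IJ]] adm_diag[OF sub_labeled_in[OF L s(2) IJ'], unfolded c]
    ultimately show ?thesis using True by (simp add: DD_alt[OF f d IJ] adm_fits[OF f d] of_bool_conj)
  next
    case False
    \<comment> \<open>A fitting configuration puts each component into a single row, hence entirely
      on one side of the threshold \<open>n\<close>; the diagram would then split at
      \<open>I\<close> and \<open>J\<close>.\<close>
    have "\<not> fits d (jn x y)"
    proof
      assume ft: "fits d (jn x y)"
      have s1: "c \<subseteq> ?X \<or> c \<subseteq> ?X'" if cd: "c \<in> fst d" for c
      proof -
        obtain p where p: "p \<in> c" using cd part unfolding partition_on_def by (metis ex_in_conv)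
        have r: "fst (jn x y q) = fst (jn x y p)" "q \<in> points a b" if "q \<in> c" for q
        proof -
          show "q \<in> points a b" by (rule labeled_block(1)[OF L cd that])
          show "fst (jn x y q) = fst (jn x y p)" using ft cd p that unfolding fits_def by blast
        qed
        show ?thesis
        proof (cases "n < fst (jn x y p)")
          case True
          then have "q \<in> ?X" if "q \<in> c" for q using r[OF that] I J by (auto simp: points_def sub_points_def)
          then show ?thesis by blast
        next
          case False
          then have "q \<in> ?X'" if "q \<in> c" for q using r[OF that] I J by (auto simp: points_def sub_points_def)
          then show ?thesis by blast
        qed
      qed
      have s2: "?X \<inter> ?X' = {}" by (auto simp: sub_points_def)
      have s3: "\<Union>(fst d) = ?X \<union> ?X'" using part Un by (simp add: partition_on_def)
      have e1: "?X = \<Union>{c\<in>fst d. c \<subseteq> ?X}" by (rule split_union[OF s1 s2 s3])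
      have e2: "?X' = \<Union>{c\<in>fst d. c \<subseteq> ?X'}"
        by (rule split_union[OF s1[THEN disj_comms(1)[THEN iffD1]] s2[unfolded Int_commute[of ?X]] s3[unfolded Un_commute[of ?X]]])
      have "splits_at a b d I J"
        unfolding splits_at_def by (intro conjI, rule exI, rule conjI[OF _ e1], rule Collect_restrict, rule exI, rule conjI[OF _ e2], rule Collect_restrict)
      then show False using False by simp
    qed
    then show ?thesis using False by (simp add: DD_alt[OF f d IJ] adm_fits[OF f d])
  qed
qed

end

section \<open>Positions of the direct summands\<close>

lemma subset_list_props: "distinct (subset_list d)" "set (subset_list d) = Pow {1..d}"
proof -
  show "distinct (subset_list d)" unfolding subset_list_def by (rule distinct_set_subseqs) simp
  have "{1..<Suc d} = {1..d}" by auto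
  then show "set (subset_list d) = Pow {1..d}" unfolding subset_list_def set_map subseqs_powset set_upt by simp
qed

lemma pos_nth: "i < length (subset_list d) \<Longrightarrow> pos d (subset_list d ! i) = i"
  unfolding pos_def using subset_list_props(1) by (intro the_equality) (auto simp: nth_eq_iff_index_eq)

lemma pos_mem:
  assumes "I \<subseteq> {1..d}"
  shows "pos d I < length (subset_list d)" "subset_list d ! pos d I = I"
proof -
  have "I \<in> set (subset_list d)" using assms subset_list_props(2) by auto
  then obtain i where i: "i < length (subset_list d)" "subset_list d ! i = I" by (auto simp: in_set_conv_nth)
  then have "pos d I = i" using pos_nth by blast
  then show "pos d I < length (subset_list d)" "subset_list d ! pos d I = I" using i by auto
qed

lemma nth_subset: "i < length (subset_list d) \<Longrightarrow> subset_list d ! i \<subseteq> {1..d}"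
  using subset_list_props(2)[of d] nth_mem[of i "subset_list d"] by auto

lemma pos_eq_iff: "I \<subseteq> {1..d} \<Longrightarrow> i < length (subset_list d) \<Longrightarrow> i = pos d I \<longleftrightarrow> subset_list d ! i = I"
  using pos_nth pos_mem by metis

section \<open>The functor \<open>Res\<^sub>n\<close> on diagrams\<close>

lemma emb_mor_apply: "emb_mor v (i, j, x) = (if i = 0 \<and> j = 0 then v x else 0)"
  by (simp add: emb_mor_def single_def)

context fin_group
begin

lemma Ccat_linear: "linear_category (Ccat G (s :: 'k::field_char_0))"
  unfolding Ccat_def by (rule linear_category.linear_category_ps[OF Gcat_linear])

lemma Decomp_iff:
  "(I1, I2, J1, J2, f1, f2) \<in> Decomp G a b f \<longleftrightarrow> I1 \<subseteq> {1..a} \<and> J1 \<subseteq> {1..b} \<and> I2 = {1..a} - I1 \<and> J2 = {1..b} - J1 \<and>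
     (f1, f2) \<in> DD a b f I1 J1"
proof -
  have e: "I1 \<union> I2 = {1..a} \<and> I1 \<inter> I2 = {} \<longleftrightarrow> I1 \<subseteq> {1..a} \<and> I2 = {1..a} - I1" for I1 I2 :: "nat set" and a by blast
  show ?thesis
    unfolding DD_def Decomp_def mem_Collect_eq prod.case using e[of I1 I2 a] e[of J1 J2 b] by blast
qed

lemma finite_Decomp: "f \<in> P G a b \<Longrightarrow> finite (Decomp G a b f)"
proof -
  assume f: "f \<in> P G a b"
  have "Decomp G a b f \<subseteq> (\<lambda>(I, J, f1, f2). (I, {1..a} - I, J, {1..b} - J, f1, f2)) `
      (SIGMA I:Pow {1..a}. SIGMA J:Pow {1..b}. DD a b f I J)"
  proof
    fix x assume x: "x \<in> Decomp G a b f"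
    obtain I1 I2 J1 J2 f1 f2 where [simp]: "x = (I1, I2, J1, J2, f1, f2)" by (metis prod.collapse)
    show "x \<in> (\<lambda>(I, J, f1, f2). (I, {1..a} - I, J, {1..b} - J, f1, f2)) ` (SIGMA I:Pow {1..a}. SIGMA J:Pow {1..b}. DD a b f I J)"
      using x unfolding \<open>x = _\<close> Decomp_iff by (intro image_eqI[where x = "(I1, J1, f1, f2)"]) auto
  qed
  moreover have "finite (SIGMA I:Pow {1..a}. SIGMA J:Pow {1..b}. DD a b f I J)"
    using finite_DD[OF f] by (intro finite_SigmaI) auto
  ultimately show ?thesis by (meson finite_imageI finite_subset)
qed

text \<open>Positions are injective in the index sets, so exactly the decompositions along the two
  sets belonging to \<open>i\<close> and \<open>j\<close> contribute to this entry.\<close>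

lemma entry_D_diag:
  assumes f: "f \<in> P G a b" and i: "i < length (subset_list a)" and j: "j < length (subset_list b)"
  shows "entry (D_diag G a b f) j i = (\<Sum>(f1, f2)\<in>DD a b f (subset_list a ! i) (subset_list b ! j).
     tens (emb_mor (basis f1)) (emb_mor (basis f2) :: nat \<times> nat \<times> 'a gdiag \<Rightarrow> 'k::field_char_0))"
proof -
  let ?I = "subset_list a ! i" and ?J = "subset_list b ! j"
  let ?X = "{x \<in> Decomp G a b f. fst x = ?I \<and> fst (snd (snd x)) = ?J}"
  let ?h = "\<lambda>(f1, f2). (?I, {1..a} - ?I, ?J, {1..b} - ?J, f1, f2)"
  let ?g = "\<lambda>(I1, I2, J1, J2, f1, f2). tens (emb_mor (basis f1)) (emb_mor (basis f2) :: nat \<times> nat \<times> 'a gdiag \<Rightarrow> 'k)"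
  have "entry (D_diag G a b f) j i = (\<Sum>x\<in>Decomp G a b f. if fst x = ?I \<and> fst (snd (snd x)) = ?J then ?g x else 0)"
    unfolding D_diag_def entry_sum
  proof (rule sum.cong[OF refl])
    fix x assume x: "x \<in> Decomp G a b f"
    obtain I1 I2 J1 J2 f1 f2 where [simp]: "x = (I1, I2, J1, J2, f1, f2)" by (metis prod.collapse)
    have "i = pos a I1 \<longleftrightarrow> ?I = I1" "j = pos b J1 \<longleftrightarrow> ?J = J1"
      using x pos_eq_iff[OF _ i] pos_eq_iff[OF _ j] unfolding \<open>x = _\<close> Decomp_iff by blast+
    then show "entry (case x of (I1, I2, J1, J2, f1, f2) \<Rightarrow> single (pos b J1) (pos a I1) (tens (emb_mor (basis f1)) (emb_mor (basis f2)))) j i =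
        (if fst x = ?I \<and> fst (snd (snd x)) = ?J then ?g x else 0)"
      by (auto simp: entry_single)
  qed
  also have "\<dots> = sum ?g ?X" using finite_Decomp[OF f] by (simp add: sum.inter_filter)
  also have "?X = ?h ` DD a b f ?I ?J"
  proof (intro equalityI subsetI)
    fix x assume x: "x \<in> ?X"
    obtain I1 I2 J1 J2 f1 f2 where [simp]: "x = (I1, I2, J1, J2, f1, f2)" by (metis prod.collapse)
    have "I1 = ?I" "J1 = ?J" "x \<in> Decomp G a b f" using x by auto
    then show "x \<in> ?h ` DD a b f ?I ?J"
      unfolding \<open>x = _\<close> Decomp_iff by (intro image_eqI[where x = "(f1, f2)"]) auto
  next
    fix x assume "x \<in> ?h ` DD a b f ?I ?J"
    then obtain f1 f2 where [simp]: "x = (?I, {1..a} - ?I, ?J, {1..b} - ?J, f1, f2)" and m: "(f1, f2) \<in> DD a b f ?I ?J" by auto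
    show "x \<in> ?X" using nth_subset[OF i] nth_subset[OF j] m unfolding \<open>x = _\<close> mem_Collect_eq Decomp_iff by simp
  qed
  also have "sum ?g (?h ` DD a b f ?I ?J) = (\<Sum>(f1, f2)\<in>DD a b f ?I ?J. tens (emb_mor (basis f1)) (emb_mor (basis f2)))"
    by (subst sum.reindex) (auto simp: inj_on_def intro!: sum.cong)
  finally show ?thesis .
qed

lemma basis_expand:
  assumes "u \<in> Hom (Gcat G t) a b"
  shows "u = (\<Sum>f\<in>P G a b. smul (u f) (basis f))"
proof
  fix g show "u g = (\<Sum>f\<in>P G a b. smul (u f) (basis f)) g"
    using assms by (cases "g \<in> P G a b") (auto simp: sum_fun_apply smul_apply basis_def Gcat_hom if_distrib[of "\<lambda>c. _ * c"] sum.delta' cong: if_cong intro!: sum.neutral)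
qed

end

context wreath_rep
begin

text \<open>The basis element of a tensor power of \<open>W\<close> that corresponds to the
  restriction of \<open>x\<close> to the positions \<open>K\<close>, in increasing order.\<close>

definition lst :: "nat set \<Rightarrow> (nat \<Rightarrow> nat \<times> 'a) \<Rightarrow> (nat \<times> nat) list" where
  "lst K x = map (\<lambda>r. cod (x (en K r))) [1..<Suc (card K)]"

lemma lst_length [simp]: "length (lst K x) = card K"
  by (simp add: lst_def)

lemma lst_nth: "r \<in> {1..card K} \<Longrightarrow> lst K x ! (r - 1) = cod (x (en K r))"
  unfolding lst_def by (subst nth_map) (auto simp del: upt_Suc)

lemma lst_W:
  assumes "finite K" "\<And>i. i \<in> K \<Longrightarrow> fst (x i) \<in> {1..n}" "\<And>i. i \<in> K \<Longrightarrow> snd (x i) \<in> carrier G"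
  shows "lst K x \<in> W_basis G n (card K)"
  unfolding W_mem using en_mem[OF assms(1)] assms(2,3) by (auto simp: lst_def simp del: upt_Suc intro!: cod_mem)

end

locale res_core = wreath_rep G n \<theta> for G :: "('a, 'b) monoid_scheme" (structure) and n \<theta> +
  fixes t :: "'k::field_char_0" and D
    and F :: "((nat, 'a gdiag, 'k) ps_obj, nat \<times> nat \<times> 'a gdiag, ((nat \<Rightarrow> 'a) \<times> (nat \<Rightarrow> nat), (nat \<times> nat) list, 'k) rep,
      (nat \<times> nat) list \<times> (nat \<times> nat) list, 'k) fnctr"
  assumes D: "is_functor_D G t (t - of_nat n) (of_nat n) D" and F: "is_functor_F G n \<theta> F"
begin

abbreviation "t1 \<equiv> t - of_nat n"
abbreviation "Gt \<equiv> Gcat G t"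
abbreviation "G1 \<equiv> Gcat G t1"
abbreviation "G2 \<equiv> Gcat G (of_nat n :: 'k)"
abbreviation "CC \<equiv> Ccat G t"
abbreviation "C1 \<equiv> Ccat G t1"
abbreviation "C2 \<equiv> Ccat G (of_nat n :: 'k)"
abbreviation RH :: "(((nat \<Rightarrow> 'a) \<times> (nat \<Rightarrow> nat), (nat \<times> nat) list, 'k) rep, (nat \<times> nat) list \<times> (nat \<times> nat) list, 'k) lincat"
  where "RH \<equiv> Rep H"
abbreviation "T \<equiv> tensor_cat C1 RH"
abbreviation "E \<equiv> tensor_cat C1 C2"
abbreviation "tf \<equiv> tensor_functor C1 C2 id_functor F"
abbreviation "RR \<equiv> Res G n t D F"

sublocale Gt: linear_category "Gcat G t" by (rule Gcat_linear)
sublocale G1: linear_category "Gcat G (t - of_nat n)" by (rule Gcat_linear)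
sublocale G2: linear_category "Gcat G (of_nat n :: 'k)" by (rule Gcat_linear)
sublocale Tp: tensor_pair "Ccat G (t - of_nat n)" "Rep (wreath G n) :: (((nat \<Rightarrow> 'a) \<times> (nat \<Rightarrow> nat), (nat \<times> nat) list, 'k) rep, (nat \<times> nat) list \<times> (nat \<times> nat) list, 'k) lincat"
  unfolding tensor_pair_def by (intro conjI Ccat_linear Rep_linear)
sublocale Ep: tensor_pair "Ccat G (t - of_nat n)" "Ccat G (of_nat n :: 'k)"
  unfolding tensor_pair_def by (intro conjI Ccat_linear)
sublocale TL: linear_category "tensor_cat C1 RH" by (rule Tp.linear_category_T)

lemma funF: "linear_functor C2 RH F"
  using F Ccat_linear Rep_linear by (auto simp: is_functor_F_def linear_functor_def linear_functor_axioms_def)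

lemma F_ob: "fob F (emb_ob G2 a) = W_pow G n \<theta> a"
  and F_mor: "f \<in> P G a b \<Longrightarrow> fmor F (emb_ob G2 a) (emb_ob G2 b) (emb_mor (basis f)) = F_diag G n \<theta> a b f"
  using F by (auto simp: is_functor_F_def)

lemma D_ob: "fob D (emb_ob Gt a) = VDelta_pow G t1 (of_nat n) a"
  and D_mor: "f \<in> P G a b \<Longrightarrow> fmor D (emb_ob Gt a) (emb_ob Gt b) (emb_mor (basis f)) = D_diag G a b f"
  using D by (auto simp: is_functor_D_def)

lemma funD: "linear_functor CC (ps E) D"
  using D Ccat_linear linear_category.linear_category_ps[OF Ep.linear_category_T]
  by (auto simp: is_functor_D_def linear_functor_def linear_functor_axioms_def boxtimes_def)

sublocale TF: linear_functor "tensor_cat C1 C2" "tensor_cat C1 RH" tf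
  by (rule Ep.linear_functor_tensor[OF linear_functor_id[OF Ccat_linear] funF])

sublocale RF: two_sided "Ccat G t" "ps (tensor_cat C1 RH)" "Res G n t D F"
proof -
  have "linear_functor CC (ps T) (functor_comp (ps_functor tf) D)"
    by (rule linear_functor_comp[OF funD TF.linear_functor_ps])
  then show "two_sided CC (ps T) RR" by (simp add: two_sided_def Res_def boxtimes_functor_def)
qed

lemma target: "Res_target G n t = ps T"
  by (simp add: Res_target_def boxtimes_def)

abbreviation "em1 \<equiv> emb_ob G1"
abbreviation "em2 \<equiv> emb_ob G2"
abbreviation "emt \<equiv> emb_ob Gt"

lemma em1_obj [simp]: "em1 a \<in> Obj C1" and em2_obj [simp]: "em2 a \<in> Obj C2" and emt_obj [simp]: "emt a \<in> Obj CC"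
  by (simp_all add: Ccat_def G1.obj_emb G2.obj_emb Gt.obj_emb)

lemma C1_hom: "Hom C1 (em1 a) (em1 b) = emb_mor ` Hom G1 a b"
  and C2_hom: "Hom C2 (em2 a) (em2 b) = emb_mor ` Hom G2 a b"
  and CC_hom: "Hom CC (emt a) (emt b) = emb_mor ` Hom Gt a b"
  by (simp_all add: Ccat_def G1.hom_emb G2.hom_emb Gt.hom_emb)

text \<open>The lists underlying \<open>D [b]\<close> and, in the definition of \<open>Wl\<close>,
  \<open>Res [b]\<close>: in both cases the object is the list with its identity matrix as
  idempotent.\<close>

definition El :: "nat \<Rightarrow> ((nat, 'a gdiag, 'k) ps_obj \<times> (nat, 'a gdiag, 'k) ps_obj) list" where
  "El b = map (\<lambda>I. (em1 (card I), em2 (b - card I))) (subset_list b)"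

definition Wl :: "nat \<Rightarrow> ((nat, 'a gdiag, 'k) ps_obj \<times> ((nat \<Rightarrow> 'a) \<times> (nat \<Rightarrow> nat), (nat \<times> nat) list, 'k) rep) list" where
  "Wl b = map (\<lambda>I. (em1 (card I), W_pow G n \<theta> (b - card I))) (subset_list b)"

lemma VDelta_El: "VDelta_pow G t1 (of_nat n) b = (El b, mat_id E (El b))"
  by (simp add: VDelta_pow_def El_def Let_def)

lemma W_pow_obj: "W_pow G n \<theta> a \<in> Obj RH"
  unfolding W_pow_perm by (rule perm_rep_obj[OF W_stable])

lemma El_obj: "set (El b) \<subseteq> Obj E" and Wl_obj: "set (Wl b) \<subseteq> Obj T"
  by (auto simp: El_def Wl_def Ep.T_sel Tp.T_sel W_pow_obj)

lemma El_len [simp]: "length (El b) = length (subset_list b)" and Wl_len [simp]: "length (Wl b) = length (subset_list b)"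
  by (simp_all add: El_def Wl_def)

lemma El_nth: "i < length (subset_list b) \<Longrightarrow> El b ! i = (em1 (card (subset_list b ! i)), em2 (b - card (subset_list b ! i)))"
  and Wl_nth: "i < length (subset_list b) \<Longrightarrow> Wl b ! i = (em1 (card (subset_list b ! i)), W_pow G n \<theta> (b - card (subset_list b ! i)))"
  by (simp_all add: El_def Wl_def)

lemma tf_ob: "fob tf (em1 p, em2 q) = (em1 p, W_pow G n \<theta> q)"
  by (simp add: tensor_functor_def id_functor_def F_ob)

lemma map_tf_El: "map (fob tf) (El b) = Wl b"
  by (simp add: El_def Wl_def tf_ob)

lemma Res_ob: "fob RR (emt b) = (Wl b, mat_id T (Wl b))"
proof -
  have "matrix (length (El b)) (length (El b)) (\<lambda>j i. fmor tf (El b ! i) (El b ! j) (entry (mat_id E (El b)) j i)) = mat_id T (Wl b)"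
  proof (rule entry_eqI)
    fix j i
    show "entry (matrix (length (El b)) (length (El b)) (\<lambda>j i. fmor tf (El b ! i) (El b ! j) (entry (mat_id E (El b)) j i))) j i = entry (mat_id T (Wl b)) j i"
    proof (cases "j < length (El b) \<and> i < length (El b)")
      case True
      then have o: "El b ! i \<in> Obj E" "El b ! j \<in> Obj E" using El_obj nth_mem by blast+
      have "fob tf (El b ! i) = Wl b ! i" using True by (simp add: El_nth Wl_nth tf_ob)
      then show ?thesis using True o by (auto simp: entry_matrix entry_mat_id TF.idm TF.zero)
    qed (auto simp: entry_matrix entry_mat_id)
  qed
  then show ?thesis
    by (simp add: Res_def functor_comp_def boxtimes_functor_def D_ob VDelta_El ps_functor_def Let_def map_tf_El)
qed

lemma Res_diag:
  assumes f: "f \<in> P G a b" and i: "i < length (subset_list a)" and j: "j < length (subset_list b)"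
  shows "entry (fmor RR (emt a) (emt b) (emb_mor (basis f))) j i =
    (\<Sum>(f1, f2)\<in>DD a b f (subset_list a ! i) (subset_list b ! j).
      tens (emb_mor (basis f1)) (F_diag G n \<theta> (a - card (subset_list a ! i)) (b - card (subset_list b ! j)) f2))"
proof -
  let ?I = "subset_list a ! i" and ?J = "subset_list b ! j"
  have m: "f1 \<in> P G (card ?I) (card ?J) \<and> f2 \<in> P G (a - card ?I) (b - card ?J)" if "(f1, f2) \<in> DD a b f ?I ?J" for f1 f2
    using DD_in_P[OF f nth_subset[OF i] nth_subset[OF j] that] by auto
  have h: "emb_mor (basis f1) \<in> Hom C1 (em1 (card ?I)) (em1 (card ?J))" "emb_mor (basis f2) \<in> Hom C2 (em2 (a - card ?I)) (em2 (b - card ?J))"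
    if "(f1, f2) \<in> DD a b f ?I ?J" for f1 f2
    using m[OF that] by (auto simp: C1_hom C2_hom basis_hom)
  have o: "El a ! i \<in> Obj E" "El b ! j \<in> Obj E" using subsetD[OF El_obj nth_mem, of i a] subsetD[OF El_obj nth_mem, of j b] i j by simp_all
  have "entry (fmor RR (emt a) (emt b) (emb_mor (basis f))) j i = fmor tf (El a ! i) (El b ! j) (entry (D_diag G a b f) j i)"
    using i j by (simp add: Res_def functor_comp_def boxtimes_functor_def D_ob D_mor[OF f] VDelta_El ps_functor_def Let_def entry_matrix)
  also have "\<dots> = (\<Sum>x\<in>DD a b f ?I ?J. fmor tf (El a ! i) (El b ! j) (case x of (f1, f2) \<Rightarrow> tens (emb_mor (basis f1)) (emb_mor (basis f2))))"
    unfolding entry_D_diag[OF f i j]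
    by (rule TF.sum[OF o]) (use h in \<open>auto simp: El_nth[OF i] El_nth[OF j] intro!: Ep.T_pure\<close>)
  also have "\<dots> = (\<Sum>(f1, f2)\<in>DD a b f ?I ?J. tens (emb_mor (basis f1)) (F_diag G n \<theta> (a - card ?I) (b - card ?J) f2))"
  proof (rule sum.cong[OF refl])
    fix x assume x: "x \<in> DD a b f ?I ?J"
    obtain f1 f2 where [simp]: "x = (f1, f2)" by fastforce
    note hx = h[OF x[unfolded \<open>x = _\<close>]] and mx = m[OF x[unfolded \<open>x = _\<close>]]
    show "fmor tf (El a ! i) (El b ! j) (case x of (f1, f2) \<Rightarrow> tens (emb_mor (basis f1)) (emb_mor (basis f2))) =
       (case x of (f1, f2) \<Rightarrow> tens (emb_mor (basis f1)) (F_diag G n \<theta> (a - card ?I) (b - card ?J) f2))"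
      unfolding El_nth[OF i] El_nth[OF j] \<open>x = _\<close> prod.case
      using Ep.tensor_functor_pure[OF linear_functor_id[OF Ccat_linear] funF _ _ _ _ hx] mx
      by (simp add: id_functor_def F_mor)
  qed
  finally show ?thesis .
qed

lemma emb_hom: "u \<in> Hom Gt a b \<Longrightarrow> emb_mor u \<in> Hom CC (emt a) (emt b)"
  by (simp add: CC_hom)

lemma Res_entry:
  assumes u: "u \<in> Hom Gt a b" and i: "i < length (subset_list a)" and j: "j < length (subset_list b)"
  shows "entry (fmor RR (emt a) (emt b) (emb_mor u)) j i =
    (\<Sum>f\<in>P G a b. smul (u f) (\<Sum>(f1, f2)\<in>DD a b f (subset_list a ! i) (subset_list b ! j).
      tens (emb_mor (basis f1)) (F_diag G n \<theta> (a - card (subset_list a ! i)) (b - card (subset_list b ! j)) f2)))"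
proof -
  have e: "emb_mor u = (\<Sum>f\<in>P G a b. smul (u f) (emb_mor (basis f)))"
    by (subst basis_expand[OF u]) (simp add: Gt.emb_mor_sum Gt.emb_mor_smul)
  have h: "f \<in> P G a b \<Longrightarrow> emb_mor (basis f) \<in> Hom CC (emt a) (emt b)" for f by (intro emb_hom basis_hom)
  have "fmor RR (emt a) (emt b) (emb_mor u) = (\<Sum>f\<in>P G a b. smul (u f) (fmor RR (emt a) (emt b) (emb_mor (basis f))))"
    unfolding e by (subst RF.sum) (auto simp: h RF.scal RF.src.smul_hom)
  then show ?thesis using i j by (simp add: entry_sum entry_smul Res_diag)
qed

lemma Res_mat_hom: "u \<in> Hom Gt a b \<Longrightarrow> fmor RR (emt a) (emt b) (emb_mor u) \<in> mat_hom T (Wl a) (Wl b)"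
  using RF.mor[OF emt_obj emt_obj emb_hom, of u a b] unfolding Res_ob TL.hom_full[OF Wl_obj Wl_obj] .

lemma admissible_adm: "admissible G \<theta> f xs ys \<longleftrightarrow> adm f (\<lambda>p. dec (attached xs ys p))"
  unfolding admissible_def adm_def fits_def dec_def by (simp add: split_beta)

lemma F_diag_lst:
  assumes f: "f \<in> P G (card K) (card L)"
    and K: "finite K" "\<And>i. i \<in> K \<Longrightarrow> fst (x i) \<in> {1..n}" "\<And>i. i \<in> K \<Longrightarrow> snd (x i) \<in> carrier G"
    and L: "finite L" "\<And>i. i \<in> L \<Longrightarrow> fst (y i) \<in> {1..n}" "\<And>i. i \<in> L \<Longrightarrow> snd (y i) \<in> carrier G"
  shows "F_diag G n \<theta> (card K) (card L) f (lst L y, lst K x) = (of_bool (adm f (jn (x \<circ> en K) (y \<circ> en L))) :: 'k)"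
proof -
  have "adm f (\<lambda>p. dec (attached (lst K x) (lst L y) p)) \<longleftrightarrow> adm f (jn (x \<circ> en K) (y \<circ> en L))"
  proof (rule adm_cong[OF f])
    fix p assume "p \<in> points (card K) (card L)"
    then show "dec (attached (lst K x) (lst L y) p) = jn (x \<circ> en K) (y \<circ> en L) p"
      using en_mem[OF K(1)] en_mem[OF L(1)] K(3) L(3)
      by (auto simp: points_def attached_def lst_nth simp del: One_nat_def atLeastAtMost_iff)
  qed
  then show ?thesis using lst_W[OF K] lst_W[OF L] by (simp add: F_diag_def admissible_adm)
qed

text \<open>The analogue of \<open>ker\<close> for a tensor: a kernel in the diagram factor and a
  matrix coordinate in the representation factor. The indices \<open>0, 0\<close> are those of the
  single entry of \<open>emb_mor\<close>.\<close>

definition sk :: "nat \<Rightarrow> nat \<Rightarrow> ((nat \<times> nat \<times> 'a gdiag) \<times> (nat \<times> nat) list \<times> (nat \<times> nat) list \<Rightarrow> 'k) \<Rightarrow> (point \<Rightarrow> nat \<times> 'a) \<Rightarrow> (nat \<times> nat) list \<times> (nat \<times> nat) list \<Rightarrow> 'k" where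
  "sk p q M z yx = (\<Sum>f\<in>P G p q. M ((0, 0, f), yx) * of_bool (adm f z))"

text \<open>Positions in rows beyond \<open>n\<close> go to the first factor, those in the rows up
  to \<open>n\<close> to a power of \<open>W\<close>; this names the block to be read.
  \<open>D\<close> splits each diagram in the same way, and by \<open>DD_kernel\<close> the product
  of the admissibilities of its parts is its own admissibility. The parameter does not occur, so no
  interpolation is involved.\<close>

lemma Res_kernel:
  assumes u: "u \<in> Hom Gt a b" and v: "val1 a x" "val1 b y"
    and r: "\<And>i. i \<in> {1..a} \<Longrightarrow> 1 \<le> fst (x i)" "\<And>j. j \<in> {1..b} \<Longrightarrow> 1 \<le> fst (y j)"
    and I: "I = {i\<in>{1..a}. n < fst (x i)}" and J: "J = {j\<in>{1..b}. n < fst (y j)}"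
  shows "sk (card I) (card J) (entry (fmor RR (emt a) (emt b) (emb_mor u)) (pos b J) (pos a I)) (jn (x \<circ> en I) (y \<circ> en J))
      (lst ({1..b} - J) y, lst ({1..a} - I) x) = ker a b u (jn x y)"
proof -
  let ?z1 = "jn (x \<circ> en I) (y \<circ> en J)" and ?yx = "(lst ({1..b} - J) y, lst ({1..a} - I) x)"
  have IJ: "I \<subseteq> {1..a}" "J \<subseteq> {1..b}" using I J by auto
  have c: "card ({1..a} - I) = a - card I" "card ({1..b} - J) = b - card J"
    using IJ finite_subset[OF IJ(1)] finite_subset[OF IJ(2)] by (simp_all add: card_Diff_subset)
  have tm: "(\<Sum>g\<in>P G (card I) (card J). (\<Sum>(f1, f2)\<in>DD a b f I J. tens (emb_mor (basis f1)) (F_diag G n \<theta> (a - card I) (b - card J) f2)) ((0, 0, g), ?yx)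
      * of_bool (adm g ?z1)) = (of_bool (adm f (jn x y)) :: 'k)" if f: "f \<in> P G a b" for f
  proof -
    have "(\<Sum>g\<in>P G (card I) (card J). (\<Sum>(f1, f2)\<in>DD a b f I J. tens (emb_mor (basis f1)) (F_diag G n \<theta> (a - card I) (b - card J) f2)) ((0, 0, g), ?yx) * of_bool (adm g ?z1)) =
      (\<Sum>g\<in>P G (card I) (card J). \<Sum>(f1, f2)\<in>DD a b f I J. basis f1 g * F_diag G n \<theta> (a - card I) (b - card J) f2 ?yx * (of_bool (adm g ?z1) :: 'k))"
      by (simp add: sum_fun_apply split_beta tens_apply emb_mor_apply sum_distrib_right)
    also have "\<dots> = (\<Sum>(f1, f2)\<in>DD a b f I J. \<Sum>g\<in>P G (card I) (card J). basis f1 g * F_diag G n \<theta> (a - card I) (b - card J) f2 ?yx * of_bool (adm g ?z1))"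
      unfolding split_beta by (rule sum.swap)
    also have "\<dots> = (\<Sum>(f1, f2)\<in>DD a b f I J. of_bool (adm f1 ?z1) * of_bool (adm f2 (jn (x \<circ> en ({1..a} - I)) (y \<circ> en ({1..b} - J)))))"
    proof (rule sum.cong[OF refl])
      fix w assume w: "w \<in> DD a b f I J"
      obtain f1 f2 where [simp]: "w = (f1, f2)" by fastforce
      note m = DD_in_P[OF f IJ w[unfolded \<open>w = _\<close>]]
      have "F_diag G n \<theta> (a - card I) (b - card J) f2 ?yx = (of_bool (adm f2 (jn (x \<circ> en ({1..a} - I)) (y \<circ> en ({1..b} - J)))) :: 'k)"
        unfolding c[symmetric]
      proof (rule F_diag_lst)
        show "f2 \<in> P G (card ({1..a} - I)) (card ({1..b} - J))" using m(2) by (simp add: c del: One_nat_def)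
      qed (use v r in \<open>auto simp: I J val1_def simp del: One_nat_def\<close>)
      moreover have "(\<Sum>g\<in>P G (card I) (card J). basis f1 g * s * of_bool (adm g ?z1)) = of_bool (adm f1 ?z1) * s" for s :: 'k
      proof -
        have "(\<Sum>g\<in>P G (card I) (card J). basis f1 g * s * of_bool (adm g ?z1)) = (\<Sum>g\<in>P G (card I) (card J). if g = f1 then s * of_bool (adm f1 ?z1) else 0)"
          by (rule sum.cong) (auto simp: basis_def)
        then show ?thesis using m(1) by (simp add: sum.delta mult.commute)
      qed
      ultimately show "(case w of (f1, f2) \<Rightarrow> \<Sum>g\<in>P G (card I) (card J). basis f1 g * F_diag G n \<theta> (a - card I) (b - card J) f2 ?yx * of_bool (adm g ?z1)) =
        (case w of (f1, f2) \<Rightarrow> of_bool (adm f1 ?z1) * (of_bool (adm f2 (jn (x \<circ> en ({1..a} - I)) (y \<circ> en ({1..b} - J)))) :: 'k))" by simp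
    qed
    also have "\<dots> = of_bool (adm f (jn x y))" by (rule DD_kernel[OF f I J])
    finally show ?thesis .
  qed
  have "sk (card I) (card J) (entry (fmor RR (emt a) (emt b) (emb_mor u)) (pos b J) (pos a I)) ?z1 ?yx =
    (\<Sum>g\<in>P G (card I) (card J). \<Sum>f\<in>P G a b. u f * ((\<Sum>(f1, f2)\<in>DD a b f I J. tens (emb_mor (basis f1)) (F_diag G n \<theta> (a - card I) (b - card J) f2)) ((0, 0, g), ?yx)
      * of_bool (adm g ?z1)))"
    unfolding sk_def Res_entry[OF u pos_mem(1)[OF IJ(1)] pos_mem(1)[OF IJ(2)]] pos_mem(2)[OF IJ(1)] pos_mem(2)[OF IJ(2)]
      sum_fun_apply[of _ "P G a b"] smul_apply sum_distrib_right mult.assoc ..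
  also have "\<dots> = (\<Sum>f\<in>P G a b. \<Sum>g\<in>P G (card I) (card J). u f * ((\<Sum>(f1, f2)\<in>DD a b f I J. tens (emb_mor (basis f1)) (F_diag G n \<theta> (a - card I) (b - card J) f2)) ((0, 0, g), ?yx)
      * of_bool (adm g ?z1)))"
    by (rule sum.swap)
  also have "\<dots> = ker a b u (jn x y)"
    unfolding sum_distrib_left[symmetric] ker_def by (rule sum.cong[OF refl]) (simp only: tm)
  finally show ?thesis .
qed

text \<open>For pure tensors, support and invariance are clear, and both survive sums. Conversely
  \<open>u\<close> is the sum over the diagrams \<open>f\<close> of the pure tensors of
  \<open>f\<close> and the coordinate function of \<open>u\<close> at \<open>f\<close>, which is an
  intertwiner by \<open>perm_rep_hom\<close>.\<close>

lemma T_hom_iff: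
  assumes B: "stable B" and B': "stable B'"
  shows "u \<in> Hom T (em1 p, perm_rep B) (em1 q, perm_rep B') \<longleftrightarrow>
    (\<forall>i j f ys xs. u ((i, j, f), (ys, xs)) \<noteq> 0 \<longrightarrow> i = 0 \<and> j = 0 \<and> f \<in> P G p q \<and> ys \<in> B' \<and> xs \<in> B) \<and>
    (\<forall>f. \<forall>h\<in>carrier H. \<forall>xs\<in>B. \<forall>ys\<in>B'. u ((0, 0, f), (act h ys, act h xs)) = u ((0, 0, f), (ys, xs)))" (is "_ \<longleftrightarrow> ?A u \<and> ?B u")
proof
  assume "u \<in> Hom T (em1 p, perm_rep B) (em1 q, perm_rep B')"
  then show "?A u \<and> ?B u"
  proof (induction u rule: Tp.T_induct)
    case zero
    show ?case by (simp add: zero_fun_apply)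
  next
    case (pure f M)
    then obtain v where v: "v \<in> Hom G1 p q" "f = emb_mor v" by (auto simp: C1_hom)
    have M: "M \<in> bmats B B'" "\<And>h xs ys. h \<in> carrier H \<Longrightarrow> xs \<in> B \<Longrightarrow> ys \<in> B' \<Longrightarrow> M (act h ys, act h xs) = M (ys, xs)"
      using pure(2) unfolding perm_rep_hom[OF B B'] by auto
    show ?case unfolding v(2) using v(1) M by (auto simp: tens_apply emb_mor_apply bmats_def Gcat_hom)
  next
    case (add u v)
    have "u x \<noteq> 0 \<or> v x \<noteq> 0" if "(u + v) x \<noteq> 0" for x using that by (auto simp: plus_fun_apply)
    then show ?case using add.IH by (auto simp: plus_fun_apply) metis+
  qed
next
  assume a: "?A u \<and> ?B u"
  have s: "(\<lambda>yx. u ((0, 0, f), yx)) \<in> Hom RH (perm_rep B) (perm_rep B')" for f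
    unfolding perm_rep_hom[OF B B'] bmats_def mem_Collect_eq using a by blast
  have "u = (\<Sum>f\<in>P G p q. tens (emb_mor (basis f)) (\<lambda>yx. u ((0, 0, f), yx)))"
  proof (rule ext)
    fix x :: "(nat \<times> nat \<times> 'a gdiag) \<times> (nat \<times> nat) list \<times> (nat \<times> nat) list"
    obtain i j g ys xs where [simp]: "x = ((i, j, g), (ys, xs))" by (metis prod.collapse)
    have "(\<Sum>f\<in>P G p q. tens (emb_mor (basis f)) (\<lambda>yx. u ((0, 0, f), yx))) x =
        (\<Sum>f\<in>P G p q. if f = g then if i = 0 \<and> j = 0 then u ((0, 0, g), (ys, xs)) else 0 else 0)"
      unfolding sum_fun_apply by (rule sum.cong) (auto simp: tens_apply emb_mor_apply basis_def)
    also have "\<dots> = u x"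
    proof -
      have "u ((i, j, g), (ys, xs)) = 0 \<or> i = 0 \<and> j = 0 \<and> g \<in> P G p q" using a by blast
      then show ?thesis by (auto simp: sum.delta)
    qed
    finally show "u x = (\<Sum>f\<in>P G p q. tens (emb_mor (basis f)) (\<lambda>yx. u ((0, 0, f), yx))) x" ..
  qed
  moreover have "(\<Sum>f\<in>P G p q. tens (emb_mor (basis f)) (\<lambda>yx. u ((0, 0, f), yx))) \<in> Hom T (em1 p, perm_rep B) (em1 q, perm_rep B')"
    by (rule TL.sum_hom) (auto simp: Tp.T_sel(1) perm_rep_obj B B' C1_hom basis_hom intro!: Tp.T_pure s)
  ultimately show "u \<in> Hom T (em1 p, perm_rep B) (em1 q, perm_rep B')" by simp
qed

text \<open>The projection of \<open>W\<^sup>\<otimes>\<^sup>n\<close> onto the span of the basis elements with distinct rows, and also the embedding of the latter.\<close>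

definition diagB :: "(nat \<times> nat) list \<times> (nat \<times> nat) list \<Rightarrow> 'k" where
  "diagB = (\<lambda>(ys, xs). of_bool (ys = xs \<and> xs \<in> B0))"

end

section \<open>Kernels relative to \<open>n\<close> distinguished rows\<close>

context fin_group
begin

lemma adm_same: "f \<in> P G a b \<Longrightarrow> valid a b z \<Longrightarrow> valid a b z' \<Longrightarrow> ty a b z = ty a b z' \<Longrightarrow> adm f z \<longleftrightarrow> adm f z'"
  by (simp add: adm_ty)

lemma ker_same: "valid a b z \<Longrightarrow> valid a b z' \<Longrightarrow> ty a b z = ty a b z' \<Longrightarrow> ker a b u z = ker a b u z'"
  unfolding ker_def by (intro sum.cong refl arg_cong2[where f = "(*)"] arg_cong[where f = of_bool] adm_same)

lemma ty_cong:
  assumes v: "valid a b z" and e: "\<And>p. p \<in> points a b \<Longrightarrow> z p = z' p"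
  shows "valid a b z'" "ty a b z = ty a b z'"
proof -
  show v': "valid a b z'" using v e by (auto simp: valid_def)
  show "ty a b z = ty a b z'" unfolding ty_eq_iff[OF v v'] using e by simp
qed

lemma ty_same:
  assumes "valid a b z" "valid a b z'" "ty a b z = ty a b z'" "p \<in> points a b" "q \<in> points a b"
  shows "fst (z p) = fst (z q) \<longleftrightarrow> fst (z' p) = fst (z' q)"
    and "fst (z p) = fst (z q) \<Longrightarrow> inv (snd (z p)) \<otimes> snd (z q) = inv (snd (z' p)) \<otimes> snd (z' q)"
  using ty_eq_iff[OF assms(1,2)] assms(3-5) by blast+

definition emap :: "nat set \<Rightarrow> nat set \<Rightarrow> point \<Rightarrow> point" where
  "emap I J p = (case p of Up r \<Rightarrow> Up (en I r) | Lo r \<Rightarrow> Lo (en J r) | Mid r \<Rightarrow> Mid r)"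

lemma jn_emap: "p \<in> points c d \<Longrightarrow> jn (x \<circ> en I) (y \<circ> en J) p = jn x y (emap I J p)"
  by (auto simp: points_def emap_def)

lemma emap_mem: "I \<subseteq> {1..a} \<Longrightarrow> J \<subseteq> {1..b} \<Longrightarrow> p \<in> points (card I) (card J) \<Longrightarrow> emap I J p \<in> points a b"
proof -
  assume IJ: "I \<subseteq> {1..a}" "J \<subseteq> {1..b}" and p: "p \<in> points (card I) (card J)"
  have "en I r \<in> {1..a}" if "r \<in> {1..card I}" for r using en_mem[OF finite_subset[OF IJ(1)] that] IJ by auto
  moreover have "en J r \<in> {1..b}" if "r \<in> {1..card J}" for r using en_mem[OF finite_subset[OF IJ(2)] that] IJ by auto
  ultimately show ?thesis using p by (auto simp: points_def emap_def)
qed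

lemma val1_restrict: "K \<subseteq> {1..a} \<Longrightarrow> val1 a x \<Longrightarrow> val1 (card K) (x \<circ> en K)"
proof -
  assume K: "K \<subseteq> {1..a}" and v: "val1 a x"
  have "en K r \<in> {1..a}" if "r \<in> {1..card K}" for r using en_mem[OF finite_subset[OF K] that] K by auto
  then show ?thesis using v by (simp add: val1_def)
qed

lemma restrict_ty:
  assumes IJ: "I \<subseteq> {1..a}" "J \<subseteq> {1..b}" and v: "val1 a x" "val1 b y" "val1 a x'" "val1 b y'"
    and e: "ty a b (jn x y) = ty a b (jn x' y')"
  shows "ty (card I) (card J) (jn (x \<circ> en I) (y \<circ> en J)) = ty (card I) (card J) (jn (x' \<circ> en I) (y' \<circ> en J))"
proof -
  have vz: "valid a b (jn x y)" "valid a b (jn x' y')" using v by (auto simp: valid_jn)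
  have vr: "valid (card I) (card J) (jn (x \<circ> en I) (y \<circ> en J))" "valid (card I) (card J) (jn (x' \<circ> en I) (y' \<circ> en J))"
    using v IJ by (auto simp: valid_jn val1_restrict)
  show ?thesis
    unfolding ty_eq_iff[OF vr]
    using ty_same[OF vz e emap_mem[OF IJ] emap_mem[OF IJ]] by (simp add: jn_emap)
qed

lemma ker_exists2:
  fixes T :: "(nat \<Rightarrow> nat \<times> 'a) \<Rightarrow> (nat \<Rightarrow> nat \<times> 'a) \<Rightarrow> 'k::field_char_0" and t :: 'k
  assumes inv: "\<And>x y x' y'. val1 a x \<Longrightarrow> val1 b y \<Longrightarrow> val1 a x' \<Longrightarrow> val1 b y' \<Longrightarrow> ty a b (jn x y) = ty a b (jn x' y') \<Longrightarrow> T x y = T x' y'"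
  shows "\<exists>u. u \<in> Hom (Gcat G t) a b \<and> (\<forall>x y. val1 a x \<longrightarrow> val1 b y \<longrightarrow> ker a b u (jn x y) = T x y)"
proof -
  let ?x = "\<lambda>z i. z (Up i)" and ?y = "\<lambda>z j. z (Lo j)"
  have e: "p \<in> points a b \<Longrightarrow> z p = jn (?x z) (?y z) p" for z p by (auto simp: points_def)
  have "T (?x z) (?y z) = T (?x z') (?y z')" if v: "valid a b z" "valid a b z'" and t: "ty a b z = ty a b z'" for z z'
  proof (rule inv)
    note w = ty_cong[OF v(1), of "jn (?x z) (?y z)", OF e] ty_cong[OF v(2), of "jn (?x z') (?y z')", OF e]
    show "val1 a (?x z)" "val1 b (?y z)" "val1 a (?x z')" "val1 b (?y z')" using w(1,3) by (auto simp: valid_jn)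
    show "ty a b (jn (?x z) (?y z)) = ty a b (jn (?x z') (?y z'))" using w(2,4) t by simp
  qed
  from ker_exists[where T = "\<lambda>z. T (?x z) (?y z)" and t = t, OF this]
  obtain u where u: "u \<in> Hom (Gcat G t) a b" "\<And>z. valid a b z \<Longrightarrow> ker a b u z = T (?x z) (?y z)" by blast
  then show ?thesis by (intro exI[of _ u]) (simp add: valid_jn)
qed

lemma ker_inj2:
  fixes u :: "'a gdiag \<Rightarrow> 'k::field_char_0"
  assumes u: "u \<in> Hom (Gcat G t) a b" "v \<in> Hom (Gcat G t) a b"
    and z: "\<And>x y. val1 a x \<Longrightarrow> val1 b y \<Longrightarrow> ker a b u (jn x y) = ker a b v (jn x y)"
  shows "u = v"
proof (rule ker_inj[OF u, of 0])
  fix z assume v: "valid a b z"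
  have e: "p \<in> points a b \<Longrightarrow> z p = jn (\<lambda>i. z (Up i)) (\<lambda>j. z (Lo j)) p" for p by (auto simp: points_def)
  have "val1 a (\<lambda>i. z (Up i))" "val1 b (\<lambda>j. z (Lo j))" using ty_cong(1)[OF v, of "jn (\<lambda>i. z (Up i)) (\<lambda>j. z (Lo j))", OF e] by (auto simp: valid_jn)
  then show "ker a b u z = ker a b v z" unfolding ker_jn[of a b _ z] by (rule z)
qed

end

context wreath_rep
begin

section \<open>Good tuples and coordinates relative to them\<close>

abbreviation Iw :: "nat \<Rightarrow> nat set" where "Iw a \<equiv> {n<..n + a}"

definition good :: "nat \<Rightarrow> (nat \<Rightarrow> nat \<times> 'a) \<Rightarrow> bool" where
  "good a y \<longleftrightarrow> (\<forall>i\<in>{1..n}. \<forall>j\<in>{1..n + a}. i \<noteq> j \<longrightarrow> fst (y i) \<noteq> fst (y j))"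

text \<open>After the renaming of rows by \<open>std\<close>, these are the positions in rows beyond
  \<open>n\<close> (see \<open>std_out\<close>), so they name a block of \<open>Res\<close>.\<close>

definition out :: "nat \<Rightarrow> (nat \<Rightarrow> nat \<times> 'a) \<Rightarrow> (nat \<Rightarrow> nat \<times> 'a) \<Rightarrow> nat set" where
  "out b x y = {i\<in>{1..b}. \<forall>k\<in>{1..n}. fst (y k) \<noteq> fst (x i)}"

text \<open>The coordinates of \<open>q\<close> relative to the first \<open>n\<close> entries of \<open>y\<close>, provided that its row occurs there.\<close>

definition rel :: "(nat \<Rightarrow> nat \<times> 'a) \<Rightarrow> nat \<times> 'a \<Rightarrow> nat \<times> 'a" where
  "rel y q = (let k = (THE k. k \<in> {1..n} \<and> fst (y k) = fst q) in (k, inv (snd (y k)) \<otimes> snd q))"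

lemma goodD: "good a y \<Longrightarrow> i \<in> {1..n} \<Longrightarrow> j \<in> {1..n + a} \<Longrightarrow> fst (y i) = fst (y j) \<Longrightarrow> i = j"
  unfolding good_def by blast

lemma the_row: "good a y \<Longrightarrow> k \<in> {1..n} \<Longrightarrow> (THE l. l \<in> {1..n} \<and> fst (y l) = fst (y k)) = k"
proof (rule the_equality)
  assume g: "good a y" and k: "k \<in> {1..n}"
  show "k \<in> {1..n} \<and> fst (y k) = fst (y k)" using k by simp
  fix l assume l: "l \<in> {1..n} \<and> fst (y l) = fst (y k)"
  have "k \<in> {1..n + a}" using k by auto
  then show "l = k" using goodD[OF g, of l k] l by blast
qed

lemma rel_eq:
  assumes "good a y" "k \<in> {1..n}" "fst (y k) = fst q"
  shows "rel y q = (k, inv (snd (y k)) \<otimes> snd q)"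
  using the_row[OF assms(1,2)] unfolding rel_def Let_def assms(3) by simp

lemma out_sub: "out b x y \<subseteq> {1..b}"
  by (auto simp: out_def)

lemma not_out: "i \<in> {1..b} - out b x y \<Longrightarrow> \<exists>k\<in>{1..n}. fst (y k) = fst (x i)"
  by (auto simp: out_def)

text \<open>The part of a joint type that concerns goodness, \<open>out\<close> and
  \<open>rel\<close>. It does not tell which of the two tuples is the upper one and so serves both
  directions.\<close>

definition SAME where
  "SAME a b x y x' y' \<longleftrightarrow> (\<forall>i\<in>{1..n + a}. \<forall>j\<in>{1..n + a}. fst (y i) = fst (y j) \<longleftrightarrow> fst (y' i) = fst (y' j)) \<and>
     (\<forall>i\<in>{1..n + a}. \<forall>j\<in>{1..b}. (fst (y i) = fst (x j) \<longleftrightarrow> fst (y' i) = fst (x' j)) \<and>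
       (fst (y i) = fst (x j) \<longrightarrow> inv (snd (y i)) \<otimes> snd (x j) = inv (snd (y' i)) \<otimes> snd (x' j)))"

lemma SAME_good: "SAME a b x y x' y' \<Longrightarrow> good a y \<longleftrightarrow> good a y'"
  unfolding SAME_def good_def by (auto simp del: One_nat_def)

lemma SAME_out: "SAME a b x y x' y' \<Longrightarrow> out b x y = out b x' y'"
  unfolding SAME_def out_def by (auto simp del: One_nat_def)

lemma SAME_rel:
  assumes s: "SAME a b x y x' y'" and g: "good a y" and i: "i \<in> {1..b} - out b x y"
  shows "rel y (x i) = rel y' (x' i)"
proof -
  obtain k where k: "k \<in> {1..n}" "fst (y k) = fst (x i)" using not_out[OF i] by blast
  have "k \<in> {1..n + a}" using k(1) by auto
  then have "fst (y' k) = fst (x' i)" "inv (snd (y k)) \<otimes> snd (x i) = inv (snd (y' k)) \<otimes> snd (x' i)"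
    using s k(2) i unfolding SAME_def by blast+
  then show ?thesis using rel_eq[OF g k] rel_eq[OF _ k(1), of a y' "x' i"] g SAME_good[OF s] by simp
qed

lemma lst_cong: "finite K \<Longrightarrow> (\<And>i. i \<in> K \<Longrightarrow> x i = y i) \<Longrightarrow> lst K x = lst K y"
  unfolding lst_def using en_mem[of K] by (auto simp del: upt_Suc)

lemma lst_initial: "lst {1..n} y = map (\<lambda>i. cod (y i)) [1..<Suc n]"
  unfolding lst_def by (auto simp: en_initial simp del: upt_Suc One_nat_def)

lemma compl_Iw: "{1..n + a} - Iw a = {1..n}"
  by auto

lemma lst_B0: "(\<And>i. i \<in> {1..n} \<Longrightarrow> fst (y i) \<in> {1..n} \<and> snd (y i) \<in> carrier G) \<Longrightarrow> inj_on (\<lambda>i. fst (y i)) {1..n} \<Longrightarrow> lst {1..n} y \<in> B0"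
proof -
  assume a: "\<And>i. i \<in> {1..n} \<Longrightarrow> fst (y i) \<in> {1..n} \<and> snd (y i) \<in> carrier G" and i: "inj_on (\<lambda>i. fst (y i)) {1..n}"
  have "map fst (lst {1..n} y) = map (\<lambda>i. fst (y i)) [1..<Suc n]" by (simp add: lst_initial o_def del: upt_Suc One_nat_def)
  moreover have "distinct (map (\<lambda>i. fst (y i)) [1..<Suc n])" using i by (simp add: distinct_map atLeastLessThanSuc_atLeastAtMost del: upt_Suc)
  ultimately have "distinct (map fst (lst {1..n} y))" by simp
  moreover have "lst {1..n} y \<in> W_basis G n n" using lst_W[of "{1..n}" y] a by simp
  ultimately show "lst {1..n} y \<in> B0" by (simp add: B0_def)
qed

text \<open>Entries at the positions in \<open>I\<close> are taken from \<open>g\<close>, the others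
  from \<open>xs\<close>, both located by rank. This supplies configurations at which
  \<open>Res_kernel\<close> reads off a prescribed coordinate of a prescribed block.\<close>

lemma realize:
  assumes I: "I \<subseteq> {1..b}" and xs: "xs \<in> W_basis G n (b - card I)" and g: "\<And>q. q \<in> {1..card I} \<Longrightarrow> n < fst (g q) \<and> snd (g q) \<in> carrier G"
  obtains x where "val1 b x" "\<And>i. i \<in> {1..b} \<Longrightarrow> 1 \<le> fst (x i)" "I = {i\<in>{1..b}. n < fst (x i)}"
    "\<And>q. q \<in> {1..card I} \<Longrightarrow> x (en I q) = g q" "lst ({1..b} - I) x = xs"
proof -
  have fI: "finite I" using I finite_subset by blast
  have cI: "card ({1..b} - I) = b - card I" using I fI by (simp add: card_Diff_subset)
  define x where "x i = (if i \<in> I then g (card {k\<in>I. k \<le> i}) else dec (xs ! (card {k\<in>{1..b} - I. k \<le> i} - 1)))" for i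
  have xin: "n < fst (x i) \<and> snd (x i) \<in> carrier G" if "i \<in> I" for i using g[OF rank_mem[OF fI that]] that by (simp add: x_def)
  have xout: "fst (x i) \<in> {1..n} \<and> snd (x i) \<in> carrier G" if "i \<in> {1..b} - I" for i
  proof -
    have "card {k\<in>{1..b} - I. k \<le> i} \<in> {1..b - card I}" using rank_mem[OF _ that] cI by simp
    then have "xs ! (card {k\<in>{1..b} - I. k \<le> i} - 1) \<in> pairs" using xs by (auto simp: W_mem intro!: subsetD[OF _ nth_mem])
    then show ?thesis using dec_mem that by (simp add: x_def del: One_nat_def atLeastAtMost_iff)
  qed
  have "val1 b x" unfolding val1_def using xin xout by blast
  moreover have "1 \<le> fst (x i)" if "i \<in> {1..b}" for i using xin[of i] xout[of i] that by (cases "i \<in> I") auto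
  moreover have "I = {i\<in>{1..b}. n < fst (x i)}" using xin xout I by force
  moreover have "x (en I q) = g q" if "q \<in> {1..card I}" for q using en_mem[OF fI that] rank_en[OF fI that] by (simp add: x_def)
  moreover have "lst ({1..b} - I) x = xs"
  proof (rule nth_equalityI)
    show "length (lst ({1..b} - I) x) = length xs" using xs cI by (simp add: W_mem)
    fix i assume i: "i < length (lst ({1..b} - I) x)"
    let ?e = "en ({1..b} - I) (Suc i)"
    have q: "Suc i \<in> {1..card ({1..b} - I)}" using i by simp
    have e: "?e \<in> {1..b} - I" "card {k\<in>{1..b} - I. k \<le> ?e} = Suc i" using en_mem[OF _ q] rank_en[OF _ q] by auto
    have "xs ! i \<in> pairs" using xs i cI by (auto simp: W_mem)
    then show "lst ({1..b} - I) x ! i = xs ! i" using lst_nth[OF q, of x] e by (simp add: x_def del: One_nat_def)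
  qed
  ultimately show thesis by (rule that)
qed

text \<open>Renaming rows such that the first \<open>n\<close> entries of a good \<open>y\<close> lie in the rows \<open>1, \<dots>, n\<close> and all other rows are larger.\<close>

definition rmap :: "(nat \<Rightarrow> nat \<times> 'a) \<Rightarrow> nat \<Rightarrow> nat" where
  "rmap y r = (if \<exists>k\<in>{1..n}. fst (y k) = r then (THE k. k \<in> {1..n} \<and> fst (y k) = r) else n + 1 + r)"

definition std :: "(nat \<Rightarrow> nat \<times> 'a) \<Rightarrow> (nat \<Rightarrow> nat \<times> 'a) \<Rightarrow> nat \<Rightarrow> nat \<times> 'a" where
  "std y x i = (rmap y (fst (x i)), snd (x i))"

lemma rmap_in: "good a y \<Longrightarrow> k \<in> {1..n} \<Longrightarrow> rmap y (fst (y k)) = k"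
  unfolding rmap_def using the_row[of a y k] by (auto simp del: One_nat_def atLeastAtMost_iff)

lemma rmap_out: "\<forall>k\<in>{1..n}. fst (y k) \<noteq> r \<Longrightarrow> rmap y r = n + 1 + r"
  unfolding rmap_def by auto

lemma rmap_range: "good a y \<Longrightarrow> 1 \<le> rmap y r" "good a y \<Longrightarrow> n < rmap y r \<longleftrightarrow> (\<forall>k\<in>{1..n}. fst (y k) \<noteq> r)"
proof -
  assume g: "good a y"
  show "1 \<le> rmap y r"
    using rmap_in[OF g] rmap_out[of y r] by (cases "\<exists>k\<in>{1..n}. fst (y k) = r") auto
  show "n < rmap y r \<longleftrightarrow> (\<forall>k\<in>{1..n}. fst (y k) \<noteq> r)"
    using rmap_in[OF g] rmap_out[of y r] by (cases "\<exists>k\<in>{1..n}. fst (y k) = r") auto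
qed

text \<open>Values up to \<open>n\<close> name the distinguished rows of \<open>y\<close>, which are
  distinct; all other rows are shifted by \<open>n + 1\<close>, beyond \<open>n\<close> even for the
  row \<open>0\<close>.\<close>

lemma rmap_inj:
  assumes g: "good a y" and e: "rmap y r = rmap y s"
  shows "r = s"
proof (cases "n < rmap y r")
  case True
  then have "\<forall>k\<in>{1..n}. fst (y k) \<noteq> r" "\<forall>k\<in>{1..n}. fst (y k) \<noteq> s" using e rmap_range(2)[OF g] by metis+
  then show ?thesis using e rmap_out[of y r] rmap_out[of y s] by linarith
next
  case False
  then obtain k l where "k \<in> {1..n}" "fst (y k) = r" "l \<in> {1..n}" "fst (y l) = s" using rmap_range(2)[OF g] e by metis
  then show ?thesis using rmap_in[OF g] e by metis
qed

lemma std_out: "good a y \<Longrightarrow> {i\<in>{1..b}. n < fst (std y x i)} = out b x y"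
  unfolding out_def std_def by (simp add: rmap_range(2) del: One_nat_def)

lemma std_Iw: "good a y \<Longrightarrow> {j\<in>{1..n + a}. n < fst (std y y j)} = Iw a"
proof -
  assume g: "good a y"
  have "n < fst (std y y j) \<longleftrightarrow> n < j" if j: "j \<in> {1..n + a}" for j
    using goodD[OF g _ j] j by (force simp: std_def rmap_range(2)[OF g] simp del: One_nat_def)
  then show ?thesis by auto
qed

lemma std_fst: "good a y \<Longrightarrow> k \<in> {1..n} \<Longrightarrow> fst (std y y k) = k"
  by (simp add: std_def rmap_in)

lemma std_val1: "val1 b x \<Longrightarrow> val1 b (std y x)"
  by (simp add: val1_def std_def)

text \<open>An injective renaming of rows preserves types, so kernels may be evaluated in standard
  position.\<close>

lemma std_ty:
  assumes g: "good a y" and v: "val1 p x" "val1 q w"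
  shows "ty p q (jn x w) = ty p q (jn (std y x) (std y w))"
proof -
  have z: "jn (std y x) (std y w) s = (rmap y (fst (jn x w s)), snd (jn x w s))" if "s \<in> points p q" for s
    using that by (auto simp: points_def std_def)
  have "valid p q (jn x w)" "valid p q (jn (std y x) (std y w))" using v std_val1 by (auto simp: valid_jn)
  then show ?thesis using rmap_inj[OF g] by (subst ty_eq_iff) (auto simp: z)
qed

end

section \<open>Morphisms to good tuples: from \<open>[b]\<close> to \<open>[n + a]\<close>\<close>

context res_core
begin

lemma Wl_hom:
  assumes M: "M \<in> mat_hom T (Wl b) [(em1 a, kH)]" and I: "I \<subseteq> {1..b}"
  shows "entry M 0 (pos b I) \<in> Hom T (em1 (card I), perm_rep (W_basis G n (b - card I))) (em1 a, kH)"
  using mat_hom_entry[OF M, of 0 "pos b I"] pos_mem[OF I] by (simp add: Wl_nth W_pow_perm)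

lemma Wl_hom2:
  assumes M: "M \<in> mat_hom T [(em1 a, kH)] (Wl b)" and I: "I \<subseteq> {1..b}"
  shows "entry M (pos b I) 0 \<in> Hom T (em1 a, kH) (em1 (card I), perm_rep (W_basis G n (b - card I)))"
  using mat_hom_entry[OF M, of "pos b I" 0] pos_mem[OF I] by (simp add: Wl_nth W_pow_perm)

lemma Res_entry_hom:
  assumes u: "u \<in> Hom Gt a b" and I: "I \<subseteq> {1..a}" and J: "J \<subseteq> {1..b}"
  shows "entry (fmor RR (emt a) (emt b) (emb_mor u)) (pos b J) (pos a I) \<in>
     Hom T (em1 (card I), perm_rep (W_basis G n (a - card I))) (em1 (card J), perm_rep (W_basis G n (b - card J)))"
  using mat_hom_entry[OF Res_mat_hom[OF u], of "pos b J" "pos a I"] pos_mem[OF I] pos_mem[OF J] by (simp add: Wl_nth W_pow_perm)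

lemma Iw_sub: "Iw a \<subseteq> {1..n + a}"
  by auto

lemma SAME_ty1:
  assumes v: "val1 b x" "val1 (n + a) y" "val1 b x'" "val1 (n + a) y'" and e: "ty b (n + a) (jn x y) = ty b (n + a) (jn x' y')"
  shows "SAME a b x y x' y'"
proof -
  have vz: "valid b (n + a) (jn x y)" "valid b (n + a) (jn x' y')" using v by (auto simp: valid_jn)
  have p: "i \<in> {1..n + a} \<Longrightarrow> Lo i \<in> points b (n + a)" "j \<in> {1..b} \<Longrightarrow> Up j \<in> points b (n + a)" for i j
    by (auto simp: points_def)
  show ?thesis
    unfolding SAME_def
    using ty_same[OF vz e p(1) p(1)] ty_same[OF vz e p(1) p(2)] by simp
qed

text \<open>The kernel forced on a preimage of \<open>M\<close>. Taking the first \<open>n\<close>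
  entries of \<open>y\<close> as a frame and moving it to \<open>y0\<close> turns the entries of
  \<open>x\<close> in its rows into \<open>rel y \<circ> x\<close>; the other positions select the
  block of \<open>M\<close> and are evaluated in the first factor.\<close>

definition T1 where
  "T1 a b M x y = (if good a y then sk (card (out b x y)) a (entry M 0 (pos b (out b x y)))
     (jn (x \<circ> en (out b x y)) (y \<circ> en (Iw a))) (y0, lst ({1..b} - out b x y) (rel y \<circ> x)) else 0)"

text \<open>All ingredients depend on the joint type only: goodness, \<open>out\<close> and
  \<open>rel\<close> through \<open>SAME\<close>, and the kernel in the first factor through the
  restricted type.\<close>

lemma kernel_T1:
  "\<exists>u. u \<in> Hom Gt b (n + a) \<and> (\<forall>x y. val1 b x \<longrightarrow> val1 (n + a) y \<longrightarrow> ker b (n + a) u (jn x y) = T1 a b M x y)"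
proof (rule ker_exists2[where T = "\<lambda>x y. T1 a b M x y"])
  fix x y x' y' :: "nat \<Rightarrow> nat \<times> 'a"
  assume v: "val1 b x" "val1 (n + a) y" "val1 b x'" "val1 (n + a) y'" and e: "ty b (n + a) (jn x y) = ty b (n + a) (jn x' y')"
  have s: "SAME a b x y x' y'" by (rule SAME_ty1[OF _ _ _ _ e]) (fact v)+
  let ?I = "out b x y"
  have "T1 a b M x' y' = (if good a y then sk (card ?I) a (entry M 0 (pos b ?I)) (jn (x' \<circ> en ?I) (y' \<circ> en (Iw a))) (y0, lst ({1..b} - ?I) (rel y' \<circ> x')) else 0)"
    by (simp add: T1_def SAME_out[OF s] SAME_good[OF s])
  also have "\<dots> = T1 a b M x y"
  proof (cases "good a y")
    case True
    have l: "lst ({1..b} - ?I) (rel y' \<circ> x') = lst ({1..b} - ?I) (rel y \<circ> x)"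
      using SAME_rel[OF s True] by (intro lst_cong) auto
    have tt: "ty (card ?I) (card (Iw a)) (jn (x \<circ> en ?I) (y \<circ> en (Iw a))) = ty (card ?I) (card (Iw a)) (jn (x' \<circ> en ?I) (y' \<circ> en (Iw a)))"
      by (rule restrict_ty[OF out_sub Iw_sub v e])
    have vv: "valid (card ?I) (card (Iw a)) (jn (x \<circ> en ?I) (y \<circ> en (Iw a)))" "valid (card ?I) (card (Iw a)) (jn (x' \<circ> en ?I) (y' \<circ> en (Iw a)))"
      unfolding valid_jn by (intro conjI val1_restrict[OF out_sub] val1_restrict[OF Iw_sub] v)+
    have "adm f (jn (x \<circ> en ?I) (y \<circ> en (Iw a))) \<longleftrightarrow> adm f (jn (x' \<circ> en ?I) (y' \<circ> en (Iw a)))"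
      if "f \<in> P G (card ?I) a" for f 
    proof -
      from that have "f \<in> P G (card ?I) (card (Iw a))" by simp
      then show ?thesis by (rule adm_same[OF _ vv tt])
    qed
    then show ?thesis using True by (simp add: T1_def sk_def l del: One_nat_def)
  qed (simp add: T1_def)
  finally show "T1 a b M x y = T1 a b M x' y'" ..
qed

text \<open>A good configuration is moved to standard position without changing its type. There
  \<open>Res_kernel\<close> reads its value from the block at \<open>Iw a\<close>, with the frame
  giving a tuple in \<open>B0\<close>.\<close>

lemma Psi1_inj:
  assumes u: "u \<in> Hom Gt b (n + a)" "u' \<in> Hom Gt b (n + a)"
    and sup: "\<And>x y w. val1 b x \<Longrightarrow> val1 (n + a) y \<Longrightarrow> \<not> good a y \<Longrightarrow> w \<in> {u, u'} \<Longrightarrow> ker b (n + a) w (jn x y) = 0"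
    and eq: "\<And>I f xs ys. I \<subseteq> {1..b} \<Longrightarrow> ys \<in> B0 \<Longrightarrow>
      entry (fmor RR (emt b) (emt (n + a)) (emb_mor u)) (pos (n + a) (Iw a)) (pos b I) ((0, 0, f), (ys, xs)) =
      entry (fmor RR (emt b) (emt (n + a)) (emb_mor u')) (pos (n + a) (Iw a)) (pos b I) ((0, 0, f), (ys, xs))"
  shows "u = u'"
proof (rule ker_inj2[OF u])
  fix x y assume v: "val1 b x" "val1 (n + a) y"
  show "ker b (n + a) u (jn x y) = ker b (n + a) u' (jn x y)"
  proof (cases "good a y")
    case False
    then show ?thesis using sup[OF v(1) v(2) False] by simp
  next
    case True
    note g = True
    let ?x = "std y x" and ?y = "std y y" and ?I = "out b x y"
    have vs: "val1 b ?x" "val1 (n + a) ?y" using v std_val1 by auto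
    have ty: "ty b (n + a) (jn x y) = ty b (n + a) (jn ?x ?y)" by (rule std_ty[OF g v])
    have k: "ker b (n + a) w (jn x y) = ker b (n + a) w (jn ?x ?y)" for w :: "'a gdiag \<Rightarrow> 'k"
      by (rule ker_same[OF _ _ ty]) (simp_all add: valid_jn v vs)
    have r: "1 \<le> fst (?x i)" "1 \<le> fst (?y i)" for i using rmap_range(1)[OF g] by (auto simp: std_def simp del: One_nat_def)
    have B: "lst {1..n} ?y \<in> B0"
    proof (rule lst_B0)
      show "fst (?y i) \<in> {1..n} \<and> snd (?y i) \<in> carrier G" if "i \<in> {1..n}" for i
        using std_fst[OF g that] vs(2) that by (auto simp: val1_def)
      show "inj_on (\<lambda>i. fst (?y i)) {1..n}" using std_fst[OF g] by (auto intro!: inj_onI)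
    qed
    have R: "ker b (n + a) w (jn ?x ?y) = sk (card ?I) (card (Iw a))
        (entry (fmor RR (emt b) (emt (n + a)) (emb_mor w)) (pos (n + a) (Iw a)) (pos b ?I))
        (jn (?x \<circ> en ?I) (?y \<circ> en (Iw a))) (lst ({1..n + a} - Iw a) ?y, lst ({1..b} - ?I) ?x)"
      if "w \<in> Hom Gt b (n + a)" for w
      by (rule Res_kernel[symmetric, OF that vs r(1) r(2) std_out[OF g, symmetric] std_Iw[OF g, symmetric]])
    show ?thesis
      unfolding k R[OF u(1)] R[OF u(2)] compl_Iw sk_def using eq[OF out_sub B] by (intro sum.cong refl) simp
  qed
qed

text \<open>Both entries are invariant under the wreath product, which is transitive on
  \<open>B0\<close>, so \<open>ys = y0\<close> suffices. For \<open>y0\<close> the two are compared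
  as kernels in the first factor, at configurations supplied by \<open>realize\<close>.\<close>

lemma Psi1_eq:
  assumes u: "u \<in> Hom Gt b (n + a)"
    and ku: "\<And>x y. val1 b x \<Longrightarrow> val1 (n + a) y \<Longrightarrow> ker b (n + a) u (jn x y) = T1 a b M x y"
    and M: "M \<in> mat_hom T (Wl b) [(em1 a, kH)]" and I: "I \<subseteq> {1..b}" and ys: "ys \<in> B0"
  shows "entry (fmor RR (emt b) (emt (n + a)) (emb_mor u)) (pos (n + a) (Iw a)) (pos b I) (k, (ys, xs)) =
    entry M 0 (pos b I) (k, (ys, xs))"
proof -
  let ?E = "entry (fmor RR (emt b) (emt (n + a)) (emb_mor u)) (pos (n + a) (Iw a)) (pos b I)"
  let ?M = "entry M 0 (pos b I)"
  let ?W = "W_basis G n (b - card I)"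
  have fI: "finite I" using I finite_subset by blast
  have E: "?E \<in> Hom T (em1 (card I), perm_rep ?W) (em1 a, perm_rep (W_basis G n n))"
    using Res_entry_hom[OF u I Iw_sub] by simp
  note Ei = E[unfolded T_hom_iff[OF W_stable W_stable], THEN conjunct1, rule_format] and Ee = E[unfolded T_hom_iff[OF W_stable W_stable], THEN conjunct2, rule_format]
  note Mh = Wl_hom[OF M I]
  note Mi = Mh[unfolded T_hom_iff[OF W_stable B0_stable], THEN conjunct1, rule_format] and Me = Mh[unfolded T_hom_iff[OF W_stable B0_stable], THEN conjunct2, rule_format]
  have main: "?E ((0, 0, f), (y0, xs)) = ?M ((0, 0, f), (y0, xs))" if xs: "xs \<in> ?W" for xs f
  proof -
    let ?c = "\<lambda>f. ?E ((0, 0, f), (y0, xs))" and ?c' = "\<lambda>f. ?M ((0, 0, f), (y0, xs))"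
    have "?c = ?c'"
    \<comment> \<open>The test rows start beyond \<open>n\<close>, so they stay apart from the rows
      of the frame.\<close>
    proof (rule ker_inj[where r = n and a = "card I" and b = a and t = t])
      show "?c \<in> Hom Gt (card I) a" "?c' \<in> Hom Gt (card I) a" unfolding Gcat_hom using Ei Mi by blast+
      fix z assume v: "valid (card I) a z" and r: "\<And>p. p \<in> points (card I) a \<Longrightarrow> fst (z p) \<in> {n<..n + card I + a}"
      have zx: "n < fst (z (Up q)) \<and> snd (z (Up q)) \<in> carrier G" if "q \<in> {1..card I}" for q
        using r[of "Up q"] validD[OF v, of "Up q"] that by (auto simp: points_def)
      have zy: "n < fst (z (Lo q)) \<and> snd (z (Lo q)) \<in> carrier G" if "q \<in> {1..card (Iw a)}" for q
        using r[of "Lo q"] validD[OF v, of "Lo q"] that by (auto simp: points_def)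
      obtain x where x: "val1 b x" "\<And>i. i \<in> {1..b} \<Longrightarrow> 1 \<le> fst (x i)" "I = {i\<in>{1..b}. n < fst (x i)}"
        "\<And>q. q \<in> {1..card I} \<Longrightarrow> x (en I q) = z (Up q)" "lst ({1..b} - I) x = xs"
        by (rule realize[where g = "\<lambda>q. z (Up q)", OF I xs zx]) blast+
      have y0W: "y0 \<in> W_basis G n (n + a - card (Iw a))" using y0_B0 B0_W by auto
      obtain y where y: "val1 (n + a) y" "\<And>i. i \<in> {1..n + a} \<Longrightarrow> 1 \<le> fst (y i)" "Iw a = {i\<in>{1..n + a}. n < fst (y i)}"
        "\<And>q. q \<in> {1..card (Iw a)} \<Longrightarrow> y (en (Iw a) q) = z (Lo q)" "lst ({1..n + a} - Iw a) y = y0"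
        by (rule realize[where g = "\<lambda>q. z (Lo q)", OF Iw_sub y0W zy]) blast+
      have ly: "lst {1..n} y = y0" using y(5) unfolding compl_Iw .
      have yi: "y i = (i, \<one>)" if i: "i \<in> {1..n}" for i
      proof -
        have "cod (y i) = cod (i, \<one>)" using ly i unfolding lst_initial y0_def map_eq_conv by (simp del: upt_Suc)
        moreover have "snd (y i) \<in> carrier G" using y(1) i by (simp add: val1_def)
        ultimately show ?thesis by (metis dec_cod one_closed snd_conv)
      qed
      have zz: "jn (x \<circ> en I) (y \<circ> en (Iw a)) p = z p" if "p \<in> points (card I) a" for p
        using x(4) y(4) that by (auto simp: points_def simp del: One_nat_def)
      have yj: "n < fst (y j) \<longleftrightarrow> n < j" if "j \<in> {1..n + a}" for j
        using y(3) that by (metis (mono_tags, lifting) atLeastAtMost_iff greaterThanAtMost_iff mem_Collect_eq)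
      have gy: "good a y" unfolding good_def
      proof (intro ballI impI)
        fix i j assume ij: "i \<in> {1..n}" "j \<in> {1..n + a}" "i \<noteq> j"
        then show "fst (y i) \<noteq> fst (y j)" using yj[of j] yi[of j] yi[of i] by (cases "j \<le> n") auto
      qed
      have xout: "fst (x i) \<in> {1..n}" if "i \<in> {1..b} - I" for i using that x(2)[of i] x(3) by auto
      have o: "out b x y = I"
      proof -
        have "(\<forall>k\<in>{1..n}. fst (y k) \<noteq> fst (x i)) \<longleftrightarrow> i \<in> I" if i: "i \<in> {1..b}" for i
        proof (cases "i \<in> I")
          case True
          then have "n < fst (x i)" using x(3) by blast
          then show ?thesis using yi True by auto
        next
          case False
          then show ?thesis using xout[of i] yi[of "fst (x i)"] i by fastforce
        qed
        then have "out b x y = {i\<in>{1..b}. i \<in> I}" unfolding out_def by blast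
        then show ?thesis using I by auto
      qed
      \<comment> \<open>The frame of \<open>y\<close> is \<open>y0\<close> itself, so relative
        coordinates are the original ones.\<close>
      have relx: "rel y (x i) = x i" if i: "i \<in> {1..b} - I" for i
        using rel_eq[OF gy xout[OF i], of "x i"] yi[OF xout[OF i]] x(1) i by (simp add: val1_def)
      have ll: "lst ({1..b} - I) (rel y \<circ> x) = xs"
        using lst_cong[of "{1..b} - I" "rel y \<circ> x" x] relx x(5) by simp
      have skc: "sk (card I) a N z' yx = sk (card I) a N z yx" if "\<And>p. p \<in> points (card I) a \<Longrightarrow> z' p = z p" for N z' yx
        unfolding sk_def using adm_cong[of _ "card I" a z' z] that by (intro sum.cong refl) simp
      have "ker (card I) a ?c z = sk (card I) a ?E z (y0, xs)" by (simp add: ker_def sk_def)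
      also have "\<dots> = ker b (n + a) u (jn x y)"
        using Res_kernel[OF u x(1) y(1) x(2) y(2) x(3) y(3)] unfolding x(5) y(5) by (simp add: skc[OF zz])
      also have "\<dots> = T1 a b M x y" by (rule ku[OF x(1) y(1)])
      also have "\<dots> = sk (card I) a ?M z (y0, xs)" by (simp add: T1_def gy o ll skc[OF zz] del: One_nat_def)
      also have "\<dots> = ker (card I) a ?c' z" by (simp add: ker_def sk_def)
      finally show "ker (card I) a ?c z = ker (card I) a ?c' z" .
    qed
    then show ?thesis by (rule fun_cong)
  qed
  obtain i j f where [simp]: "k = (i, j, f)" by (metis prod.collapse)
  show ?thesis
  proof (cases "i = 0 \<and> j = 0 \<and> xs \<in> ?W")
    case False
    then have "?E (k, (ys, xs)) = 0" "?M (k, (ys, xs)) = 0" using Ei[of i j f] Mi[of i j f] unfolding \<open>k = _\<close> by blast+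
    then show ?thesis by simp
  next
    case True
    obtain h where h: "h \<in> carrier H" "act h y0 = ys" using B0_transitive[OF y0_B0 ys] by blast
    let ?xs = "act (inv\<^bsub>H\<^esub> h) xs"
    have xs': "?xs \<in> ?W" using stableD(3)[OF W_stable _, of "inv\<^bsub>H\<^esub> h" xs] h(1) True by simp
    have a: "act h ?xs = xs" using act_inv(2)[OF h(1) stableD(2)[OF W_stable, of xs]] True by blast
    have "?E ((0, 0, f), (act h y0, act h ?xs)) = ?E ((0, 0, f), (y0, ?xs))"
      using Ee[OF h(1), of ?xs y0 f] xs' y0_B0 B0_W by blast
    moreover have "?M ((0, 0, f), (act h y0, act h ?xs)) = ?M ((0, 0, f), (y0, ?xs))"
      using Me[OF h(1), of ?xs y0 f] xs' y0_B0 by blast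
    ultimately show ?thesis using main[OF xs', of f] True unfolding a h(2) by simp
  qed
qed

section \<open>Morphisms from good tuples: the same with upper and lower points exchanged\<close>

lemma SAME_ty2:
  assumes v: "val1 b x" "val1 (n + a) y" "val1 b x'" "val1 (n + a) y'" and e: "ty (n + a) b (jn y x) = ty (n + a) b (jn y' x')"
  shows "SAME a b x y x' y'"
proof -
  have vz: "valid (n + a) b (jn y x)" "valid (n + a) b (jn y' x')" using v by (auto simp: valid_jn)
  have p: "i \<in> {1..n + a} \<Longrightarrow> Up i \<in> points (n + a) b" "j \<in> {1..b} \<Longrightarrow> Lo j \<in> points (n + a) b" for i j
    by (auto simp: points_def)
  show ?thesis
    unfolding SAME_def
    using ty_same[OF vz e p(1) p(1)] ty_same[OF vz e p(1) p(2)] by simp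
qed

definition T2 where
  "T2 a b M x y = (if good a y then sk a (card (out b x y)) (entry M (pos b (out b x y)) 0)
     (jn (y \<circ> en (Iw a)) (x \<circ> en (out b x y))) (lst ({1..b} - out b x y) (rel y \<circ> x), y0) else 0)"

lemma kernel_T2:
  "\<exists>u. u \<in> Hom Gt (n + a) b \<and> (\<forall>y x. val1 (n + a) y \<longrightarrow> val1 b x \<longrightarrow> ker (n + a) b u (jn y x) = T2 a b M x y)"
proof (rule ker_exists2[where T = "\<lambda>y x. T2 a b M x y"])
  fix y x y' x' :: "nat \<Rightarrow> nat \<times> 'a"
  assume v: "val1 (n + a) y" "val1 b x" "val1 (n + a) y'" "val1 b x'" and e: "ty (n + a) b (jn y x) = ty (n + a) b (jn y' x')"
  have s: "SAME a b x y x' y'" by (rule SAME_ty2[OF _ _ _ _ e]) (fact v)+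
  let ?I = "out b x y"
  have "T2 a b M x' y' = (if good a y then sk a (card ?I) (entry M (pos b ?I) 0) (jn (y' \<circ> en (Iw a)) (x' \<circ> en ?I)) (lst ({1..b} - ?I) (rel y' \<circ> x'), y0) else 0)"
    by (simp add: T2_def SAME_out[OF s] SAME_good[OF s])
  also have "\<dots> = T2 a b M x y"
  proof (cases "good a y")
    case True
    have l: "lst ({1..b} - ?I) (rel y' \<circ> x') = lst ({1..b} - ?I) (rel y \<circ> x)"
      using SAME_rel[OF s True] by (intro lst_cong) auto
    have tt: "ty (card (Iw a)) (card ?I) (jn (y \<circ> en (Iw a)) (x \<circ> en ?I)) = ty (card (Iw a)) (card ?I) (jn (y' \<circ> en (Iw a)) (x' \<circ> en ?I))"
      by (rule restrict_ty[OF Iw_sub out_sub v e])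
    have vv: "valid (card (Iw a)) (card ?I) (jn (y \<circ> en (Iw a)) (x \<circ> en ?I))" "valid (card (Iw a)) (card ?I) (jn (y' \<circ> en (Iw a)) (x' \<circ> en ?I))"
      unfolding valid_jn by (intro conjI val1_restrict[OF out_sub] val1_restrict[OF Iw_sub] v)+
    have "adm f (jn (y \<circ> en (Iw a)) (x \<circ> en ?I)) \<longleftrightarrow> adm f (jn (y' \<circ> en (Iw a)) (x' \<circ> en ?I))"
      if "f \<in> P G a (card ?I)" for f 
    proof -
      from that have "f \<in> P G (card (Iw a)) (card ?I)" by simp
      then show ?thesis by (rule adm_same[OF _ vv tt])
    qed
    then show ?thesis using True by (simp add: T2_def sk_def l del: One_nat_def)
  qed (simp add: T2_def)
  finally show "T2 a b M x y = T2 a b M x' y'" ..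
qed

lemma Psi2_inj:
  assumes u: "u \<in> Hom Gt (n + a) b" "u' \<in> Hom Gt (n + a) b"
    and sup: "\<And>x y w. val1 b x \<Longrightarrow> val1 (n + a) y \<Longrightarrow> \<not> good a y \<Longrightarrow> w \<in> {u, u'} \<Longrightarrow> ker (n + a) b w (jn y x) = 0"
    and eq: "\<And>I f xs ys. I \<subseteq> {1..b} \<Longrightarrow> ys \<in> B0 \<Longrightarrow>
      entry (fmor RR (emt (n + a)) (emt b) (emb_mor u)) (pos b I) (pos (n + a) (Iw a)) ((0, 0, f), (xs, ys)) =
      entry (fmor RR (emt (n + a)) (emt b) (emb_mor u')) (pos b I) (pos (n + a) (Iw a)) ((0, 0, f), (xs, ys))"
  shows "u = u'"
proof (rule ker_inj2[OF u])
  fix y x assume v: "val1 (n + a) y" "val1 b x"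
  show "ker (n + a) b u (jn y x) = ker (n + a) b u' (jn y x)"
  proof (cases "good a y")
    case False
    then show ?thesis using sup[OF v(2) v(1) False] by simp
  next
    case True
    note g = True
    let ?x = "std y x" and ?y = "std y y" and ?I = "out b x y"
    have vs: "val1 b ?x" "val1 (n + a) ?y" using v std_val1 by auto
    have ty: "ty (n + a) b (jn y x) = ty (n + a) b (jn ?y ?x)" by (rule std_ty[OF g v])
    have k: "ker (n + a) b w (jn y x) = ker (n + a) b w (jn ?y ?x)" for w :: "'a gdiag \<Rightarrow> 'k"
      by (rule ker_same[OF _ _ ty]) (simp_all add: valid_jn v vs)
    have r: "1 \<le> fst (?x i)" "1 \<le> fst (?y i)" for i using rmap_range(1)[OF g] by (auto simp: std_def simp del: One_nat_def)
    have B: "lst {1..n} ?y \<in> B0"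
    proof (rule lst_B0)
      show "fst (?y i) \<in> {1..n} \<and> snd (?y i) \<in> carrier G" if "i \<in> {1..n}" for i
        using std_fst[OF g that] vs(2) that by (auto simp: val1_def)
      show "inj_on (\<lambda>i. fst (?y i)) {1..n}" using std_fst[OF g] by (auto intro!: inj_onI)
    qed
    have R: "ker (n + a) b w (jn ?y ?x) = sk (card (Iw a)) (card ?I)
        (entry (fmor RR (emt (n + a)) (emt b) (emb_mor w)) (pos b ?I) (pos (n + a) (Iw a)))
        (jn (?y \<circ> en (Iw a)) (?x \<circ> en ?I)) (lst ({1..b} - ?I) ?x, lst ({1..n + a} - Iw a) ?y)"
      if "w \<in> Hom Gt (n + a) b" for w
      by (rule Res_kernel[symmetric, OF that vs(2,1) r(2) r(1) std_Iw[OF g, symmetric] std_out[OF g, symmetric]])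
    show ?thesis
      unfolding k R[OF u(1)] R[OF u(2)] compl_Iw sk_def using eq[OF out_sub B] by (intro sum.cong refl) simp
  qed
qed

lemma Psi2_eq:
  assumes u: "u \<in> Hom Gt (n + a) b"
    and ku: "\<And>x y. val1 b x \<Longrightarrow> val1 (n + a) y \<Longrightarrow> ker (n + a) b u (jn y x) = T2 a b M x y"
    and M: "M \<in> mat_hom T [(em1 a, kH)] (Wl b)" and I: "I \<subseteq> {1..b}" and ys: "ys \<in> B0"
  shows "entry (fmor RR (emt (n + a)) (emt b) (emb_mor u)) (pos b I) (pos (n + a) (Iw a)) (k, (xs, ys)) =
    entry M (pos b I) 0 (k, (xs, ys))"
proof -
  let ?E = "entry (fmor RR (emt (n + a)) (emt b) (emb_mor u)) (pos b I) (pos (n + a) (Iw a))"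
  let ?M = "entry M (pos b I) 0"
  let ?W = "W_basis G n (b - card I)"
  have fI: "finite I" using I finite_subset by blast
  have E: "?E \<in> Hom T (em1 a, perm_rep (W_basis G n n)) (em1 (card I), perm_rep ?W)"
    using Res_entry_hom[OF u Iw_sub I] by simp
  note Ei = E[unfolded T_hom_iff[OF W_stable W_stable], THEN conjunct1, rule_format] and Ee = E[unfolded T_hom_iff[OF W_stable W_stable], THEN conjunct2, rule_format]
  note Mh = Wl_hom2[OF M I]
  note Mi = Mh[unfolded T_hom_iff[OF B0_stable W_stable], THEN conjunct1, rule_format] and Me = Mh[unfolded T_hom_iff[OF B0_stable W_stable], THEN conjunct2, rule_format]
  have main: "?E ((0, 0, f), (xs, y0)) = ?M ((0, 0, f), (xs, y0))" if xs: "xs \<in> ?W" for xs f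
  proof -
    let ?c = "\<lambda>f. ?E ((0, 0, f), (xs, y0))" and ?c' = "\<lambda>f. ?M ((0, 0, f), (xs, y0))"
    have "?c = ?c'"
    proof (rule ker_inj[where r = n and a = a and b = "card I" and t = t])
      show "?c \<in> Hom Gt a (card I)" "?c' \<in> Hom Gt a (card I)" unfolding Gcat_hom using Ei Mi by blast+
      fix z assume v: "valid a (card I) z" and r: "\<And>p. p \<in> points a (card I) \<Longrightarrow> fst (z p) \<in> {n<..n + a + card I}"
      have zx: "n < fst (z (Lo q)) \<and> snd (z (Lo q)) \<in> carrier G" if "q \<in> {1..card I}" for q
        using r[of "Lo q"] validD[OF v, of "Lo q"] that by (auto simp: points_def)
      have zy: "n < fst (z (Up q)) \<and> snd (z (Up q)) \<in> carrier G" if "q \<in> {1..card (Iw a)}" for q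
        using r[of "Up q"] validD[OF v, of "Up q"] that by (auto simp: points_def)
      obtain x where x: "val1 b x" "\<And>i. i \<in> {1..b} \<Longrightarrow> 1 \<le> fst (x i)" "I = {i\<in>{1..b}. n < fst (x i)}"
        "\<And>q. q \<in> {1..card I} \<Longrightarrow> x (en I q) = z (Lo q)" "lst ({1..b} - I) x = xs"
        by (rule realize[where g = "\<lambda>q. z (Lo q)", OF I xs zx]) blast+
      have y0W: "y0 \<in> W_basis G n (n + a - card (Iw a))" using y0_B0 B0_W by auto
      obtain y where y: "val1 (n + a) y" "\<And>i. i \<in> {1..n + a} \<Longrightarrow> 1 \<le> fst (y i)" "Iw a = {i\<in>{1..n + a}. n < fst (y i)}"
        "\<And>q. q \<in> {1..card (Iw a)} \<Longrightarrow> y (en (Iw a) q) = z (Up q)" "lst ({1..n + a} - Iw a) y = y0"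
        by (rule realize[where g = "\<lambda>q. z (Up q)", OF Iw_sub y0W zy]) blast+
      have ly: "lst {1..n} y = y0" using y(5) unfolding compl_Iw .
      have yi: "y i = (i, \<one>)" if i: "i \<in> {1..n}" for i
      proof -
        have "cod (y i) = cod (i, \<one>)" using ly i unfolding lst_initial y0_def map_eq_conv by (simp del: upt_Suc)
        moreover have "snd (y i) \<in> carrier G" using y(1) i by (simp add: val1_def)
        ultimately show ?thesis by (metis dec_cod one_closed snd_conv)
      qed
      have zz: "jn (y \<circ> en (Iw a)) (x \<circ> en I) p = z p" if "p \<in> points a (card I)" for p
        using x(4) y(4) that by (auto simp: points_def simp del: One_nat_def)
      have yj: "n < fst (y j) \<longleftrightarrow> n < j" if "j \<in> {1..n + a}" for j
        using y(3) that by (metis (mono_tags, lifting) atLeastAtMost_iff greaterThanAtMost_iff mem_Collect_eq)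
      have gy: "good a y" unfolding good_def
      proof (intro ballI impI)
        fix i j assume ij: "i \<in> {1..n}" "j \<in> {1..n + a}" "i \<noteq> j"
        then show "fst (y i) \<noteq> fst (y j)" using yj[of j] yi[of j] yi[of i] by (cases "j \<le> n") auto
      qed
      have xout: "fst (x i) \<in> {1..n}" if "i \<in> {1..b} - I" for i using that x(2)[of i] x(3) by auto
      have o: "out b x y = I"
      proof -
        have "(\<forall>k\<in>{1..n}. fst (y k) \<noteq> fst (x i)) \<longleftrightarrow> i \<in> I" if i: "i \<in> {1..b}" for i
        proof (cases "i \<in> I")
          case True
          then have "n < fst (x i)" using x(3) by blast
          then show ?thesis using yi True by auto
        next
          case False
          then show ?thesis using xout[of i] yi[of "fst (x i)"] i by fastforce
        qed
        then have "out b x y = {i\<in>{1..b}. i \<in> I}" unfolding out_def by blast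
        then show ?thesis using I by auto
      qed
      have relx: "rel y (x i) = x i" if i: "i \<in> {1..b} - I" for i
        using rel_eq[OF gy xout[OF i], of "x i"] yi[OF xout[OF i]] x(1) i by (simp add: val1_def)
      have ll: "lst ({1..b} - I) (rel y \<circ> x) = xs"
        using lst_cong[of "{1..b} - I" "rel y \<circ> x" x] relx x(5) by simp
      have skc: "sk a (card I) N z' yx = sk a (card I) N z yx" if "\<And>p. p \<in> points a (card I) \<Longrightarrow> z' p = z p" for N z' yx
        unfolding sk_def using adm_cong[of _ a "card I" z' z] that by (intro sum.cong refl) simp
      have "ker a (card I) ?c z = sk a (card I) ?E z (xs, y0)" by (simp add: ker_def sk_def)
      also have "\<dots> = ker (n + a) b u (jn y x)"
        using Res_kernel[OF u y(1) x(1) y(2) x(2) y(3) x(3)] unfolding x(5) y(5) by (simp add: skc[OF zz])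
      also have "\<dots> = T2 a b M x y" by (rule ku[OF x(1) y(1)])
      also have "\<dots> = sk a (card I) ?M z (xs, y0)" by (simp add: T2_def gy o ll skc[OF zz] del: One_nat_def)
      also have "\<dots> = ker a (card I) ?c' z" by (simp add: ker_def sk_def)
      finally show "ker a (card I) ?c z = ker a (card I) ?c' z" .
    qed
    then show ?thesis by (rule fun_cong)
  qed
  obtain i j f where [simp]: "k = (i, j, f)" by (metis prod.collapse)
  show ?thesis
  proof (cases "i = 0 \<and> j = 0 \<and> xs \<in> ?W")
    case False
    then have "?E (k, (xs, ys)) = 0" "?M (k, (xs, ys)) = 0" using Ei[of i j f] Mi[of i j f] unfolding \<open>k = _\<close> by blast+
    then show ?thesis by simp
  next
    case True
    obtain h where h: "h \<in> carrier H" "act h y0 = ys" using B0_transitive[OF y0_B0 ys] by blast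
    let ?xs = "act (inv\<^bsub>H\<^esub> h) xs"
    have xs': "?xs \<in> ?W" using stableD(3)[OF W_stable _, of "inv\<^bsub>H\<^esub> h" xs] h(1) True by simp
    have a: "act h ?xs = xs" using act_inv(2)[OF h(1) stableD(2)[OF W_stable, of xs]] True by blast
    have "?E ((0, 0, f), (act h ?xs, act h y0)) = ?E ((0, 0, f), (?xs, y0))"
      using Ee[OF h(1), of y0 ?xs f] xs' y0_B0 B0_W by blast
    moreover have "?M ((0, 0, f), (act h ?xs, act h y0)) = ?M ((0, 0, f), (?xs, y0))"
      using Me[OF h(1), of y0 ?xs f] xs' y0_B0 by blast
    ultimately show ?thesis using main[OF xs', of f] True unfolding a h(2) by simp
  qed
qed

end

section \<open>The representing objects\<close>

context linear_category
begin

lemma entry_single_left: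
  assumes "set As \<subseteq> Obj C" "set Bs \<subseteq> Obj C" "set Es \<subseteq> Obj C" "M \<in> mat_hom C As Bs" "j < length Bs" "l < length Es" "i < length As"
  shows "entry (mat_comp C As Bs Es (single l' j f) M) l i = (if l = l' then Comp C (As ! i) (Bs ! j) (Es ! l) f (entry M j i) else 0)"
proof -
  have "(\<Sum>k<length Bs. Comp C (As ! i) (Bs ! k) (Es ! l) (entry (single l' j f) l k) (entry M k i)) =
    (\<Sum>k<length Bs. if k = j then if l = l' then Comp C (As ! i) (Bs ! j) (Es ! l) f (entry M j i) else 0 else 0)"
    using assms by (intro sum.cong refl) (auto simp: entry_single comp_zero_left objD mat_hom_entry)
  then show ?thesis using assms(5-7) by (simp add: entry_mat_comp sum.delta)
qed

lemma entry_single_right: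
  assumes "set As \<subseteq> Obj C" "set Bs \<subseteq> Obj C" "set Es \<subseteq> Obj C" "N \<in> mat_hom C Bs Es" "j < length Bs" "l < length Es" "i < length As"
  shows "entry (mat_comp C As Bs Es N (single j i' f)) l i = (if i = i' then Comp C (As ! i) (Bs ! j) (Es ! l) (entry N l j) f else 0)"
proof -
  have "(\<Sum>k<length Bs. Comp C (As ! i) (Bs ! k) (Es ! l) (entry N l k) (entry (single j i' f) k i)) =
    (\<Sum>k<length Bs. if k = j then if i = i' then Comp C (As ! i) (Bs ! j) (Es ! l) (entry N l j) f else 0 else 0)"
    using assms by (intro sum.cong refl) (auto simp: entry_single comp_zero_right objD mat_hom_entry)
  then show ?thesis using assms(5-7) by (simp add: entry_mat_comp sum.delta)
qed

lemma obj_single_idem: "([A], emb_mor e) \<in> Obj (ps C) \<longleftrightarrow> A \<in> Obj C \<and> e \<in> Hom C A A \<and> Comp C A A A e e = e"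
  by (auto simp: obj_ps mat_hom_single mat_comp_single dest: emb_mor_inj)

lemma hom_single_idem: "Hom (ps C) ([A], emb_mor e) ([B], emb_mor e') = emb_mor ` {f \<in> Hom C A B. Comp C A B B e' f = f \<and> Comp C A A B f e = f}"
proof -
  have "emb_mor f = emb_mor g \<longleftrightarrow> f = g" for f g :: "'x \<Rightarrow> 'k" using emb_mor_inj by blast
  then show ?thesis by (auto simp: ps_def mat_hom_single mat_comp_single)
qed

end

context fin_group
begin

lemma inv_mult_one_iff: "x \<in> carrier G \<Longrightarrow> y \<in> carrier G \<Longrightarrow> inv x \<otimes> y = \<one> \<longleftrightarrow> x = y"
  by (metis inv_closed inv_equality inv_inv l_inv)

lemma ty_point_eq:
  assumes v: "valid a b z" "valid a b z'" and e: "ty a b z = ty a b z'" and pq: "p \<in> points a b" "q \<in> points a b"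
  shows "z p = z q \<longleftrightarrow> z' p = z' q"
proof -
  have "z p = z q \<longleftrightarrow> fst (z p) = fst (z q) \<and> inv (snd (z p)) \<otimes> snd (z q) = \<one>" if "valid a b z" for z
    using inv_mult_one_iff[OF validD[OF that pq(1)] validD[OF that pq(2)]] by (auto simp: prod_eq_iff)
  then show ?thesis using ty_same[OF v e pq] v by metis
qed

end

lemma (in wreath_rep) good_iff:
  "(\<And>i j. i \<in> {1..n + a} \<Longrightarrow> j \<in> {1..n + a} \<Longrightarrow> fst (y i) = fst (y j) \<longleftrightarrow> fst (y' i) = fst (y' j)) \<Longrightarrow> good a y \<longleftrightarrow> good a y'"
  unfolding good_def by (intro ball_cong imp_cong refl arg_cong[where f = Not]) auto

context res_core
begin

lemma good_proj_exists:
  "\<exists>w. w \<in> Hom Gt (n + a) (n + a) \<and> (\<forall>x y. val1 (n + a) x \<longrightarrow> val1 (n + a) y \<longrightarrow>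
     ker (n + a) (n + a) w (jn x y) = of_bool ((\<forall>i\<in>{1..n + a}. x i = y i) \<and> good a x))"
proof (rule ker_exists2[where T = "\<lambda>x y. of_bool ((\<forall>i\<in>{1..n + a}. x i = y i) \<and> good a x)"])
  fix x y x' y' :: "nat \<Rightarrow> nat \<times> 'a"
  assume v: "val1 (n + a) x" "val1 (n + a) y" "val1 (n + a) x'" "val1 (n + a) y'" and e: "ty (n + a) (n + a) (jn x y) = ty (n + a) (n + a) (jn x' y')"
  have vz: "valid (n + a) (n + a) (jn x y)" "valid (n + a) (n + a) (jn x' y')" using v by (auto simp: valid_jn)
  have "x i = y i \<longleftrightarrow> x' i = y' i" if "i \<in> {1..n + a}" for i
    using ty_point_eq[OF vz e, of "Up i" "Lo i"] that by (simp add: points_def)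
  moreover have "good a x \<longleftrightarrow> good a x'"
  proof (rule good_iff)
    fix i j assume "i \<in> {1..n + a}" "j \<in> {1..n + a}"
    then show "fst (x i) = fst (x j) \<longleftrightarrow> fst (x' i) = fst (x' j)" using ty_same(1)[OF vz e, of "Up i" "Up j"] by (simp add: points_def)
  qed
  ultimately show "of_bool ((\<forall>i\<in>{1..n + a}. x i = y i) \<and> good a x) = (of_bool ((\<forall>i\<in>{1..n + a}. x' i = y' i) \<and> good a x') :: 'k)" by simp
qed

text \<open>On the level of kernels, the restriction to good tuples.\<close>

definition gp :: "nat \<Rightarrow> 'a gdiag \<Rightarrow> 'k" where
  "gp a = (SOME w. w \<in> Hom Gt (n + a) (n + a) \<and> (\<forall>x y. val1 (n + a) x \<longrightarrow> val1 (n + a) y \<longrightarrow>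
     ker (n + a) (n + a) w (jn x y) = of_bool ((\<forall>i\<in>{1..n + a}. x i = y i) \<and> good a x)))"

lemma gp_hom: "gp a \<in> Hom Gt (n + a) (n + a)"
  and gp_ker: "val1 (n + a) x \<Longrightarrow> val1 (n + a) y \<Longrightarrow> ker (n + a) (n + a) (gp a) (jn x y) = of_bool ((\<forall>i\<in>{1..n + a}. x i = y i) \<and> good a x)"
  using someI_ex[OF good_proj_exists[of a]] unfolding gp_def[symmetric] by blast+

definition Z :: "nat \<Rightarrow> (nat, 'a gdiag, 'k) ps_obj" where "Z a = ([n + a], emb_mor (gp a))"
definition dg :: "nat \<Rightarrow> (nat \<times> nat \<times> 'a gdiag) \<times> (nat \<times> nat) list \<times> (nat \<times> nat) list \<Rightarrow> 'k" where
  "dg p = tens (Idm C1 (em1 p)) diagB"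
abbreviation "Yk a \<equiv> (em1 a, kH :: (_, _, 'k) rep)"
abbreviation "Yo a \<equiv> emb_ob T (Yk a)"
abbreviation "pw a \<equiv> pos (n + a) (Iw a)"
abbreviation "rs b c u \<equiv> fmor RR (emt b) (emt c) (emb_mor u)"
text \<open>Selects in \<open>Res [n + a]\<close> the summand with the first \<open>n\<close>
  positions in the representations and the last \<open>a\<close> in the diagrams, then cuts the
  tensor power of \<open>W\<close> down to the regular representation. \<open>N0\<close> is the
  embedding in the other direction.\<close>

definition "E0 a = single 0 (pw a) (dg a)"
definition "N0 a = single (pw a) 0 (dg a)"

lemma diagB_hom': "B \<in> {W_basis G n n, B0} \<Longrightarrow> B' \<in> {W_basis G n n, B0} \<Longrightarrow> diagB \<in> Hom RH (perm_rep B) (perm_rep B')"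
proof -
  assume B: "B \<in> {W_basis G n n, B0}" "B' \<in> {W_basis G n n, B0}"
  then have s: "stable B" "stable B'" "B0 \<subseteq> B" "B0 \<subseteq> B'" using W_stable B0_stable B0_W by auto
  have e: "act h ys = act h xs \<and> act h xs \<in> B0 \<longleftrightarrow> ys = xs \<and> xs \<in> B0" if h: "h \<in> carrier H" and p: "set xs \<subseteq> pairs" "set ys \<subseteq> pairs" for h xs ys
    using act_inv(1)[OF h p(1)] act_inv(1)[OF h p(2)] stableD(3)[OF B0_stable h] stableD(3)[OF B0_stable H.inv_closed[OF h]] by metis
  show ?thesis
    unfolding perm_rep_hom[OF s(1,2)] using s(3,4) e stableD(2)[OF s(1)] stableD(2)[OF s(2)] by (auto simp: bmats_def diagB_def)
qed

lemma dg_hom: "B \<in> {W_basis G n n, B0} \<Longrightarrow> B' \<in> {W_basis G n n, B0} \<Longrightarrow> dg a \<in> Hom T (em1 a, perm_rep B) (em1 a, perm_rep B')"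
  unfolding dg_def by (intro Tp.T_pure diagB_hom' Tp.C.id_hom em1_obj)

lemma perm_obj: "B \<in> {W_basis G n n, B0} \<Longrightarrow> (perm_rep B :: (_, _, 'k) rep) \<in> Obj RH"
  using perm_rep_obj[OF W_stable] perm_rep_obj[OF B0_stable] by auto

lemma comp_dg_left:
  assumes V: "V \<in> Obj RH" and B: "B \<in> {W_basis G n n, B0}" "B' \<in> {W_basis G n n, B0}"
    and X: "X \<in> Hom T (em1 p, V) (em1 q, perm_rep B)"
  shows "Comp T (em1 p, V) (em1 q, perm_rep B) (em1 q, perm_rep B') (dg q) X (k, (ys, xs)) = (if ys \<in> B0 then X (k, (ys, xs)) else 0)"
proof -
  note o = em1_obj em1_obj em1_obj V perm_obj[OF B(1)] perm_obj[OF B(2)]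
  have i: "Idm C1 (em1 q) \<in> Hom C1 (em1 q) (em1 q)" by (rule Tp.C.id_hom) simp
  have fB: "finite B" "B0 \<subseteq> B" using B(1) stableD(1)[OF W_stable] stableD(1)[OF B0_stable] B0_W by auto
  show ?thesis
    using X
  proof (induction X rule: Tp.T_induct)
    case zero
    show ?case unfolding Tp.T_comp_zero_right[OF o dg_hom[OF B]] by (simp add: zero_fun_apply)
  next
    case (pure f M)
    have "bmat_comp B diagB M (ys, xs) = (\<Sum>w\<in>B. if w = ys then if ys \<in> B0 then M (ys, xs) else 0 else 0)"
      unfolding bmat_comp_apply by (rule sum.cong) (auto simp: diagB_def)
    then have b: "bmat_comp B diagB M (ys, xs) = (if ys \<in> B0 then M (ys, xs) else 0)" using fB by (auto simp: sum.delta)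
    have "Comp RH V (perm_rep B) (perm_rep B') diagB M = bmat_comp B diagB M" by (simp add: perm_rep_def Rep_sel)
    then show ?case unfolding dg_def using Tp.T_comp_pure[OF o pure i diagB_hom'[OF B]] b pure(1)
      by (simp add: Tp.C.id_left tens_apply)
  next
    case (add X Y)
    show ?case by (subst Tp.T_comp_add_right[OF o add(1,2) dg_hom[OF B]]) (simp add: plus_fun_apply add(3,4))
  qed
qed

lemma comp_dg_right:
  assumes V: "V \<in> Obj RH" and B: "B \<in> {W_basis G n n, B0}" "B' \<in> {W_basis G n n, B0}"
    and X: "X \<in> Hom T (em1 p, perm_rep B) (em1 q, V)"
  shows "Comp T (em1 p, perm_rep B') (em1 p, perm_rep B) (em1 q, V) X (dg p) (k, (ys, xs)) = (if xs \<in> B0 then X (k, (ys, xs)) else 0)"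
proof -
  note o = em1_obj em1_obj em1_obj perm_obj[OF B(2)] perm_obj[OF B(1)] V
  have i: "Idm C1 (em1 p) \<in> Hom C1 (em1 p) (em1 p)" by (rule Tp.C.id_hom) simp
  have fB: "finite B" "B0 \<subseteq> B" using B(1) stableD(1)[OF W_stable] stableD(1)[OF B0_stable] B0_W by auto
  show ?thesis
    using X
  proof (induction X rule: Tp.T_induct)
    case zero
    show ?case unfolding Tp.T_comp_zero_left[OF o dg_hom[OF B(2,1)]] by (simp add: zero_fun_apply)
  next
    case (pure f M)
    have "bmat_comp B M diagB (ys, xs) = (\<Sum>w\<in>B. if w = xs then if xs \<in> B0 then M (ys, xs) else 0 else 0)"
      unfolding bmat_comp_apply by (rule sum.cong) (auto simp: diagB_def)
    then have b: "bmat_comp B M diagB (ys, xs) = (if xs \<in> B0 then M (ys, xs) else 0)" using fB by (auto simp: sum.delta)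
    have "Comp RH (perm_rep B') (perm_rep B) V M diagB = bmat_comp B M diagB" by (simp add: perm_rep_def Rep_sel)
    then show ?case unfolding dg_def using Tp.T_comp_pure[OF o i diagB_hom'[OF B(2,1)] pure] b pure(1)
      by (simp add: Tp.C.id_right tens_apply)
  next
    case (add X Y)
    show ?case by (subst Tp.T_comp_add_left[OF o dg_hom[OF B(2,1)] add(1,2)]) (simp add: plus_fun_apply add(3,4))
  qed
qed

lemma Wl_pw: "Wl (n + a) ! pw a = (em1 a, perm_rep (W_basis G n n))" "pw a < length (Wl (n + a))"
  using pos_mem[OF Iw_sub[of a]] by (simp_all add: Wl_nth W_pow_perm)

lemma Yk_obj: "Yk a \<in> Obj T" "set [Yk a] \<subseteq> Obj T"
  by (simp_all add: Tp.T_sel(1) perm_obj)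

lemma Yo_obj: "Yo a \<in> Obj (ps T)"
  by (rule TL.obj_emb[OF Yk_obj(1)])

lemma Yo_eq: "Yo a = ([Yk a], mat_id T [Yk a])"
  by (simp add: emb_ob_def[of T])

lemma E0_mat: "E0 a \<in> mat_hom T (Wl (n + a)) [Yk a]" and N0_mat: "N0 a \<in> mat_hom T [Yk a] (Wl (n + a))"
proof -
  have z: "A \<in> Obj T \<Longrightarrow> B \<in> Obj T \<Longrightarrow> 0 \<in> Hom T A B" for A B by (rule TL.zero_hom)
  have o: "j < length (Wl (n + a)) \<Longrightarrow> Wl (n + a) ! j \<in> Obj T" for j using Wl_obj nth_mem by blast
  show "E0 a \<in> mat_hom T (Wl (n + a)) [Yk a]" "N0 a \<in> mat_hom T [Yk a] (Wl (n + a))"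
    unfolding mat_hom_iff E0_def N0_def using Wl_pw[of a] dg_hom[of "W_basis G n n" B0 a] dg_hom[of B0 "W_basis G n n" a] z o Yk_obj(1)
    by (auto simp: entry_single)
qed

lemma E0_hom: "E0 a \<in> Hom (ps T) (fob RR (emt (n + a))) (Yo a)" and N0_hom: "N0 a \<in> Hom (ps T) (Yo a) (fob RR (emt (n + a)))"
  using E0_mat N0_mat unfolding Res_ob Yo_eq TL.hom_full[OF Wl_obj Yk_obj(2)] TL.hom_full[OF Yk_obj(2) Wl_obj] .

lemma comp_CC: "Comp CC ([a], e) ([b], e') ([c], e'') (emb_mor v) (emb_mor u) = emb_mor (gc t a b c v u)"
  by (simp add: Ccat_def Gt.mat_comp_single)

lemma emt_eq: "emt b = ([b], emb_mor (Idm Gt b))"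
  by (simp add: emb_ob_def Gt.mat_id_single)

lemma idG: "u \<in> Hom Gt a b \<Longrightarrow> gc t a a b u (basis (id_diag G a)) = u" "u \<in> Hom Gt a b \<Longrightarrow> gc t a b b (basis (id_diag G b)) u = u"
  using Gt.id_right[of a b u] Gt.id_left[of a b u] by simp_all

text \<open>\<open>gp a\<close> is a diagonal matrix, so composing multiplies the kernel by the
  indicator of goodness. The product is again a function of the type, hence the kernel of some
  morphism, and this one does not depend on the parameter as \<open>gcomp_eqI\<close>
  requires.\<close>

lemma ker_gp1:
  assumes u: "u \<in> Hom Gt b (n + a)" and v: "val1 b x" "val1 (n + a) y"
  shows "ker b (n + a) (gc t b (n + a) (n + a) (gp a) u) (jn x y) = of_bool (good a y) * ker b (n + a) u (jn x y)"
proof -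
  have "\<exists>w. w \<in> Hom Gt b (n + a) \<and> (\<forall>x y. val1 b x \<longrightarrow> val1 (n + a) y \<longrightarrow>
      ker b (n + a) w (jn x y) = of_bool (good a y) * ker b (n + a) u (jn x y))"
  proof (rule ker_exists2[where T = "\<lambda>x y. of_bool (good a y) * ker b (n + a) u (jn x y)"])
    fix x y x' y' :: "nat \<Rightarrow> nat \<times> 'a"
    assume v: "val1 b x" "val1 (n + a) y" "val1 b x'" "val1 (n + a) y'" and e: "ty b (n + a) (jn x y) = ty b (n + a) (jn x' y')"
    have vz: "valid b (n + a) (jn x y)" "valid b (n + a) (jn x' y')" using v by (auto simp: valid_jn)
    have "good a y \<longleftrightarrow> good a y'" by (rule SAME_good[OF SAME_ty1[OF _ _ _ _ e]]) (fact v)+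
    then show "of_bool (good a y) * ker b (n + a) u (jn x y) = of_bool (good a y') * ker b (n + a) u (jn x' y')"
      using ker_same[OF vz e, of u] by simp
  qed
  then obtain w where w: "w \<in> Hom Gt b (n + a)"
    "\<And>x y. val1 b x \<Longrightarrow> val1 (n + a) y \<Longrightarrow> ker b (n + a) w (jn x y) = of_bool (good a y) * ker b (n + a) u (jn x y)" by blast
  have "gc t b (n + a) (n + a) (gp a) u = w"
  proof (rule gcomp_eqI[OF w(1)])
    fix N x y assume xy: "x \<in> conf {1..N} b" "y \<in> conf {1..N} (n + a)"
    have "ker b (n + a) u (jn x s) * ker (n + a) (n + a) (gp a) (jn s y) =
        (if s = y then of_bool (good a y) * ker b (n + a) u (jn x y) else 0)" if s: "s \<in> conf {1..N} (n + a)" for s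
    proof -
      have "ker (n + a) (n + a) (gp a) (jn s y) = of_bool (s = y \<and> good a y)"
        using gp_ker[OF conf_val1[OF s] conf_val1[OF xy(2)]] conf_eq[OF s xy(2)] by (auto simp del: One_nat_def)
      then show ?thesis by simp
    qed
    then have "(\<Sum>s\<in>conf {1..N} (n + a). ker b (n + a) u (jn x s) * ker (n + a) (n + a) (gp a) (jn s y)) =
      (\<Sum>s\<in>conf {1..N} (n + a). if s = y then of_bool (good a y) * ker b (n + a) u (jn x y) else 0)" by (rule sum.cong[OF refl])
    also have "\<dots> = ker b (n + a) w (jn x y)"
      using finite_conf[of "{1..N}" "n + a"] xy w(2)[OF conf_val1[OF xy(1)] conf_val1[OF xy(2)]] by (simp add: sum.delta del: One_nat_def)
    finally show "(\<Sum>s\<in>conf {1..N} (n + a). ker b (n + a) u (jn x s) * ker (n + a) (n + a) (gp a) (jn s y)) =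
      ker b (n + a) w (jn x y)" .
  qed
  then show ?thesis using w(2)[OF v] by simp
qed

text \<open>Turns being a morphism into \<open>Z a\<close> into a condition on the support of the
  kernel.\<close>

lemma gp_absorb1:
  assumes u: "u \<in> Hom Gt b (n + a)"
  shows "gc t b (n + a) (n + a) (gp a) u = u \<longleftrightarrow>
    (\<forall>x y. val1 b x \<longrightarrow> val1 (n + a) y \<longrightarrow> \<not> good a y \<longrightarrow> ker b (n + a) u (jn x y) = 0)" (is "?l \<longleftrightarrow> ?r")
proof
  assume ?l
  then show ?r using ker_gp1[OF u] by (metis mult_zero_left of_bool_eq(1))
next
  assume r: ?r
  show ?l
  proof (rule ker_inj2[OF gcomp_hom u])
    fix x y assume v: "val1 b x" "val1 (n + a) y"
    show "ker b (n + a) (gc t b (n + a) (n + a) (gp a) u) (jn x y) = ker b (n + a) u (jn x y)"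
      using ker_gp1[OF u v] r v by (cases "good a y") simp_all
  qed
qed

lemma ker_gp2:
  assumes u: "u \<in> Hom Gt (n + a) b" and v: "val1 b x" "val1 (n + a) y"
  shows "ker (n + a) b (gc t (n + a) (n + a) b u (gp a)) (jn y x) = of_bool (good a y) * ker (n + a) b u (jn y x)"
proof -
  have "\<exists>w. w \<in> Hom Gt (n + a) b \<and> (\<forall>y x. val1 (n + a) y \<longrightarrow> val1 b x \<longrightarrow>
      ker (n + a) b w (jn y x) = of_bool (good a y) * ker (n + a) b u (jn y x))"
  proof (rule ker_exists2[where T = "\<lambda>y x. of_bool (good a y) * ker (n + a) b u (jn y x)"])
    fix y x y' x' :: "nat \<Rightarrow> nat \<times> 'a"
    assume v: "val1 (n + a) y" "val1 b x" "val1 (n + a) y'" "val1 b x'" and e: "ty (n + a) b (jn y x) = ty (n + a) b (jn y' x')"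
    have vz: "valid (n + a) b (jn y x)" "valid (n + a) b (jn y' x')" using v by (auto simp: valid_jn)
    have "good a y \<longleftrightarrow> good a y'" by (rule SAME_good[OF SAME_ty2[OF _ _ _ _ e]]) (fact v)+
    then show "of_bool (good a y) * ker (n + a) b u (jn y x) = of_bool (good a y') * ker (n + a) b u (jn y' x')"
      using ker_same[OF vz e, of u] by simp
  qed
  then obtain w where w: "w \<in> Hom Gt (n + a) b"
    "\<And>x y. val1 b x \<Longrightarrow> val1 (n + a) y \<Longrightarrow> ker (n + a) b w (jn y x) = of_bool (good a y) * ker (n + a) b u (jn y x)" by blast
  have "gc t (n + a) (n + a) b u (gp a) = w"
  proof (rule gcomp_eqI[OF w(1)])
    fix N y x assume xy: "y \<in> conf {1..N} (n + a)" "x \<in> conf {1..N} b"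
    have "ker (n + a) (n + a) (gp a) (jn y s) * ker (n + a) b u (jn s x) =
        (if s = y then of_bool (good a y) * ker (n + a) b u (jn y x) else 0)" if s: "s \<in> conf {1..N} (n + a)" for s
    proof -
      have "ker (n + a) (n + a) (gp a) (jn y s) = of_bool (s = y \<and> good a y)"
        using gp_ker[OF conf_val1[OF xy(1)] conf_val1[OF s]] conf_eq[OF xy(1) s] by (auto simp del: One_nat_def)
      then show ?thesis by simp
    qed
    then have "(\<Sum>s\<in>conf {1..N} (n + a). ker (n + a) (n + a) (gp a) (jn y s) * ker (n + a) b u (jn s x)) =
      (\<Sum>s\<in>conf {1..N} (n + a). if s = y then of_bool (good a y) * ker (n + a) b u (jn y x) else 0)" by (rule sum.cong[OF refl])
    also have "\<dots> = ker (n + a) b w (jn y x)"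
      using finite_conf[of "{1..N}" "n + a"] xy w(2)[OF conf_val1[OF xy(2)] conf_val1[OF xy(1)]] by (simp add: sum.delta del: One_nat_def)
    finally show "(\<Sum>s\<in>conf {1..N} (n + a). ker (n + a) (n + a) (gp a) (jn y s) * ker (n + a) b u (jn s x)) =
      ker (n + a) b w (jn y x)" .
  qed
  then show ?thesis using w(2)[OF v] by simp
qed

lemma gp_absorb2:
  assumes u: "u \<in> Hom Gt (n + a) b"
  shows "gc t (n + a) (n + a) b u (gp a) = u \<longleftrightarrow>
    (\<forall>x y. val1 b x \<longrightarrow> val1 (n + a) y \<longrightarrow> \<not> good a y \<longrightarrow> ker (n + a) b u (jn y x) = 0)" (is "?l \<longleftrightarrow> ?r")
proof
  assume ?l
  then show ?r using ker_gp2[OF u] by (metis mult_zero_left of_bool_eq(1))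
next
  assume r: ?r
  show ?l
  proof (rule ker_inj2[OF gcomp_hom u])
    fix y x assume v: "val1 (n + a) y" "val1 b x"
    show "ker (n + a) b (gc t (n + a) (n + a) b u (gp a)) (jn y x) = ker (n + a) b u (jn y x)"
      using ker_gp2[OF u v(2,1)] r v by (cases "good a y") simp_all
  qed
qed

lemma gp_idem: "gc t (n + a) (n + a) (n + a) (gp a) (gp a) = gp a"
  unfolding gp_absorb1[OF gp_hom]
proof (intro allI impI)
  fix x y assume v: "val1 (n + a) x" "val1 (n + a) y" and g: "\<not> good a y"
  have "good a x \<longleftrightarrow> good a y" if "\<forall>i\<in>{1..n + a}. x i = y i" by (rule good_iff) (use that in auto)
  then show "ker (n + a) (n + a) (gp a) (jn x y) = 0" using gp_ker[OF v] g by auto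
qed

section \<open>Unit and counit for the objects \<open>Z a\<close>\<close>

lemma Z_obj: "Z a \<in> Obj CC"
  by (simp add: Z_def Ccat_def Gt.obj_single_idem gp_hom gp_idem)

lemma hom_emt_Z: "Hom CC (emt b) (Z a) = emb_mor ` {u \<in> Hom Gt b (n + a). gc t b (n + a) (n + a) (gp a) u = u}"
  and hom_Z_emt: "Hom CC (Z a) (emt b) = emb_mor ` {u \<in> Hom Gt (n + a) b. gc t (n + a) (n + a) b u (gp a) = u}"
  and hom_Z_Z: "Hom CC (Z a) (Z a') = emb_mor ` {u \<in> Hom Gt (n + a) (n + a'). gc t (n + a) (n + a') (n + a') (gp a') u = u \<and> gc t (n + a) (n + a) (n + a') u (gp a) = u}"
  unfolding Z_def emt_eq Ccat_def Gt.hom_single_idem using idG by (auto intro!: image_cong)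

lemma gp_hom_Z: "emb_mor (gp a) \<in> Hom CC (Z a) (emt (n + a))" "emb_mor (gp a) \<in> Hom CC (emt (n + a)) (Z a)"
  unfolding hom_emt_Z hom_Z_emt using gp_hom gp_idem by auto

text \<open>The idempotent \<open>gp a\<close> is at once the inclusion of \<open>Z a\<close> into
  \<open>[n + a]\<close> and the projection onto it; \<epsilon> is \<open>E0\<close> after the image
  of the inclusion, and \<eta> the image of the projection after \<open>N0\<close>.\<close>

definition "\<epsilon> a = Comp (ps T) (fob RR (Z a)) (fob RR (emt (n + a))) (Yo a) (E0 a) (fmor RR (Z a) (emt (n + a)) (emb_mor (gp a)))"
definition "\<eta> a = Comp (ps T) (Yo a) (fob RR (emt (n + a))) (fob RR (Z a)) (fmor RR (emt (n + a)) (Z a) (emb_mor (gp a))) (N0 a)"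

lemma eps_hom: "\<epsilon> a \<in> Hom (ps T) (fob RR (Z a)) (Yo a)" and eta_hom: "\<eta> a \<in> Hom (ps T) (Yo a) (fob RR (Z a))"
  unfolding \<epsilon>_def \<eta>_def
  by (intro RF.tgt.comp_hom RF.ob RF.mor Z_obj emt_obj Yo_obj gp_hom_Z E0_hom N0_hom)+

lemma eps_comp:
  assumes X: "X \<in> Obj CC" and f: "f \<in> Hom CC X (Z a)"
  shows "Comp (ps T) (fob RR X) (fob RR (Z a)) (Yo a) (\<epsilon> a) (fmor RR X (Z a) f) =
    Comp (ps T) (fob RR X) (fob RR (emt (n + a))) (Yo a) (E0 a) (fmor RR X (emt (n + a)) (Comp CC X (Z a) (emt (n + a)) (emb_mor (gp a)) f))"
  unfolding \<epsilon>_def RF.comp[OF X Z_obj emt_obj f gp_hom_Z(1)]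
  by (rule RF.tgt.assoc[symmetric]) (intro RF.ob RF.mor X f Z_obj emt_obj Yo_obj gp_hom_Z E0_hom)+

lemma eta_comp:
  assumes X: "X \<in> Obj CC" and f: "f \<in> Hom CC (Z a) X"
  shows "Comp (ps T) (Yo a) (fob RR (Z a)) (fob RR X) (fmor RR (Z a) X f) (\<eta> a) =
    Comp (ps T) (Yo a) (fob RR (emt (n + a))) (fob RR X) (fmor RR (emt (n + a)) X (Comp CC (emt (n + a)) (Z a) X f (emb_mor (gp a)))) (N0 a)"
  unfolding \<eta>_def RF.comp[OF emt_obj Z_obj X gp_hom_Z(2) f]
  by (rule RF.tgt.assoc) (intro RF.ob RF.mor X f Z_obj emt_obj Yo_obj gp_hom_Z N0_hom)+

lemma eps_Res:
  assumes u: "u \<in> Hom Gt b (n + a)" "gc t b (n + a) (n + a) (gp a) u = u"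
  shows "Comp (ps T) (fob RR (emt b)) (fob RR (Z a)) (Yo a) (\<epsilon> a) (fmor RR (emt b) (Z a) (emb_mor u)) =
    mat_comp T (Wl b) (Wl (n + a)) [Yk a] (E0 a) (rs b (n + a) u)"
proof -
  have "Comp CC (emt b) (Z a) (emt (n + a)) (emb_mor (gp a)) (emb_mor u) = emb_mor u"
    unfolding Z_def emt_eq comp_CC u(2) ..
  then show ?thesis using u eps_comp[OF emt_obj, of "emb_mor u" b a] by (simp add: hom_emt_Z Res_ob Yo_eq)
qed

lemma eta_Res:
  assumes u: "u \<in> Hom Gt (n + a) b" "gc t (n + a) (n + a) b u (gp a) = u"
  shows "Comp (ps T) (Yo a) (fob RR (Z a)) (fob RR (emt b)) (fmor RR (Z a) (emt b) (emb_mor u)) (\<eta> a) =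
    mat_comp T [Yk a] (Wl (n + a)) (Wl b) (rs (n + a) b u) (N0 a)"
proof -
  have "Comp CC (emt (n + a)) (Z a) (emt b) (emb_mor u) (emb_mor (gp a)) = emb_mor u"
    unfolding Z_def emt_eq comp_CC u(2) ..
  then show ?thesis using u eta_comp[OF emt_obj, of "emb_mor u" a b] by (simp add: hom_Z_emt Res_ob Yo_eq)
qed

lemma Wl_pos: "I \<subseteq> {1..b} \<Longrightarrow> Wl b ! pos b I = (em1 (card I), perm_rep (W_basis G n (b - card I)))"
  using pos_mem[of I b] by (simp add: Wl_nth W_pow_perm)

lemma Wrep_obj: "(perm_rep (W_basis G n c) :: (_, _, 'k) rep) \<in> Obj RH"
  by (rule perm_rep_obj[OF W_stable])

lemma entry_E0:
  assumes u: "u \<in> Hom Gt b (n + a)" and I: "I \<subseteq> {1..b}"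
  shows "entry (mat_comp T (Wl b) (Wl (n + a)) [Yk a] (E0 a) (rs b (n + a) u)) 0 (pos b I) (k, (ys, xs)) =
    (if ys \<in> B0 then entry (rs b (n + a) u) (pw a) (pos b I) (k, (ys, xs)) else 0)"
proof -
  have X: "entry (rs b (n + a) u) (pw a) (pos b I) \<in> Hom T (em1 (card I), perm_rep (W_basis G n (b - card I))) (em1 a, perm_rep (W_basis G n n))"
    using Res_entry_hom[OF u I Iw_sub] by simp
  show ?thesis
    unfolding E0_def using TL.entry_single_left[OF Wl_obj Wl_obj Yk_obj(2) Res_mat_hom[OF u] Wl_pw(2), where l = 0 and i = "pos b I" and l' = 0 and f = "dg a"] pos_mem(1)[OF I]
      comp_dg_left[OF Wrep_obj _ _ X, of B0] by (simp add: Wl_pw Wl_pos[OF I])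
qed

lemma entry_N0:
  assumes u: "u \<in> Hom Gt (n + a) b" and I: "I \<subseteq> {1..b}"
  shows "entry (mat_comp T [Yk a] (Wl (n + a)) (Wl b) (rs (n + a) b u) (N0 a)) (pos b I) 0 (k, (ys, xs)) =
    (if xs \<in> B0 then entry (rs (n + a) b u) (pos b I) (pw a) (k, (ys, xs)) else 0)"
proof -
  have X: "entry (rs (n + a) b u) (pos b I) (pw a) \<in> Hom T (em1 a, perm_rep (W_basis G n n)) (em1 (card I), perm_rep (W_basis G n (b - card I)))"
    using Res_entry_hom[OF u Iw_sub I] by simp
  show ?thesis
    unfolding N0_def using TL.entry_single_right[OF Yk_obj(2) Wl_obj Wl_obj Res_mat_hom[OF u] Wl_pw(2), where l = "pos b I" and i = 0 and i' = 0 and f = "dg a"] pos_mem(1)[OF I]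
      comp_dg_right[OF Wrep_obj _ _ X, of B0] by (simp add: Wl_pw Wl_pos[OF I])
qed

text \<open>\<open>T1\<close> vanishes at tuples that are not good, so the morphism with this kernel
  lands in \<open>Z a\<close>. \<open>Psi1_eq\<close> gives the entries with \<open>ys\<close> in
  \<open>B0\<close>; off \<open>B0\<close> both sides vanish. The kernel remains in the conclusion
  because the lifts are studied through it.\<close>

lemma surj1:
  assumes M: "M \<in> mat_hom T (Wl b) [Yk a]"
  shows "\<exists>u. u \<in> Hom Gt b (n + a) \<and> gc t b (n + a) (n + a) (gp a) u = u \<and>
    (\<forall>x y. val1 b x \<longrightarrow> val1 (n + a) y \<longrightarrow> ker b (n + a) u (jn x y) = T1 a b M x y) \<and>
    mat_comp T (Wl b) (Wl (n + a)) [Yk a] (E0 a) (rs b (n + a) u) = M"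
proof -
  from kernel_T1 obtain u where u: "u \<in> Hom Gt b (n + a)"
    and k: "\<And>x y. val1 b x \<Longrightarrow> val1 (n + a) y \<Longrightarrow> ker b (n + a) u (jn x y) = T1 a b M x y" by blast
  have "gc t b (n + a) (n + a) (gp a) u = u"
    unfolding gp_absorb1[OF u] by (auto simp: k T1_def)
  moreover have "mat_comp T (Wl b) (Wl (n + a)) [Yk a] (E0 a) (rs b (n + a) u) = M" (is "?N = M")
  proof (rule mat_hom_eqI[OF _ M])
    show "?N \<in> mat_hom T (Wl b) [Yk a]" by (rule TL.mat_comp_hom) (intro Wl_obj Yk_obj Res_mat_hom u E0_mat)+
    fix j i assume ji: "j < length [Yk a]" "i < length (Wl b)"
    define I where "I = subset_list b ! i"
    have I: "I \<subseteq> {1..b}" "i = pos b I" using ji nth_subset pos_nth by (auto simp: I_def simp del: One_nat_def)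
    have "entry ?N 0 (pos b I) x = entry M 0 (pos b I) x" for x
    proof -
      obtain kk ys xs where [simp]: "x = (kk, (ys, xs))" by (metis prod.collapse)
      obtain p q f where [simp]: "kk = (p, q, f)" by (metis prod.collapse)
      have "entry M 0 (pos b I) (kk, (ys, xs)) = 0" if "ys \<notin> B0"
        using Wl_hom[OF M I(1)] that unfolding T_hom_iff[OF W_stable B0_stable] \<open>kk = _\<close> by blast
      then show ?thesis using entry_E0[OF u I(1), of kk ys xs] Psi1_eq[OF u k M I(1), of ys kk xs] by simp
    qed
    then show "entry ?N j i = entry M j i" using ji I(2) by (simp add: fun_eq_iff)
  qed
  ultimately show ?thesis using u k by blast
qed

lemma bij1:
  "bij_betw (\<lambda>f. Comp (ps T) (fob RR (emt b)) (fob RR (Z a)) (Yo a) (\<epsilon> a) (fmor RR (emt b) (Z a) f))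
     (Hom CC (emt b) (Z a)) (Hom (ps T) (fob RR (emt b)) (Yo a))"
  (is "bij_betw ?\<phi> _ ?Y")
proof -
  let ?U = "{u \<in> Hom Gt b (n + a). gc t b (n + a) (n + a) (gp a) u = u}"
  have Y: "?Y = mat_hom T (Wl b) [Yk a]" unfolding Res_ob Yo_eq by (rule TL.hom_full[OF Wl_obj Yk_obj(2)])
  have \<phi>: "?\<phi> (emb_mor u) = mat_comp T (Wl b) (Wl (n + a)) [Yk a] (E0 a) (rs b (n + a) u)" if "u \<in> ?U" for u
    using eps_Res that by blast
  have "u = u'" if u: "u \<in> ?U" "u' \<in> ?U" and e: "?\<phi> (emb_mor u) = ?\<phi> (emb_mor u')" for u u'
  proof (rule Psi1_inj)
    show h: "u \<in> Hom Gt b (n + a)" "u' \<in> Hom Gt b (n + a)" using u by auto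
    show "ker b (n + a) w (jn x y) = 0" if "val1 b x" "val1 (n + a) y" "\<not> good a y" "w \<in> {u, u'}" for x y w
    proof -
      have "w \<in> Hom Gt b (n + a)" "gc t b (n + a) (n + a) (gp a) w = w" using that(4) u by auto
      then show ?thesis using gp_absorb1[of w b a] that by blast
    qed
    fix I f and xs ys :: "(nat \<times> nat) list" assume I: "I \<subseteq> {1..b}" and ys: "ys \<in> B0"
    show "entry (rs b (n + a) u) (pw a) (pos b I) ((0, 0, f), (ys, xs)) = entry (rs b (n + a) u') (pw a) (pos b I) ((0, 0, f), (ys, xs))"
      using entry_E0[OF h(1) I, of "(0, 0, f)" ys xs] entry_E0[OF h(2) I, of "(0, 0, f)" ys xs] ys e unfolding \<phi>[OF u(1)] \<phi>[OF u(2)] by simp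
  qed
  then have inj: "inj_on ?\<phi> (emb_mor ` ?U)" by (intro inj_onI) auto
  have "?\<phi> ` emb_mor ` ?U = ?Y"
  proof
    show "?\<phi> ` emb_mor ` ?U \<subseteq> ?Y"
      unfolding hom_emt_Z[symmetric] using RF.tgt.comp_hom[OF RF.ob[OF emt_obj] RF.ob[OF Z_obj] Yo_obj RF.mor[OF emt_obj Z_obj] eps_hom] by blast
    show "?Y \<subseteq> ?\<phi> ` emb_mor ` ?U"
    proof
      fix M assume "M \<in> ?Y"
      then obtain u where "u \<in> ?U" "mat_comp T (Wl b) (Wl (n + a)) [Yk a] (E0 a) (rs b (n + a) u) = M" using surj1[of M b a] unfolding Y by blast
      then have "?\<phi> (emb_mor u) = M" "emb_mor u \<in> emb_mor ` ?U" using \<phi>[of u] by auto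
      then show "M \<in> ?\<phi> ` emb_mor ` ?U" by (metis (no_types, lifting) imageI)
    qed
  qed
  then show ?thesis unfolding hom_emt_Z using inj by (simp add: bij_betw_def)
qed

lemma surj2:
  assumes M: "M \<in> mat_hom T [Yk a] (Wl b)"
  shows "\<exists>u. u \<in> Hom Gt (n + a) b \<and> gc t (n + a) (n + a) b u (gp a) = u \<and>
    (\<forall>x y. val1 b x \<longrightarrow> val1 (n + a) y \<longrightarrow> ker (n + a) b u (jn y x) = T2 a b M x y) \<and>
    mat_comp T [Yk a] (Wl (n + a)) (Wl b) (rs (n + a) b u) (N0 a) = M"
proof -
  from kernel_T2 obtain u where u: "u \<in> Hom Gt (n + a) b"
    and k: "\<And>x y. val1 b x \<Longrightarrow> val1 (n + a) y \<Longrightarrow> ker (n + a) b u (jn y x) = T2 a b M x y" by blast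
  have "gc t (n + a) (n + a) b u (gp a) = u"
    unfolding gp_absorb2[OF u] by (auto simp: k T2_def)
  moreover have "mat_comp T [Yk a] (Wl (n + a)) (Wl b) (rs (n + a) b u) (N0 a) = M" (is "?N = M")
  proof (rule mat_hom_eqI[OF _ M])
    show "?N \<in> mat_hom T [Yk a] (Wl b)" by (rule TL.mat_comp_hom) (intro Yk_obj Wl_obj N0_mat Res_mat_hom u)+
    fix j i assume ji: "j < length (Wl b)" "i < length [Yk a]"
    define I where "I = subset_list b ! j"
    have I: "I \<subseteq> {1..b}" "j = pos b I" using ji nth_subset pos_nth by (auto simp: I_def simp del: One_nat_def)
    have "entry ?N (pos b I) 0 x = entry M (pos b I) 0 x" for x
    proof -
      obtain kk ys xs where [simp]: "x = (kk, (ys, xs))" by (metis prod.collapse)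
      obtain p q f where [simp]: "kk = (p, q, f)" by (metis prod.collapse)
      have "entry M (pos b I) 0 (kk, (ys, xs)) = 0" if "xs \<notin> B0"
        using Wl_hom2[OF M I(1)] that unfolding T_hom_iff[OF B0_stable W_stable] \<open>kk = _\<close> by blast
      then show ?thesis using entry_N0[OF u I(1), of kk ys xs] Psi2_eq[OF u k M I(1), of xs kk ys] by simp
    qed
    then show "entry ?N j i = entry M j i" using ji I(2) by (simp add: fun_eq_iff)
  qed
  ultimately show ?thesis using u k by blast
qed

lemma bij2:
  "bij_betw (\<lambda>f. Comp (ps T) (Yo a) (fob RR (Z a)) (fob RR (emt b)) (fmor RR (Z a) (emt b) f) (\<eta> a))
     (Hom CC (Z a) (emt b)) (Hom (ps T) (Yo a) (fob RR (emt b)))"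
  (is "bij_betw ?\<phi> _ ?Y")
proof -
  let ?U = "{u \<in> Hom Gt (n + a) b. gc t (n + a) (n + a) b u (gp a) = u}"
  have Y: "?Y = mat_hom T [Yk a] (Wl b)" unfolding Res_ob Yo_eq by (rule TL.hom_full[OF Yk_obj(2) Wl_obj])
  have \<phi>: "?\<phi> (emb_mor u) = mat_comp T [Yk a] (Wl (n + a)) (Wl b) (rs (n + a) b u) (N0 a)" if "u \<in> ?U" for u
    using eta_Res that by blast
  have "u = u'" if u: "u \<in> ?U" "u' \<in> ?U" and e: "?\<phi> (emb_mor u) = ?\<phi> (emb_mor u')" for u u'
  proof (rule Psi2_inj)
    show h: "u \<in> Hom Gt (n + a) b" "u' \<in> Hom Gt (n + a) b" using u by auto
    show "ker (n + a) b w (jn y x) = 0" if "val1 b x" "val1 (n + a) y" "\<not> good a y" "w \<in> {u, u'}" for x y w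
    proof -
      have "w \<in> Hom Gt (n + a) b" "gc t (n + a) (n + a) b w (gp a) = w" using that(4) u by auto
      then show ?thesis using gp_absorb2[of w a b] that by blast
    qed
    fix I f and xs ys :: "(nat \<times> nat) list" assume I: "I \<subseteq> {1..b}" and ys: "ys \<in> B0"
    show "entry (rs (n + a) b u) (pos b I) (pw a) ((0, 0, f), (xs, ys)) = entry (rs (n + a) b u') (pos b I) (pw a) ((0, 0, f), (xs, ys))"
      using entry_N0[OF h(1) I, of "(0, 0, f)" xs ys] entry_N0[OF h(2) I, of "(0, 0, f)" xs ys] ys e unfolding \<phi>[OF u(1)] \<phi>[OF u(2)] by simp
  qed
  then have inj: "inj_on ?\<phi> (emb_mor ` ?U)" by (intro inj_onI) auto
  have "?\<phi> ` emb_mor ` ?U = ?Y"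
  proof
    show "?\<phi> ` emb_mor ` ?U \<subseteq> ?Y"
      unfolding hom_Z_emt[symmetric] using RF.tgt.comp_hom[OF Yo_obj RF.ob[OF Z_obj] RF.ob[OF emt_obj] eta_hom RF.mor[OF Z_obj emt_obj]] by blast
    show "?Y \<subseteq> ?\<phi> ` emb_mor ` ?U"
    proof
      fix M assume "M \<in> ?Y"
      then obtain u where "u \<in> ?U" "mat_comp T [Yk a] (Wl (n + a)) (Wl b) (rs (n + a) b u) (N0 a) = M" using surj2[of M a b] unfolding Y by blast
      then have "?\<phi> (emb_mor u) = M" "emb_mor u \<in> emb_mor ` ?U" using \<phi>[of u] by auto
      then show "M \<in> ?\<phi> ` emb_mor ` ?U" by (metis (no_types, lifting) imageI)
    qed
  qed
  then show ?thesis unfolding hom_Z_emt using inj by (simp add: bij_betw_def)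
qed

lemma thru_emt: "X \<in> Obj CC \<Longrightarrow> Idm CC X \<in> thru CC (range emt) X X"
  using Gt.thru_ps[of X] by (simp add: Ccat_def)

lemma Z_represents: "RF.represents (Yo a) (Z a) (\<epsilon> a) (\<eta> a)"
  by (rule RF.represents_from_dense[of "range emt"]) (auto intro: thru_emt Yo_obj Z_obj eps_hom eta_hom bij1 bij2)

end

context wreath_rep
begin

lemma lst_rows: "map fst (lst {1..n} y) = map (\<lambda>i. fst (y i)) [1..<Suc n]"
  by (simp add: lst_initial o_def del: upt_Suc One_nat_def)

lemma lst_inj: "lst {1..n} y \<in> B0 \<Longrightarrow> inj_on (\<lambda>i. fst (y i)) {1..n}"
proof -
  assume "lst {1..n} y \<in> B0"
  then have "distinct (map (\<lambda>i. fst (y i)) [1..<Suc n])" unfolding B0_def lst_rows[symmetric] by blast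
  then show ?thesis by (simp add: distinct_map atLeastLessThanSuc_atLeastAtMost del: upt_Suc)
qed

lemma good_inj: "good a y \<Longrightarrow> inj_on (\<lambda>i. fst (y i)) {1..n}"
proof (rule inj_onI)
  fix i j assume "good a y" "i \<in> {1..n}" "j \<in> {1..n}" "fst (y i) = fst (y j)"
  then show "i = j" using goodD[of a y i j] by auto
qed

lemma good0: "good 0 y \<longleftrightarrow> inj_on (\<lambda>i. fst (y i)) {1..n}"
  by (auto simp: good_def inj_on_def simp del: One_nat_def)

end

section \<open>Lifts of morphisms between generators\<close>

context res_core
begin

lemma hom_T_zero: "stable B \<Longrightarrow> stable B' \<Longrightarrow> u \<in> Hom T (em1 p, perm_rep B) (em1 q, perm_rep B') \<Longrightarrow> ys \<notin> B' \<or> xs \<notin> B \<Longrightarrow> u (k, (ys, xs)) = 0"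
proof -
  assume s: "stable B" "stable B'" and u: "u \<in> Hom T (em1 p, perm_rep B) (em1 q, perm_rep B')" and y: "ys \<notin> B' \<or> xs \<notin> B"
  obtain i j f where k: "k = (i, j, f)" by (metis prod.collapse)
  have "u ((i, j, f), (ys, xs)) \<noteq> 0 \<longrightarrow> i = 0 \<and> j = 0 \<and> f \<in> P G p q \<and> ys \<in> B' \<and> xs \<in> B"
    using u unfolding T_hom_iff[OF s] by blast
  then show ?thesis using y k by blast
qed

lemma pos_eq_pw: "I \<subseteq> {1..n + a} \<Longrightarrow> pos (n + a) I = pw a \<longleftrightarrow> I = Iw a"
  using pos_mem(2)[of I "n + a"] pos_mem(2)[OF Iw_sub[of a]] by metis

context
  fixes a a' \<gamma> assumes \<gamma>: "\<gamma> \<in> Hom T (Yk a) (Yk a')"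
begin

text \<open>\<open>M1\<close> and \<open>M2\<close> are what \<gamma> contributes to the two lifting
  squares before \<open>gp\<close> is inserted.\<close>

abbreviation "M1 \<equiv> mat_comp T (Wl (n + a)) [Yk a] [Yk a'] (emb_mor \<gamma>) (E0 a)"
abbreviation "M2 \<equiv> mat_comp T [Yk a] [Yk a'] (Wl (n + a')) (N0 a') (emb_mor \<gamma>)"

lemma M1_hom: "M1 \<in> mat_hom T (Wl (n + a)) [Yk a']" and M2_hom: "M2 \<in> mat_hom T [Yk a] (Wl (n + a'))"
  using TL.mat_comp_hom[OF Wl_obj Yk_obj(2) Yk_obj(2) E0_mat TL.emb_mor_hom[OF \<gamma>]]
    TL.mat_comp_hom[OF Yk_obj(2) Yk_obj(2) Wl_obj TL.emb_mor_hom[OF \<gamma>] N0_mat] by auto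

lemma \<gamma>_zero: "ys \<notin> B0 \<or> xs \<notin> B0 \<Longrightarrow> \<gamma> (k, (ys, xs)) = 0"
  by (rule hom_T_zero[OF B0_stable B0_stable \<gamma>])

lemma entry_emb: "entry (emb_mor \<gamma>) 0 0 = \<gamma>"
  by (simp add: emb_mor_def entry_single)

lemma entry_M1: "I \<subseteq> {1..n + a} \<Longrightarrow> entry M1 0 (pos (n + a) I) (k, (ys, xs)) = (if I = Iw a then \<gamma> (k, (ys, xs)) else 0)"
  unfolding E0_def
  using TL.entry_single_right[OF Wl_obj Yk_obj(2) Yk_obj(2) TL.emb_mor_hom[OF \<gamma>], where j = 0 and l = 0 and i = "pos (n + a) I" and i' = "pw a" and f = "dg a"]
    pos_mem(1)[of I "n + a"] comp_dg_right[OF perm_obj _ _ \<gamma>, where k = k and ys = ys and xs = xs and B' = "W_basis G n n"] \<gamma>_zero[of ys xs k]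
  by (cases "I = Iw a") (simp_all add: entry_emb pos_eq_pw Wl_pw zero_fun_apply)

lemma entry_M2: "J \<subseteq> {1..n + a'} \<Longrightarrow> entry M2 (pos (n + a') J) 0 (k, (ys, xs)) = (if J = Iw a' then \<gamma> (k, (ys, xs)) else 0)"
  unfolding N0_def
  using TL.entry_single_left[OF Yk_obj(2) Yk_obj(2) Wl_obj TL.emb_mor_hom[OF \<gamma>], where j = 0 and i = 0 and l = "pos (n + a') J" and l' = "pw a'" and f = "dg a'"]
    pos_mem(1)[of J "n + a'"] comp_dg_left[OF perm_obj _ _ \<gamma>, where k = k and ys = ys and xs = xs and B' = "W_basis G n n"] \<gamma>_zero[of ys xs k]
  by (cases "J = Iw a'") (simp_all add: entry_emb pos_eq_pw Wl_pw zero_fun_apply)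

text \<open>By \<open>entry_M1\<close> the only block of \<open>M1\<close> that can be nonzero is
  the one at \<open>Iw a\<close>, and there \<gamma> restricts the tuples to
  \<open>B0\<close>.\<close>

lemma T1_nonzero:
  assumes nz: "T1 a' (n + a) M1 x y \<noteq> 0"
  shows "good a' y" "out (n + a) x y = Iw a" "lst {1..n} (rel y \<circ> x) \<in> B0"
proof -
  let ?O = "out (n + a) x y"
  show g: "good a' y"
  proof (rule ccontr)
    assume "\<not> good a' y"
    then show False using nz by (simp only: T1_def if_False simp_thms)
  qed
  have "entry M1 0 (pos (n + a) ?O) (k, (y0, lst ({1..n + a} - ?O) (rel y \<circ> x))) = 0" if "?O \<noteq> Iw a \<or> lst {1..n} (rel y \<circ> x) \<notin> B0" for k
    using entry_M1[OF out_sub[of "n + a" x y], where k = k and ys = y0] that \<gamma>_zero compl_Iw[of a] by (cases "?O = Iw a") auto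
  then have "?O = Iw a \<and> lst {1..n} (rel y \<circ> x) \<in> B0" using nz g unfolding T1_def sk_def by fastforce
  then show "?O = Iw a" "lst {1..n} (rel y \<circ> x) \<in> B0" by auto
qed

text \<open>The first \<open>n\<close> positions of \<open>x\<close> are not in \<open>out\<close>,
  so their rows occur in the frame of \<open>y\<close>; distinct relative coordinates make these
  rows distinct, and the later positions avoid the frame. So the kernel is supported on good tuples
  on the source side as well.\<close>

lemma T1_rows:
  assumes nz: "T1 a' (n + a) M1 x y \<noteq> 0"
  shows "i \<in> {1..n} \<Longrightarrow> \<exists>k\<in>{1..n}. fst (y k) = fst (x i)" "good a x"
proof -
  note N = T1_nonzero[OF nz]
  show row: "\<exists>k\<in>{1..n}. fst (y k) = fst (x i)" if "i \<in> {1..n}" for i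
    by (rule not_out[where b = "n + a"]) (use that N(2) in auto)
  have inj: "i = j" if ij: "i \<in> {1..n}" "j \<in> {1..n}" and e: "fst (x i) = fst (x j)" for i j
  proof -
    have "fst (rel y (x i)) = fst (rel y (x j))" by (simp add: rel_def e Let_def)
    then show ?thesis using inj_onD[OF lst_inj[OF N(3)] _ ij] by simp
  qed
  show "good a x" unfolding good_def
  proof (intro ballI impI)
    fix i j assume ij: "i \<in> {1..n}" "j \<in> {1..n + a}" "i \<noteq> j"
    show "fst (x i) \<noteq> fst (x j)"
    proof (cases "j \<le> n")
      case True
      then show ?thesis using inj ij by auto
    next
      case False
      then have "j \<in> out (n + a) x y" using N(2) ij by auto
      then show ?thesis using row[OF ij(1)] unfolding out_def by fastforce
    qed
  qed
qed

text \<open>Counting rows: where the kernel does not vanish, the first \<open>n\<close> rows of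
  \<open>x\<close> are exactly \<open>1, \<dots>, n\<close> and all occur in the frame of
  \<open>y\<close>, which therefore consists of these rows; this forces \<open>J = Iw a'\<close> and
  \<open>ys\<close> in \<open>B0\<close>. It makes a lift found through \<open>E0\<close> compatible
  with \<open>N0\<close>.\<close>

lemma kernel_block_zero:
  assumes v: "v \<in> Hom Gt (n + a) (n + a')" and K: "\<And>x y. val1 (n + a) x \<Longrightarrow> val1 (n + a') y \<Longrightarrow> ker (n + a) (n + a') v (jn x y) = T1 a' (n + a) M1 x y"
    and J: "J \<subseteq> {1..n + a'}" and ne: "\<not> (J = Iw a' \<and> ys \<in> B0)"
  shows "entry (rs (n + a) (n + a') v) (pos (n + a') J) (pw a) (k, (ys, xs)) = 0"
proof -
  let ?R = "entry (rs (n + a) (n + a') v) (pos (n + a') J) (pw a)"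
  let ?B = "W_basis G n (n + a' - card J)"
  have R: "?R \<in> Hom T (em1 a, perm_rep (W_basis G n n)) (em1 (card J), perm_rep ?B)"
    using Res_entry_hom[OF v Iw_sub J] by simp
  have Ri: "?R ((i, j, f), (ys, xs)) \<noteq> 0 \<longrightarrow> i = 0 \<and> j = 0 \<and> f \<in> P G a (card J) \<and> ys \<in> ?B \<and> xs \<in> W_basis G n n" for i j f ys xs
    using R unfolding T_hom_iff[OF W_stable W_stable] by blast
  obtain i j f where k: "k = (i, j, f)" by (metis prod.collapse)
  show ?thesis
  proof (cases "i = 0 \<and> j = 0 \<and> ys \<in> ?B \<and> xs \<in> W_basis G n n")
    case False
    then show ?thesis using Ri unfolding k by blast
  next
    case True
    let ?c = "\<lambda>f. ?R ((0, 0, f), (ys, xs))"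
    have "?c = 0"
    proof (rule ker_inj[where r = n and a = a and b = "card J" and t = t])
      show "?c \<in> Hom Gt a (card J)" unfolding Gcat_hom using Ri by blast
      show "0 \<in> Hom Gt a (card J)" by (rule Gt.zero_hom) simp_all
      fix z assume vz: "valid a (card J) z" and r: "\<And>p. p \<in> points a (card J) \<Longrightarrow> fst (z p) \<in> {n<..n + a + card J}"
      have zx: "n < fst (z (Up q)) \<and> snd (z (Up q)) \<in> carrier G" if "q \<in> {1..card (Iw a)}" for q
        using r[of "Up q"] validD[OF vz, of "Up q"] that by (auto simp: points_def)
      have zy: "n < fst (z (Lo q)) \<and> snd (z (Lo q)) \<in> carrier G" if "q \<in> {1..card J}" for q
        using r[of "Lo q"] validD[OF vz, of "Lo q"] that by (auto simp: points_def)
      have xsW: "xs \<in> W_basis G n (n + a - card (Iw a))" using True by simp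
      obtain x where x: "val1 (n + a) x" "\<And>i. i \<in> {1..n + a} \<Longrightarrow> 1 \<le> fst (x i)" "Iw a = {i\<in>{1..n + a}. n < fst (x i)}"
        "\<And>q. q \<in> {1..card (Iw a)} \<Longrightarrow> x (en (Iw a) q) = z (Up q)" "lst ({1..n + a} - Iw a) x = xs"
        by (rule realize[where g = "\<lambda>q. z (Up q)", OF Iw_sub xsW zx]) blast+
      obtain y where y: "val1 (n + a') y" "\<And>i. i \<in> {1..n + a'} \<Longrightarrow> 1 \<le> fst (y i)" "J = {i\<in>{1..n + a'}. n < fst (y i)}"
        "\<And>q. q \<in> {1..card J} \<Longrightarrow> y (en J q) = z (Lo q)" "lst ({1..n + a'} - J) y = ys"
        by (rule realize[where g = "\<lambda>q. z (Lo q)", OF J _ zy, of ys]) (use True in blast)+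
      have "T1 a' (n + a) M1 x y = 0"
      proof (rule ccontr)
        assume nz: "T1 a' (n + a) M1 x y \<noteq> 0"
        note N = T1_nonzero[OF nz] and row = T1_rows[OF nz]
        have xr: "(\<lambda>i. fst (x i)) ` {1..n} \<subseteq> {1..n}" 
        proof (rule image_subsetI)
          fix i assume "i \<in> {1..n}"
          then have i: "i \<in> {1..n + a}" "i \<notin> Iw a" by auto
          then have "\<not> n < fst (x i)" using x(3) by blast
          then show "fst (x i) \<in> {1..n}" using x(2)[OF i(1)] by simp
        qed
        have xim: "(\<lambda>i. fst (x i)) ` {1..n} = {1..n}"
          by (rule card_subset_eq[OF _ xr]) (simp_all add: card_image[OF good_inj[OF row(2)]] del: One_nat_def)
        have sub: "{1..n} \<subseteq> (\<lambda>i. fst (y i)) ` {1..n}" 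
        proof
          fix r assume "r \<in> {1..n}"
          then have "r \<in> (\<lambda>i. fst (x i)) ` {1..n}" using xim by simp
          then obtain i where i: "i \<in> {1..n}" "r = fst (x i)" by blast
          then obtain k where "k \<in> {1..n}" "fst (y k) = r" using row(1)[OF i(1)] by blast
          then show "r \<in> (\<lambda>i. fst (y i)) ` {1..n}" by blast
        qed
        have yim: "(\<lambda>i. fst (y i)) ` {1..n} = {1..n}"
          by (rule card_subset_eq[OF _ sub, symmetric]) (simp_all add: card_image[OF good_inj[OF N(1)]] del: One_nat_def)
        have yr: "n < fst (y j) \<longleftrightarrow> n < j" if j: "j \<in> {1..n + a'}" for j
        proof (cases "j \<le> n")
          case True
          then have "fst (y j) \<in> {1..n}" using yim j by auto
          then show ?thesis using True by simp
        next
          case False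
          have "fst (y i) \<noteq> fst (y j)" if "i \<in> {1..n}" for i
            using goodD[OF N(1) that j] that False by auto
          then have "fst (y j) \<notin> (\<lambda>i. fst (y i)) ` {1..n}" by fastforce
          then show ?thesis using False y(2)[OF j] unfolding yim by auto
        qed
        then have J': "J = Iw a'" unfolding y(3) by auto
        have "lst {1..n} y \<in> B0"
        proof (rule lst_B0[OF _ good_inj[OF N(1)]])
          show "fst (y i) \<in> {1..n} \<and> snd (y i) \<in> carrier G" if "i \<in> {1..n}" for i using yim y(1) that by (auto simp: val1_def)
        qed
        then have "ys \<in> B0" using y(5) unfolding J' compl_Iw by simp
        then show False using ne J' by blast
      qed
      have zz: "jn (x \<circ> en (Iw a)) (y \<circ> en J) p = z p" if "p \<in> points a (card J)" for p
        using x(4) y(4) that by (auto simp: points_def simp del: One_nat_def)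
      have "ker a (card J) ?c z = sk a (card J) ?R (jn (x \<circ> en (Iw a)) (y \<circ> en J)) (ys, xs)"
        unfolding ker_def sk_def using adm_cong[of _ a "card J" "jn (x \<circ> en (Iw a)) (y \<circ> en J)" z] zz by (intro sum.cong refl) simp
      also have "\<dots> = ker (n + a) (n + a') v (jn x y)"
        using Res_kernel[OF v x(1) y(1) x(2) y(2) x(3) y(3)] unfolding x(5) y(5) by simp
      also have "\<dots> = 0" unfolding K[OF x(1) y(1)] by fact
      finally show "ker a (card J) ?c z = ker a (card J) 0 z" by (simp add: ker_zero)
    qed
    from fun_cong[OF this, of f] show ?thesis using True unfolding k by (simp add: zero_fun_apply)
  qed
qed

text \<open>The preimage \<open>v\<close> of \<open>M1\<close> under the first bijection satisfies
  the square for \<epsilon>. Its kernel is good on both sides, so it is a morphism between the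
  objects \<open>Z\<close>. In the square for \<eta>, the block at \<open>Iw a'\<close> with tuples
  in \<open>B0\<close> repeats an entry of the first square, and everything else vanishes by
  \<open>kernel_block_zero\<close>.\<close>

lemma lift_exists:
  "\<exists>v. v \<in> Hom Gt (n + a) (n + a') \<and>
     RF.lifts (Yo a) (Z a) (\<epsilon> a) (\<eta> a) (Yo a') (Z a') (\<epsilon> a') (\<eta> a') (emb_mor \<gamma>) (emb_mor v) \<and>
     (\<forall>x y. val1 (n + a) x \<longrightarrow> val1 (n + a') y \<longrightarrow> ker (n + a) (n + a') v (jn x y) = T1 a' (n + a) M1 x y)"
proof -
  from surj1[OF M1_hom] obtain v where v: "v \<in> Hom Gt (n + a) (n + a')" "gc t (n + a) (n + a') (n + a') (gp a') v = v"
    and K: "\<And>x y. val1 (n + a) x \<Longrightarrow> val1 (n + a') y \<Longrightarrow> ker (n + a) (n + a') v (jn x y) = T1 a' (n + a) M1 x y"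
    and E: "mat_comp T (Wl (n + a)) (Wl (n + a')) [Yk a'] (E0 a') (rs (n + a) (n + a') v) = M1" by blast
  have v2: "gc t (n + a) (n + a) (n + a') v (gp a) = v"
    unfolding gp_absorb2[OF v(1)] using T1_rows(2) K by metis
  have N: "mat_comp T [Yk a] (Wl (n + a)) (Wl (n + a')) (rs (n + a) (n + a') v) (N0 a) = M2" (is "?N = _")
  proof (rule mat_hom_eqI[OF _ M2_hom])
    show "?N \<in> mat_hom T [Yk a] (Wl (n + a'))" by (rule TL.mat_comp_hom) (intro Yk_obj Wl_obj N0_mat Res_mat_hom v)+
    fix j i assume ji: "j < length (Wl (n + a'))" "i < length [Yk a]"
    define J where "J = subset_list (n + a') ! j"
    have J: "J \<subseteq> {1..n + a'}" "j = pos (n + a') J" using ji nth_subset pos_nth by (auto simp: J_def simp del: One_nat_def)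
    have "entry ?N (pos (n + a') J) 0 x = entry M2 (pos (n + a') J) 0 x" for x
    proof -
      obtain k ys xs where x: "x = (k, (ys, xs))" by (metis prod.collapse)
      show ?thesis
      proof (cases "J = Iw a' \<and> ys \<in> B0")
        case True
        have "entry M1 0 (pw a) (k, (ys, xs)) = entry (rs (n + a) (n + a') v) (pw a') (pw a) (k, (ys, xs))"
          using entry_E0[OF v(1) Iw_sub, of k ys xs] True unfolding E by simp
        then show ?thesis using True entry_N0[OF v(1) J(1), of k ys xs] entry_M1[OF Iw_sub, of k ys xs] entry_M2[OF J(1), of k ys xs] \<gamma>_zero[of ys xs k]
          unfolding x by auto
      next
        case False
        then show ?thesis using kernel_block_zero[OF v(1) K J(1) False, of k xs] entry_N0[OF v(1) J(1), of k ys xs] entry_M2[OF J(1), of k ys xs] \<gamma>_zero[of ys xs k]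
          unfolding x by auto
      qed
    qed
    then show "entry ?N j i = entry M2 j i" using ji J(2) by (simp add: fun_eq_iff)
  qed
  have h: "emb_mor v \<in> Hom CC (Z a) (Z a')" "emb_mor v \<in> Hom CC (Z a) (emt (n + a'))" "emb_mor v \<in> Hom CC (emt (n + a)) (Z a')"
    using v v2 by (auto simp: hom_Z_Z hom_Z_emt hom_emt_Z)
  have g: "emb_mor \<gamma> \<in> Hom (ps T) (Yo a) (Yo a')" using \<gamma> by (simp add: TL.hom_emb[OF Yk_obj(1) Yk_obj(1)])
  \<comment> \<open>As \<open>v\<close> absorbs both idempotents, it commutes with the inclusions
    and with the projections of the objects \<open>Z\<close>.\<close>
  have c: "Comp CC (Z a) (Z a') (emt (n + a')) (emb_mor (gp a')) (emb_mor v) = Comp CC (Z a) (emt (n + a)) (emt (n + a')) (emb_mor v) (emb_mor (gp a))"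
    "Comp CC (emt (n + a)) (Z a) (Z a') (emb_mor v) (emb_mor (gp a)) = Comp CC (emt (n + a)) (emt (n + a')) (Z a') (emb_mor (gp a')) (emb_mor v)"
    unfolding Z_def emt_eq comp_CC v(2) v2 by simp_all
  note O = RF.ob[OF Z_obj] RF.ob[OF emt_obj] Yo_obj
  have "Comp (ps T) (fob RR (Z a)) (fob RR (Z a')) (Yo a') (\<epsilon> a') (fmor RR (Z a) (Z a') (emb_mor v)) =
    Comp (ps T) (fob RR (Z a)) (fob RR (emt (n + a'))) (Yo a') (E0 a') (Comp (ps T) (fob RR (Z a)) (fob RR (emt (n + a))) (fob RR (emt (n + a')))
      (rs (n + a) (n + a') v) (fmor RR (Z a) (emt (n + a)) (emb_mor (gp a))))"
    unfolding eps_comp[OF Z_obj h(1)] c(1) RF.comp[OF Z_obj emt_obj emt_obj gp_hom_Z(1) emb_hom[OF v(1)]] ..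
  also have "\<dots> = Comp (ps T) (fob RR (Z a)) (fob RR (emt (n + a))) (Yo a') (Comp (ps T) (fob RR (emt (n + a))) (fob RR (emt (n + a'))) (Yo a') (E0 a') (rs (n + a) (n + a') v))
      (fmor RR (Z a) (emt (n + a)) (emb_mor (gp a)))"
    by (rule RF.tgt.assoc) (intro O RF.mor Z_obj emt_obj gp_hom_Z E0_hom emb_hom v)+
  also have "Comp (ps T) (fob RR (emt (n + a))) (fob RR (emt (n + a'))) (Yo a') (E0 a') (rs (n + a) (n + a') v) =
      Comp (ps T) (fob RR (emt (n + a))) (Yo a) (Yo a') (emb_mor \<gamma>) (E0 a)"
    unfolding Res_ob Yo_eq TL.comp_ps by (rule E)
  also have "Comp (ps T) (fob RR (Z a)) (fob RR (emt (n + a))) (Yo a') (Comp (ps T) (fob RR (emt (n + a))) (Yo a) (Yo a') (emb_mor \<gamma>) (E0 a))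
      (fmor RR (Z a) (emt (n + a)) (emb_mor (gp a))) = Comp (ps T) (fob RR (Z a)) (Yo a) (Yo a') (emb_mor \<gamma>) (\<epsilon> a)"
    unfolding \<epsilon>_def by (rule RF.tgt.assoc[symmetric]) (intro O RF.mor Z_obj emt_obj gp_hom_Z E0_hom g)+
  finally have 1: "Comp (ps T) (fob RR (Z a)) (fob RR (Z a')) (Yo a') (\<epsilon> a') (fmor RR (Z a) (Z a') (emb_mor v)) =
    Comp (ps T) (fob RR (Z a)) (Yo a) (Yo a') (emb_mor \<gamma>) (\<epsilon> a)" .
  have "Comp (ps T) (Yo a) (fob RR (Z a)) (fob RR (Z a')) (fmor RR (Z a) (Z a') (emb_mor v)) (\<eta> a) =
    Comp (ps T) (Yo a) (fob RR (emt (n + a))) (fob RR (Z a')) (Comp (ps T) (fob RR (emt (n + a))) (fob RR (emt (n + a'))) (fob RR (Z a'))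
      (fmor RR (emt (n + a')) (Z a') (emb_mor (gp a'))) (rs (n + a) (n + a') v)) (N0 a)"
    unfolding eta_comp[OF Z_obj h(1)] c(2) RF.comp[OF emt_obj emt_obj Z_obj emb_hom[OF v(1)] gp_hom_Z(2)] ..
  also have "\<dots> = Comp (ps T) (Yo a) (fob RR (emt (n + a'))) (fob RR (Z a')) (fmor RR (emt (n + a')) (Z a') (emb_mor (gp a')))
      (Comp (ps T) (Yo a) (fob RR (emt (n + a))) (fob RR (emt (n + a'))) (rs (n + a) (n + a') v) (N0 a))"
    by (rule RF.tgt.assoc[symmetric]) (intro O RF.mor Z_obj emt_obj gp_hom_Z N0_hom emb_hom v)+
  also have "Comp (ps T) (Yo a) (fob RR (emt (n + a))) (fob RR (emt (n + a'))) (rs (n + a) (n + a') v) (N0 a) =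
      Comp (ps T) (Yo a) (Yo a') (fob RR (emt (n + a'))) (N0 a') (emb_mor \<gamma>)"
    unfolding Res_ob Yo_eq TL.comp_ps by (rule N)
  also have "Comp (ps T) (Yo a) (fob RR (emt (n + a'))) (fob RR (Z a')) (fmor RR (emt (n + a')) (Z a') (emb_mor (gp a')))
      (Comp (ps T) (Yo a) (Yo a') (fob RR (emt (n + a'))) (N0 a') (emb_mor \<gamma>)) = Comp (ps T) (Yo a) (Yo a') (fob RR (Z a')) (\<eta> a') (emb_mor \<gamma>)"
    unfolding \<eta>_def by (rule RF.tgt.assoc) (intro O RF.mor Z_obj emt_obj gp_hom_Z N0_hom g)+
  finally have 2: "Comp (ps T) (Yo a) (fob RR (Z a)) (fob RR (Z a')) (fmor RR (Z a) (Z a') (emb_mor v)) (\<eta> a) =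
    Comp (ps T) (Yo a) (Yo a') (fob RR (Z a')) (\<eta> a') (emb_mor \<gamma>)" .
  show ?thesis using v(1) K h(1) 1 2 unfolding RF.lifts_def by blast
qed

end

lemma lifts_exist: "g \<in> Hom (ps T) (Yo a) (Yo a') \<Longrightarrow> \<exists>h. RF.lifts (Yo a) (Z a) (\<epsilon> a) (\<eta> a) (Yo a') (Z a') (\<epsilon> a') (\<eta> a') g h"
  unfolding TL.hom_emb[OF Yk_obj(1) Yk_obj(1)] using lift_exists by blast

text \<open>Objects of the completion are retracts of sums of pairs \<open>(A, V)\<close>; here
  \<open>A\<close> is resolved through the \<open>[a]\<close> and \<open>V\<close> through the
  regular representation, and the two resolutions are tensored.\<close>

lemma generated:
  assumes Y: "Y \<in> Obj (ps T)"
  shows "Idm (ps T) Y \<in> thru (ps T) (range Yo) Y Y"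
proof (rule TL.linear_category_ps[THEN linear_category.thru_trans, OF TL.thru_ps[OF Y]])
  show "emb_ob T ` Obj T \<subseteq> Obj (ps T)" by (auto intro: TL.obj_emb)
  show "range Yo \<subseteq> Obj (ps T)" using Yo_obj by blast
  show "Y \<in> Obj (ps T)" "Y \<in> Obj (ps T)" by (fact Y)+
  fix s assume "s \<in> emb_ob T ` Obj T"
  then obtain A V where s: "s = emb_ob T (A, V)" and A: "A \<in> Obj C1" and V: "V \<in> Obj RH" by (auto simp: Tp.T_sel)
  have k: "kH \<in> Obj RH" by (rule perm_obj) simp
  have "Idm C1 A \<in> thru C1 (range em1) A A" using G1.thru_ps[of A] A by (simp add: Ccat_def)
  then have "tens (Idm C1 A) (Idm RH V) \<in> thru T (range em1 \<times> {kH}) (A, V) (A, V)"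
    by (rule Tp.thru_tensor[OF _ Rep_generated[OF V]]) (use A V k em1_obj in blast)+
  then have "emb_mor (Idm T (A, V)) \<in> thru (ps T) (emb_ob T ` (range em1 \<times> {kH})) s s"
    unfolding s Tp.T_sel(3) by (rule TL.thru_emb[rotated 3]) (use A V k in \<open>auto simp: Tp.T_sel\<close>)
  moreover have "emb_ob T ` (range em1 \<times> {kH}) = range Yo" by auto
  ultimately show "Idm (ps T) s \<in> thru (ps T) (range Yo) s s" unfolding s TL.idm_emb by simp
qed

end

section \<open>The idempotent\<close>

context fin_group
begin

text \<open>A configuration of type \<open>id_diag\<close>, with distinct rows and the same tuple on
  both sides, so that \<open>ty_eq_iff\<close> can recognise this type.\<close>

lemma id_diag_ty: "id_diag G n = ty n n (jn (\<lambda>i. (i, \<one>)) (\<lambda>i. (i, \<one>)))"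
proof -
  have 1: "rowpart n n (jn (\<lambda>i. (i, \<one>)) (\<lambda>i. (i, \<one>))) = (\<lambda>i. {Up i, Lo (id i)}) ` {1..n}"
  proof -
    have a: "{q\<in>points n n. fst (jn (\<lambda>i. (i, \<one>)) (\<lambda>i. (i, \<one>)) q) = i} = {Up i, Lo i}" if "i \<in> {1..n}" for i
      using that by (auto simp: points_def)
    have "rowpart n n (jn (\<lambda>i. (i, \<one>)) (\<lambda>i. (i, \<one>))) = (\<lambda>p. {q\<in>points n n. fst (jn (\<lambda>i. (i, \<one>)) (\<lambda>i. (i, \<one>)) q) = fst (jn (\<lambda>i. (i, \<one>)) (\<lambda>i. (i, \<one>)) p)}) ` (Up ` {1..n} \<union> Lo ` {1..n})"
      unfolding rowpart_def points_def[of n n] ..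
    also have "\<dots> = (\<lambda>i. {Up i, Lo i}) ` {1..n}"
      unfolding image_Un image_image jn_simps fst_conv using a by (simp del: One_nat_def cong: image_cong_simp)
    finally show ?thesis by simp
  qed
  have 2: "relab n n (jn (\<lambda>i. (i, \<one>)) (\<lambda>i. (i, \<one>))) = (\<lambda>p\<in>points n n. case p of Up i \<Rightarrow> \<one> | Lo j \<Rightarrow> \<one> | Mid j \<Rightarrow> undefined)"
    unfolding relab_def by (rule restrict_ext) (auto simp: points_def)
  show ?thesis unfolding id_diag_def strands_def ty_def 1 2 ..
qed

text \<open>By Moebius inversion the kernel is the indicator of the type of the identity
  diagram.\<close>

lemma ker_x_idem:
  assumes v: "val1 n x" "val1 n y"
  shows "ker n n (x_idem G n) (jn x y) = (of_bool ((\<forall>i\<in>{1..n}. x i = y i) \<and> inj_on (\<lambda>i. fst (x i)) {1..n}) :: 'k::field_char_0)"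
proof -
  let ?w = "\<lambda>i. (i, \<one>)"
  have vz: "valid n n (jn x y)" "valid n n (jn ?w ?w)" using v by (auto simp: valid_jn val1_def)
  have "ty n n (jn x y) = id_diag G n \<longleftrightarrow> (\<forall>i\<in>{1..n}. x i = y i) \<and> inj_on (\<lambda>i. fst (x i)) {1..n}" (is "?l \<longleftrightarrow> ?r")
  proof
    assume l: ?l
    note e = l[unfolded id_diag_ty]
    have "x i = y i" if "i \<in> {1..n}" for i
      using ty_point_eq[OF vz e, of "Up i" "Lo i"] that by (simp add: points_def)
    moreover have "i = j" if "i \<in> {1..n}" "j \<in> {1..n}" "fst (x i) = fst (x j)" for i j
      using ty_same(1)[OF vz e, of "Up i" "Up j"] that by (simp add: points_def)
    ultimately show ?r by (auto intro!: inj_onI)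
  next
    assume r: ?r
    have z: "jn x y (Up i) = x i" "jn x y (Lo i) = x i" if "i \<in> {1..n}" for i using r that by auto
    have i: "fst (x i) = fst (x j) \<longleftrightarrow> i = j" if "i \<in> {1..n}" "j \<in> {1..n}" for i j
      using inj_on_eq_iff[of "\<lambda>i. fst (x i)" "{1..n}" i j] r that by blast
    have l: "inv (snd (x i)) \<otimes> snd (x i) = \<one>" if "i \<in> {1..n}" for i using v(1) that by (auto simp: val1_def)
    show ?l unfolding id_diag_ty ty_eq_iff[OF vz] points_ball using z i l by (simp del: One_nat_def atLeastAtMost_iff cong: ball_cong)
  qed
  moreover have "ker n n (x_idem G n) (jn x y) = (of_bool (ty n n (jn x y) = id_diag G n) :: 'k)"
    unfolding x_idem_def using xdiag_props[OF id_in_P, where ?'k = 'k] vz(1) by blast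
  ultimately show ?thesis by simp
qed

text \<open>If the rows agree, exactly one \<open>k\<close> is admissible, namely that of the
  quotients of the group elements. So the average over \<open>k\<close> forgets group elements and
  keeps rows.\<close>

lemma ker_omega:
  assumes v: "val1 n x" "val1 n y"
  shows "ker n n (omega G n) (jn x y) = (1 / of_nat (order G) ^ n * of_bool (\<forall>i\<in>{1..n}. fst (x i) = fst (y i)) :: 'k::field_char_0)"
proof -
  let ?K = "{1..n} \<rightarrow>\<^sub>E carrier G"
  let ?k0 = "\<lambda>i\<in>{1..n}. inv (snd (x i)) \<otimes> snd (y i)"
  have k0: "?k0 \<in> ?K" using v by (auto simp: val1_def)
  have e: "adm (strands G n id k) (jn x y) \<longleftrightarrow> (\<forall>i\<in>{1..n}. fst (x i) = fst (y i)) \<and> k = ?k0" if k: "k \<in> ?K" for k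
  proof -
    have kc: "k i \<in> carrier G" if "i \<in> {1..n}" for i using k that by auto
    have g: "snd (y i) = snd (x i) \<otimes> k i \<longleftrightarrow> k i = ?k0 i" if i: "i \<in> {1..n}" for i
    proof -
      have c: "snd (x i) \<in> carrier G" "snd (y i) \<in> carrier G" "k i \<in> carrier G" using v i kc by (auto simp: val1_def)
      show ?thesis using inv_solve_left[of "k i" "snd (x i)" "snd (y i)"] c i by auto
    qed
    have "k = ?k0 \<longleftrightarrow> (\<forall>i\<in>{1..n}. k i = ?k0 i)" using PiE_ext[OF k k0] by blast
    moreover have "adm (strands G n id k) (jn x y) \<longleftrightarrow> (\<forall>i\<in>{1..n}. y i = (fst (x i), snd (x i) \<otimes> k i))"
      using adm_strands[OF permutes_id[folded id_def] kc v] by (simp only: id_apply)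
    moreover have "y i = (fst (x i), snd (x i) \<otimes> k i) \<longleftrightarrow> fst (x i) = fst (y i) \<and> k i = ?k0 i" if "i \<in> {1..n}" for i
      unfolding g[OF that, symmetric] prod_eq_iff fst_conv snd_conv by auto
    ultimately show ?thesis by blast
  qed
  have "(\<Sum>k\<in>?K. ker n n (basis (strands G n id k)) (jn x y)) = (\<Sum>k\<in>?K. if k = ?k0 then of_bool (\<forall>i\<in>{1..n}. fst (x i) = fst (y i)) else 0 :: 'k)"
  proof (rule sum.cong[OF refl])
    fix k assume k: "k \<in> ?K"
    have "strands G n id k \<in> P G n n" by (rule strands_in_P[OF permutes_id]) (use k in auto)
    then show "ker n n (basis (strands G n id k)) (jn x y) = (if k = ?k0 then of_bool (\<forall>i\<in>{1..n}. fst (x i) = fst (y i)) else 0 :: 'k)"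
      using e[OF k] by (simp add: ker_basis del: One_nat_def)
  qed
  also have "\<dots> = of_bool (\<forall>i\<in>{1..n}. fst (x i) = fst (y i))"
    using k0 finite_PiE[of "{1..n}" "\<lambda>_. carrier G"] fin by (simp add: sum.delta del: One_nat_def)
  finally show ?thesis by (simp add: omega_def ker_smul ker_sum del: One_nat_def)
qed

lemma ker_e_sym:
  assumes v: "val1 n x" "val1 n y"
  shows "ker n n (e_sym G n) (jn x y) = (1 / fact n * (\<Sum>\<sigma>\<in>{\<sigma>. \<sigma> permutes {1..n}}. of_bool (\<forall>i\<in>{1..n}. y (\<sigma> i) = x i)) :: 'k::field_char_0)"
proof -
  have "ker n n (basis (strands G n \<sigma> (\<lambda>_. \<one>))) (jn x y) = (of_bool (\<forall>i\<in>{1..n}. y (\<sigma> i) = x i) :: 'k)" if s: "\<sigma> permutes {1..n}" for \<sigma>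
  proof -
    have "strands G n \<sigma> (\<lambda>_. \<one>) \<in> P G n n" by (rule strands_in_P[OF s]) simp
    moreover have "(fst (x i), snd (x i) \<otimes> \<one>) = x i" if "i \<in> {1..n}" for i using v(1) that by (simp add: val1_def)
    ultimately show ?thesis using adm_strands[OF s _ v, of "\<lambda>_. \<one>"] by (simp add: ker_basis del: One_nat_def)
  qed
  then show ?thesis by (simp add: e_sym_def ker_smul ker_sum del: One_nat_def)
qed

text \<open>The support of the kernel of \<open>e\<close>: the rows of \<open>x\<close> are
  distinct, and \<open>y\<close> has the same rows in any order, with arbitrary group
  elements.\<close>

definition match :: "nat \<Rightarrow> (nat \<Rightarrow> nat \<times> 'a) \<Rightarrow> (nat \<Rightarrow> nat \<times> 'a) \<Rightarrow> bool" where
  "match n x y \<longleftrightarrow> inj_on (\<lambda>i. fst (x i)) {1..n} \<and> (\<exists>\<sigma>. \<sigma> permutes {1..n} \<and> (\<forall>i\<in>{1..n}. fst (y (\<sigma> i)) = fst (x i)))"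

text \<open>Distinct rows leave room for at most one permutation, so the sum counts \<open>0\<close>
  or \<open>1\<close>.\<close>

lemma count_match:
  "(if inj_on (\<lambda>i. fst (x i)) {1..n} then \<Sum>\<sigma>\<in>{\<sigma>. \<sigma> permutes {1..n}}. of_bool (\<forall>i\<in>{1..n}. fst (y (\<sigma> i)) = fst (x i)) else 0) = (of_bool (match n x y) :: 'k::field_char_0)"
proof (cases "match n x y")
  case False
  then show ?thesis by (auto simp: match_def simp del: One_nat_def intro!: sum.neutral)
next
  case True
  then obtain \<tau> where i: "inj_on (\<lambda>i. fst (x i)) {1..n}" and t: "\<tau> permutes {1..n}" "\<And>i. i \<in> {1..n} \<Longrightarrow> fst (y (\<tau> i)) = fst (x i)"
    unfolding match_def by blast
  have "(\<forall>i\<in>{1..n}. fst (y (\<sigma> i)) = fst (x i)) \<longleftrightarrow> \<sigma> = \<tau>" if s: "\<sigma> permutes {1..n}" for \<sigma>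
  proof
    assume a: "\<forall>i\<in>{1..n}. fst (y (\<sigma> i)) = fst (x i)"
    show "\<sigma> = \<tau>"
    proof
      fix i
      show "\<sigma> i = \<tau> i"
      proof (cases "i \<in> {1..n}")
        case True
        then have "\<sigma> i \<in> \<tau> ` {1..n}" using permutes_image[OF t(1)] permutes_in_image[OF s] by blast
        then obtain j where j: "j \<in> {1..n}" "\<sigma> i = \<tau> j" by blast
        then have "fst (x j) = fst (x i)" using a True t(2)[OF j(1)] by metis
        then show ?thesis using inj_onD[OF i _ j(1) True] j(2) by simp
      qed (use s t in \<open>simp add: permutes_not_in\<close>)
    qed
  qed (use t in blast)
  then have "(\<Sum>\<sigma>\<in>{\<sigma>. \<sigma> permutes {1..n}}. of_bool (\<forall>i\<in>{1..n}. fst (y (\<sigma> i)) = fst (x i)) :: 'k) = (\<Sum>\<sigma>\<in>{\<sigma>. \<sigma> permutes {1..n}}. if \<sigma> = \<tau> then 1 else 0)"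
    by (intro sum.cong refl) simp
  then show ?thesis using i t(1) True finite_permutations[of "{1..n}"] by (simp add: sum.delta del: One_nat_def)
qed

text \<open>Multiplying the kernels: \<open>x_n\<close> forces distinct rows and equal tuples,
  \<omega> then forgets the group elements, and the symmetriser allows any order of the rows. The
  constants are the two normalisations.\<close>

lemma e_idem_eq:
  fixes t :: "'k::field_char_0"
  assumes v: "v \<in> Hom (Gcat G t) n n" and k: "\<And>x y. val1 n x \<Longrightarrow> val1 n y \<Longrightarrow> ker n n v (jn x y) = 1 / (of_nat (order G) ^ n * fact n) * of_bool (match n x y)"
  shows "e_idem G t n = v"
proof -
  let ?m = "1 / of_nat (order G) ^ n :: 'k"
  let ?q = "\<lambda>x y. ?m * of_bool (inj_on (\<lambda>i. fst (x i)) {1..n} \<and> (\<forall>i\<in>{1..n}. fst (x i) = fst (y i)))"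
  have "\<exists>w. w \<in> Hom (Gcat G t) n n \<and> (\<forall>x y. val1 n x \<longrightarrow> val1 n y \<longrightarrow> ker n n w (jn x y) = ?q x y)"
  proof (rule ker_exists2)
    fix x y x' y' :: "nat \<Rightarrow> nat \<times> 'a"
    assume v: "val1 n x" "val1 n y" "val1 n x'" "val1 n y'" and e: "ty n n (jn x y) = ty n n (jn x' y')"
    have vz: "valid n n (jn x y)" "valid n n (jn x' y')" using v by (auto simp: valid_jn)
    have "fst (x i) = fst (x j) \<longleftrightarrow> fst (x' i) = fst (x' j)" "fst (x i) = fst (y j) \<longleftrightarrow> fst (x' i) = fst (y' j)" if "i \<in> {1..n}" "j \<in> {1..n}" for i j
      using ty_same(1)[OF vz e, of "Up i" "Up j"] ty_same(1)[OF vz e, of "Up i" "Lo j"] that by (simp_all add: points_def)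
    then show "?q x y = ?q x' y'" by (simp add: inj_on_def del: One_nat_def)
  qed
  then obtain w where w: "w \<in> Hom (Gcat G t) n n" "\<And>x y. val1 n x \<Longrightarrow> val1 n y \<Longrightarrow> ker n n w (jn x y) = ?q x y" by blast
  have "gc t n n n (omega G n) (x_idem G n) = w"
  proof (rule gcomp_eqI[OF w(1)])
    fix N x z assume xz: "x \<in> conf {1..N} n" "z \<in> conf {1..N} n"
    have "(\<Sum>y\<in>conf {1..N} n. ker n n (x_idem G n) (jn x y) * ker n n (omega G n) (jn y z)) = (\<Sum>y\<in>conf {1..N} n. if y = x then ?q x z else 0)"
    proof (rule sum.cong[OF refl])
      fix y assume y: "y \<in> conf {1..N} n"
      show "ker n n (x_idem G n) (jn x y) * ker n n (omega G n) (jn y z) = (if y = x then ?q x z else 0)"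
        unfolding ker_x_idem[OF conf_val1[OF xz(1)] conf_val1[OF y]] ker_omega[OF conf_val1[OF y] conf_val1[OF xz(2)]] conf_eq[OF xz(1) y] by auto
    qed
    also have "\<dots> = ker n n w (jn x z)" using xz finite_conf[of "{1..N}" n] w(2)[OF conf_val1 conf_val1] by (simp add: sum.delta del: One_nat_def)
    finally show "(\<Sum>y\<in>conf {1..N} n. ker n n (x_idem G n) (jn x y) * ker n n (omega G n) (jn y z)) = ker n n w (jn x z)" .
  qed
  moreover have "gc t n n n (e_sym G n) w = v"
  proof (rule gcomp_eqI[OF v])
    fix N x z assume xz: "x \<in> conf {1..N} n" "z \<in> conf {1..N} n"
    let ?S = "{\<sigma>. \<sigma> permutes {1..n}}"
    let ?i = "inj_on (\<lambda>i. fst (x i)) {1..n}"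
    have inner: "(\<Sum>y\<in>conf {1..N} n. ?q x y * of_bool (\<forall>i\<in>{1..n}. z (\<sigma> i) = y i)) = ?m * of_bool (?i \<and> (\<forall>i\<in>{1..n}. fst (z (\<sigma> i)) = fst (x i)))"
      if s: "\<sigma> \<in> ?S" for \<sigma>
    proof -
      \<comment> \<open>For fixed \<sigma> this is the only middle tuple that contributes.\<close>
      let ?y = "\<lambda>i\<in>{1..n}. z (\<sigma> i)"
      have "\<sigma> i \<in> {1..n}" if "i \<in> {1..n}" for i using s that permutes_in_image by fastforce
      then have y0: "?y \<in> conf {1..N} n" using xz(2) unfolding conf_def by (simp add: PiE_iff del: One_nat_def)
      have "(\<Sum>y\<in>conf {1..N} n. ?q x y * of_bool (\<forall>i\<in>{1..n}. z (\<sigma> i) = y i)) = (\<Sum>y\<in>conf {1..N} n. if y = ?y then ?q x ?y else 0)"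
      proof (rule sum.cong[OF refl])
        fix y assume y: "y \<in> conf {1..N} n"
        have "(\<forall>i\<in>{1..n}. z (\<sigma> i) = y i) \<longleftrightarrow> y = ?y" using conf_eq[OF y y0] by (auto simp del: One_nat_def)
        then show "?q x y * of_bool (\<forall>i\<in>{1..n}. z (\<sigma> i) = y i) = (if y = ?y then ?q x ?y else 0)" by (simp del: One_nat_def)
      qed
      also have "\<dots> = ?q x ?y" using y0 finite_conf[of "{1..N}" n] by (simp add: sum.delta del: One_nat_def)
      also have "\<dots> = ?m * of_bool (?i \<and> (\<forall>i\<in>{1..n}. fst (z (\<sigma> i)) = fst (x i)))" by (auto simp del: One_nat_def)
      finally show ?thesis .
    qed
    have "(\<Sum>y\<in>conf {1..N} n. ker n n w (jn x y) * ker n n (e_sym G n) (jn y z)) =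
      (\<Sum>y\<in>conf {1..N} n. \<Sum>\<sigma>\<in>?S. 1 / fact n * (?q x y * of_bool (\<forall>i\<in>{1..n}. z (\<sigma> i) = y i)))"
    proof (rule sum.cong[OF refl])
      fix y assume y: "y \<in> conf {1..N} n"
      show "ker n n w (jn x y) * ker n n (e_sym G n) (jn y z) = (\<Sum>\<sigma>\<in>?S. 1 / fact n * (?q x y * of_bool (\<forall>i\<in>{1..n}. z (\<sigma> i) = y i)))"
        unfolding w(2)[OF conf_val1[OF xz(1)] conf_val1[OF y]] ker_e_sym[OF conf_val1[OF y] conf_val1[OF xz(2)]] sum_distrib_left
        by (rule sum.cong[OF refl]) (simp only: mult_ac)
    qed
    also have "\<dots> = (\<Sum>\<sigma>\<in>?S. 1 / fact n * (\<Sum>y\<in>conf {1..N} n. ?q x y * of_bool (\<forall>i\<in>{1..n}. z (\<sigma> i) = y i)))"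
      by (subst sum.swap) (simp only: sum_distrib_left)
    also have "\<dots> = (\<Sum>\<sigma>\<in>?S. 1 / fact n * (?m * of_bool (?i \<and> (\<forall>i\<in>{1..n}. fst (z (\<sigma> i)) = fst (x i)))))"
      by (rule sum.cong[OF refl]) (simp only: inner)
    also have "\<dots> = 1 / (of_nat (order G) ^ n * fact n) * (if ?i then \<Sum>\<sigma>\<in>?S. of_bool (\<forall>i\<in>{1..n}. fst (z (\<sigma> i)) = fst (x i)) else 0)"
      by (cases ?i) (simp_all add: sum_divide_distrib[symmetric] sum_distrib_left[symmetric] mult.commute del: One_nat_def)
    also have "\<dots> = ker n n v (jn x z)" unfolding count_match k[OF conf_val1[OF xz(1)] conf_val1[OF xz(2)]] ..
    finally show "(\<Sum>y\<in>conf {1..N} n. ker n n w (jn x y) * ker n n (e_sym G n) (jn y z)) = ker n n v (jn x z)" .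
  qed
  ultimately show ?thesis by (simp add: e_idem_def)
qed

end

section \<open>The value at the tensor unit\<close>

context res_core
begin

text \<open>Constant matrices are intertwiners of permutation representations, and composing two
  multiplies their constants by the size of the middle basis. This is enough to split the trivial
  representation off the regular one.\<close>

definition kk :: "'k \<Rightarrow> (nat \<times> nat) list set \<Rightarrow> (nat \<times> nat) list set \<Rightarrow> (nat \<times> nat) list \<times> (nat \<times> nat) list \<Rightarrow> 'k" where
  "kk c B B' = (\<lambda>(ys, xs). if ys \<in> B' \<and> xs \<in> B then c else 0)"

lemma kk_hom: "stable B \<Longrightarrow> stable B' \<Longrightarrow> kk c B B' \<in> Hom RH (perm_rep B) (perm_rep B')"
  using stableD(3)[of B] stableD(3)[of B'] by (auto simp: perm_rep_hom bmats_def kk_def)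

lemma kk_comp: "stable B \<Longrightarrow> Comp RH V (perm_rep B) V' (kk c B B') (kk d A B) = kk (of_nat (card B) * (c * d)) A B'"
  by (rule ext) (auto simp: perm_rep_def Rep_sel bmat_comp_def kk_def)

lemma stable_unit: "stable {[]}"
  by (simp add: stable_def)

abbreviation "U0 \<equiv> (em1 0, perm_rep {[]} :: (_, _, 'k) rep)"

lemma U0_obj: "U0 \<in> Obj T"
  by (simp add: Tp.T_sel(1) perm_rep_obj[OF stable_unit])

lemma unit_eq: "Unit (ps T) = emb_ob T U0"
proof -
  have "Unit RH = perm_rep {[]}" by (auto simp: Rep_sel perm_rep_def bmat_id_def fun_eq_iff)
  moreover have "Unit C1 = em1 0" by (simp add: Ccat_def ps_def emb_ob_def)
  moreover have "Unit T = (Unit C1, Unit RH)" by (simp add: tensor_cat_def)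
  moreover have "Unit (ps T) = emb_ob T (Unit T)" by (simp add: ps_def emb_ob_def)
  ultimately show ?thesis by simp
qed

text \<open>The inverse of the order of the wreath product, which is \<open>card B0\<close>: it
  normalises the average over the group and is also the value of the kernel of \<open>e\<close> on
  its support.\<close>

definition "c0 = (1 / (of_nat (order G) ^ n * fact n) :: 'k)"

lemma c0: "of_nat (card B0) * c0 = 1"
  using order_gt_0_iff_finite fin by (simp add: c0_def card_B0)

definition tn :: "((nat \<times> nat) list \<times> (nat \<times> nat) list \<Rightarrow> 'k) \<Rightarrow> (nat \<times> nat \<times> 'a gdiag) \<times> (nat \<times> nat) list \<times> (nat \<times> nat) list \<Rightarrow> 'k" where
  "tn M = tens (Idm C1 (em1 0)) M"

lemma tn_hom: "stable B \<Longrightarrow> stable B' \<Longrightarrow> tn (kk c B B') \<in> Hom T (em1 0, perm_rep B) (em1 0, perm_rep B')"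
  unfolding tn_def by (intro Tp.T_pure kk_hom Tp.C.id_hom em1_obj)

lemma tn_comp:
  assumes A: "stable A" and B: "stable B" and B': "stable B'"
  shows "Comp T (em1 0, perm_rep A) (em1 0, perm_rep B) (em1 0, perm_rep B') (tn (kk c B B')) (tn (kk d A B)) = tn (kk (of_nat (card B) * (c * d)) A B')"
proof -
  have i: "Idm C1 (em1 0) \<in> Hom C1 (em1 0) (em1 0)" by (rule Tp.C.id_hom) simp
  show ?thesis
    unfolding tn_def Tp.T_comp_pure[OF em1_obj em1_obj em1_obj perm_rep_obj[OF A] perm_rep_obj[OF B] perm_rep_obj[OF B'] i kk_hom[OF A B] i kk_hom[OF B B']]
      kk_comp[OF B] Tp.C.id_left[OF em1_obj em1_obj i] ..
qed

text \<open>The averaging projection of the regular representation onto its invariants;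
  \<open>i1\<close> and \<open>p1\<close> factor it through the trivial representation, hence
  through the tensor unit.\<close>

abbreviation "\<gamma>0 \<equiv> tn (kk c0 B0 B0)"
abbreviation "i1 \<equiv> emb_mor (tn (kk 1 {[]} B0))"
abbreviation "p1 \<equiv> emb_mor (tn (kk c0 B0 {[]}))"

lemma unit_split:
  "i1 \<in> Hom (ps T) (emb_ob T U0) (Yo 0)" "p1 \<in> Hom (ps T) (Yo 0) (emb_ob T U0)"
  "Comp (ps T) (emb_ob T U0) (Yo 0) (emb_ob T U0) p1 i1 = Idm (ps T) (emb_ob T U0)"
  "Comp (ps T) (Yo 0) (emb_ob T U0) (Yo 0) i1 p1 = emb_mor \<gamma>0"
proof -
  show "i1 \<in> Hom (ps T) (emb_ob T U0) (Yo 0)" "p1 \<in> Hom (ps T) (Yo 0) (emb_ob T U0)"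
    unfolding TL.hom_emb[OF U0_obj Yk_obj(1)] TL.hom_emb[OF Yk_obj(1) U0_obj]
    using tn_hom[OF stable_unit B0_stable] tn_hom[OF B0_stable stable_unit] by blast+
  have "kk 1 {[]} {[]} = Idm RH (perm_rep {[]})" by (auto simp: perm_rep_def Rep_sel kk_def bmat_id_def fun_eq_iff)
  then have "tn (kk 1 {[]} {[]}) = Idm T U0" by (simp add: tn_def Tp.T_sel(3))
  then show "Comp (ps T) (emb_ob T U0) (Yo 0) (emb_ob T U0) p1 i1 = Idm (ps T) (emb_ob T U0)"
    unfolding TL.comp_emb TL.idm_emb tn_comp[OF stable_unit B0_stable stable_unit] by (simp add: c0)
  show "Comp (ps T) (Yo 0) (emb_ob T U0) (Yo 0) i1 p1 = emb_mor \<gamma>0"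
    unfolding TL.comp_emb tn_comp[OF B0_stable stable_unit B0_stable] by simp
qed

lemma \<gamma>0_hom: "\<gamma>0 \<in> Hom T (Yk 0) (Yk 0)"
  by (rule tn_hom[OF B0_stable B0_stable])

lemma \<gamma>0_idem: "Comp (ps T) (Yo 0) (Yo 0) (Yo 0) (emb_mor \<gamma>0) (emb_mor \<gamma>0) = emb_mor \<gamma>0"
  unfolding TL.comp_emb tn_comp[OF B0_stable B0_stable B0_stable] using c0 by (simp add: mult.assoc[symmetric])

text \<open>Emptiness of \<open>out\<close> says that all rows of \<open>x\<close> occur in the
  frame of the good tuple \<open>y\<close>, and relative coordinates in \<open>B0\<close> say that
  they occur at different places; together this is a permutation.\<close>

lemma match_iff:
  assumes g: "good 0 y" and v: "val1 n x" "val1 n y"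
  shows "out n x y = {} \<and> lst {1..n} (rel y \<circ> x) \<in> B0 \<longleftrightarrow> match n x y"
proof
  assume a: "out n x y = {} \<and> lst {1..n} (rel y \<circ> x) \<in> B0"
  have r: "fst (rel y (x i)) \<in> {1..n} \<and> fst (y (fst (rel y (x i)))) = fst (x i)" if i: "i \<in> {1..n}" for i
  proof -
    obtain k where k: "k \<in> {1..n}" "fst (y k) = fst (x i)" using not_out[of i n x y] a i by blast
    then show ?thesis using rel_eq[OF g k] by simp
  qed
  define \<sigma> where "\<sigma> i = (if i \<in> {1..n} then fst (rel y (x i)) else i)" for i
  have inj: "inj_on (\<lambda>i. fst (rel y (x i))) {1..n}" using lst_inj[of "rel y \<circ> x"] a by (simp add: o_def)
  have "\<sigma> permutes {1..n}"
  proof (rule inj_imp_permutes)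
    show "inj_on \<sigma> {1..n}" by (rule inj_on_cong[THEN iffD2, OF _ inj]) (simp add: \<sigma>_def)
  qed (use r in \<open>auto simp: \<sigma>_def simp del: One_nat_def\<close>)
  moreover have "fst (y (\<sigma> i)) = fst (x i)" if "i \<in> {1..n}" for i using r[OF that] that by (simp add: \<sigma>_def)
  moreover have "inj_on (\<lambda>i. fst (x i)) {1..n}"
  proof (rule inj_onI)
    fix i j assume ij: "i \<in> {1..n}" "j \<in> {1..n}" and e: "fst (x i) = fst (x j)"
    have "fst (rel y (x i)) = fst (rel y (x j))" by (simp add: rel_def e Let_def)
    then show "i = j" using inj_onD[OF inj _ ij] by simp
  qed
  ultimately show "match n x y" unfolding match_def by blast
next
  assume "match n x y"
  then obtain \<sigma> where i: "inj_on (\<lambda>i. fst (x i)) {1..n}" and s: "\<sigma> permutes {1..n}" "\<And>i. i \<in> {1..n} \<Longrightarrow> fst (y (\<sigma> i)) = fst (x i)"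
    unfolding match_def by blast
  have m: "\<sigma> i \<in> {1..n}" if "i \<in> {1..n}" for i using permutes_in_image[OF s(1)] that by blast
  have "i \<notin> out n x y" for i
  proof
    assume "i \<in> out n x y"
    then have i: "i \<in> {1..n}" "\<forall>k\<in>{1..n}. fst (y k) \<noteq> fst (x i)" by (simp_all add: out_def)
    then show False using m[OF i(1)] s(2)[OF i(1)] by blast
  qed
  then have "out n x y = {}" by blast
  moreover have rel: "rel y (x i) = (\<sigma> i, inv (snd (y (\<sigma> i))) \<otimes> snd (x i))" if "i \<in> {1..n}" for i
    by (rule rel_eq[OF g m[OF that] s(2)[OF that]])
  have "lst {1..n} (rel y \<circ> x) \<in> B0"
  proof (rule lst_B0)
    show "fst ((rel y \<circ> x) i) \<in> {1..n} \<and> snd ((rel y \<circ> x) i) \<in> carrier G" if "i \<in> {1..n}" for i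
      using rel[OF that] m[OF that] v that m[OF that] by (simp add: val1_def del: One_nat_def atLeastAtMost_iff)
    show "inj_on (\<lambda>i. fst ((rel y \<circ> x) i)) {1..n}"
      by (rule inj_on_cong[THEN iffD2, OF _ permutes_inj_on[OF s(1)]]) (simp add: rel del: One_nat_def atLeastAtMost_iff)
  qed
  ultimately show "out n x y = {} \<and> lst {1..n} (rel y \<circ> x) \<in> B0" by blast
qed

text \<open>For \<open>a = 0\<close> the only block is that of the empty set. There the first factor
  is the identity of \<open>[0]\<close>, with kernel \<open>1\<close>, and the second the constant
  \<open>c0\<close>. A tuple that matches is good, so the case distinction in \<open>T1\<close>
  agrees with \<open>match\<close>.\<close>

lemma T1_unit:
  assumes v: "val1 n x" "val1 n y"
  shows "T1 0 n (mat_comp T (Wl (n + 0)) [Yk 0] [Yk 0] (emb_mor \<gamma>0) (E0 0)) x y = c0 * of_bool (match n x y)"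
proof (cases "good 0 y")
  case False
  then have "\<not> match n x y"
  proof (rule contrapos_nn)
    assume "match n x y"
    then obtain \<sigma> where i: "inj_on (\<lambda>i. fst (x i)) {1..n}" and s: "\<sigma> permutes {1..n}" "\<And>i. i \<in> {1..n} \<Longrightarrow> fst (y (\<sigma> i)) = fst (x i)"
      unfolding match_def by blast
    have "inj_on ((\<lambda>i. fst (y i)) \<circ> \<sigma>) {1..n}" by (rule inj_on_cong[THEN iffD2, OF _ i]) (simp add: s(2) del: One_nat_def atLeastAtMost_iff)
    then show "good 0 y" unfolding good0 using inj_on_imageI2[of "\<lambda>i. fst (y i)" \<sigma> "{1..n}"] inj_on_image_iff permutes_image[OF s(1)]
      by (metis inj_on_imageI)
  qed
  then show ?thesis using False by (simp add: T1_def)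
next
  case True
  let ?O = "out n x y" and ?l = "lst ({1..n} - out n x y) (rel y \<circ> x)"
  have i: "Idm C1 (em1 0) (0, 0, f) = basis (id_diag G 0) f" for f
    unfolding Ccat_def G1.idm_emb by (simp add: emb_mor_apply)
  have e: "entry (mat_comp T (Wl (n + 0)) [Yk 0] [Yk 0] (emb_mor \<gamma>0) (E0 0)) 0 (pos n ?O) ((0, 0, f), (y0, ?l)) =
      of_bool (?O = {} \<and> ?l \<in> B0) * c0 * basis (id_diag G 0) f" for f
    using entry_M1[OF \<gamma>0_hom, of ?O "(0, 0, f)" y0 ?l] out_sub[of n x y] y0_B0 by (auto simp: tn_def tens_apply i kk_def)
  have "(\<Sum>f\<in>P G 0 0. of_bool (?O = {} \<and> ?l \<in> B0) * c0 * basis (id_diag G 0) f * of_bool (adm f (jn x' y'))) = of_bool (?O = {} \<and> ?l \<in> B0) * c0" for x' y'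
  proof -
    have "ker 0 0 (basis (id_diag G 0)) (jn x' y') = (1 :: 'k)" by (simp add: ker_id val1_def)
    then show ?thesis unfolding ker_def mult.assoc sum_distrib_left[symmetric] by simp
  qed
  then have "T1 0 n (mat_comp T (Wl (n + 0)) [Yk 0] [Yk 0] (emb_mor \<gamma>0) (E0 0)) x y = of_bool (?O = {} \<and> ?l \<in> B0) * c0"
    using True e by (cases "?O = {}") (simp_all add: T1_def sk_def del: One_nat_def)
  also have "?O = {} \<and> ?l \<in> B0 \<longleftrightarrow> match n x y" using match_iff[OF True v] by auto
  finally show ?thesis by (simp add: mult.commute)
qed

text \<open>The lift of the averaging projection and \<open>e\<close> have the same kernel, by
  \<open>T1_unit\<close> and \<open>e_idem_eq\<close>. This is where the explicit formula for
  \<open>e\<close> meets the adjunction.\<close>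

lemma e_idem_lifts: "RF.lifts (Yo 0) (Z 0) (\<epsilon> 0) (\<eta> 0) (Yo 0) (Z 0) (\<epsilon> 0) (\<eta> 0) (emb_mor \<gamma>0) (emb_mor (e_idem G t n))"
proof -
  obtain v where v: "v \<in> Hom Gt (n + 0) (n + 0)"
    "RF.lifts (Yo 0) (Z 0) (\<epsilon> 0) (\<eta> 0) (Yo 0) (Z 0) (\<epsilon> 0) (\<eta> 0) (emb_mor \<gamma>0) (emb_mor v)"
    "\<And>x y. val1 (n + 0) x \<Longrightarrow> val1 (n + 0) y \<Longrightarrow> ker (n + 0) (n + 0) v (jn x y) = T1 0 (n + 0) (mat_comp T (Wl (n + 0)) [Yk 0] [Yk 0] (emb_mor \<gamma>0) (E0 0)) x y"
    using lift_exists[OF \<gamma>0_hom] by blast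
  have "e_idem G t n = v"
    by (rule e_idem_eq) (use v(1) v(3) T1_unit in \<open>simp_all add: c0_def\<close>)
  then show ?thesis using v(2) by simp
qed

lemma e_idem_hom: "emb_mor (e_idem G t n) \<in> Hom CC (Z 0) (Z 0)"
  using e_idem_lifts by (simp add: RF.lifts_def)

lemma e_idem_props: "e_idem G t n \<in> Hom Gt n n" "gc t n n n (gp 0) (e_idem G t n) = e_idem G t n" "gc t n n n (e_idem G t n) (gp 0) = e_idem G t n"
  using e_idem_hom unfolding hom_Z_Z by (auto dest!: Gt.emb_mor_inj)

text \<open>Both \<open>e e\<close> and \<open>e\<close> lift the idempotent \<gamma>0, and lifts
  are unique.\<close>

lemma e_idem_idem: "gc t n n n (e_idem G t n) (e_idem G t n) = e_idem G t n"
proof -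
  note g = TL.hom_emb[OF Yk_obj(1) Yk_obj(1), of 0 0, THEN equalityD2, THEN subsetD, OF imageI[OF \<gamma>0_hom]]
  have "Comp CC (Z 0) (Z 0) (Z 0) (emb_mor (e_idem G t n)) (emb_mor (e_idem G t n)) = emb_mor (e_idem G t n)"
    using RF.lift_comp[OF Z_represents Z_represents Z_represents Yo_obj Yo_obj Yo_obj g g e_idem_lifts e_idem_lifts]
    unfolding \<gamma>0_idem by (rule RF.lift_unique[OF Z_represents Z_represents _ e_idem_lifts])
  then show ?thesis unfolding Z_def comp_CC by (auto dest: Gt.emb_mor_inj)
qed

text \<open>The tensor unit is a retract of the generator with \<open>a = 0\<close>. The
  corresponding projection lifts to \<open>e\<close>, an idempotent of \<open>Z 0\<close>, which
  serves both as the inclusion of \<open>X\<close> into \<open>Z 0\<close> and as the projection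
  onto \<open>X\<close>.\<close>

theorem adjoint_exists:
  "\<exists>R. adjunction CC (ps T) RR R \<and> adjunction (ps T) CC R RR \<and> isomorphic CC (fob R (Unit (ps T))) (X_obj G t n)"
  unfolding unit_eq
proof (rule RF.adjoint_from_generators[where Yg = Yo and Zg = Z and \<epsilon>g = \<epsilon> and \<eta>g = \<eta> and ?s1.0 = 0 and ?i1.0 = i1 and ?p1.0 = p1
      and ?u1.0 = "emb_mor (e_idem G t n)" and ?d1.0 = "emb_mor (e_idem G t n)"])
  let ?e = "emb_mor (e_idem G t n)"
  show "Yo s \<in> Obj (ps T)" for s by (rule Yo_obj)
  show "RF.represents (Yo s) (Z s) (\<epsilon> s) (\<eta> s)" for s by (rule Z_represents)
  show "\<exists>h. RF.lifts (Yo s) (Z s) (\<epsilon> s) (\<eta> s) (Yo s') (Z s') (\<epsilon> s') (\<eta> s') g h" if "g \<in> Hom (ps T) (Yo s) (Yo s')" for s s' g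
    by (rule lifts_exist[OF that])
  show "Idm (ps T) Y \<in> thru (ps T) (range Yo) Y Y" if "Y \<in> Obj (ps T)" for Y by (rule generated[OF that])
  show "\<exists>Z' u d. Z' \<in> Obj CC \<and> (\<forall>k<K. u k \<in> Hom CC Z' (Z (s k)) \<and> d k \<in> Hom CC (Z (s k)) Z') \<and>
        (\<Sum>k<K. Comp CC Z' (Z (s k)) Z' (d k) (u k)) = Idm CC Z' \<and> (\<forall>k<K. \<forall>l<K. Comp CC (Z (s l)) Z' (Z (s k)) (u k) (d l) = h k l)"
    if "\<And>k l. k < K \<Longrightarrow> l < K \<Longrightarrow> h k l \<in> Hom CC (Z (s l)) (Z (s k))"
      "\<And>k m. k < K \<Longrightarrow> m < K \<Longrightarrow> (\<Sum>l<K. Comp CC (Z (s m)) (Z (s l)) (Z (s k)) (h k l) (h l m)) = h k m" for K :: nat and s h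
    using Gt.ps_splitting[of K "\<lambda>k. n + s k" "\<lambda>k. emb_mor (gp (s k))" h] that Z_obj unfolding Z_def Ccat_def by blast
  show "emb_ob T U0 \<in> Obj (ps T)" by (rule TL.obj_emb[OF U0_obj])
  show "i1 \<in> Hom (ps T) (emb_ob T U0) (Yo 0)" "p1 \<in> Hom (ps T) (Yo 0) (emb_ob T U0)"
    "Comp (ps T) (emb_ob T U0) (Yo 0) (emb_ob T U0) p1 i1 = Idm (ps T) (emb_ob T U0)" by (fact unit_split)+
  show "X_obj G t n \<in> Obj CC"
    by (simp add: X_obj_def Ccat_def Gt.obj_single_idem e_idem_props(1) e_idem_idem)
  have h: "?e \<in> Hom CC (X_obj G t n) (Z 0) \<and> ?e \<in> Hom CC (Z 0) (X_obj G t n)"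
    unfolding X_obj_def Z_def Ccat_def Gt.hom_single_idem using e_idem_props e_idem_idem by simp
  then show "?e \<in> Hom CC (X_obj G t n) (Z 0)" "?e \<in> Hom CC (Z 0) (X_obj G t n)" by auto
  have "Idm CC (X_obj G t n) = ?e" by (simp add: Ccat_def ps_def X_obj_def)
  then show "Comp CC (X_obj G t n) (Z 0) (X_obj G t n) ?e ?e = Idm CC (X_obj G t n)"
    unfolding X_obj_def Z_def comp_CC by (simp add: e_idem_idem)
  have "Comp CC (Z 0) (X_obj G t n) (Z 0) ?e ?e = ?e" unfolding X_obj_def Z_def comp_CC by (simp add: e_idem_idem)
  then show "RF.lifts (Yo 0) (Z 0) (\<epsilon> 0) (\<eta> 0) (Yo 0) (Z 0) (\<epsilon> 0) (\<eta> 0) (Comp (ps T) (Yo 0) (emb_ob T U0) (Yo 0) i1 p1)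
      (Comp CC (Z 0) (X_obj G t n) (Z 0) ?e ?e)"
    unfolding unit_split(4) using e_idem_lifts by simp
qed

end

theorem theorem4p6:
  fixes G :: "('g, 'z) monoid_scheme" and n :: nat and t :: "'k::field_char_0"
    and \<theta> :: "nat \<Rightarrow> 'g"
  assumes "group G" and "finite (carrier G)"
    and "bij_betw \<theta> {1..order G} (carrier G)"
    and "is_functor_D G t (t - of_nat n) (of_nat n) D"
    and "is_functor_F G n \<theta> F"
  shows "\<exists>R. adjunction (Ccat G t) (Res_target G n t) (Res G n t D F) R \<and>
             adjunction (Res_target G n t) (Ccat G t) R (Res G n t D F) \<and>
             isomorphic (Ccat G t) (fob R (Unit (Res_target G n t))) (X_obj G t n)"
proof -
  interpret res_core G n \<theta> t D F
    using assms by (simp add: res_core_def res_core_axioms_def wreath_rep_def wreath_rep_axioms_def fin_group_def fin_group_axioms_def)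
  show ?thesis unfolding target by (rule adjoint_exists)
qed

end
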